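(* Let $K$ be a multi-quadratic number field and let $K_{(10)} = K \cap \mathbb{Q}(\zeta_{10})$. Then $J_1(2,10)(K)_{\mathrm{tors}} = J_1(2,10)(K_{(10)})$, and $$J_1(2,10)(K)_{\mathrm{tors}} \cong \begin{cases} \mathbb{Z}/6 & \text{if } K_{(10)} = \mathbb{Q},\\ \mathbb{Z}/2 \times \mathbb{Z}/6 & \text{if } K_{(10)} = \mathbb{Q}(\sqrt{5}).\end{cases}$$
   Context: A multi-quadratic number field is a number field (including $\mathbb{Q}$ itself) which is a compositum of quadratic number fields. For positive integers $M,N$, $X_1(M,MN)$ is the modular curve (coarse moduli space) attached to the level structure $\Gamma_1(M,MN) = \{\begin{pmatrix}1&b\\0&d\end{pmatrix} \in \mathrm{GL}_2(\mathbb{Z}/MN) : b \equiv 0,\ d\equiv 1 \bmod M\}$; it is defined over $\mathbb{Q}(\zeta_M)$ and its non-cuspidal points correspond to elliptic curves together with a subgroup isomorphic to $\mathbb{Z}/M\times\mathbb{Z}/MN$ (with appropriate level structure). $J_1(M,MN)$ denotes its Jacobian. Here $X_1(2,10)$ is defined over $\mathbb{Q}$ (it is a genus one curve, the elliptic curve with Cremona label 20a2). $\zeta_N$ is a primitive $N$-th root of unity. *)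

theory Defs
  imports "HOL-Algebra.Algebra" "HOL-Algebra.Algebraic_Closure_Type" "HOL-Analysis.Analysis"
begin

text \<open>All fields are subfields of the complex numbers, viewed as a ring in the sense of
  HOL-Algebra.\<close>

abbreviation CC :: "complex ring" where
  "CC \<equiv> ring_of_type_algebra"

abbreviation adjoin :: "complex set \<Rightarrow> complex set \<Rightarrow> complex set" where
  "adjoin k S \<equiv> generate_field CC (k \<union> S)"

definition Qbar :: "complex set" where
  "Qbar = {z. Polynomial.algebraic z}"

definition quadratic_field :: "complex set \<Rightarrow> bool" where
  "quadratic_field L \<longleftrightarrow> subfield L CC \<and> ring.dimension CC 2 \<rat> L"

text \<open>The empty compositum is the field of rational numbers.\<close>

definition multiquadratic_field :: "complex set \<Rightarrow> bool" where
  "multiquadratic_field K \<longleftrightarrow>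
     (\<exists>\<L>. finite \<L> \<and> (\<forall>L\<in>\<L>. quadratic_field L) \<and> K = adjoin \<rat> (\<Union>\<L>))"

definition cyclotomic_field :: "nat \<Rightarrow> complex set" where
  "cyclotomic_field n = adjoin \<rat> {cis (2 * pi / real n)}"


section \<open>Elliptic curves and level structures\<close>

text \<open>For \<open>j\<close> different from \<open>0\<close> and \<open>1728\<close>, the elliptic curve
  \<open>y\<^sup>2 = x\<^sup>3 + a x + a\<close> with \<open>a = -27 j / (4 (j - 1728))\<close> has \<open>j\<close>-invariant \<open>j\<close>.\<close>

definition ej_coeff :: "complex \<Rightarrow> complex" where
  "ej_coeff j = - (27 * j) / (4 * (j - 1728))"

datatype point = Infinity | Affine complex complex

definition ej_points :: "complex \<Rightarrow> point set" where
  "ej_points j =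
     insert Infinity {Affine x y | x y. y\<^sup>2 = x ^ 3 + ej_coeff j * x + ej_coeff j}"

fun ej_add :: "complex \<Rightarrow> point \<Rightarrow> point \<Rightarrow> point" where
  "ej_add j Infinity R = R"
| "ej_add j R Infinity = R"
| "ej_add j (Affine x1 y1) (Affine x2 y2) =
     (if x1 = x2 \<and> y1 = - y2 then Infinity
      else let l = (if x1 = x2 then (3 * x1\<^sup>2 + ej_coeff j) / (2 * y1)
                    else (y2 - y1) / (x2 - x1));
               x3 = l\<^sup>2 - x1 - x2
           in Affine x3 (l * (x1 - x3) - y1))"

definition ej_mult :: "complex \<Rightarrow> nat \<Rightarrow> point \<Rightarrow> point" where
  "ej_mult j n R = (ej_add j R ^^ n) Infinity"

text \<open>A level structure of type \<open>\<Gamma>\<^sub>1(M, MN)\<close> is given by points \<open>P\<close> and \<open>Q\<close> for which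
  \<open>(a, b) \<mapsto> a P + b Q\<close> is an embedding of \<open>\<int>/MN \<times> \<int>/M\<close>. Indeed, if \<open>e\<^sub>1, e\<^sub>2\<close> is the basis of
  \<open>(\<int>/MN)\<^sup>2\<close>, then \<open>\<Gamma>\<^sub>1(M, MN)\<close> is the stabiliser of \<open>e\<^sub>1\<close> and \<open>N e\<^sub>2\<close>; the points \<open>P\<close> and \<open>Q\<close>
  are the images of these two vectors under a full level \<open>MN\<close> structure.\<close>

definition gamma1_structure :: "nat \<Rightarrow> nat \<Rightarrow> complex \<Rightarrow> point \<Rightarrow> point \<Rightarrow> bool" where
  "gamma1_structure M N j P Q \<longleftrightarrow>
     P \<in> ej_points j \<and> Q \<in> ej_points j \<and>
     (\<forall>a b. ej_add j (ej_mult j a P) (ej_mult j b Q) = Infinity \<longleftrightarrow> M * N dvd a \<and> M dvd b)"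


section \<open>The function field of the modular curve\<close>

text \<open>
  The modular curve is the smooth projective curve given by its function field, the residue field
  of the coarse moduli space at its generic point. When \<open>j\<close> is transcendental, a complex elliptic
  curve with invariant \<open>j\<close> together with a level structure \<open>P\<close>, \<open>Q\<close> is a geometric generic point
  of the moduli problem, and the residue field is its field of moduli. The only
  automorphisms of the curve are \<open>\<plusminus>1\<close>, so the field of moduli over \<open>k\<close> is generated by \<open>j\<close> and
  the \<open>x\<close>-coordinates of the points \<open>a P + b Q\<close>: these coordinates determine the pair \<open>(P, Q)\<close> up
  to a common sign. (For \<open>M = 1\<close> this is the usual description of the function field of \<open>X\<^sub>1(N)\<close> as
  \<open>\<rat>(j, x(P))\<close>.) The base field \<open>k\<close> has to contain the \<open>M\<close>-th roots of unity.
\<close>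

definition X1_field :: "complex set \<Rightarrow> complex \<Rightarrow> point \<Rightarrow> point \<Rightarrow> complex set" where
  "X1_field k j P Q =
     adjoin k (insert j {x. \<exists>a b y. ej_add j (ej_mult j a P) (ej_mult j b Q) = Affine x y})"


section \<open>Divisor classes of a function field\<close>

text \<open>Places of a function field \<open>F\<close> over \<open>k\<close>, that is, closed points of the smooth projective
  curve with function field \<open>F\<close>, are represented by their normalised discrete valuations, taken as
  extensional functions on \<open>F - {0}\<close>.\<close>

definition places :: "complex set \<Rightarrow> complex set \<Rightarrow> (complex \<Rightarrow> int) set" where
  "places k F =
     {v \<in> extensional (F - {0}).
        (\<forall>f\<in>F - {0}. \<forall>g\<in>F - {0}. v (f * g) = v f + v g) \<and>
        (\<forall>f\<in>F - {0}. \<forall>g\<in>F - {0}. f + g \<noteq> 0 \<longrightarrow> min (v f) (v g) \<le> v (f + g)) \<and>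
        (\<forall>c\<in>k - {0}. v c = 0) \<and>
        v ` (F - {0}) = UNIV}"

abbreviation Div :: "complex set \<Rightarrow> complex set \<Rightarrow> ((complex \<Rightarrow> int) \<Rightarrow>\<^sub>0 int) monoid" where
  "Div k F \<equiv> free_Abelian_group (places k F)"

text \<open>The degree is the sum of the multiplicities because this is only used for an algebraically
  closed \<open>k\<close>, where every place has degree one.\<close>

definition Div0 :: "complex set \<Rightarrow> complex set \<Rightarrow> ((complex \<Rightarrow> int) \<Rightarrow>\<^sub>0 int) set" where
  "Div0 k F =
     {D \<in> carrier (Div k F). (\<Sum>v\<in>Poly_Mapping.keys D. Poly_Mapping.lookup D v) = 0}"

definition principal_divisors ::
    "complex set \<Rightarrow> complex set \<Rightarrow> ((complex \<Rightarrow> int) \<Rightarrow>\<^sub>0 int) set" where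
  "principal_divisors k F =
     {D \<in> carrier (Div k F). \<exists>f\<in>F - {0}. \<forall>v\<in>places k F. Poly_Mapping.lookup D v = v f}"

definition Pic0 :: "complex set \<Rightarrow> complex set \<Rightarrow> ((complex \<Rightarrow> int) \<Rightarrow>\<^sub>0 int) set monoid" where
  "Pic0 k F = ((Div k F)\<lparr>carrier := Div0 k F\<rparr>) Mod principal_divisors k F"


section \<open>Rational points of the Jacobian\<close>

definition field_auts :: "complex set \<Rightarrow> complex set \<Rightarrow> (complex \<Rightarrow> complex) set" where
  "field_auts F F0 =
     {\<sigma> \<in> ring_iso (CC\<lparr>carrier := F\<rparr>) (CC\<lparr>carrier := F\<rparr>). \<forall>f\<in>F0. \<sigma> f = f}"

text \<open>Precomposition is the action of the inverse of \<open>\<sigma>\<close> on places. As \<open>\<sigma>\<close> will range over a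
  group, this has the same invariants as the action of \<open>\<sigma>\<close>.\<close>

definition act_place :: "complex set \<Rightarrow> (complex \<Rightarrow> complex) \<Rightarrow> (complex \<Rightarrow> int) \<Rightarrow> (complex \<Rightarrow> int)"
  where "act_place F \<sigma> v = restrict (v \<circ> \<sigma>) (F - {0})"

definition act_div :: "complex set \<Rightarrow> (complex \<Rightarrow> complex) \<Rightarrow>
    ((complex \<Rightarrow> int) \<Rightarrow>\<^sub>0 int) \<Rightarrow> ((complex \<Rightarrow> int) \<Rightarrow>\<^sub>0 int)" where
  "act_div F \<sigma> = frag_extend (frag_of \<circ> act_place F \<sigma>)"

text \<open>The group of \<open>K\<close>-rational points of the Jacobian \<open>J\<close> of the modular curve \<open>X\<close> with generic
  level structure \<open>(j, P, Q)\<close>, for a number field \<open>K\<close>: the invariants of \<open>Gal(Qbar/K)\<close> in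
  \<open>J(Qbar) = Pic\<^sup>0(X\<^bsub>Qbar\<^esub>)\<close>. The curve is geometrically irreducible over \<open>K\<close>, so \<open>Gal(Qbar/K)\<close> is
  the automorphism group of the function field over \<open>Qbar\<close> relative to the one over \<open>K\<close>. A
  class is a coset of divisors and it is invariant if the action maps it onto itself.\<close>

definition J1_points ::
    "complex \<Rightarrow> point \<Rightarrow> point \<Rightarrow> complex set \<Rightarrow> ((complex \<Rightarrow> int) \<Rightarrow>\<^sub>0 int) set monoid" where
  "J1_points j P Q K =
     (let F = X1_field Qbar j P Q; F0 = X1_field K j P Q in
      (Pic0 Qbar F)\<lparr>carrier :=
         {C \<in> carrier (Pic0 Qbar F). \<forall>\<sigma>\<in>field_auts F F0. act_div F \<sigma> ` C = C}\<rparr>)"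

definition torsion :: "('a, 'b) monoid_scheme \<Rightarrow> 'a set" where
  "torsion G = {x \<in> carrier G. \<exists>n::nat. n > 0 \<and> x [^]\<^bsub>G\<^esub> n = \<one>\<^bsub>G\<^esub>}"

end

theory Submission
  imports Defs "HOL-Computational_Algebra.Nth_Powers" "HOL-Number_Theory.Residues"
begin

text \<open>
  The Tate normal form of a curve with a point of order 10, with the parameter \<open>f\<close> of \<open>X\<^sub>1(10)\<close>,
  and the square root of the discriminant of the remaining 2-division polynomial show that
  the function field of \<open>X\<^sub>1(2,10)\<close> is generated by \<open>u = 2 f - 1\<close> and \<open>v\<close> with
  \<open>v\<^sup>2 = u\<^sup>3 + u\<^sup>2 - u\<close>. The places of this field are the points of the elliptic curve \<open>E\<close> with this
  equation, seen through Laurent expansions. Lines realise the group law in the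
  divisor class group, and a function whose only pole is double is a polynomial in \<open>u\<close>, so that
  \<open>P \<mapsto> [P] - [\<infinity>]\<close> identifies \<open>E\<close> with the Jacobian, equivariantly for \<open>Gal(Qbar/K)\<close>. It
  remains to find the torsion of \<open>E(K)\<close>.

  On a multi-quadratic field all automorphisms are commuting involutions. A point of odd order splits
  into eigenpoints for \<open>\<plusminus>1\<close>, and the abscissa of a simultaneous eigenpoint is rational and periodic
  under duplication, which forces it to be 1 for reasons of height. A point of
  order 4 would give an element of \<open>K\<close> whose square generates a quadratic field and has norm 5; its
  norm is \<open>\<plusminus>\<surd>5\<close>, which is fixed by an involution that should change its sign.
  Finally \<open>E\<close> and its twist by 5 have finitely many rational points, by descents on
  \<open>r\<^sup>4 + r\<^sup>2 s\<^sup>2 - s\<^sup>4\<close> and related quartic forms, and hence \<open>E(\<rat>(\<surd>5))\<close> is finite.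
\<close>

section \<open>Subfields of the complex numbers\<close>

text \<open>The assertion concerns all of J(K10), not only its torsion, so that rank zero over Q and
  over Q(sqrt 5) has to be established; this is the purpose of the descents. The bound on the
  torsion over K itself comes from Galois symmetry and heights. Associativity of the chord and
  tangent law on E is pulled back from the quotient group of divisors along P -> [P] - [infinity].
  Injectivity of this map is where genus one enters: a function on E cannot have a single simple
  pole. Since u is transcendental, the function fields over Qbar and over K are realised as the
  subfields Qbar(u, v) and K(u, v) of the complex numbers. An automorphism of the first over the
  second acts through the coefficients, by an automorphism of Qbar over K, and conversely every such
  automorphism of Qbar extends. The symmetries of a multi-quadratic field K are restrictions of
  automorphisms of Qbar. On K they are determined by the set of square roots that they fix, and this
  finite set is what an induction can count.\<close>

lemma CC_simps [simp]:
  "carrier CC = UNIV" "monoid.mult CC = (*)" "ring.add CC = (+)" "one CC = 1" "ring.zero CC = 0"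
  by (auto simp: ring_of_type_algebra_def fun_eq_iff)

lemma field_CC: "field CC"
  by (rule field_from_type_algebra)

lemmas domain_CC = field.axioms(1)[OF field_CC]
lemmas ring_CC = cring.axioms(1)[OF domain.axioms(1)[OF domain_CC]]

lemma CC_a_inv [simp]: "a_inv CC x = - x"
proof -
  have "a_inv CC x + x = 0"
    using abelian_group.l_neg[OF ring.is_abelian_group[OF ring_CC], of x] by simp
  then show ?thesis
    using eq_neg_iff_add_eq_0 by blast
qed

lemma CC_m_inv [simp]: "x \<noteq> 0 \<Longrightarrow> m_inv CC x = inverse x"
  using monoid.Units_l_inv[OF ring.is_monoid[OF ring_CC], of x] field.field_Units[OF field_CC] inverse_unique[of x "m_inv CC x"] by (simp add: mult.commute)

lemma CC_pow [simp]: "x [^]\<^bsub>CC\<^esub> (n::nat) = x ^ n"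
  by (induction n) (simp_all add: mult.commute)

lemma subfieldCI:
  assumes "1 \<in> L" "\<And>x y. x \<in> L \<Longrightarrow> y \<in> L \<Longrightarrow> x + y \<in> L" "\<And>x. x \<in> L \<Longrightarrow> - x \<in> L"
    "\<And>x y. x \<in> L \<Longrightarrow> y \<in> L \<Longrightarrow> x * y \<in> L" "\<And>x. x \<in> L \<Longrightarrow> x \<noteq> 0 \<Longrightarrow> inverse x \<in> L"
  shows "subfield L CC"
  by (rule field.subfieldI'[OF field_CC]) (use assms in \<open>auto intro!: ring.subringI[OF ring_CC]\<close>)

context
  fixes L :: "complex set"
  assumes L: "subfield L CC"
begin

lemma sf_0 [simp]: "0 \<in> L" and sf_1 [simp]: "1 \<in> L"
  using subringE(2,3)[OF subfieldE(1)[OF L]] by auto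

lemma sf_add: "x \<in> L \<Longrightarrow> y \<in> L \<Longrightarrow> x + y \<in> L"
  using subringE(7)[OF subfieldE(1)[OF L]] by auto

lemma sf_mult: "x \<in> L \<Longrightarrow> y \<in> L \<Longrightarrow> x * y \<in> L"
  using subringE(6)[OF subfieldE(1)[OF L]] by auto

lemma sf_uminus: "x \<in> L \<Longrightarrow> - x \<in> L"
  using subringE(5)[OF subfieldE(1)[OF L]] by auto

lemma sf_diff: "x \<in> L \<Longrightarrow> y \<in> L \<Longrightarrow> x - y \<in> L"
  using sf_add[of x "- y"] sf_uminus[of y] by simp

lemma sf_inverse: "x \<in> L \<Longrightarrow> inverse x \<in> L"
  using ring.subfield_m_inv(1)[OF ring_CC L, of x] by (cases "x = 0") auto

lemma sf_divide: "x \<in> L \<Longrightarrow> y \<in> L \<Longrightarrow> x / y \<in> L"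
  by (simp add: divide_inverse sf_mult sf_inverse)

lemma sf_power: "x \<in> L \<Longrightarrow> x ^ n \<in> L"
  by (induction n) (auto intro: sf_mult)

lemma sf_of_nat: "of_nat n \<in> L"
  by (induction n) (auto intro: sf_add)

lemma sf_of_int: "of_int n \<in> L"
  by (cases n) (use sf_of_nat sf_uminus in \<open>auto simp del: of_nat_Suc\<close>)

lemma sf_numeral: "numeral n \<in> L"
  using sf_of_nat[of "numeral n"] by simp

lemma sf_Rats: "\<rat> \<subseteq> L"
proof
  fix x :: complex
  assume "x \<in> \<rat>"
  then show "x \<in> L"
    by (elim Rats_cases') (auto intro!: sf_divide sf_of_int)
qed

lemma sf_sum: "(\<And>i. i \<in> A \<Longrightarrow> f i \<in> L) \<Longrightarrow> sum f A \<in> L"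
  by (induction A rule: infinite_finite_induct) (auto intro: sf_add)

lemmas sf_intros = sf_0 sf_1 sf_add sf_mult sf_uminus sf_diff sf_inverse sf_divide sf_power
  sf_of_nat sf_of_int sf_numeral sf_sum

end

lemma subfield_Rats: "subfield \<rat> CC"
  by (rule subfieldCI) auto

lemma subfield_adjoin: "subfield (adjoin k S) CC"
  by (rule field.generate_field_is_subfield[OF field_CC]) simp

lemma adjoin_incl: "k \<union> S \<subseteq> adjoin k S"
  by (auto intro: generate_field.incl)

lemma adjoin_min: "subfield L CC \<Longrightarrow> k \<subseteq> L \<Longrightarrow> S \<subseteq> L \<Longrightarrow> adjoin k S \<subseteq> L"
  by (rule field.generate_field_min_subfield1[OF field_CC]) auto

lemma adjoin_base_subset: "k \<subseteq> adjoin k S" and adjoin_gen_subset: "S \<subseteq> adjoin k S"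
  using adjoin_incl by auto

section \<open>Polynomials over a subfield\<close>

text \<open>Polynomials over a subfield stay inside \<open>complex poly\<close>, so that roots,
  orders and the fundamental theorem of algebra remain available for them.\<close>

definition pover :: "complex set \<Rightarrow> complex poly set" where
  "pover L = {p. \<forall>i. coeff p i \<in> L}"

lemma poverD: "p \<in> pover L \<Longrightarrow> coeff p i \<in> L"
  by (simp add: pover_def)

context
  fixes L :: "complex set"
  assumes L: "subfield L CC"
begin

lemma pover_0 [simp]: "0 \<in> pover L" and pover_1 [simp]: "1 \<in> pover L"
  by (auto simp: pover_def coeff_1 sf_intros[OF L])

lemma pover_add: "p \<in> pover L \<Longrightarrow> q \<in> pover L \<Longrightarrow> p + q \<in> pover L"
  by (auto simp: pover_def sf_intros[OF L])

lemma pover_diff: "p \<in> pover L \<Longrightarrow> q \<in> pover L \<Longrightarrow> p - q \<in> pover L"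
  by (auto simp: pover_def sf_intros[OF L])

lemma pover_uminus: "p \<in> pover L \<Longrightarrow> - p \<in> pover L"
  by (auto simp: pover_def sf_intros[OF L])

lemma pover_mult: "p \<in> pover L \<Longrightarrow> q \<in> pover L \<Longrightarrow> p * q \<in> pover L"
  by (auto simp: pover_def coeff_mult intro!: sf_sum[OF L] sf_mult[OF L])

lemma pover_smult: "c \<in> L \<Longrightarrow> q \<in> pover L \<Longrightarrow> smult c q \<in> pover L"
  by (auto simp: pover_def intro!: sf_mult[OF L])

lemma pover_monom: "c \<in> L \<Longrightarrow> monom c n \<in> pover L"
  by (auto simp: pover_def sf_intros[OF L])

lemma pover_pCons: "c \<in> L \<Longrightarrow> p \<in> pover L \<Longrightarrow> pCons c p \<in> pover L"
  by (auto simp: pover_def coeff_pCons split: nat.splits)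

lemma pover_pCons_iff: "pCons c p \<in> pover L \<longleftrightarrow> c \<in> L \<and> p \<in> pover L"
  using pover_pCons by (auto simp: pover_def coeff_pCons split: nat.splits)

lemma pover_power: "p \<in> pover L \<Longrightarrow> p ^ n \<in> pover L"
  by (induction n) (auto intro: pover_mult)

lemma poly_in_sf:
  assumes "p \<in> pover L" "x \<in> L"
  shows "poly p x \<in> L"
  using assms unfolding poly_altdef by (intro sf_sum[OF L] sf_mult[OF L] sf_power[OF L]) (auto simp: pover_def)

text \<open>Cancelling the top term of \<open>h\<close> against a monic \<open>p\<close> uses only
  the leading coefficient of \<open>h\<close>, so quotient and remainder never leave
  \<open>L\<close>.\<close>

lemma pover_division:
  assumes "p \<in> pover L" "lead_coeff p = 1" "h \<in> pover L"
  shows "\<exists>q\<in>pover L. \<exists>r\<in>pover L. h = q * p + r \<and> (r = 0 \<or> degree r < degree p)"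
  using assms(3)
proof (induction "degree h" arbitrary: h rule: less_induct)
  case less
  show ?case
  proof (cases "h = 0 \<or> degree h < degree p")
    case True
    then show ?thesis
      using less.prems by (intro bexI[of _ 0] bexI[of _ h]) auto
  next
    case False
    define m where "m = monom (lead_coeff h) (degree h - degree p)"
    have m: "m \<in> pover L"
      unfolding m_def using less.prems by (intro pover_monom) (auto simp: pover_def)
    have dm: "degree m = degree h - degree p" "lead_coeff m = lead_coeff h"
      using False by (auto simp: m_def degree_monom_eq)
    have p0: "p \<noteq> 0"
      using assms(2) by auto
    \<comment> \<open>In degree zero there is no smaller degree for the induction, but then
      \<open>p\<close> is 1 and divides \<open>h\<close>.\<close>
    show ?thesis
    proof (cases "degree h = 0")
      case True
      then have "degree p = 0"
        using False by auto
      then have "p = 1"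
        using assms(2) by (metis degree_eq_zeroE lead_coeff_pCons(2) one_pCons)
      then show ?thesis
        using less.prems by (intro bexI[of _ h] bexI[of _ 0]) auto
    next
      case d0: False
      have "degree (m * p) = degree h"
        using False p0 dm by (subst degree_mult_eq) (auto simp: m_def)
      then have "degree (h - m * p) \<le> degree h"
        using degree_diff_le[of h "degree h" "m * p"] by auto
      moreover have "coeff (h - m * p) (degree h) = 0"
        using False dm assms(2) coeff_mult_degree_sum[of m p] by auto
      ultimately have "degree (h - m * p) < degree h"
        using d0 by (metis degree_0 leading_coeff_0_iff nat_less_le)
      moreover have "h - m * p \<in> pover L"
        using less.prems m assms(1) by (intro pover_diff pover_mult)
      ultimately obtain q r where qr: "q \<in> pover L" "r \<in> pover L" "h - m * p = q * p + r"
        "r = 0 \<or> degree r < degree p"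
        using less.hyps by blast
      then show ?thesis
        using m by (intro bexI[of _ "q + m"] bexI[of _ r]) (auto simp: algebra_simps intro: pover_add)
    qed
  qed
qed

end

lemma pover_mono: "L \<subseteq> M \<Longrightarrow> pover L \<subseteq> pover M"
  by (auto simp: pover_def)

section \<open>Algebraic numbers\<close>

text \<open>Coefficient lists in HOL-Algebra start with the leading coefficient, hence the
  reversal.\<close>

lemma CC_eval: "ring.eval CC p x = poly (Poly (rev p)) x"
proof (induction p)
  case (Cons a p)
  have "poly (Poly (rev (a # p))) x = poly (Poly (rev p)) x + a * x ^ length p"
    by (simp add: Poly_append poly_monom algebra_simps)
  then show ?case
    using Cons by (simp add: ring.eval.simps[OF ring_CC])
qed (simp add: ring.eval.simps[OF ring_CC])

lemma CC_algebraic_iff: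
  assumes "subfield K CC"
  shows "(ring.algebraic CC over K) x \<longleftrightarrow> (\<exists>p\<in>pover K. p \<noteq> 0 \<and> poly p x = 0)"
proof
  assume "(ring.algebraic CC over K) x"
  then obtain p where p: "p \<in> carrier (K [X]\<^bsub>CC\<^esub>)" "p \<noteq> []" "ring.eval CC p x = 0"
    using domain.algebraicE[OF domain_CC subfieldE(1)[OF assms], of x] by auto
  then have pol: "set p \<subseteq> K" "hd p \<noteq> 0"
    by (auto simp: univ_poly_def polynomial_def)
  have "coeff (Poly (rev p)) i \<in> K" for i
    using pol(1) sf_0[OF assms] by (auto simp: nth_default_def rev_nth)
  moreover have "coeff (Poly (rev p)) (length p - 1) = hd p"
    using p(2) by (simp add: nth_default_def rev_nth hd_conv_nth)
  then have "Poly (rev p) \<noteq> 0"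
    using pol(2) by (metis coeff_0)
  ultimately show "\<exists>p\<in>pover K. p \<noteq> 0 \<and> poly p x = 0"
    using p(3) by (intro bexI[of _ "Poly (rev p)"]) (auto simp: CC_eval pover_def)
next
  assume "\<exists>p\<in>pover K. p \<noteq> 0 \<and> poly p x = 0"
  then obtain p where p: "p \<in> pover K" "p \<noteq> 0" "poly p x = 0"
    by auto
  have "set (coeffs p) \<subseteq> K"
    using p(1) by (auto simp: coeffs_def pover_def split: if_splits)
  then have "rev (coeffs p) \<in> carrier (K [X]\<^bsub>CC\<^esub>)"
    using p(1,2) by (auto simp: univ_poly_def polynomial_def pover_def coeffs_def hd_rev last_coeffs_eq_coeff_degree
        simp flip: coeffs_def)
  moreover have "rev (coeffs p) \<noteq> []"
    using p(2) by auto
  moreover have "ring.eval CC (rev (coeffs p)) x = 0"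
    using p(3) by (simp add: CC_eval)
  ultimately show "(ring.algebraic CC over K) x"
    using ring.algebraicI[OF ring_CC] by auto
qed

lemma Qbar_alt: "Qbar = {x \<in> carrier CC. (ring.algebraic CC over \<rat>) x}"
  by (auto simp: Qbar_def CC_algebraic_iff[OF subfield_Rats] algebraic_altdef pover_def)

lemma subfield_Qbar: "subfield Qbar CC"
  unfolding Qbar_alt by (rule field.subfield_of_algebraics[OF field_CC subfield_Rats])

text \<open>The coefficients generate a finite extension \<open>E\<close> of the rationals, and
  \<open>x\<close> generates a finite extension of \<open>E\<close>; by the tower law
  \<open>x\<close> lies in a finite extension of the rationals.\<close>

lemma Qbar_root:
  assumes "p \<in> pover Qbar" "p \<noteq> 0" "poly p x = 0"
  shows "x \<in> Qbar"
proof -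
  define E where "E = ring.finite_extension CC \<rat> (coeffs p)"
  have alg: "(ring.algebraic CC over \<rat>) c" if "c \<in> set (coeffs p)" for c
  proof -
    have "c \<in> Qbar"
      using that assms(1) by (auto simp: coeffs_def pover_def split: if_splits)
    then show ?thesis
      by (simp add: Qbar_alt)
  qed
  have E: "subfield E CC"
    unfolding E_def by (intro domain.finite_extension_is_subfield[OF domain_CC subfield_Rats] alg) auto
  have fE: "ring.finite_dimension CC \<rat> E"
    unfolding E_def by (intro domain.finite_extension_finite_dimension(1)[OF domain_CC subfield_Rats] alg) auto
  have "set (coeffs p) \<subseteq> E"
    unfolding E_def by (rule domain.finite_extension_mem[OF domain_CC subfieldE(1)[OF subfield_Rats]]) auto
  then have "p \<in> pover E"
    using sf_0[OF E] by (auto simp: pover_def) (metis coeff_in_coeffs coeff_0 le_degree subsetD)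
  then have algx: "(ring.algebraic CC over E) x"
    using assms(2,3) CC_algebraic_iff[OF E] by auto
  define F where "F = ring.simple_extension CC E x"
  have "ring.finite_dimension CC E F"
    unfolding F_def using domain.finite_dimension_simple_extension[OF domain_CC E, of x] algx by auto
  then have fF: "ring.finite_dimension CC \<rat> F"
    using ring.telescopic_base_dim(1)[OF ring_CC subfield_Rats E fE] by auto
  have sF: "subring F CC"
    unfolding F_def by (intro domain.simple_extension_is_subring[OF domain_CC] subfieldE(1)[OF E]) auto
  have "x \<in> F"
    unfolding F_def by (intro ring.simple_extension_mem[OF ring_CC] subfieldE(1)[OF E]) auto
  then have "(ring.algebraic CC over \<rat>) x"
    by (rule ring.finite_dimension_imp_algebraic[OF ring_CC subfield_Rats sF fF])
  then show ?thesis
    by (simp add: Qbar_alt)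
qed

lemma Qbar_csqrt: "x \<in> Qbar \<Longrightarrow> csqrt x \<in> Qbar"
  by (auto simp: Qbar_def)

lemma Qbar_sq: "y\<^sup>2 \<in> Qbar \<Longrightarrow> y \<in> Qbar"
  by (auto simp: Qbar_def intro: algebraic_root[of "y\<^sup>2" "monom 1 2" y] simp: poly_monom degree_monom_eq)

lemma Rats_subset_Qbar: "\<rat> \<subseteq> Qbar"
  by (rule sf_Rats[OF subfield_Qbar])

lemma poly_has_root: 
  assumes "degree (p :: complex poly) > 0"
  shows "\<exists>x. poly p x = 0"
  using fundamental_theorem_of_algebra[of p] constant_degree[of p] assms by auto

section \<open>Two quartic equations\<close>

lemma not_coprime_prime_int:
  assumes "\<not> coprime (x::int) y"
  obtains p where "Factorial_Ring.prime p" "p dvd x" "p dvd y"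
proof (cases "x = 0 \<and> y = 0")
  case True
  then show ?thesis
    using that[of 2] by simp
next
  case False
  then obtain p where "Factorial_Ring.prime p" "p dvd gcd x y"
    using assms prime_divisorE[of "gcd x y"] by (metis coprime_iff_gcd_eq_1 gcd_eq_0_iff is_unit_gcd_iff)
  then show ?thesis
    using that by auto
qed

lemma coprimeI_prime_int:
  assumes "\<And>p. Factorial_Ring.prime p \<Longrightarrow> p dvd x \<Longrightarrow> p dvd y \<Longrightarrow> False"
  shows "coprime (x::int) y"
  using not_coprime_prime_int assms by blast

lemma coprime_primeD_int:
  "coprime (x::int) y \<Longrightarrow> Factorial_Ring.prime p \<Longrightarrow> p dvd x \<Longrightarrow> p dvd y \<Longrightarrow> False"
  using coprime_common_divisor not_prime_unit by blast

lemma prime_dvd_5: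
  assumes "Factorial_Ring.prime (p::int)" "p dvd 5"
  shows "p = 5"
proof -
  have "Factorial_Ring.prime (5::int)"
    by simp
  then show ?thesis
    using assms primes_dvd_imp_eq by blast
qed

lemma coprime_mult_power_int:
  fixes x y z :: int
  assumes "coprime x y" "x * y = z ^ k" "x > 0" "y > 0" "k > 0"
  obtains a b where "a > 0" "b > 0" "x = a ^ k" "y = b ^ k" "a * b = \<bar>z\<bar>"
proof -
  have c: "coprime (nat x) (nat y)"
    using assms(1,3,4) by (metis coprime_int_iff int_nat_eq less_imp_le)
  have "nat x * nat y = nat \<bar>z\<bar> ^ k"
    using assms(2,3,4) by (metis abs_mult_pos' abs_of_pos less_imp_le nat_abs_mult_distrib nat_power_eq power_abs abs_ge_zero)
  then have "is_nth_power k (nat x * nat y)"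
    by (simp add: is_nth_powerI)
  then have "is_nth_power k (nat x)" "is_nth_power k (nat y)"
    using is_nth_power_mult_coprime_natD[of "nat x" "nat y" k] c assms(3,4) by auto
  then obtain a b where ab: "nat x = a ^ k" "nat y = b ^ k"
    by (auto elim!: is_nth_powerE)
  have x: "x = int a ^ k" and y: "y = int b ^ k"
    using ab assms(3,4) by (metis int_nat_eq less_imp_le of_nat_power)+
  have pos: "a > 0" "b > 0"
    using x y assms(3,4,5) by (auto intro!: gr0I)
  have "(int a * int b) ^ k = \<bar>z\<bar> ^ k"
    using x y assms(2,3,4) by (metis abs_of_pos mult_pos_pos power_abs power_mult_distrib)
  then have "int a * int b = \<bar>z\<bar>"
    using assms(5) by (simp add: power_eq_iff_eq_base)
  then show ?thesis
    using that[of "int a" "int b"] x y pos by auto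
qed

text \<open>5 divides at most one of two coprime factors. That factor absorbs all of
  \<open>5 ^ k\<close>, and what remains is a fourth power, split into coprime parts.\<close>

lemma coprime_mult_five_power:
  fixes x y z :: int
  assumes "coprime x y" "x * y = 5 ^ k * z ^ 4" "x > 0" "y > 0"
  obtains a b where "a > 0" "b > 0" "a * b = \<bar>z\<bar>" "x = a ^ 4 \<and> y = 5 ^ k * b ^ 4 \<or> x = 5 ^ k * b ^ 4 \<and> y = a ^ 4"
proof -
  have key: "\<exists>a b. a > 0 \<and> b > 0 \<and> a * b = \<bar>z\<bar> \<and> x = a ^ 4 \<and> y = 5 ^ k * b ^ 4"
    if c: "coprime x y" "x * y = 5 ^ k * z ^ 4" "x > 0" "y > 0" "coprime 5 x" for x y
  proof -
    have "5 ^ k dvd x * y"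
      using c(2) by simp
    moreover have "coprime (5 ^ k) x"
      using c(5) by simp
    ultimately obtain w where w: "y = 5 ^ k * w"
      by (metis coprime_dvd_mult_right_iff dvdE)
    have "x * w = z ^ 4"
      using c(2) unfolding w by simp
    moreover have "coprime x w"
      using c(1) unfolding w by simp
    moreover have "w > 0"
      using c(4) w by (simp add: zero_less_mult_iff)
    ultimately obtain a b where "a > 0" "b > 0" "x = a ^ 4" "w = b ^ 4" "a * b = \<bar>z\<bar>"
      using coprime_mult_power_int[of x w z 4] c(3) by auto
    then show ?thesis
      using w by blast
  qed
  show ?thesis
  proof (cases "5 dvd x")
    case True
    then have "\<not> 5 dvd y"
      using assms(1) coprime_primeD_int[of x y 5] by auto
    then have "coprime 5 y"
      using prime_imp_coprime[of "5::int" y] by simp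
    then show ?thesis
      using key[of y x] assms that by (metis coprime_commute mult.commute)
  next
    case False
    then have "coprime 5 x"
      using prime_imp_coprime[of "5::int" x] by simp
    then show ?thesis
      using key[of x y] assms that by blast
  qed
qed

lemma prime_5_int: "Factorial_Ring.prime (5 :: int)"
  by simp

lemma five_dvd_cancel: "5 * 5 dvd 5 * w \<Longrightarrow> 5 dvd (w :: int)"
  by (simp only: dvd_mult_cancel_left) simp

lemma sum_diff_factors_pos:
  fixes M t w :: int
  assumes "(M - t) * (M + t) = w" "w > 0" "M > 0"
  shows "M - t > 0" "M + t > 0"
proof -
  have "(M - t > 0 \<and> M + t > 0) \<or> (M - t < 0 \<and> M + t < 0)"
    using assms(1,2) by (metis zero_less_mult_iff)
  then show "M - t > 0" "M + t > 0"
    using assms(3) by auto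
qed

text \<open>Infinite descent on \<open>s\<close>. For odd \<open>s\<close> the equation reads
  \<open>(M - 2 * t) * (M + 2 * t) = 5 * s ^ 4\<close> with
  \<open>M = 2 * r\<^sup>2 + s\<^sup>2\<close>, and the coprime factors are \<open>A ^ 4\<close> and
  \<open>5 * B ^ 4\<close> with \<open>A * B = \<bar>s\<bar>\<close>. Adding them gives
  \<open>4 * r\<^sup>2 = (A\<^sup>2 - B\<^sup>2)\<^sup>2 + 4 * B ^ 4\<close>, a quartic that belongs
  to the 2-isogenous curve y^2 = x^3 - 2 x^2 + 5 x. Its own factorisation into \<open>m ^ 4\<close>
  and \<open>n ^ 4\<close> makes \<open>(n, m, A)\<close> a solution of the original equation, with
  \<open>m\<close> dividing \<open>s\<close>.\<close>

lemma quartic_descent: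
  fixes r s t :: int
  assumes "coprime r s" "t\<^sup>2 = r ^ 4 + r\<^sup>2 * s\<^sup>2 - s ^ 4" "s \<noteq> 0"
  shows "r\<^sup>2 = 1 \<and> s\<^sup>2 = 1"
  using assms
proof (induction "nat \<bar>s\<bar>" arbitrary: r s t rule: less_induct)
  case less
  note cop = less.prems(1) and eq = less.prems(2) and s0 = less.prems(3)
  have IH: "r'\<^sup>2 = 1 \<and> s'\<^sup>2 = 1" if "\<bar>s'\<bar> < \<bar>s\<bar>" "coprime r' s'" "t'\<^sup>2 = r' ^ 4 + r'\<^sup>2 * s'\<^sup>2 - s' ^ 4" "s' \<noteq> 0"
    for r' s' t'
    using less.hyps[OF _ that(2,3,4)] that(1) s0 by auto
  have prs: "False" if "Factorial_Ring.prime p" "p dvd r" "p dvd s" for p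
    using coprime_primeD_int[OF cop that] .
  show ?case
  proof (cases "odd s")
    case True
    define M where "M = 2 * r\<^sup>2 + s\<^sup>2"
    have M: "M > 0" "odd M"
      using s0 True by (auto simp: M_def add_nonneg_pos)
    have XY: "(M - 2 * t) * (M + 2 * t) = 5 ^ 1 * s ^ 4"
      using eq unfolding M_def by Groebner_Basis.algebra
    have pos: "M - 2 * t > 0" "M + 2 * t > 0"
      using sum_diff_factors_pos[OF XY] M s0 by auto
    have "coprime (M - 2 * t) (M + 2 * t)"
    proof (rule coprimeI_prime_int)
      fix p :: int
      assume p: "Factorial_Ring.prime p" "p dvd M - 2 * t" "p dvd M + 2 * t"
      have "p dvd 2 * M"
        using dvd_add[OF p(2,3)] by simp
      moreover have "\<not> p dvd 2"
        using p M primes_dvd_imp_eq[of p 2] by auto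
      ultimately have pM: "p dvd M"
        using p(1) prime_dvd_multD by blast
      \<comment> \<open>If 5 divided both factors, 25 would divide \<open>5 * s ^ 4\<close>, and so
        5 would divide \<open>s\<close> after all.\<close>
      have "p dvd s"
      proof (rule ccontr)
        assume "\<not> p dvd s"
        have "p dvd 5 * s ^ 4"
          using dvd_mult2[OF p(2), of "M + 2 * t"] unfolding XY by simp
        then have "p = 5"
          using p(1) \<open>\<not> p dvd s\<close> prime_dvd_multD prime_dvd_power prime_dvd_5 by blast
        then have "5 * 5 dvd 5 * s ^ 4"
          using mult_dvd_mono[OF p(2,3)] unfolding XY by (simp only: power_one_right)
        then have "5 dvd s ^ 4"
          by (rule five_dvd_cancel)
        then show False
          using \<open>p = 5\<close> \<open>\<not> p dvd s\<close> p(1) prime_dvd_power by blast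
      qed
      then have "p dvd 2 * r\<^sup>2"
        using pM unfolding M_def by (metis dvd_add_left_iff dvd_power_same dvd_mult2 power2_eq_square)
      then have "p dvd r"
        using p(1) \<open>\<not> p dvd 2\<close> prime_dvd_multD prime_dvd_power by blast
      then show False
        using prs p(1) \<open>p dvd s\<close> by blast
    qed
    then obtain A B where AB: "A > 0" "B > 0" "A * B = \<bar>s\<bar>"
      "M - 2 * t = A ^ 4 \<and> M + 2 * t = 5 ^ 1 * B ^ 4 \<or> M - 2 * t = 5 ^ 1 * B ^ 4 \<and> M + 2 * t = A ^ 4"
      using coprime_mult_five_power[OF _ XY pos] by metis
    have s2: "s\<^sup>2 = A\<^sup>2 * B\<^sup>2"
      using AB(3) by (metis power2_abs power_mult_distrib)
    have "2 * M = A ^ 4 + 5 * B ^ 4"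
      using AB(4) by auto
    then have r4: "4 * r\<^sup>2 = (A\<^sup>2 - B\<^sup>2)\<^sup>2 + 4 * B ^ 4"
      unfolding M_def s2 by Groebner_Basis.algebra
    have odd: "odd A" "odd B"
      using True AB(3) by (metis dvd_mult2 even_abs_add_iff dvd_abs_iff, metis dvd_mult dvd_abs_iff)
    then have "even (A\<^sup>2 - B\<^sup>2)"
      by simp
    then obtain a where a: "A\<^sup>2 - B\<^sup>2 = 2 * a"
      by (elim evenE)
    define R where "R = \<bar>r\<bar>"
    have R2: "R\<^sup>2 = a\<^sup>2 + B ^ 4"
      using r4 unfolding a R_def by (simp add: power_mult_distrib)
    have XY': "(R - a) * (R + a) = B ^ 4"
      using R2 by Groebner_Basis.algebra
    have "R > 0"
      using R2 AB(2) unfolding R_def by (auto simp: add_nonneg_eq_0_iff)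
    then have pos': "R - a > 0" "R + a > 0"
      using sum_diff_factors_pos[OF XY'] AB(2) by auto
    have "coprime (R - a) (R + a)"
    proof (rule coprimeI_prime_int)
      fix p :: int
      assume p: "Factorial_Ring.prime p" "p dvd R - a" "p dvd R + a"
      have "p dvd B ^ 4"
        using dvd_mult2[OF p(2), of "R + a"] unfolding XY' .
      then have pB: "p dvd B"
        using p(1) prime_dvd_power by blast
      then have "\<not> p dvd 2"
        using odd(2) p(1) primes_dvd_imp_eq[of p 2] by auto
      moreover have "p dvd 2 * R"
        using dvd_add[OF p(2,3)] by simp
      ultimately have "p dvd R"
        using p(1) prime_dvd_multD by blast
      moreover have "p dvd s"
        using pB AB(3) by (metis dvd_abs_iff dvd_mult)
      ultimately show False
        using prs p(1) unfolding R_def by simp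
    qed
    then obtain m n where mn: "m > 0" "n > 0" "R - a = m ^ 4" "R + a = n ^ 4" "m * n = \<bar>B\<bar>"
      using coprime_mult_power_int[OF _ XY' pos'] by (metis zero_less_numeral)
    have "coprime n m"
      using \<open>coprime (R - a) (R + a)\<close> unfolding mn by (simp add: coprime_commute)
    have B: "B = m * n"
      using mn(5) AB(2) by simp
    have eqA: "A\<^sup>2 = n ^ 4 + n\<^sup>2 * m\<^sup>2 - m ^ 4"
      using a mn(3,4) unfolding B by Groebner_Basis.algebra
    have sAmn: "\<bar>s\<bar> = A * n * m"
      using AB(3) B by (simp add: mult_ac)
    \<comment> \<open>As \<open>\<bar>s\<bar> = A * n * m\<close>, the new \<open>m\<close> is
      smaller than \<open>\<bar>s\<bar>\<close> unless \<open>A = n = 1\<close>; this exception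
      yields the trivial solutions.\<close>
    show ?thesis
    proof (cases "A * n = 1")
      case True
      then have An: "A = 1" "n = 1"
        using AB(1) mn(2) by (auto simp: zmult_eq_1_iff)
      then have "m\<^sup>2 = m ^ 4"
        using eqA by simp
      then have "m\<^sup>2 * 1 = m\<^sup>2 * m\<^sup>2"
        by Groebner_Basis.algebra
      then have "m\<^sup>2 = 1"
        using mn(1) by (subst (asm) mult_left_cancel) auto
      then have "m = 1"
        using mn(1) by (simp add: power2_eq_1_iff)
      then have "B = 1" "\<bar>s\<bar> = 1"
        using B An sAmn by auto
      moreover have "a = 0"
        using a An \<open>B = 1\<close> by simp
      ultimately have "R\<^sup>2 = 1" "\<bar>s\<bar>\<^sup>2 = 1"
        using R2 by auto
      then show ?thesis
        unfolding R_def by simp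
    next
      case False
      then have "A * n \<ge> 2"
        using AB(1) mn(2) by (smt (verit) mult_pos_pos)
      then have "\<bar>s\<bar> \<ge> 2 * m"
        unfolding sAmn using mn(1) by (intro mult_right_mono) auto
      then have lt: "\<bar>m\<bar> < \<bar>s\<bar>"
        using mn(1) by linarith
      have "n\<^sup>2 = 1 \<and> m\<^sup>2 = 1"
        using IH[OF lt \<open>coprime n m\<close> eqA] mn(1) by simp
      then have nm: "n = 1" "m = 1"
        using mn(1,2) by (auto simp: power2_eq_1_iff)
      then have "A\<^sup>2 = 1"
        using eqA by simp
      then have "A = 1"
        using AB(1) by (simp add: power2_eq_1_iff)
      then show ?thesis
        using False nm by simp
    qed
  next
    case False
    then have "even s"
      by simp
    then obtain s1 where s1: "s = 2 * s1"
      by (elim evenE)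
    have "odd r"
      using prs[of 2] False by auto
    \<comment> \<open>Removing the factor 4 from \<open>N\<^sup>2 - t\<^sup>2 = 20 * s1 ^ 4\<close>
      makes the factors coprime. The smaller solution is trivial by induction, which gives
      \<open>a = 0\<close>, whereas \<open>a\<close> is odd: an even \<open>s\<close> does not
      occur.\<close>
    define N where "N = r\<^sup>2 + 2 * s1\<^sup>2"
    have N: "N > 0" "odd N"
      using s0 s1 \<open>odd r\<close> by (auto simp: N_def add_nonneg_pos)
    have XY: "(N - t) * (N + t) = 20 * s1 ^ 4"
      using eq unfolding N_def s1 by Groebner_Basis.algebra
    have "odd (t\<^sup>2)"
      unfolding eq using \<open>odd r\<close> False by simp
    then have "odd t"
      by simp
    then have "even (N - t)" "even (N + t)"
      using N(2) by auto
    then obtain U Y where U: "N - t = 2 * U" and Y: "N + t = 2 * Y"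
      by (meson evenE)
    have XY2: "U * Y = 5 ^ 1 * s1 ^ 4"
      using XY unfolding U Y by simp
    have pos: "U > 0" "Y > 0"
      using sum_diff_factors_pos[OF XY] N s0 s1 U Y by auto
    have NXY: "N = U + Y"
      using U Y by simp
    have copXY: "coprime U Y"
    proof (rule coprimeI_prime_int)
      fix p :: int
      assume p: "Factorial_Ring.prime p" "p dvd U" "p dvd Y"
      have pN: "p dvd N"
        unfolding NXY using p by simp
      have "p dvd s1"
      proof (rule ccontr)
        assume n: "\<not> p dvd s1"
        have "p dvd 5 * s1 ^ 4"
          using dvd_mult2[OF p(2), of Y] unfolding XY2 by simp
        then have "p = 5"
          using p(1) n prime_dvd_multD prime_dvd_power prime_dvd_5 by blast
        then have "5 * 5 dvd 5 * s1 ^ 4"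
          using mult_dvd_mono[OF p(2,3)] unfolding XY2 by (simp only: power_one_right)
        then have "5 dvd s1 ^ 4"
          by (rule five_dvd_cancel)
        then show False
          using \<open>p = 5\<close> n p(1) prime_dvd_power by blast
      qed
      then have "p dvd r\<^sup>2"
        using pN unfolding N_def by (metis dvd_add_left_iff dvd_mult dvd_mult2 power2_eq_square)
      then show False
        using prs[of p] p(1) \<open>p dvd s1\<close> s1 prime_dvd_power by (metis dvd_mult)
    qed
    then obtain A B where AB: "A > 0" "B > 0" "A * B = \<bar>s1\<bar>"
      "U = A ^ 4 \<and> Y = 5 ^ 1 * B ^ 4 \<or> U = 5 ^ 1 * B ^ 4 \<and> Y = A ^ 4"
      using coprime_mult_five_power[OF _ XY2 pos] by metis
    have s2: "s1\<^sup>2 = A\<^sup>2 * B\<^sup>2"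
      using AB(3) by (metis power2_abs power_mult_distrib)
    have "N = A ^ 4 + 5 * B ^ 4"
      using AB(4) NXY by auto
    then have r2: "r\<^sup>2 = (A\<^sup>2 - B\<^sup>2)\<^sup>2 + 4 * B ^ 4"
      unfolding N_def s2 by Groebner_Basis.algebra
    define R where "R = \<bar>r\<bar>"
    define a where "a = A\<^sup>2 - B\<^sup>2"
    have R2: "R\<^sup>2 = a\<^sup>2 + 4 * B ^ 4"
      using r2 unfolding R_def a_def by simp
    have "odd R"
      using \<open>odd r\<close> by (simp add: R_def)
    moreover have "odd (a\<^sup>2)"
      using R2 \<open>odd R\<close> by (metis dvd_add_left_iff dvd_mult2 even_numeral even_power odd_pos pos2)
    ultimately have "even (R - a)" "even (R + a)"
      by auto
    then obtain X' Y' where X': "R - a = 2 * X'" and Y': "R + a = 2 * Y'"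
      by (meson evenE)
    have XYR: "(R - a) * (R + a) = 4 * B ^ 4"
      using R2 by Groebner_Basis.algebra
    have XY': "X' * Y' = B ^ 4"
      using XYR unfolding X' Y' by simp
    have "R > 0"
      using \<open>odd R\<close> unfolding R_def by (metis abs_ge_zero dvd_0_right less_le)
    then have pos': "X' > 0" "Y' > 0"
      using sum_diff_factors_pos[OF XYR] AB(2) X' Y' by auto
    have RX: "R = X' + Y'" and aX: "a = Y' - X'"
      using X' Y' by auto
    have cop': "coprime X' Y'"
    proof (rule coprimeI_prime_int)
      fix p :: int
      assume p: "Factorial_Ring.prime p" "p dvd X'" "p dvd Y'"
      have "p dvd B ^ 4"
        using dvd_mult2[OF p(2), of Y'] unfolding XY' .
      then have "p dvd B"
        using p(1) prime_dvd_power by blast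
      then have "p dvd s"
        using AB(3) s1 by (metis dvd_abs_iff dvd_mult)
      moreover have "p dvd R"
        unfolding RX using p by simp
      ultimately show False
        using prs p(1) unfolding R_def by simp
    qed
    then obtain m n where mn: "m > 0" "n > 0" "X' = m ^ 4" "Y' = n ^ 4" "m * n = \<bar>B\<bar>"
      using coprime_mult_power_int[OF _ XY' pos'] by (metis zero_less_numeral)
    have "coprime n m"
      using cop' unfolding mn by (simp add: coprime_commute)
    have B: "B = m * n"
      using mn(5) AB(2) by simp
    have eqA: "A\<^sup>2 = n ^ 4 + n\<^sup>2 * m\<^sup>2 - m ^ 4"
      using a_def aX mn(3,4) unfolding B by Groebner_Basis.algebra
    have "\<bar>s\<bar> = 2 * (A * n * m)"
      using AB(3) B s1 by (simp add: abs_mult mult_ac)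
    moreover have "A * n \<ge> 1"
      using AB(1) mn(2) by (smt (verit) mult_pos_pos)
    then have "A * n * m \<ge> 1 * m"
      using mn(1) by (intro mult_right_mono) auto
    ultimately have lt: "\<bar>m\<bar> < \<bar>s\<bar>"
      using mn(1) by linarith
    have "n\<^sup>2 = 1 \<and> m\<^sup>2 = 1"
      using IH[OF lt \<open>coprime n m\<close> eqA] mn(1) by simp
    then have nm: "n = 1" "m = 1"
      using mn(1,2) by (auto simp: power2_eq_1_iff)
    then have "a = 0"
      using aX mn by simp
    then show ?thesis
      using \<open>odd (a\<^sup>2)\<close> by simp
  qed
qed

section \<open>Quartic forms attached to the twist by 5\<close>

lemma square_mod_5: "(x::int)\<^sup>2 mod 5 = 0 \<and> x mod 5 = 0 \<or> x\<^sup>2 mod 5 = 1 \<and> x mod 5 \<noteq> 0 \<or> x\<^sup>2 mod 5 = 4 \<and> x mod 5 \<noteq> 0"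
proof -
  have "x mod 5 \<in> {0,1,2,3,4}"
    by auto
  moreover have "x\<^sup>2 mod 5 = (x mod 5)\<^sup>2 mod 5"
    by (simp add: power_mod)
  ultimately show ?thesis
    by auto
qed

text \<open>Completing the square shows that 5 divides \<open>2 * r\<^sup>2 + s\<^sup>2\<close>; as
  -2 is not a square modulo 5, it then divides both \<open>r\<close> and \<open>s\<close>.\<close>

lemma quartic_five_1:
  fixes r s t :: int
  assumes "coprime r s" "5 * t\<^sup>2 = r ^ 4 + r\<^sup>2 * s\<^sup>2 - s ^ 4"
  shows False
proof -
  have "(2 * r\<^sup>2 + s\<^sup>2)\<^sup>2 = 5 * (4 * t\<^sup>2 + s ^ 4)"
    using assms(2) by Groebner_Basis.algebra
  then have "5 dvd (2 * r\<^sup>2 + s\<^sup>2)\<^sup>2"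
    by simp
  then have "5 dvd 2 * r\<^sup>2 + s\<^sup>2"
    using prime_dvd_power[of "5::int"] by simp
  then have "5 dvd r \<and> 5 dvd s"
    using square_mod_5[of r] square_mod_5[of s] by presburger
  then show False
    using coprime_primeD_int[OF assms(1), of 5] by simp
qed

lemma square_mod_8: "(x::int)\<^sup>2 mod 8 = 1 \<and> odd x \<or> x\<^sup>2 mod 8 = 0 \<and> even x \<or> x\<^sup>2 mod 8 = 4 \<and> even x"
proof -
  have "x mod 8 \<in> {0,1,2,3,4,5,6,7}"
    by auto
  moreover have "x\<^sup>2 mod 8 = (x mod 8)\<^sup>2 mod 8"
    by (simp add: power_mod)
  moreover have "even x \<longleftrightarrow> even (x mod 8)"
    by presburger
  ultimately show ?thesis
    by auto
qed

text \<open>Modulo 8 the right-hand side is 5 for odd \<open>r\<close> and \<open>s\<close>, and 3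
  or 7 for even \<open>r\<close> and odd \<open>s\<close>; none of these is a square.\<close>

lemma quartic_five_parity:
  fixes r s t :: int
  assumes "coprime r s" "t\<^sup>2 = \<alpha> * r ^ 4 + 5 * (r\<^sup>2 * s\<^sup>2) - \<beta> * s ^ 4" "\<alpha> mod 8 = 1" "\<beta> mod 8 = 1"
  shows "even s \<and> odd r"
proof -
  define R S where "R = r\<^sup>2 mod 8" and "S = s\<^sup>2 mod 8"
  have "t\<^sup>2 mod 8 = (\<alpha> * (r\<^sup>2)\<^sup>2 + 5 * (r\<^sup>2 * s\<^sup>2) - \<beta> * (s\<^sup>2)\<^sup>2) mod 8"
    unfolding assms(2) by (simp flip: power_mult)
  also have "\<dots> = ((\<alpha> mod 8) * R\<^sup>2 + 5 * (R * S) - (\<beta> mod 8) * S\<^sup>2) mod 8"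
    unfolding R_def S_def by (intro mod_diff_cong mod_add_cong mod_mult_cong) (simp_all add: power_mod mod_simps)
  finally have t: "t\<^sup>2 mod 8 = (R\<^sup>2 + 5 * (R * S) - S\<^sup>2) mod 8"
    using assms by simp
  have "\<not> (even r \<and> even s)"
    using coprime_primeD_int[OF assms(1), of 2] by auto
  then show ?thesis
    using square_mod_8[of r] square_mod_8[of s] square_mod_8[of t] t
    unfolding R_def[symmetric] S_def[symmetric] by auto
qed

lemma halves_of_difference:
  fixes N t w :: int
  assumes "(N - t) * (N + t) = 4 * w" "w > 0" "N > 0" "odd N" "odd t"
  obtains U Y where "U > 0" "Y > 0" "U * Y = w" "N = U + Y" "t = Y - U"
proof -
  have "even (N - t)" "even (N + t)"
    using assms(4,5) by auto
  then obtain U Y where U: "N - t = 2 * U" and Y: "N + t = 2 * Y"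
    by (meson evenE)
  have "U * Y = w"
    using assms(1) unfolding U Y by simp
  moreover have "U > 0" "Y > 0"
    using sum_diff_factors_pos[OF assms(1)] assms U Y by auto
  ultimately show ?thesis
    using that[of U Y] U Y by simp
qed

text \<open>The first factorisation of the descent already forces \<open>A\<^sup>2\<close> to be
  congruent to \<open>2 * B\<^sup>2\<close> modulo 5 with \<open>A\<close> and \<open>B\<close>
  prime to 5, and 2 is not a square modulo 5.\<close>

lemma quartic_five_2:
  fixes r s t :: int
  assumes cop: "coprime r s" and eq: "t\<^sup>2 = 25 * r ^ 4 + 5 * (r\<^sup>2 * s\<^sup>2) - s ^ 4" and s5: "\<not> 5 dvd s"
  shows False
proof -
  have par: "even s" "odd r"
    using quartic_five_parity[OF cop, of t 25 1] eq by auto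
  obtain s1 where s1: "s = 2 * s1"
    using par(1) by (elim evenE)
  have s0: "s1 \<noteq> 0"
    using s5 s1 by auto
  define N where "N = 5 * r\<^sup>2 + 2 * s1\<^sup>2"
  have N: "N > 0" "odd N"
    using par s0 by (auto simp: N_def add_nonneg_pos)
  have "odd (t\<^sup>2)"
    unfolding eq using par by simp
  then have "odd t"
    by simp
  have NN: "(N - t) * (N + t) = 4 * (5 ^ 1 * s1 ^ 4)"
    using eq unfolding N_def s1 by Groebner_Basis.algebra
  have "5 ^ 1 * s1 ^ 4 > 0"
    using s0 s1 by simp
  then obtain U Y where XY: "U > 0" "Y > 0" "U * Y = 5 ^ 1 * s1 ^ 4" "N = U + Y"
    using halves_of_difference[OF NN _ N \<open>odd t\<close>] by metis
  have "coprime U Y"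
  proof (rule coprimeI_prime_int)
    fix p :: int
    assume p: "Factorial_Ring.prime p" "p dvd U" "p dvd Y"
    have pN: "p dvd N"
      unfolding XY using p by simp
    have "p \<noteq> 5"
    proof
      assume "p = 5"
      then have "5 * 5 dvd 5 * s1 ^ 4"
        using mult_dvd_mono[OF p(2,3)] unfolding XY by (simp only: power_one_right)
      then have "5 dvd s1 ^ 4"
        by (rule five_dvd_cancel)
      then show False
        using \<open>p = 5\<close> p(1) prime_dvd_power s5 s1 by (metis dvd_mult)
    qed
    have "p dvd 5 * s1 ^ 4"
      using dvd_mult2[OF p(2), of Y] unfolding XY by simp
    then have ps: "p dvd s1"
      using p(1) \<open>p \<noteq> 5\<close> prime_dvd_multD prime_dvd_power prime_dvd_5 by blast
    then have "p dvd 5 * r\<^sup>2"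
      using pN unfolding N_def by (metis dvd_add_left_iff dvd_mult dvd_mult2 power2_eq_square)
    then have "p dvd r"
      using p(1) \<open>p \<noteq> 5\<close> prime_dvd_multD prime_dvd_power prime_dvd_5 by blast
    then show False
      using coprime_primeD_int[OF cop p(1)] ps s1 by simp
  qed
  then obtain A B where AB: "A > 0" "B > 0" "A * B = \<bar>s1\<bar>"
    "U = A ^ 4 \<and> Y = 5 ^ 1 * B ^ 4 \<or> U = 5 ^ 1 * B ^ 4 \<and> Y = A ^ 4"
    using coprime_mult_five_power[OF _ XY(3,1,2)] by metis
  have s2: "s1\<^sup>2 = A\<^sup>2 * B\<^sup>2"
    using AB(3) by (metis power2_abs power_mult_distrib)
  have "N = A ^ 4 + 5 * B ^ 4"
    using AB(4) XY by auto
  then have "A\<^sup>2 * (A\<^sup>2 - 2 * B\<^sup>2) = 5 * (r\<^sup>2 - B ^ 4)"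
    unfolding N_def s2 by Groebner_Basis.algebra
  then have "5 dvd A\<^sup>2 * (A\<^sup>2 - 2 * B\<^sup>2)"
    by simp
  moreover have nAB: "\<not> 5 dvd A" "\<not> 5 dvd B"
    using s5 AB(3) s1 by (metis dvd_abs_iff dvd_mult dvd_mult2)+
  ultimately have "5 dvd A\<^sup>2 - 2 * B\<^sup>2"
    using prime_dvd_multD[OF prime_5_int] prime_dvd_power[OF prime_5_int] by blast
  then show False
    using nAB square_mod_5[of A] square_mod_5[of B] by presburger
qed

text \<open>Descent as in \<open>quartic_descent\<close>, starting from
  \<open>N\<^sup>2 - t\<^sup>2 = 4 * (5 ^ 3 * s1 ^ 4)\<close>. The factors \<open>n ^ 4\<close> and
  \<open>25 * m ^ 4\<close> of the second factorisation come in two orders: one gives the form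
  excluded by \<open>quartic_five_2\<close>, the other the same form with a smaller
  \<open>s\<close>.\<close>

lemma quartic_five_3:
  fixes r s t :: int
  assumes "coprime r s" "t\<^sup>2 = r ^ 4 + 5 * (r\<^sup>2 * s\<^sup>2) - 25 * s ^ 4" "\<not> 5 dvd r" "s \<noteq> 0"
  shows False
  using assms
proof (induction "nat \<bar>s\<bar>" arbitrary: r s t rule: less_induct)
  case less
  note cop = less.prems(1) and eq = less.prems(2) and r5 = less.prems(3) and s0 = less.prems(4)
  have IH: False if "\<bar>s'\<bar> < \<bar>s\<bar>" "coprime r' s'" "t'\<^sup>2 = r' ^ 4 + 5 * (r'\<^sup>2 * s'\<^sup>2) - 25 * s' ^ 4"
    "\<not> 5 dvd r'" "s' \<noteq> 0" for r' s' t'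
    using less.hyps[OF _ that(2,3,4,5)] that(1) s0 by auto
  have prs: "False" if "Factorial_Ring.prime p" "p dvd r" "p dvd s" for p
    using coprime_primeD_int[OF cop that] .
  have par: "even s" "odd r"
    using quartic_five_parity[OF cop, of t 1 25] eq by auto
  obtain s1 where s1: "s = 2 * s1"
    using par(1) by (elim evenE)
  define N where "N = r\<^sup>2 + 10 * s1\<^sup>2"
  have N: "N > 0" "odd N"
    using par s0 s1 by (auto simp: N_def add_nonneg_pos)
  have "odd (t\<^sup>2)"
    unfolding eq using par by simp
  then have "odd t"
    by simp
  have NN: "(N - t) * (N + t) = 4 * (5 ^ 3 * s1 ^ 4)"
    using eq unfolding N_def s1 by Groebner_Basis.algebra
  have "5 ^ 3 * s1 ^ 4 > 0"
    using s0 s1 by simp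
  then obtain U Y where XY: "U > 0" "Y > 0" "U * Y = 5 ^ 3 * s1 ^ 4" "N = U + Y"
    using halves_of_difference[OF NN _ N \<open>odd t\<close>] by metis
  have "coprime U Y"
  proof (rule coprimeI_prime_int)
    fix p :: int
    assume p: "Factorial_Ring.prime p" "p dvd U" "p dvd Y"
    have pN: "p dvd N"
      unfolding XY using p by simp
    have "p dvd 5 ^ 3 * s1 ^ 4"
      using dvd_mult2[OF p(2), of Y] unfolding XY .
    then have "p = 5 \<or> p dvd s1"
      using p(1) prime_dvd_multD prime_dvd_power prime_dvd_5 by blast
    then have "p dvd 10 * s1\<^sup>2"
      by (auto simp: power2_eq_square)
    then have "p dvd r\<^sup>2"
      using pN unfolding N_def by (metis dvd_add_left_iff)
    then have pr: "p dvd r"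
      using p(1) prime_dvd_power by blast
    then show False
      using \<open>p = 5 \<or> p dvd s1\<close> r5 prs[OF p(1)] s1 by auto
  qed
  then obtain A B where AB: "A > 0" "B > 0" "A * B = \<bar>s1\<bar>"
    "U = A ^ 4 \<and> Y = 5 ^ 3 * B ^ 4 \<or> U = 5 ^ 3 * B ^ 4 \<and> Y = A ^ 4"
    using coprime_mult_five_power[OF _ XY(3,1,2)] by metis
  have s2: "s1\<^sup>2 = A\<^sup>2 * B\<^sup>2"
    using AB(3) by (metis power2_abs power_mult_distrib)
  have "N = A ^ 4 + 125 * B ^ 4"
    using AB(4) XY by auto
  then have r2: "r\<^sup>2 = (A\<^sup>2 - 5 * B\<^sup>2)\<^sup>2 + 100 * B ^ 4"
    unfolding N_def s2 by Groebner_Basis.algebra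
  define R where "R = \<bar>r\<bar>"
  define a where "a = A\<^sup>2 - 5 * B\<^sup>2"
  have R2: "R\<^sup>2 = a\<^sup>2 + 100 * B ^ 4"
    using r2 unfolding R_def a_def by simp
  have "odd R"
    using par by (simp add: R_def)
  then have "R > 0"
    unfolding R_def by (metis abs_ge_zero dvd_0_right less_le)
  have "odd (R\<^sup>2)"
    using \<open>odd R\<close> by simp
  then have "odd a"
    unfolding R2 by simp
  have "(R - a) * (R + a) = 4 * (5 ^ 2 * B ^ 4)"
    using R2 by Groebner_Basis.algebra
  then obtain X' Y' where XY': "X' > 0" "Y' > 0" "X' * Y' = 5 ^ 2 * B ^ 4" "R = X' + Y'" "a = Y' - X'"
    using halves_of_difference[of R a "5 ^ 2 * B ^ 4"] \<open>odd R\<close> \<open>odd a\<close> \<open>R > 0\<close> AB(2) by auto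
  have cop': "coprime X' Y'"
  proof (rule coprimeI_prime_int)
    fix p :: int
    assume p: "Factorial_Ring.prime p" "p dvd X'" "p dvd Y'"
    have "p dvd R"
      unfolding XY' using p by simp
    then have pr: "p dvd r"
      by (simp add: R_def)
    have "p dvd 5 ^ 2 * B ^ 4"
      using dvd_mult2[OF p(2), of Y'] unfolding XY' .
    then have "p = 5 \<or> p dvd B"
      using p(1) prime_dvd_multD prime_dvd_power prime_dvd_5 by blast
    moreover have "p dvd s" if "p dvd B"
      using that AB(3) s1 by (metis dvd_abs_iff dvd_mult)
    ultimately show False
      using prs[OF p(1) pr] pr r5 by auto
  qed
  then obtain n m where mn: "n > 0" "m > 0" "n * m = \<bar>B\<bar>"
    "X' = n ^ 4 \<and> Y' = 5 ^ 2 * m ^ 4 \<or> X' = 5 ^ 2 * m ^ 4 \<and> Y' = n ^ 4"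
    using coprime_mult_five_power[OF _ XY'(3,1,2)] by metis
  have B: "B = n * m"
    using mn AB(2) by simp
  have copnm: "coprime n m" "\<not> 5 dvd n"
  proof -
    have c: "coprime (n ^ 4) (5 ^ 2 * m ^ 4)"
      using cop' mn(4) by (auto simp: coprime_commute)
    then show "coprime n m"
      by simp
    show "\<not> 5 dvd n"
    proof
      assume "5 dvd n"
      then have "5 dvd n ^ 4" "(5::int) dvd 5 ^ 2 * m ^ 4"
        by (auto intro: dvd_mult2 dvd_power)
      then show False
        using coprime_primeD_int[OF c, of 5] by simp
    qed
  qed
  show False
    using mn(4)
  proof
    assume "X' = n ^ 4 \<and> Y' = 5 ^ 2 * m ^ 4"
    then have "A\<^sup>2 = 25 * m ^ 4 + 5 * (m\<^sup>2 * n\<^sup>2) - n ^ 4"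
      using a_def XY'(5) unfolding B by Groebner_Basis.algebra
    then show False
      using quartic_five_2[of m n A] copnm by (simp add: coprime_commute)
  next
    assume "X' = 5 ^ 2 * m ^ 4 \<and> Y' = n ^ 4"
    then have "A\<^sup>2 = n ^ 4 + 5 * (n\<^sup>2 * m\<^sup>2) - 25 * m ^ 4"
      using a_def XY'(5) unfolding B by Groebner_Basis.algebra
    moreover have "\<bar>s\<bar> = 2 * (A * n * m)"
      using AB(3) B s1 by (simp add: abs_mult mult_ac)
    moreover have "A * n \<ge> 1"
      using AB(1) mn(1) by (smt (verit) mult_pos_pos)
    then have "A * n * m \<ge> 1 * m"
      using mn(2) by (intro mult_right_mono) auto
    ultimately show False
      using IH[of m n A] copnm mn(2) by simp
  qed
qed

section \<open>Rational points on the curve and on its quadratic twist by 5\<close>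

lemma coprime_product_square:
  fixes a b c w :: int
  assumes "coprime a b" "coprime a c" "coprime b c" "a * b * c = w\<^sup>2" "a \<noteq> 0" "b \<noteq> 0" "c \<noteq> 0"
  obtains r s t where "\<bar>a\<bar> = r\<^sup>2" "\<bar>b\<bar> = s\<^sup>2" "\<bar>c\<bar> = t\<^sup>2"
proof -
  have "\<bar>a\<bar> * (\<bar>b\<bar> * \<bar>c\<bar>) = w\<^sup>2"
    using assms(4) by (metis abs_mult abs_power2 mult.assoc)
  moreover have "coprime \<bar>a\<bar> (\<bar>b\<bar> * \<bar>c\<bar>)"
    using assms(1,2) by simp
  ultimately obtain r u where r: "\<bar>a\<bar> = r\<^sup>2" "\<bar>b\<bar> * \<bar>c\<bar> = u\<^sup>2"
    using coprime_mult_power_int[of "\<bar>a\<bar>" "\<bar>b\<bar> * \<bar>c\<bar>" w 2] assms(5-7) by (metis mult_pos_pos zero_less_abs_iff zero_less_numeral)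
  moreover have "coprime \<bar>b\<bar> \<bar>c\<bar>"
    using assms(3) by simp
  ultimately obtain s t where "\<bar>b\<bar> = s\<^sup>2" "\<bar>c\<bar> = t\<^sup>2"
    using coprime_mult_power_int[of "\<bar>b\<bar>" "\<bar>c\<bar>" u 2] assms(5-7) by (metis zero_less_abs_iff zero_less_numeral)
  then show ?thesis
    using that r by blast
qed

text \<open>\<open>a\<^sup>2 + a * c - c\<^sup>2\<close> is the numerator of
  \<open>x\<^sup>2 + x - 1\<close> at \<open>x = a / c\<close>, and a norm form of Q(sqrt 5). It is
  \<open>- c\<^sup>2\<close> modulo \<open>a\<close> and \<open>a\<^sup>2\<close> modulo
  \<open>c\<close>, hence the coprimality.\<close>

lemma norm_form_nonzero:
  fixes a c :: int
  assumes "coprime a c" "c > 0"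
  shows "a\<^sup>2 + a * c - c\<^sup>2 \<noteq> 0" "coprime a (a\<^sup>2 + a * c - c\<^sup>2)" "coprime c (a\<^sup>2 + a * c - c\<^sup>2)"
proof -
  show ca: "coprime a (a\<^sup>2 + a * c - c\<^sup>2)"
  proof (rule coprimeI_prime_int)
    fix p :: int
    assume p: "Factorial_Ring.prime p" "p dvd a" "p dvd a\<^sup>2 + a * c - c\<^sup>2"
    have "p dvd a * (a + c) - (a\<^sup>2 + a * c - c\<^sup>2)"
      using dvd_diff[OF dvd_mult2[OF p(2), of "a + c"] p(3)] .
    then have "p dvd c\<^sup>2"
      by (simp add: power2_eq_square algebra_simps)
    then show False
      using coprime_primeD_int[OF assms(1) p(1,2)] p(1) prime_dvd_power by blast
  qed
  show "coprime c (a\<^sup>2 + a * c - c\<^sup>2)"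
  proof (rule coprimeI_prime_int)
    fix p :: int
    assume p: "Factorial_Ring.prime p" "p dvd c" "p dvd a\<^sup>2 + a * c - c\<^sup>2"
    have "p dvd (a\<^sup>2 + a * c - c\<^sup>2) - c * (a - c)"
      using dvd_diff[OF p(3) dvd_mult2[OF p(2), of "a - c"]] .
    then have "p dvd a\<^sup>2"
      by (simp add: power2_eq_square algebra_simps)
    then show False
      using coprime_primeD_int[OF assms(1) p(1) _ p(2)] p(1) prime_dvd_power by blast
  qed
  show "a\<^sup>2 + a * c - c\<^sup>2 \<noteq> 0"
  proof
    assume 0: "a\<^sup>2 + a * c - c\<^sup>2 = 0"
    then have "is_unit a"
      using ca by simp
    then have "a = 1 \<or> a = -1"
      by auto
    moreover have "c * (c - a) = a * a"
      using 0 by (simp add: power2_eq_square algebra_simps)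
    ultimately have "c * (c - a) = 1"
      by auto
    then have "c = 1 \<and> c - a = 1"
      using assms(2) by (simp add: zmult_eq_1_iff)
    then show False
      using \<open>a = 1 \<or> a = -1\<close> by auto
  qed
qed

lemma square_dvd_square_mult:
  fixes u q w :: int
  assumes "u\<^sup>2 = q\<^sup>2 * w" "q \<noteq> 0"
  obtains z where "w = z\<^sup>2"
proof -
  have "q\<^sup>2 dvd u\<^sup>2"
    using assms by simp
  then have "q dvd u"
    by simp
  then obtain z where "u = q * z"
    by (elim dvdE)
  then have "w = z\<^sup>2"
    using assms by (simp add: power_mult_distrib)
  then show ?thesis
    by (rule that)
qed

lemma rat_coprime_fraction:
  obtains a c :: int where "x = (of_int a / of_int c :: rat)" "coprime a c" "c > 0"
proof -
  obtain a c where ac: "quotient_of x = (a, c)"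
    by fastforce
  show ?thesis
    using that[of a c] quotient_of_div[OF ac] quotient_of_coprime[OF ac] quotient_of_denom_pos[OF ac] by simp
qed

text \<open>Clearing denominators with \<open>c ^ 4\<close>, one power more than the cubic asks for,
  keeps \<open>c\<close> as a third factor beside \<open>a\<close> and the norm form and leaves a
  square on the other side.\<close>

lemma curve_point_integers:
  fixes x y :: rat and a c d :: int
  assumes "of_int d * y\<^sup>2 = x ^ 3 + x\<^sup>2 - x" "x = of_int a / of_int c" "c > 0"
  obtains p q where "q \<noteq> 0" "d * p\<^sup>2 = q\<^sup>2 * (a * c * (a\<^sup>2 + a * c - c\<^sup>2))"
proof -
  obtain p q where y: "y = of_int p / of_int q" "q > 0"
    using rat_coprime_fraction[of y] by blast
  have "of_int d * (of_int p / of_int q)\<^sup>2 = (of_int a / of_int c) ^ 3 + (of_int a / of_int c)\<^sup>2 - (of_int a / of_int c :: rat)"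
    using assms y by simp
  then have "(of_int (d * (p * c\<^sup>2)\<^sup>2) :: rat) = of_int (q\<^sup>2 * (a * c * (a\<^sup>2 + a * c - c\<^sup>2)))"
    using y(2) assms(3) by (simp add: field_simps power2_eq_square power3_eq_cube)
  then have "d * (p * c\<^sup>2)\<^sup>2 = q\<^sup>2 * (a * c * (a\<^sup>2 + a * c - c\<^sup>2))"
    by (simp only: of_int_eq_iff)
  then show ?thesis
    using that[of q "p * c\<^sup>2"] y(2) by simp
qed

text \<open>In lowest terms \<open>a\<close>, \<open>c\<close> and \<open>N\<close> are pairwise
  coprime with square product, so they are squares up to sign. As \<open>c > 0\<close>, the signs of
  \<open>a\<close> and \<open>N\<close> agree; a negative sign exchanges the roles of
  \<open>r\<close> and \<open>s\<close> in the quartic.\<close>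

lemma rational_points:
  fixes x y :: rat
  assumes "y\<^sup>2 = x ^ 3 + x\<^sup>2 - x"
  shows "x = 0 \<or> x = 1 \<or> x = -1"
proof (cases "x = 0")
  case False
  obtain a c where ac: "x = of_int a / of_int c" "coprime a c" "c > 0"
    using rat_coprime_fraction[of x] by blast
  have a0: "a \<noteq> 0"
    using False ac by auto
  define N where "N = a\<^sup>2 + a * c - c\<^sup>2"
  note nf = norm_form_nonzero[OF ac(2,3), folded N_def]
  have "of_int 1 * y\<^sup>2 = x ^ 3 + x\<^sup>2 - x"
    using assms by simp
  then obtain p q where pq: "q \<noteq> 0" "1 * p\<^sup>2 = q\<^sup>2 * (a * c * N)"
    unfolding N_def by (rule curve_point_integers[OF _ ac(1,3)])
  then obtain w where w: "a * c * N = w\<^sup>2"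
    using square_dvd_square_mult[of p q "a * c * N"] by auto
  obtain r s t where rst: "\<bar>a\<bar> = r\<^sup>2" "\<bar>c\<bar> = s\<^sup>2" "\<bar>N\<bar> = t\<^sup>2"
    using coprime_product_square[OF ac(2) nf(2,3) w a0 _ nf(1)] ac(3) by auto
  have c: "c = s\<^sup>2"
    using rst(2) ac(3) by simp
  have "coprime \<bar>a\<bar> \<bar>c\<bar>"
    using ac(2) by simp
  then have cop: "coprime r s"
    unfolding rst by simp
  have r0: "r \<noteq> 0" and s0: "s \<noteq> 0"
    using a0 rst(1) c ac(3) by auto
  have "a * c * N > 0"
    using w a0 ac(3) nf(1) by (metis less_irrefl mult_eq_0_iff zero_less_power2 zero_eq_power2)
  then have "a * N * c > 0"
    by (simp add: mult_ac)
  then have sgn: "a * N > 0"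
    using ac(3) by (rule zero_less_mult_pos2)
  show ?thesis
  proof (cases "a > 0")
    case True
    then have "N > 0"
      using sgn by (simp add: zero_less_mult_iff)
    then have aN: "a = r\<^sup>2" "N = t\<^sup>2"
      using True rst by auto
    have "t\<^sup>2 = r ^ 4 + r\<^sup>2 * s\<^sup>2 - s ^ 4"
      using N_def unfolding aN c by (simp flip: power_mult)
    then have "r\<^sup>2 = 1 \<and> s\<^sup>2 = 1"
      using quartic_descent[OF cop] s0 by blast
    then show ?thesis
      using ac(1) aN c by simp
  next
    case False
    then have "a < 0"
      using a0 by simp
    then have "N < 0"
      using sgn by (simp add: zero_less_mult_iff)
    then have aN: "a = - r\<^sup>2" "N = - t\<^sup>2"
      using \<open>a < 0\<close> rst by auto
    have "t\<^sup>2 = s ^ 4 + s\<^sup>2 * r\<^sup>2 - r ^ 4"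
      using N_def unfolding aN c by (simp add: algebra_simps flip: power_mult)
    then have "s\<^sup>2 = 1 \<and> r\<^sup>2 = 1"
      using quartic_descent[of s r] cop r0 by (simp add: coprime_commute)
    then show ?thesis
      using ac(1) aN c by simp
  qed
qed simp

text \<open>Here \<open>5 * (a * c * N)\<close> is a square, so 5 divides one of the coprime factors
  \<open>a\<close>, \<open>c\<close> and \<open>N\<close>. Each of the three places for 5, with each
  sign, leads to a quartic excluded above.\<close>

lemma rational_points_twist:
  fixes x y :: rat
  assumes "5 * y\<^sup>2 = x ^ 3 + x\<^sup>2 - x"
  shows "x = 0"
proof (rule ccontr)
  assume x0: "x \<noteq> 0"
  obtain a c where ac: "x = of_int a / of_int c" "coprime a c" "c > 0"
    using rat_coprime_fraction[of x] by blast
  have a0: "a \<noteq> 0"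
    using x0 ac by auto
  define N where "N = a\<^sup>2 + a * c - c\<^sup>2"
  note nf = norm_form_nonzero[OF ac(2,3), folded N_def]
  have "of_int 5 * y\<^sup>2 = x ^ 3 + x\<^sup>2 - x"
    using assms by simp
  then obtain p q where pq: "q \<noteq> 0" "5 * p\<^sup>2 = q\<^sup>2 * (a * c * N)"
    unfolding N_def by (rule curve_point_integers[OF _ ac(1,3)])
  then have "(5 * p)\<^sup>2 = q\<^sup>2 * (5 * (a * c * N))"
    by (simp add: power2_eq_square)
  then obtain w where w: "5 * (a * c * N) = w\<^sup>2"
    using square_dvd_square_mult[of "5 * p" q] pq(1) by blast
  then have "5 dvd w\<^sup>2"
    by (metis dvd_triv_left)
  then have "5 dvd w"
    using prime_dvd_power[of "5::int" w 2] by simp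
  then obtain z where z: "w = 5 * z"
    by (elim dvdE)
  have W: "a * c * N = 5 * z\<^sup>2"
    using w unfolding z by (simp add: power2_eq_square mult_ac)
  have cs: "coprime r s" if "\<bar>a'\<bar> = r\<^sup>2" "\<bar>c'\<bar> = s\<^sup>2" "coprime a' c'" for a' c' r s :: int
  proof -
    have "coprime \<bar>a'\<bar> \<bar>c'\<bar>"
      using that(3) by simp
    then show ?thesis
      unfolding that(1,2) by simp
  qed
  have "5 dvd a * c * N"
    using W by simp
  then have "5 dvd a \<or> 5 dvd c \<or> 5 dvd N"
    using prime_dvd_multD[OF prime_5_int] by blast
  then consider "5 dvd a" | "5 dvd c" | "5 dvd N"
    by blast
  then show False
  proof cases
    case 1
    then obtain a' where a': "a = 5 * a'"
      by (elim dvdE)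
    have cop: "coprime a' c" "coprime a' N"
      using ac(2) nf(2) unfolding a' by auto
    have Wz: "a' * c * N = z\<^sup>2"
      using W unfolding a' by simp
    have nz: "a' \<noteq> 0" "c \<noteq> 0"
      using a0 a' ac(3) by auto
    obtain r s t where rst: "\<bar>a'\<bar> = r\<^sup>2" "\<bar>c\<bar> = s\<^sup>2" "\<bar>N\<bar> = t\<^sup>2"
      by (rule coprime_product_square[OF cop(1,2) nf(3) Wz nz nf(1)])
    have rs: "coprime r s"
      using cs[OF rst(1,2) cop(1)] .
    have c: "c = s\<^sup>2"
      using rst(2) ac(3) by simp
    have "\<not> 5 dvd c"
      using coprime_primeD_int[OF ac(2), of 5] 1 by auto
    then have s5: "\<not> 5 dvd s"
      unfolding c by (auto simp: power2_eq_square)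
    have "r \<noteq> 0"
      using a0 a' rst(1) by auto
    have "a' * N * c \<ge> 0"
      using Wz by (simp add: mult_ac)
    then have "a' * N \<ge> 0"
      using ac(3) by (simp add: zero_le_mult_iff)
    then have "a' = r\<^sup>2 \<and> N = t\<^sup>2 \<or> a' = - r\<^sup>2 \<and> N = - t\<^sup>2"
      using rst a0 a' nf(1) by (auto simp: zero_le_mult_iff)
    then show False
    proof
      assume h: "a' = r\<^sup>2 \<and> N = t\<^sup>2"
      have "t\<^sup>2 = 25 * r ^ 4 + 5 * (r\<^sup>2 * s\<^sup>2) - s ^ 4"
        using N_def h unfolding a' c by (auto simp: algebra_simps power_mult_distrib simp flip: power_mult)
      then show False
        using quartic_five_2[OF rs _ s5] by blast
    next
      assume h: "a' = - r\<^sup>2 \<and> N = - t\<^sup>2"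
      have "t\<^sup>2 = s ^ 4 + 5 * (s\<^sup>2 * r\<^sup>2) - 25 * r ^ 4"
        using N_def h unfolding a' c by (auto simp: algebra_simps power_mult_distrib simp flip: power_mult)
      then show False
        using quartic_five_3[of s r t] rs s5 \<open>r \<noteq> 0\<close> by (simp add: coprime_commute)
    qed
  next
    case 2
    then obtain c' where c': "c = 5 * c'"
      by (elim dvdE)
    have c'0: "c' > 0"
      using ac(3) c' by simp
    have cop: "coprime a c'" "coprime c' N"
      using ac(2) nf(3) unfolding c' by auto
    have z: "a * c' * N = z\<^sup>2"
      using W unfolding c' by simp
    have "c' \<noteq> 0"
      using c'0 by simp
    then obtain r s t where rst: "\<bar>a\<bar> = r\<^sup>2" "\<bar>c'\<bar> = s\<^sup>2" "\<bar>N\<bar> = t\<^sup>2"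
      by (rule coprime_product_square[OF cop(1) nf(2) cop(2) z a0 _ nf(1)])
    have rs: "coprime r s"
      using cs[OF rst(1,2) cop(1)] .
    have c: "c' = s\<^sup>2"
      using rst(2) c'0 by simp
    have "\<not> 5 dvd a"
      using coprime_primeD_int[OF ac(2), of 5] 2 by auto
    then have "\<not> 5 dvd \<bar>a\<bar>"
      by simp
    then have r5: "\<not> 5 dvd r"
      unfolding rst(1) by (auto simp: power2_eq_square)
    have "s \<noteq> 0"
      using c'0 rst(2) by auto
    have "a * N * c' \<ge> 0"
      using z by (simp add: mult_ac)
    then have "a * N \<ge> 0"
      using c'0 by (simp add: zero_le_mult_iff)
    then have "a = r\<^sup>2 \<and> N = t\<^sup>2 \<or> a = - r\<^sup>2 \<and> N = - t\<^sup>2"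
      using rst a0 nf(1) by (auto simp: zero_le_mult_iff)
    then show False
    proof
      assume h: "a = r\<^sup>2 \<and> N = t\<^sup>2"
      have "t\<^sup>2 = r ^ 4 + 5 * (r\<^sup>2 * s\<^sup>2) - 25 * s ^ 4"
        using N_def h unfolding c' c by (auto simp: algebra_simps power_mult_distrib simp flip: power_mult)
      then show False
        using quartic_five_3[OF rs _ r5 \<open>s \<noteq> 0\<close>] by blast
    next
      assume h: "a = - r\<^sup>2 \<and> N = - t\<^sup>2"
      have "t\<^sup>2 = 25 * s ^ 4 + 5 * (s\<^sup>2 * r\<^sup>2) - r ^ 4"
        using N_def h unfolding c' c by (auto simp: algebra_simps power_mult_distrib simp flip: power_mult)
      then show False
        using quartic_five_2[of s r t] rs r5 by (simp add: coprime_commute)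
    qed
  next
    case 3
    then obtain N' where N': "N = 5 * N'"
      by (elim dvdE)
    have cop: "coprime a N'" "coprime c N'"
      using nf(2,3) unfolding N' by auto
    have z: "a * c * N' = z\<^sup>2"
      using W unfolding N' by simp
    have nz: "c \<noteq> 0" "N' \<noteq> 0"
      using ac(3) nf(1) N' by auto
    obtain r s t where rst: "\<bar>a\<bar> = r\<^sup>2" "\<bar>c\<bar> = s\<^sup>2" "\<bar>N'\<bar> = t\<^sup>2"
      by (rule coprime_product_square[OF ac(2) cop z a0 nz])
    have rs: "coprime r s"
      using cs[OF rst(1,2) ac(2)] .
    have c: "c = s\<^sup>2"
      using rst(2) ac(3) by simp
    have "a * N' * c \<ge> 0"
      using z by (simp add: mult_ac)
    then have "a * N' \<ge> 0"
      using ac(3) by (simp add: zero_le_mult_iff)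
    then have "a = r\<^sup>2 \<and> N' = t\<^sup>2 \<or> a = - r\<^sup>2 \<and> N' = - t\<^sup>2"
      using rst a0 nf(1) N' by (auto simp: zero_le_mult_iff)
    then show False
    proof
      assume h: "a = r\<^sup>2 \<and> N' = t\<^sup>2"
      have "5 * t\<^sup>2 = r ^ 4 + r\<^sup>2 * s\<^sup>2 - s ^ 4"
        using N_def h unfolding N' c by (auto simp flip: power_mult)
      then show False
        using quartic_five_1[OF rs] by blast
    next
      assume h: "a = - r\<^sup>2 \<and> N' = - t\<^sup>2"
      have "5 * t\<^sup>2 = s ^ 4 + s\<^sup>2 * r\<^sup>2 - r ^ 4"
        using N_def h unfolding N' c by (auto simp: algebra_simps simp flip: power_mult)
      then show False
        using quartic_five_1[of s r t] rs by (simp add: coprime_commute)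
    qed
  qed
qed

section \<open>Rational preperiodic points of the duplication map\<close>

text \<open>Duplication sends the abscissa \<open>a / c\<close> to the quotient of these two
  numbers; a bound for their common factor is what makes it raise heights. The numerator is prime to
  \<open>a\<close> and \<open>c\<close>. Its only possible common prime with the norm form
  \<open>q\<close> is 5, and only to the first power in \<open>q\<close>, because
  \<open>4 * q = (2 * a + c)\<^sup>2 - 5 * c\<^sup>2\<close>.\<close>

lemma duplication_gcd:
  fixes a c g :: int
  assumes cop: "coprime a c" and g: "g dvd (a\<^sup>2 + c\<^sup>2)\<^sup>2" "g dvd 4 * a * c * (a\<^sup>2 + a * c - c\<^sup>2)"
  shows "g dvd 20"
proof -
  define E where "E = a\<^sup>2 + c\<^sup>2"
  define q where "q = a\<^sup>2 + a * c - c\<^sup>2"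
  have Ea: "coprime E a" "coprime E c"
  proof -
    show "coprime E a"
    proof (rule coprimeI_prime_int)
      fix p :: int
      assume p: "Factorial_Ring.prime p" "p dvd E" "p dvd a"
      then have "p dvd c\<^sup>2"
        unfolding E_def by (metis dvd_add_right_iff dvd_mult2 power2_eq_square)
      then show False
        using coprime_primeD_int[OF cop p(1,3)] p(1) prime_dvd_power by blast
    qed
    show "coprime E c"
    proof (rule coprimeI_prime_int)
      fix p :: int
      assume p: "Factorial_Ring.prime p" "p dvd E" "p dvd c"
      then have "p dvd a\<^sup>2"
        unfolding E_def by (metis dvd_add_left_iff dvd_mult2 power2_eq_square)
      then show False
        using coprime_primeD_int[OF cop p(1) _ p(3)] p(1) prime_dvd_power by blast
    qed
  qed
  have only5: "p = 5" if p: "Factorial_Ring.prime p" "p dvd E" "p dvd q" for p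
  proof -
    \<comment> \<open>Eliminates \<open>a\<close> from \<open>E\<close> and \<open>q\<close>,
      starting from \<open>q - E = c * (a - 2 * c)\<close>.\<close>
    have "5 * c ^ 3 = c * E - (a + 2 * c) * (q - E)"
      unfolding E_def q_def by (simp add: power2_eq_square power3_eq_cube algebra_simps)
    then have "p dvd 5 * c ^ 3"
      using p(2,3) by (metis dvd_diff dvd_mult)
    moreover have "\<not> p dvd c"
      using coprime_primeD_int[OF Ea(2) p(1,2)] by blast
    ultimately show ?thesis
      using p(1) prime_dvd_multD prime_dvd_power prime_dvd_5 by blast
  qed
  have "coprime g a" "coprime g c"
    using Ea g(1) unfolding E_def[symmetric] by (meson coprime_divisors coprime_power_left_iff dvd_refl zero_less_numeral)+
  then have g4: "g dvd 4 * q"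
    using g(2) unfolding q_def[symmetric] by (metis coprime_dvd_mult_right_iff mult.assoc mult.commute)
  show ?thesis
  proof (cases "5 dvd E \<and> 5 dvd q")
    case True
    then obtain q' where q': "q = 5 * q'"
      by (auto elim: dvdE)
    have "\<not> 5 dvd q'"
    proof
      assume "5 dvd q'"
      then have "25 dvd q"
        unfolding q' by auto
      have id: "4 * q = (2 * a + c)\<^sup>2 - 5 * c\<^sup>2"
        unfolding q_def by (simp add: power2_eq_square algebra_simps)
      have "5 dvd (2 * a + c)\<^sup>2"
        using id True by (metis add_diff_cancel_left' diff_add_cancel dvd_add dvd_mult dvd_triv_left)
      then have "5 dvd 2 * a + c"
        using prime_dvd_power[of "5::int" "2 * a + c" 2] by simp
      then have "5 * 5 dvd (2 * a + c)\<^sup>2"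
        unfolding power2_eq_square by (rule mult_dvd_mono) fact
      then have "5 * 5 dvd (2 * a + c)\<^sup>2 - 4 * q"
        using \<open>25 dvd q\<close> by (intro dvd_diff dvd_mult) auto
      then have "5 * 5 dvd 5 * c\<^sup>2"
        unfolding id by simp
      then have "5 dvd c\<^sup>2"
        by (rule five_dvd_cancel)
      then have "5 dvd c"
        using prime_dvd_power[of "5::int" c 2] by simp
      then show False
        using coprime_primeD_int[OF Ea(2), of 5] True by simp
    qed
    have "coprime E q'"
    proof (rule coprimeI_prime_int)
      fix p :: int
      assume p: "Factorial_Ring.prime p" "p dvd E" "p dvd q'"
      then have "p = 5"
        using only5[of p] q' by simp
      then show False
        using p \<open>\<not> 5 dvd q'\<close> by simp
    qed
    then have "coprime g q'"
      using g(1) unfolding E_def[symmetric] by (meson coprime_divisors coprime_power_left_iff dvd_refl zero_less_numeral)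
    moreover have "g dvd 20 * q'"
      using g4 unfolding q' by simp
    ultimately show ?thesis
      by (metis coprime_dvd_mult_left_iff)
  next
    case False
    have "coprime E q"
      using only5 False by (intro coprimeI_prime_int) blast
    then have "coprime g q"
      using g(1) unfolding E_def[symmetric] by (meson coprime_divisors coprime_power_left_iff dvd_refl zero_less_numeral)
    then have "g dvd 4"
      using g4 by (metis coprime_dvd_mult_left_iff)
    then show ?thesis
      by (rule dvd_trans) simp
  qed
qed

definition rat_height :: "rat \<Rightarrow> int" where
  "rat_height x = (let (a, c) = quotient_of x in max \<bar>a\<bar> c)"

lemma rat_height_fraction:
  assumes "coprime a c" "c > 0"
  shows "rat_height (of_int a / of_int c) = max \<bar>a\<bar> c"
proof -
  have "quotient_of (of_int a / of_int c) = (a, c)"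
    using assms by (metis Fract_of_int_quotient normalize_stable quotient_of_Fract)
  then show ?thesis
    by (simp add: rat_height_def)
qed

text \<open>Up to a factor of at most 20 the new numerator is
  \<open>(a\<^sup>2 + c\<^sup>2)\<^sup>2\<close>, and this is at least
  \<open>(H\<^sup>2 + 1)\<^sup>2\<close> for the old height \<open>H\<close>. The growth is quartic,
  so that only very small heights need care. Height 1 leaves 1 and -1, which are excluded, and 0,
  whose double is at infinity.\<close>

lemma rat_height_duplication:
  fixes x x' :: rat
  assumes eq: "x' * (4 * (x ^ 3 + x\<^sup>2 - x)) = (x\<^sup>2 + 1)\<^sup>2" and x: "x \<noteq> 1" "x \<noteq> -1"
  shows "rat_height x < rat_height x'"
proof -
  obtain a c where ac: "x = of_int a / of_int c" "coprime a c" "c > 0"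
    using rat_coprime_fraction[of x] by blast
  obtain a' c' where ac': "x' = of_int a' / of_int c'" "coprime a' c'" "c' > 0"
    using rat_coprime_fraction[of x'] by blast
  define H where "H = max \<bar>a\<bar> c"
  define E where "E = (a\<^sup>2 + c\<^sup>2)\<^sup>2"
  define D where "D = 4 * a * c * (a\<^sup>2 + a * c - c\<^sup>2)"
  define A C A' C' :: rat where "A = of_int a" and "C = of_int c" and "A' = of_int a'" and "C' = of_int c'"
  have C0: "C \<noteq> 0" "C' \<noteq> 0"
    using ac(3) ac'(3) by (auto simp: C_def C'_def)
  define W Z where "W = A * (A\<^sup>2 + A * C - C\<^sup>2)" and "Z = (A\<^sup>2 + C\<^sup>2)\<^sup>2"
  have "x ^ 3 + x\<^sup>2 - x = W / C ^ 3"
    using C0 unfolding ac(1) W_def A_def[symmetric] C_def[symmetric]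
    by (simp add: field_simps power2_eq_square power3_eq_cube)
  moreover have "x\<^sup>2 + 1 = (A\<^sup>2 + C\<^sup>2) / C\<^sup>2"
    using C0 unfolding ac(1) A_def[symmetric] C_def[symmetric] by (simp add: field_simps)
  then have "(x\<^sup>2 + 1)\<^sup>2 = Z / C ^ 4"
    unfolding Z_def by (simp add: power_divide flip: power_mult)
  ultimately have "A' / C' * (4 * (W / C ^ 3)) = Z / C ^ 4"
    using eq unfolding ac'(1) A'_def C'_def by simp
  then have "(A' * (4 * W)) / (C' * C ^ 3) = Z / C ^ 4"
    by simp
  then have "A' * (4 * W) * C ^ 4 = Z * (C' * C ^ 3)"
    using C0 by (subst (asm) frac_eq_eq) auto
  then have "C ^ 3 * (A' * (4 * W * C)) = C ^ 3 * (C' * Z)"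
    by (simp add: eval_nat_numeral mult_ac)
  then have "A' * (4 * W * C) = C' * Z"
    using C0 by (subst (asm) mult_left_cancel) auto
  then have "(of_int (a' * D) :: rat) = of_int (c' * E)"
    unfolding W_def Z_def A_def A'_def C_def C'_def D_def E_def by (simp add: mult_ac)
  then have aD: "a' * D = c' * E"
    by (simp only: of_int_eq_iff)
  have E0: "E > 0"
    using ac(3) unfolding E_def by (simp add: add_nonneg_pos)
  have "c' dvd D"
    using aD ac'(2) by (metis coprime_commute coprime_dvd_mult_right_iff dvd_triv_left)
  then obtain g where g: "D = c' * g"
    by (elim dvdE)
  have Eg: "E = a' * g"
    using aD ac'(3) unfolding g by simp
  have g20: "g dvd 20"
    using duplication_gcd[OF ac(2), of g] Eg g unfolding E_def D_def by (metis dvd_triv_right)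
  have EH: "E = \<bar>a'\<bar> * \<bar>g\<bar>"
    using Eg E0 by (metis abs_mult abs_of_pos)
  have "H \<ge> 1"
    using ac(3) unfolding H_def by auto
  have "H \<noteq> 1"
  proof
    assume "H = 1"
    then have "c = 1" "\<bar>a\<bar> \<le> 1"
      using ac(3) unfolding H_def by auto
    then have "a = 0 \<or> a = 1 \<or> a = -1"
      by auto
    then have "a = 0"
      using x ac(1) \<open>c = 1\<close> by auto
    then have "D = 0"
      by (simp add: D_def)
    then have "c' * E = 0"
      using aD by simp
    then show False
      using E0 ac'(3) by simp
  qed
  then have H2: "H \<ge> 2"
    using \<open>H \<ge> 1\<close> by simp
  have E1: "E \<ge> (H\<^sup>2 + 1)\<^sup>2"
  proof -
    have "a\<^sup>2 \<ge> 1 \<or> a = 0"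
      by (metis int_one_le_iff_zero_less zero_less_power2)
    moreover have "a \<noteq> 0"
      using aD E0 ac'(3) unfolding D_def by auto
    ultimately have "a\<^sup>2 \<ge> 1" "c\<^sup>2 \<ge> 1"
      using ac(3) by auto
    moreover have "H\<^sup>2 = a\<^sup>2 \<or> H\<^sup>2 = c\<^sup>2"
      unfolding H_def by (simp add: max_def)
    ultimately have "H\<^sup>2 + 1 \<le> a\<^sup>2 + c\<^sup>2"
      by auto
    then show ?thesis
      unfolding E_def by (intro power_mono) auto
  qed
  have "\<bar>a'\<bar> > H"
  proof (cases "H = 2")
    case True
    \<comment> \<open>The bound 20 would only give \<open>\<bar>a'\<bar> \<ge> 2\<close>, which is
      not enough. But exactly one of \<open>a\<close> and \<open>c\<close> is even, so
      \<open>E\<close> and \<open>g\<close> are odd and \<open>g\<close> divides 5.\<close>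
    have "odd a \<or> odd c"
      using coprime_primeD_int[OF ac(2), of 2] by auto
    moreover have "even a \<or> even c"
    proof (rule ccontr)
      assume h: "\<not> (even a \<or> even c)"
      then have "odd \<bar>a\<bar>" "odd c"
        by simp_all
      then have "\<bar>a\<bar> \<noteq> 2" "c \<noteq> 2"
        by (metis even_numeral)+
      then show False
        using True unfolding H_def by (auto simp: max_def split: if_splits)
    qed
    ultimately have "odd E"
      unfolding E_def by auto
    then have "odd g"
      using Eg by auto
    then have "coprime g 2"
      by simp
    then have "coprime g (2 * 2)"
      by (simp only: coprime_mult_right_iff)
    then have "coprime g 4"
      by simp
    moreover have "g dvd 4 * 5"
      using g20 by simp
    ultimately have "g dvd 5"
      by (metis coprime_dvd_mult_right_iff)
    then have "\<bar>g\<bar> \<le> 5"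
      using dvd_imp_le_int[of 5 g] by simp
    then have "E \<le> \<bar>a'\<bar> * 5"
      unfolding EH by (intro mult_left_mono) auto
    then show ?thesis
      using E1 True by simp
  next
    case False
    then have "H \<ge> 3"
      using H2 by simp
    have "\<bar>g\<bar> \<le> 20"
      using g20 dvd_imp_le_int[of 20 g] by simp
    then have "E \<le> \<bar>a'\<bar> * 20"
      unfolding EH by (intro mult_left_mono) auto
    moreover have "(H\<^sup>2 + 1)\<^sup>2 > 20 * H"
    proof -
      have "H\<^sup>2 \<ge> 3 * H"
        unfolding power2_eq_square using \<open>H \<ge> 3\<close> by (intro mult_right_mono) auto
      then have "(H\<^sup>2 + 1)\<^sup>2 \<ge> (3 * H + 1)\<^sup>2"
        using \<open>H \<ge> 3\<close> by (intro power_mono) auto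
      moreover have "(3 * H + 1)\<^sup>2 = 9 * (H * H) + 6 * H + 1"
        by (simp add: power2_eq_square algebra_simps)
      moreover have "H * H \<ge> 3 * H"
        using \<open>H \<ge> 3\<close> by (intro mult_right_mono) auto
      ultimately show ?thesis
        using \<open>H \<ge> 3\<close> by linarith
    qed
    ultimately show ?thesis
      using E1 by linarith
  qed
  then have "max \<bar>a'\<bar> c' > H"
    by simp
  then show ?thesis
    using rat_height_fraction[OF ac(2,3)] rat_height_fraction[OF ac'(2,3)] ac(1) ac'(1) by (simp add: H_def)
qed

text \<open>1 and -1 have height 1 and double to 1. From any other start the height rises at every
  step; the sequence never reaches 1 or -1, since their height is the least possible, and never
  returns.\<close>

lemma duplication_periodic:
  fixes f :: "nat \<Rightarrow> rat"
  assumes step: "\<And>n. f (Suc n) * (4 * (f n ^ 3 + (f n)\<^sup>2 - f n)) = ((f n)\<^sup>2 + 1)\<^sup>2"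
    and per: "f N = f 0" "N > 0"
  shows "f 0 = 1"
proof (cases "f 0 = 1 \<or> f 0 = -1")
  case True
  have one: "f (Suc n) = 1" if "f n = 1 \<or> f n = -1" for n
    using step[of n] that by auto
  have "f (Suc n) = 1" for n
    by (induction n) (use one True in auto)
  then show ?thesis
    using per by (metis gr0_implies_Suc)
next
  case False
  have h1: "rat_height (1::rat) = 1" "rat_height (-1::rat) = 1"
    using rat_height_fraction[of 1 1] rat_height_fraction[of "-1" 1] by simp_all
  have pos: "rat_height x \<ge> 1" for x
    using quotient_of_denom_pos[of x] by (cases "quotient_of x") (auto simp: rat_height_def)
  have lt: "rat_height (f 0) < rat_height (f (Suc n)) \<and> f (Suc n) \<noteq> 1 \<and> f (Suc n) \<noteq> -1" for n
  proof (induction n)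
    case 0
    then show ?case
      using rat_height_duplication[OF step[of 0]] False h1 pos[of "f 0"] by auto
  next
    case (Suc n)
    then have "rat_height (f (Suc n)) < rat_height (f (Suc (Suc n)))"
      using rat_height_duplication[OF step[of "Suc n"]] by blast
    then show ?case
      using Suc h1 pos[of "f 0"] by auto
  qed
  then show ?thesis
    using per by (metis gr0_implies_Suc less_irrefl)
qed

section \<open>Automorphisms of the field of algebraic numbers\<close>

text \<open>An annihilating polynomial of least degree, made monic. The remainder of a division by
  it annihilates \<open>x\<close> as well and has smaller degree, so it vanishes.\<close>

lemma minimal_polynomial_exists:
  assumes L: "subfield L CC" and p: "p \<in> pover L" "p \<noteq> 0" "poly p x = 0"
  obtains m where "m \<in> pover L" "lead_coeff m = 1" "poly m x = 0"
    "\<And>h. h \<in> pover L \<Longrightarrow> poly h x = 0 \<Longrightarrow> \<exists>q\<in>pover L. h = q * m"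
proof -
  define S where "S = {h \<in> pover L. h \<noteq> 0 \<and> poly h x = 0}"
  define m0 where "m0 = arg_min degree (\<lambda>h. h \<in> S)"
  have "p \<in> S"
    using p by (auto simp: S_def)
  then have m0: "m0 \<in> S" "\<And>h. h \<in> S \<Longrightarrow> degree m0 \<le> degree h"
    unfolding m0_def by (auto intro: arg_min_natI arg_min_nat_le)
  define m where "m = smult (inverse (lead_coeff m0)) m0"
  have lc: "lead_coeff m0 \<noteq> 0" "lead_coeff m0 \<in> L"
    using m0(1) by (auto simp: S_def pover_def)
  have m: "m \<in> pover L" "lead_coeff m = 1" "poly m x = 0" "degree m = degree m0"
    using m0(1) lc unfolding m_def S_def by (auto intro: pover_smult[OF L] sf_inverse[OF L])
  have "\<exists>q\<in>pover L. h = q * m" if h: "h \<in> pover L" "poly h x = 0" for h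
  proof -
    obtain q r where qr: "q \<in> pover L" "r \<in> pover L" "h = q * m + r" "r = 0 \<or> degree r < degree m"
      using pover_division[OF L m(1,2) h(1)] by blast
    then have "poly r x = 0"
      using h(2) m(3) by simp
    then have "r \<in> S \<or> r = 0"
      using qr(2) by (auto simp: S_def)
    then have "r = 0"
      using m0(2)[of r] qr(4) m(4) by auto
    then show ?thesis
      using qr by auto
  qed
  then show ?thesis
    using that m by blast
qed

definition embedding :: "complex set \<Rightarrow> (complex \<Rightarrow> complex) \<Rightarrow> bool" where
  "embedding L \<tau> \<longleftrightarrow> subfield L CC \<and> \<tau> 1 = 1 \<and>
     (\<forall>x\<in>L. \<forall>y\<in>L. \<tau> (x + y) = \<tau> x + \<tau> y \<and> \<tau> (x * y) = \<tau> x * \<tau> y)"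

context
  fixes L \<tau>
  assumes emb: "embedding L \<tau>"
begin

lemma embedding_subfield: "subfield L CC"
  using emb by (simp add: embedding_def)

lemma embedding_add: "x \<in> L \<Longrightarrow> y \<in> L \<Longrightarrow> \<tau> (x + y) = \<tau> x + \<tau> y"
  and embedding_mult: "x \<in> L \<Longrightarrow> y \<in> L \<Longrightarrow> \<tau> (x * y) = \<tau> x * \<tau> y"
  and embedding_1: "\<tau> 1 = 1"
  using emb by (auto simp: embedding_def)

lemma embedding_0: "\<tau> 0 = 0"
  using embedding_add[of 0 0] sf_0[OF embedding_subfield] by simp

lemma embedding_uminus: "x \<in> L \<Longrightarrow> \<tau> (- x) = - \<tau> x"
  using embedding_add[of x "- x"] sf_uminus[OF embedding_subfield, of x]
  by (simp add: embedding_0 eq_neg_iff_add_eq_0 add.commute)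

lemma embedding_diff: "x \<in> L \<Longrightarrow> y \<in> L \<Longrightarrow> \<tau> (x - y) = \<tau> x - \<tau> y"
  using embedding_add[of x "- y"] embedding_uminus[of y] sf_uminus[OF embedding_subfield, of y] by simp

lemma embedding_eq_0_iff: "x \<in> L \<Longrightarrow> \<tau> x = 0 \<longleftrightarrow> x = 0"
proof
  assume x: "x \<in> L" "\<tau> x = 0"
  show "x = 0"
  proof (rule ccontr)
    assume "x \<noteq> 0"
    then have "\<tau> x * \<tau> (inverse x) = 1"
      using x embedding_mult[of x "inverse x"] sf_inverse[OF embedding_subfield, of x] embedding_1 by simp
    then show False
      using x by simp
  qed
qed (simp add: embedding_0)

lemma embedding_inj: "x \<in> L \<Longrightarrow> y \<in> L \<Longrightarrow> \<tau> x = \<tau> y \<longleftrightarrow> x = y"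
  using embedding_eq_0_iff[of "x - y"] embedding_diff[of x y] sf_diff[OF embedding_subfield, of x y] by auto

lemma embedding_inverse: "x \<in> L \<Longrightarrow> \<tau> (inverse x) = inverse (\<tau> x)"
proof (cases "x = 0")
  case False
  assume x: "x \<in> L"
  then have "\<tau> x * \<tau> (inverse x) = 1"
    using False embedding_mult[of x "inverse x"] sf_inverse[OF embedding_subfield, of x] embedding_1 by simp
  then show ?thesis
    by (metis inverse_unique)
qed (simp add: embedding_0)

lemma embedding_divide: "x \<in> L \<Longrightarrow> y \<in> L \<Longrightarrow> \<tau> (x / y) = \<tau> x / \<tau> y"
  by (simp add: divide_inverse embedding_mult embedding_inverse sf_inverse[OF embedding_subfield])

lemma embedding_power: "x \<in> L \<Longrightarrow> \<tau> (x ^ n) = \<tau> x ^ n"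
  by (induction n) (auto simp: embedding_1 embedding_mult sf_power[OF embedding_subfield])

lemma embedding_sum: "(\<And>i. i \<in> A \<Longrightarrow> f i \<in> L) \<Longrightarrow> \<tau> (sum f A) = (\<Sum>i\<in>A. \<tau> (f i))"
  by (induction A rule: infinite_finite_induct)
    (auto simp: embedding_0 embedding_add sf_sum[OF embedding_subfield])

lemma embedding_of_nat: "\<tau> (of_nat n) = of_nat n"
  by (induction n)
    (auto simp: embedding_0 embedding_1 embedding_add sf_of_nat[OF embedding_subfield] sf_1[OF embedding_subfield])

lemma embedding_of_int: "\<tau> (of_int n) = of_int n"
  by (cases n) (auto simp: embedding_of_nat embedding_uminus sf_of_nat[OF embedding_subfield] simp del: of_nat_Suc)

lemma embedding_Rats: "x \<in> \<rat> \<Longrightarrow> \<tau> x = x"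
  by (elim Rats_cases') (simp add: embedding_divide embedding_of_int sf_of_int[OF embedding_subfield])

lemma coeff_map_embedding [simp]: "coeff (map_poly \<tau> p) i = \<tau> (coeff p i)"
  by (simp add: coeff_map_poly embedding_0)

lemma map_poly_embedding_add:
  "p \<in> pover L \<Longrightarrow> q \<in> pover L \<Longrightarrow> map_poly \<tau> (p + q) = map_poly \<tau> p + map_poly \<tau> q"
  by (rule poly_eqI) (simp add: embedding_add pover_def)

lemma map_poly_embedding_diff:
  "p \<in> pover L \<Longrightarrow> q \<in> pover L \<Longrightarrow> map_poly \<tau> (p - q) = map_poly \<tau> p - map_poly \<tau> q"
  by (rule poly_eqI) (simp add: embedding_diff pover_def)

lemma map_poly_embedding_mult:
  "p \<in> pover L \<Longrightarrow> q \<in> pover L \<Longrightarrow> map_poly \<tau> (p * q) = map_poly \<tau> p * map_poly \<tau> q"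
  by (rule poly_eqI)
    (simp add: coeff_mult embedding_sum embedding_mult pover_def sf_mult[OF embedding_subfield])

lemma map_poly_embedding_1: "map_poly \<tau> 1 = 1"
  by (rule poly_eqI) (simp add: coeff_1 embedding_0 embedding_1)

lemma map_poly_embedding_const: "map_poly \<tau> [:c:] = [:\<tau> c:]"
  by (rule poly_eqI) (simp add: coeff_pCons embedding_0 split: nat.splits)

lemma map_poly_embedding_X: "map_poly \<tau> [:0, 1:] = [:0, 1:]"
  by (rule poly_eqI) (simp add: coeff_pCons embedding_0 embedding_1 split: nat.splits)

lemma poly_map_embedding:
  "p \<in> pover L \<Longrightarrow> x \<in> L \<Longrightarrow> poly (map_poly \<tau> p) (\<tau> x) = \<tau> (poly p x)"
proof (induction p)
  case (pCons a p)
  have a: "a \<in> L" and p: "p \<in> pover L"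
    using pCons.prems(1) pover_pCons_iff[OF embedding_subfield] by auto
  have "map_poly \<tau> (pCons a p) = pCons (\<tau> a) (map_poly \<tau> p)"
    by (rule poly_eqI) (simp add: coeff_pCons split: nat.splits)
  then show ?case
    using pCons.IH[OF p pCons.prems(2)] a p pCons.prems(2)
    by (simp add: embedding_add embedding_mult sf_intros[OF embedding_subfield] poly_in_sf[OF embedding_subfield])
qed (simp add: embedding_0)

end

lemma simple_extension_eq:
  assumes "subfield L CC"
  shows "ring.simple_extension CC L x = {poly h x | h. h \<in> pover L}"
proof (rule antisym; rule subsetI)
  fix z
  assume "z \<in> ring.simple_extension CC L x"
  then show "z \<in> {poly h x | h. h \<in> pover L}"
  proof (induction rule: ring.simple_extension.induct[OF ring_CC, consumes 1, case_names zero lin])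
    case zero
    then show ?case
      using pover_0[OF assms] by (auto intro!: exI[of _ 0])
  next
    case (lin k1 k2)
    then obtain h where "h \<in> pover L" "k1 = poly h x"
      by auto
    then show ?case
      using lin pover_pCons[OF assms, of k2 h] by (auto intro!: exI[of _ "pCons k2 h"])
  qed
next
  fix z
  assume "z \<in> {poly h x | h. h \<in> pover L}"
  then obtain h where h: "h \<in> pover L" "z = poly h x"
    by auto
  have "poly h x \<in> ring.simple_extension CC L x"
    using h(1)
  proof (induction h)
    case 0
    then show ?case
      using ring.simple_extension.zero[OF ring_CC] by simp
  next
    case (pCons a p)
    then show ?case
      using ring.simple_extension.lin[OF ring_CC, of "poly p x" L x a] pover_pCons_iff[OF assms]
      by (simp add: algebra_simps)
  qed
  then show "z \<in> ring.simple_extension CC L x"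
    using h by simp
qed

text \<open>The extension sends \<open>poly h x\<close> to the value at \<open>y\<close> of the
  image of \<open>h\<close>. Two choices of \<open>h\<close> differ by a multiple of
  \<open>m\<close>, and the image of \<open>m\<close> vanishes at \<open>y\<close>.\<close>

lemma embedding_extend:
  assumes emb: "embedding L \<tau>" and m: "m \<in> pover L" "lead_coeff m = 1" "poly m x = 0"
    and min: "\<And>h. h \<in> pover L \<Longrightarrow> poly h x = 0 \<Longrightarrow> \<exists>q\<in>pover L. h = q * m"
    and y: "poly (map_poly \<tau> m) y = 0"
  obtains \<tau>' where "embedding {poly h x | h. h \<in> pover L} \<tau>'" "\<And>z. z \<in> L \<Longrightarrow> \<tau>' z = \<tau> z" "\<tau>' x = y"
proof -
  note L = embedding_subfield[OF emb]
  define M where "M = {poly h x | h. h \<in> pover L}"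
  have "(ring.algebraic CC over L) x"
    unfolding CC_algebraic_iff[OF L] using m by (intro bexI[of _ m]) auto
  then have M: "subfield M CC"
    unfolding M_def simple_extension_eq[OF L, symmetric]
    using domain.simple_extension_is_subfield[OF domain_CC L, of x] by simp
  define rep where "rep z = (SOME h. h \<in> pover L \<and> poly h x = z)" for z
  have rep: "rep z \<in> pover L \<and> poly (rep z) x = z" if "z \<in> M" for z
  proof -
    have "\<exists>h. h \<in> pover L \<and> poly h x = z"
      using that by (auto simp: M_def)
    then show ?thesis
      unfolding rep_def by (rule someI_ex)
  qed
  define \<tau>' where "\<tau>' z = poly (map_poly \<tau> (rep z)) y" for z
  have val: "\<tau>' (poly h x) = poly (map_poly \<tau> h) y" if h: "h \<in> pover L" for h
  proof -
    have "poly h x \<in> M"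
      using h by (auto simp: M_def)
    note r = rep[OF this]
    then obtain q where q: "q \<in> pover L" "rep (poly h x) - h = q * m"
      using min[of "rep (poly h x) - h"] h by (auto intro: pover_diff[OF L])
    have "map_poly \<tau> (rep (poly h x)) - map_poly \<tau> h = map_poly \<tau> q * map_poly \<tau> m"
      using r h q m by (simp flip: map_poly_embedding_diff[OF emb] map_poly_embedding_mult[OF emb])
    then have "poly (map_poly \<tau> (rep (poly h x)) - map_poly \<tau> h) y = 0"
      using y by simp
    then show ?thesis
      by (simp add: \<tau>'_def)
  qed
  have "embedding M \<tau>'"
    unfolding embedding_def
  proof (intro conjI M ballI)
    show "\<tau>' 1 = 1"
      using val[OF pover_1[OF L]] map_poly_embedding_1[OF emb] by simp
    fix a b
    assume "a \<in> M" "b \<in> M"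
    then obtain g h where gh: "g \<in> pover L" "h \<in> pover L" "a = poly g x" "b = poly h x"
      by (auto simp: M_def)
    show "\<tau>' (a + b) = \<tau>' a + \<tau>' b"
      using gh val[OF gh(1)] val[OF gh(2)] val[OF pover_add[OF L gh(1,2)]]
      by (simp add: map_poly_embedding_add[OF emb])
    show "\<tau>' (a * b) = \<tau>' a * \<tau>' b"
      using gh val[OF gh(1)] val[OF gh(2)] val[OF pover_mult[OF L gh(1,2)]]
      by (simp add: map_poly_embedding_mult[OF emb])
  qed
  moreover have "\<tau>' z = \<tau> z" if "z \<in> L" for z
    using val[of "[:z:]"] that
    by (simp add: map_poly_embedding_const[OF emb] pover_pCons[OF L] pover_0[OF L])
  moreover have "\<tau>' x = y"
    using val[of "[:0, 1:]"]
    by (simp add: map_poly_embedding_X[OF emb] pover_pCons[OF L] pover_0[OF L] sf_0[OF L] sf_1[OF L])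
  ultimately show ?thesis
    using that unfolding M_def by blast
qed

text \<open>For \<open>K\<close> inside Qbar the values outside of Qbar are left open, so one Galois
  automorphism is represented by many functions.\<close>

definition gal :: "complex set \<Rightarrow> (complex \<Rightarrow> complex) set" where
  "gal K = {\<sigma>. embedding Qbar \<sigma> \<and> \<sigma> ` Qbar = Qbar \<and> (\<forall>x\<in>K. \<sigma> x = x)}"

lemma embedding_root_Qbar:
  assumes "embedding L \<tau>" "L \<subseteq> Qbar" "x \<in> L"
  shows "\<tau> x \<in> Qbar"
proof -
  have "algebraic x"
    using assms by (auto simp: Qbar_def)
  then obtain p where p: "\<forall>i. coeff p i \<in> \<rat>" "p \<noteq> 0" "poly p x = 0"
    unfolding algebraic_altdef by auto
  note L = embedding_subfield[OF assms(1)]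
  have "map_poly \<tau> p = p"
    by (rule poly_eqI) (use p in \<open>simp add: coeff_map_embedding[OF assms(1)] embedding_Rats[OF assms(1)]\<close>)
  moreover have "p \<in> pover L"
    using p sf_Rats[OF L] by (auto simp: pover_def)
  ultimately have "poly p (\<tau> x) = 0"
    using poly_map_embedding[OF assms(1), of p x] assms(3) p embedding_0[OF assms(1)] by simp
  then show ?thesis
    using p by (auto simp: Qbar_def algebraic_altdef)
qed

text \<open>An embedding maps the finite root set of a rational polynomial injectively into itself
  and therefore permutes it.\<close>

lemma embedding_Qbar_surj:
  assumes "embedding Qbar \<tau>"
  shows "\<tau> ` Qbar = Qbar"
proof
  show "\<tau> ` Qbar \<subseteq> Qbar"
    using embedding_root_Qbar[OF assms] by auto
  show "Qbar \<subseteq> \<tau> ` Qbar"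
  proof
    fix y
    assume y: "y \<in> Qbar"
    then obtain p where p: "\<forall>i. coeff p i \<in> \<rat>" "p \<noteq> 0" "poly p y = 0"
      unfolding Qbar_def algebraic_altdef by auto
    define R where "R = {x. poly p x = 0}"
    have R: "R \<subseteq> Qbar" "finite R"
      using p poly_roots_finite[OF p(2)] by (auto simp: R_def Qbar_def algebraic_altdef)
    have "map_poly \<tau> p = p"
      by (rule poly_eqI) (use p in \<open>simp add: coeff_map_embedding[OF assms(1)] embedding_Rats[OF assms(1)]\<close>)
    moreover have "p \<in> pover Qbar"
      using p Rats_subset_Qbar by (auto simp: pover_def)
    ultimately have "\<tau> ` R \<subseteq> R"
      using poly_map_embedding[OF assms(1), of p] R embedding_0[OF assms(1)] by (auto simp: R_def)
    moreover have "inj_on \<tau> R"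
      using embedding_inj[OF assms] R by (auto simp: inj_on_def)
    ultimately have "\<tau> ` R = R"
      using R(2) by (simp add: endo_inj_surj)
    moreover have "y \<in> R"
      using p by (simp add: R_def)
    ultimately show "y \<in> \<tau> ` Qbar"
      using R(1) by blast
  qed
qed

lemma embedding_extend_Qbar:
  assumes emb: "embedding L \<tau>" and LQ: "L \<subseteq> Qbar"
  obtains \<sigma> where "embedding Qbar \<sigma>" "\<And>z. z \<in> L \<Longrightarrow> \<sigma> z = \<tau> z"
proof -
  \<comment> \<open>The order for Zorn's lemma is inclusion of graphs, which ignores the values
    outside of the domain.\<close>
  define gr where "gr M \<rho> = {(x, \<rho> x) | x. x \<in> M}" for M and \<rho> :: "complex \<Rightarrow> complex"
  define A where "A = {gr M \<rho> | M \<rho>. embedding M \<rho> \<and> L \<subseteq> M \<and> M \<subseteq> Qbar \<and> (\<forall>z\<in>L. \<rho> z = \<tau> z)}"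
  have "\<exists>G\<in>A. \<forall>H\<in>A. G \<subseteq> H \<longrightarrow> H = G"
  proof (rule subset_Zorn_nonempty)
    have "gr L \<tau> \<in> A"
      using emb LQ unfolding A_def by blast
    then show "A \<noteq> {}"
      by auto
  next
    fix \<C>
    assume ne: "\<C> \<noteq> {}" and ch: "subset.chain A \<C>"
    define U where "U = \<Union>\<C>"
    define M where "M = fst ` U"
    define \<rho> where "\<rho> x = (THE y. (x, y) \<in> U)" for x
    have memA: "\<exists>N \<theta>. G = gr N \<theta> \<and> embedding N \<theta> \<and> L \<subseteq> N \<and> N \<subseteq> Qbar \<and> (\<forall>z\<in>L. \<theta> z = \<tau> z)"
      if "G \<in> \<C>" for G
      using that ch unfolding subset.chain_def A_def by auto
    have ch2: "G \<subseteq> H \<or> H \<subseteq> G" if "G \<in> \<C>" "H \<in> \<C>" for G H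
      using that ch unfolding subset_chain_def by auto
    have two: "\<exists>N \<theta>. gr N \<theta> \<in> \<C> \<and> embedding N \<theta> \<and> L \<subseteq> N \<and> N \<subseteq> Qbar \<and> (\<forall>z\<in>L. \<theta> z = \<tau> z) \<and>
        x \<in> N \<and> y \<in> N" if "x \<in> M" "y \<in> M" for x y
    proof -
      from that obtain G H x' y' where G: "G \<in> \<C>" "(x, x') \<in> G" and H: "H \<in> \<C>" "(y, y') \<in> H"
        by (auto simp: M_def U_def)
      then obtain I where I: "I \<in> \<C>" "(x, x') \<in> I" "(y, y') \<in> I"
        using ch2[OF G(1) H(1)] by blast
      obtain N \<theta> where N: "I = gr N \<theta>" "embedding N \<theta>" "L \<subseteq> N" "N \<subseteq> Qbar" "\<forall>z\<in>L. \<theta> z = \<tau> z"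
        using memA[OF I(1)] by blast
      with I have "x \<in> N" "y \<in> N"
        by (auto simp: gr_def)
      with N I(1) show ?thesis
        by blast
    qed
    have val: "\<rho> x = \<theta> x" and sub: "x \<in> M" if N: "gr N \<theta> \<in> \<C>" "x \<in> N" for N \<theta> x
    proof -
      have "(x, \<theta> x) \<in> gr N \<theta>"
        using N(2) by (auto simp: gr_def)
      then have in1: "(x, \<theta> x) \<in> U"
        unfolding U_def using N(1) by blast
      then show "x \<in> M"
        by (auto simp: M_def intro: rev_image_eqI)
      show "\<rho> x = \<theta> x"
        unfolding \<rho>_def
      proof (rule the_equality)
        show "(x, \<theta> x) \<in> U"
          by (rule in1)
      next
        fix y
        assume "(x, y) \<in> U"
        then obtain H where H: "H \<in> \<C>" "(x, y) \<in> H"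
          by (auto simp: U_def)
        obtain N' \<theta>' where N': "H = gr N' \<theta>'"
          using memA[OF H(1)] by blast
        have "(x, \<theta> x) \<in> gr N \<theta>"
          using N by (auto simp: gr_def)
        then show "y = \<theta> x"
          using ch2[OF N(1) H(1)] H(2) N' by (auto simp: gr_def)
      qed
    qed
    have "embedding M \<rho>"
      unfolding embedding_def
    proof (intro conjI ballI)
      obtain G where "G \<in> \<C>"
        using ne by auto
      then obtain N \<theta> where N: "gr N \<theta> \<in> \<C>" "embedding N \<theta>"
        using memA by blast
      have oneN: "1 \<in> N"
        using sf_1[OF embedding_subfield[OF N(2)]] .
      show "\<rho> 1 = 1"
        using val[OF N(1) oneN] embedding_1[OF N(2)] by simp
      show "subfield M CC"
      proof (rule subfieldCI)
        show "1 \<in> M"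
          using sub[OF N(1) oneN] .
      next
        fix x y
        assume "x \<in> M" "y \<in> M"
        then obtain N \<theta> where N: "gr N \<theta> \<in> \<C>" "embedding N \<theta>" "x \<in> N" "y \<in> N"
          using two by blast
        show "x + y \<in> M" "x * y \<in> M"
          using N sub[OF N(1)] sf_add[OF embedding_subfield[OF N(2)]] sf_mult[OF embedding_subfield[OF N(2)]] by auto
      next
        fix x
        assume "x \<in> M"
        then obtain N \<theta> where N: "gr N \<theta> \<in> \<C>" "embedding N \<theta>" "x \<in> N"
          using two[of x x] by blast
        show "- x \<in> M" "inverse x \<in> M"
          using N sub[OF N(1)] sf_uminus[OF embedding_subfield[OF N(2)]] sf_inverse[OF embedding_subfield[OF N(2)]] by auto
      qed
    next
      fix x y
      assume "x \<in> M" "y \<in> M"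
      then obtain N \<theta> where N: "gr N \<theta> \<in> \<C>" "embedding N \<theta>" "x \<in> N" "y \<in> N"
        using two by blast
      have c: "x + y \<in> N" "x * y \<in> N"
        using N sf_add[OF embedding_subfield[OF N(2)]] sf_mult[OF embedding_subfield[OF N(2)]] by auto
      show "\<rho> (x + y) = \<rho> x + \<rho> y" "\<rho> (x * y) = \<rho> x * \<rho> y"
        using val[OF N(1)] c N embedding_add[OF N(2)] embedding_mult[OF N(2)] by auto
    qed
    moreover have "L \<subseteq> M" "\<forall>z\<in>L. \<rho> z = \<tau> z"
    proof -
      obtain G where "G \<in> \<C>"
        using ne by auto
      then obtain N \<theta> where N: "gr N \<theta> \<in> \<C>" "L \<subseteq> N" "\<forall>z\<in>L. \<theta> z = \<tau> z"
        using memA by blast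
      show "L \<subseteq> M" "\<forall>z\<in>L. \<rho> z = \<tau> z"
        using N val[OF N(1)] sub[OF N(1)] by auto
    qed
    moreover have "M \<subseteq> Qbar"
      using two by blast
    moreover have "\<Union>\<C> = gr M \<rho>"
    proof (rule Set.set_eqI)
      fix z
      show "z \<in> \<Union>\<C> \<longleftrightarrow> z \<in> gr M \<rho>"
      proof
        assume "z \<in> \<Union>\<C>"
        then obtain G where G: "G \<in> \<C>" "z \<in> G"
          by auto
        obtain N \<theta> where N: "G = gr N \<theta>"
          using memA[OF G(1)] by blast
        with G obtain x where "z = (x, \<theta> x)" "x \<in> N"
          by (auto simp: gr_def)
        then show "z \<in> gr M \<rho>"
          using val[of N \<theta> x] sub[of N \<theta> x] G N by (auto simp: gr_def)
      next
        assume "z \<in> gr M \<rho>"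
        then obtain x where x: "z = (x, \<rho> x)" "x \<in> M"
          by (auto simp: gr_def)
        obtain N \<theta> where N: "gr N \<theta> \<in> \<C>" "x \<in> N"
          using two[of x x] x by blast
        have "z \<in> gr N \<theta>"
          using val[OF N] x N(2) by (auto simp: gr_def)
        then show "z \<in> \<Union>\<C>"
          using N(1) by blast
      qed
    qed
    ultimately show "\<Union>\<C> \<in> A"
      unfolding A_def by (intro CollectI exI[of _ M] exI[of _ \<rho>] conjI)
  qed
  then obtain G where G: "G \<in> A" "\<And>H. H \<in> A \<Longrightarrow> G \<subseteq> H \<Longrightarrow> H = G"
    by metis
  then obtain M \<sigma> where M: "embedding M \<sigma>" "L \<subseteq> M" "M \<subseteq> Qbar" "\<forall>z\<in>L. \<sigma> z = \<tau> z" "G = gr M \<sigma>"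
    unfolding A_def by auto
  have max: "H = gr M \<sigma>" if "H \<in> A" "gr M \<sigma> \<subseteq> H" for H
    using G(2) that M(5) by simp
  note sfM = embedding_subfield[OF M(1)]
  \<comment> \<open>For any algebraic \<open>x\<close> the image under \<open>\<sigma>\<close> of
    its minimal polynomial over \<open>M\<close> has a complex root, and
    \<open>embedding_extend\<close> gives a graph over \<open>M\<close> with \<open>x\<close>
    adjoined; maximality puts \<open>x\<close> into \<open>M\<close>.\<close>
  have "Qbar \<subseteq> M"
  proof
    fix x
    assume x: "x \<in> Qbar"
    then obtain p where p: "p \<in> pover \<rat>" "p \<noteq> 0" "poly p x = 0"
      unfolding Qbar_def algebraic_altdef pover_def by auto
    then have "p \<in> pover M"
      using sf_Rats[OF sfM] by (auto simp: pover_def)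
    then obtain m where m: "m \<in> pover M" "lead_coeff m = 1" "poly m x = 0"
      "\<And>h. h \<in> pover M \<Longrightarrow> poly h x = 0 \<Longrightarrow> \<exists>q\<in>pover M. h = q * m"
      using minimal_polynomial_exists[OF sfM _ p(2,3)] by blast
    have "degree m > 0"
    proof (rule ccontr)
      assume "\<not> degree m > 0"
      then obtain c where "m = [:c:]"
        using degree_eq_zeroE by blast
      then show False
        using m(2,3) by simp
    qed
    moreover have "degree (map_poly \<sigma> m) = degree m"
      by (rule map_poly_degree_eq) (use m(2) embedding_1[OF M(1)] in simp)
    ultimately obtain y where y: "poly (map_poly \<sigma> m) y = 0"
      using poly_has_root by metis
    obtain \<rho> where \<rho>: "embedding {poly h x | h. h \<in> pover M} \<rho>" "\<And>z. z \<in> M \<Longrightarrow> \<rho> z = \<sigma> z" "\<rho> x = y"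
      using embedding_extend[OF M(1) m y] by blast
    define N where "N = {poly h x | h. h \<in> pover M}"
    have MN: "M \<subseteq> N"
    proof
      fix z
      assume "z \<in> M"
      then have "[:z:] \<in> pover M"
        using pover_pCons[OF sfM] pover_0[OF sfM] by blast
      then show "z \<in> N"
        unfolding N_def by (intro CollectI exI[of _ "[:z:]"]) auto
    qed
    have "N \<subseteq> Qbar"
      unfolding N_def using poly_in_sf[OF subfield_Qbar _ x] pover_mono[OF M(3)] by auto
    moreover have "embedding N \<rho>"
      using \<rho>(1) by (simp add: N_def)
    moreover have "L \<subseteq> N" "\<forall>z\<in>L. \<rho> z = \<tau> z"
      using M MN \<rho>(2) by auto
    ultimately have "gr N \<rho> \<in> A"
      unfolding A_def by (intro CollectI exI[of _ N] exI[of _ \<rho>] conjI refl)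
    moreover have "gr M \<sigma> \<subseteq> gr N \<rho>"
      using MN \<rho>(2) by (auto simp: gr_def)
    ultimately have "gr N \<rho> = gr M \<sigma>"
      using max by blast
    moreover have "x \<in> N"
    proof -
      have "[:0, 1:] \<in> pover M"
        using pover_pCons[OF sfM] pover_0[OF sfM] sf_0[OF sfM] sf_1[OF sfM] by blast
      then show ?thesis
        unfolding N_def by (intro CollectI exI[of _ "[:0, 1:]"]) auto
    qed
    ultimately show "x \<in> M"
      by (auto simp: gr_def)
  qed
  then have "M = Qbar"
    using M(3) by auto
  then show ?thesis
    using that M by blast
qed

text \<open>In characteristic zero the minimal polynomial of \<open>z\<close> over \<open>K\<close>
  has a second root \<open>w\<close>, and the embedding over \<open>K\<close> that sends
  \<open>z\<close> to \<open>w\<close> extends to Qbar.\<close>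

lemma fixed_field_gal:
  assumes K: "subfield K CC" "K \<subseteq> Qbar" and z: "z \<in> Qbar" "z \<notin> K"
  obtains \<sigma> where "\<sigma> \<in> gal K" "\<sigma> z \<noteq> z"
proof -
  obtain p where p: "p \<in> pover \<rat>" "p \<noteq> 0" "poly p z = 0"
    using z unfolding Qbar_def algebraic_altdef pover_def by auto
  then have "p \<in> pover K"
    using sf_Rats[OF K(1)] by (auto simp: pover_def)
  then obtain m where m: "m \<in> pover K" "lead_coeff m = 1" "poly m z = 0"
    "\<And>h. h \<in> pover K \<Longrightarrow> poly h z = 0 \<Longrightarrow> \<exists>q\<in>pover K. h = q * m"
    using minimal_polynomial_exists[OF K(1) _ p(2,3)] by blast
  obtain q where q: "m = [:- z, 1:] * q"
    using m(3) by (metis dvdE poly_eq_0_iff_dvd)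
  have m0: "m \<noteq> 0"
    using m(2) by auto
  then have q0: "q \<noteq> 0"
    using q by auto
  have "degree q > 0"
  proof (rule ccontr)
    assume "\<not> degree q > 0"
    then obtain c where c: "q = [:c:]"
      using degree_eq_zeroE by blast
    then have "c = 1"
      using m(2) q by (auto split: if_splits)
    then have "m = [:-z, 1:]"
      using q c by simp
    then have "- z \<in> K"
      using poverD[OF m(1), of 0] by simp
    then show False
      using z(2) sf_uminus[OF K(1), of "- z"] by simp
  qed
  have dm: "degree m = degree q + 1"
    unfolding q using q0 by (subst degree_mult_eq) auto
  \<comment> \<open>Separability: at a double root the derivative would vanish too and be a multiple
    of \<open>m\<close>, against its smaller degree.\<close>
  have "poly q z \<noteq> 0"
  proof
    assume "poly q z = 0"
    moreover have "pderiv m = [:- z, 1:] * pderiv q + q"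
      unfolding q by (subst pderiv_mult) (simp add: pderiv_pCons)
    ultimately have "poly (pderiv m) z = 0"
      by simp
    moreover have "pderiv m \<in> pover K"
      using m(1) by (auto simp: pover_def coeff_pderiv intro!: sf_mult[OF K(1)] sf_of_nat[OF K(1)] simp del: of_nat_Suc)
    ultimately obtain r where "pderiv m = r * m"
      using m(4) by blast
    moreover have "pderiv m \<noteq> 0"
      using dm by (simp add: pderiv_eq_0_iff)
    ultimately have "degree (pderiv m) \<ge> degree m"
      using m0 by (auto simp: degree_mult_eq)
    then show False
      using dm by (simp add: degree_pderiv)
  qed
  obtain w where w: "poly q w = 0"
    using poly_has_root[OF \<open>degree q > 0\<close>] by auto
  have emb: "embedding K (\<lambda>x. x)"
    using K(1) by (auto simp: embedding_def)
  have mw: "poly (map_poly (\<lambda>x. x) m) w = 0"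
    using w by (simp add: q)
  obtain \<tau> where \<tau>: "embedding {poly h z | h. h \<in> pover K} \<tau>" "\<And>x. x \<in> K \<Longrightarrow> \<tau> x = x" "\<tau> z = w"
    using embedding_extend[OF emb m mw] by blast
  have "{poly h z | h. h \<in> pover K} \<subseteq> Qbar"
    using poly_in_sf[OF subfield_Qbar _ z(1)] pover_mono[OF K(2)] by auto
  then obtain \<sigma> where \<sigma>: "embedding Qbar \<sigma>" "\<And>x. x \<in> {poly h z | h. h \<in> pover K} \<Longrightarrow> \<sigma> x = \<tau> x"
    using embedding_extend_Qbar[OF \<tau>(1)] by blast
  have "[:x:] \<in> pover K" if "x \<in> K" for x
    using that pover_pCons[OF K(1)] pover_0[OF K(1)] by blast
  then have inK: "x \<in> {poly h z | h. h \<in> pover K}" if "x \<in> K" for x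
    using that by (intro CollectI exI[of _ "[:x:]"]) auto
  have "[:0, 1:] \<in> pover K"
    using pover_pCons[OF K(1)] pover_0[OF K(1)] sf_0[OF K(1)] sf_1[OF K(1)] by blast
  then have inz: "z \<in> {poly h z | h. h \<in> pover K}"
    by (intro CollectI exI[of _ "[:0, 1:]"]) auto
  have "\<sigma> \<in> gal K"
    using \<sigma> \<tau> inK embedding_Qbar_surj[OF \<sigma>(1)] by (auto simp: gal_def)
  moreover have "\<sigma> z \<noteq> z"
    using \<sigma>(2)[OF inz] \<tau>(3) w \<open>poly q z \<noteq> 0\<close> by auto
  ultimately show ?thesis
    using that by blast
qed

lemma galD:
  assumes "\<sigma> \<in> gal K"
  shows "embedding Qbar \<sigma>" "\<And>x. x \<in> Qbar \<Longrightarrow> \<sigma> x \<in> Qbar" "\<And>x. x \<in> K \<Longrightarrow> \<sigma> x = x"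
    "\<And>y. y \<in> Qbar \<Longrightarrow> \<exists>x\<in>Qbar. \<sigma> x = y"
  using assms by (auto simp: gal_def image_iff set_eq_iff) metis+

lemma gal_comp: "\<sigma> \<in> gal K \<Longrightarrow> \<tau> \<in> gal K \<Longrightarrow> \<sigma> \<circ> \<tau> \<in> gal K"
proof -
  assume a: "\<sigma> \<in> gal K" "\<tau> \<in> gal K"
  then have "\<tau> x \<in> Qbar" if "x \<in> Qbar" for x
    using that by (auto simp: gal_def)
  moreover have "(\<lambda>x. \<sigma> (\<tau> x)) ` Qbar = \<sigma> ` \<tau> ` Qbar"
    by auto
  ultimately show ?thesis
    using a by (simp add: gal_def embedding_def)
qed

lemma gal_mono: "K \<subseteq> L \<Longrightarrow> gal L \<subseteq> gal K"
  by (auto simp: gal_def)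

section \<open>The function field of the curve\<close>

text \<open>The curve with ordinate squared equal to \<open>crv x\<close> has Cremona label 20a2.
  The cubic is polymorphic because it is applied to numbers, power series and Laurent
  series.\<close>

definition crv :: "'a :: comm_ring_1 \<Rightarrow> 'a" where
  "crv x = x ^ 3 + x\<^sup>2 - x"

definition crv_poly :: "complex poly" where
  "crv_poly = [:0, -1, 1, 1:]"

lemma poly_crv_poly [simp]: "poly crv_poly x = crv x"
  by (simp add: crv_poly_def crv_def power2_eq_square power3_eq_cube algebra_simps)

lemma degree_crv_poly [simp]: "degree crv_poly = 3"
  by (simp add: crv_poly_def)

lemma crv_poly_nonzero [simp]: "crv_poly \<noteq> 0"
  by (simp add: crv_poly_def)

lemma crv_poly_pover: "subfield K CC \<Longrightarrow> crv_poly \<in> pover K"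
  by (auto simp: crv_poly_def pover_pCons_iff sf_intros)

text \<open>The norm of \<open>a + b * v\<close> from K(u, v) down to K(u).\<close>

definition nrm :: "complex poly \<Rightarrow> complex poly \<Rightarrow> complex poly" where
  "nrm a b = a\<^sup>2 - crv_poly * b\<^sup>2"

lemma nrm_pover: "subfield K CC \<Longrightarrow> a \<in> pover K \<Longrightarrow> b \<in> pover K \<Longrightarrow> nrm a b \<in> pover K"
  unfolding nrm_def by (intro pover_diff pover_mult pover_power crv_poly_pover)

lemma degree_crv_times_square: "b \<noteq> 0 \<Longrightarrow> degree (crv_poly * b\<^sup>2) = 2 * degree b + 3"
  by (simp add: degree_mult_eq degree_power_eq)

text \<open>\<open>2 * degree a\<close> and \<open>2 * degree b + 3\<close> have different parity,
  so the leading terms cannot cancel. The degree of the norm will be the pole order at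
  infinity.\<close>

lemma degree_nrm:
  assumes "a \<noteq> 0" "b \<noteq> 0"
  shows "degree (nrm a b) = max (2 * degree a) (2 * degree b + 3)"
proof -
  have a: "degree (a\<^sup>2) = 2 * degree a"
    using assms(1) by (simp add: degree_power_eq)
  have ne: "degree (a\<^sup>2) \<noteq> degree (crv_poly * b\<^sup>2)"
    unfolding a degree_crv_times_square[OF assms(2)] by presburger
  consider "degree (a\<^sup>2) < degree (crv_poly * b\<^sup>2)" | "degree (a\<^sup>2) > degree (crv_poly * b\<^sup>2)"
    using ne by linarith
  then show ?thesis
  proof cases
    case 1
    then have "degree (nrm a b) = degree (crv_poly * b\<^sup>2)"
      unfolding nrm_def using degree_add_eq_right[of "a\<^sup>2" "- (crv_poly * b\<^sup>2)"] by simp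
    then show ?thesis
      using 1 unfolding a degree_crv_times_square[OF assms(2)] by simp
  next
    case 2
    then have "degree (nrm a b) = degree (a\<^sup>2)"
      unfolding nrm_def using degree_add_eq_left[of "- (crv_poly * b\<^sup>2)" "a\<^sup>2"] by simp
    then show ?thesis
      using 2 unfolding a degree_crv_times_square[OF assms(2)] by simp
  qed
qed

lemma nrm_eq_0_iff: "nrm a b = 0 \<longleftrightarrow> a = 0 \<and> b = 0"
proof
  assume 0: "nrm a b = 0"
  show "a = 0 \<and> b = 0"
  proof (cases "a = 0 \<or> b = 0")
    case True
    then show ?thesis
      using 0 by (auto simp: nrm_def)
  next
    case False
    then have "degree (nrm a b) \<ge> 3"
      using degree_nrm[of a b] by simp
    then show ?thesis
      using 0 by simp
  qed
qed (simp add: nrm_def)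

locale curve_field =
  fixes u v :: complex
  assumes u_transcendental: "\<not> algebraic u" and curve_eq: "v\<^sup>2 = crv u"
begin

definition el :: "complex poly \<Rightarrow> complex poly \<Rightarrow> complex" where
  "el a b = poly a u + poly b u * v"

text \<open>Multiplication by the conjugate \<open>a - b * v\<close> of a denominator gives every
  element of K(u, v) a denominator in \<open>u\<close> alone.\<close>

definition FF :: "complex set \<Rightarrow> complex set" where
  "FF K = {el a b / poly c u | a b c. a \<in> pover K \<and> b \<in> pover K \<and> c \<in> pover K \<and> c \<noteq> 0}"

abbreviation "F \<equiv> FF Qbar"

lemma poly_u_eq_0_iff: "p \<in> pover Qbar \<Longrightarrow> poly p u = 0 \<longleftrightarrow> p = 0"
  using Qbar_root[of p u] u_transcendental by (auto simp: Qbar_def)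

lemma el_mult: "el a b * el a' b' = el (a * a' + crv_poly * (b * b')) (a * b' + a' * b)"
proof -
  have "el a b * el a' b' = poly a u * poly a' u + v\<^sup>2 * (poly b u * poly b' u)
      + (poly a u * poly b' u + poly a' u * poly b u) * v"
    by (simp add: el_def algebra_simps power2_eq_square)
  then show ?thesis
    by (simp add: curve_eq el_def)
qed

lemma el_add: "el a b + el a' b' = el (a + a') (b + b')"
  by (simp add: el_def algebra_simps)

lemma el_diff: "el a b - el a' b' = el (a - a') (b - b')"
  by (simp add: el_def algebra_simps)

lemma el_uminus: "- el a b = el (- a) (- b)"
  by (simp add: el_def algebra_simps)

lemma el_smult: "poly p u * el a b = el (p * a) (p * b)"
  by (simp add: el_def algebra_simps)

lemma el_conj: "el a b * el a (- b) = poly (nrm a b) u"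
  unfolding el_mult by (simp add: el_def nrm_def power2_eq_square algebra_simps)

text \<open>The norm is a polynomial in the transcendental \<open>u\<close>, nonzero unless
  \<open>a\<close> and \<open>b\<close> vanish; so 1 and \<open>v\<close> are independent over
  Qbar(u).\<close>

lemma el_eq_0_iff: "a \<in> pover Qbar \<Longrightarrow> b \<in> pover Qbar \<Longrightarrow> el a b = 0 \<longleftrightarrow> a = 0 \<and> b = 0"
  using el_conj[of a b] poly_u_eq_0_iff[OF nrm_pover[OF subfield_Qbar], of a b]
  by (auto simp: nrm_eq_0_iff el_def)

lemma el_eq_iff:
  assumes "a \<in> pover Qbar" "b \<in> pover Qbar" "a' \<in> pover Qbar" "b' \<in> pover Qbar"
  shows "el a b = el a' b' \<longleftrightarrow> a = a' \<and> b = b'"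
proof -
  have "el a b = el a' b' \<longleftrightarrow> el (a - a') (b - b') = 0"
    by (simp flip: el_diff)
  also have "\<dots> \<longleftrightarrow> a - a' = 0 \<and> b - b' = 0"
    using assms by (intro el_eq_0_iff pover_diff[OF subfield_Qbar])
  finally show ?thesis
    by simp
qed

lemma FF_I: "a \<in> pover K \<Longrightarrow> b \<in> pover K \<Longrightarrow> c \<in> pover K \<Longrightarrow> c \<noteq> 0 \<Longrightarrow> el a b / poly c u \<in> FF K"
  by (auto simp: FF_def)

lemma FF_E:
  assumes "h \<in> FF K"
  obtains a b c where "a \<in> pover K" "b \<in> pover K" "c \<in> pover K" "c \<noteq> 0" "h = el a b / poly c u"
  using assms by (auto simp: FF_def)

lemma FF_mono: "K \<subseteq> L \<Longrightarrow> FF K \<subseteq> FF L"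
  using pover_mono[of K L] by (auto simp: FF_def) blast

context
  fixes K
  assumes K: "subfield K CC" "K \<subseteq> Qbar"
begin

lemma poly_u_nonzero: "c \<in> pover K \<Longrightarrow> c \<noteq> 0 \<Longrightarrow> poly c u \<noteq> 0"
  using poly_u_eq_0_iff pover_mono[OF K(2)] by blast

lemma el_FF: "a \<in> pover K \<Longrightarrow> b \<in> pover K \<Longrightarrow> el a b \<in> FF K"
  using FF_I[of a K b 1] pover_1[OF K(1)] by simp

lemma poly_FF: "a \<in> pover K \<Longrightarrow> poly a u \<in> FF K"
  using el_FF[of a 0] pover_0[OF K(1)] by (simp add: el_def)

lemma const_FF: "K \<subseteq> FF K"
proof
  fix c
  assume "c \<in> K"
  then have "[:c:] \<in> pover K"
    using pover_pCons[OF K(1)] pover_0[OF K(1)] by blast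
  then show "c \<in> FF K"
    using poly_FF[of "[:c:]"] by simp
qed

lemma pover_X: "[:0, 1:] \<in> pover K"
  using pover_pCons[OF K(1)] pover_0[OF K(1)] sf_0[OF K(1)] sf_1[OF K(1)] by blast

lemma u_FF: "u \<in> FF K"
  using poly_FF[OF pover_X] by simp

lemma v_FF: "v \<in> FF K"
  using el_FF[OF pover_0[OF K(1)] pover_1[OF K(1)]] by (simp add: el_def)

lemma subfield_FF: "subfield (FF K) CC"
proof (rule subfieldCI)
  show "1 \<in> FF K"
    using const_FF sf_1[OF K(1)] by auto
next
  fix x
  assume "x \<in> FF K"
  then obtain a b c where x: "a \<in> pover K" "b \<in> pover K" "c \<in> pover K" "c \<noteq> 0" "x = el a b / poly c u"
    by (rule FF_E)
  have "- x = el (- a) (- b) / poly c u"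
    by (simp add: x(5) el_uminus[symmetric])
  then show "- x \<in> FF K"
    using FF_I[of "- a" K "- b" c] x pover_uminus[OF K(1)] by simp
  assume "x \<noteq> 0"
  then have "nrm a b \<noteq> 0"
    using x by (auto simp: nrm_eq_0_iff el_def)
  moreover have "el a b \<noteq> 0"
    using x \<open>x \<noteq> 0\<close> by auto
  then have "el a (- b) = poly (nrm a b) u / el a b"
    by (simp add: el_conj[symmetric])
  moreover have "poly (nrm a b) u \<noteq> 0"
    using calculation(1) poly_u_nonzero nrm_pover[OF K(1) x(1,2)] by blast
  ultimately have "inverse x = poly c u * el a (- b) / poly (nrm a b) u"
    using x(5) by simp
  also have "\<dots> = el (c * a) (c * (- b)) / poly (nrm a b) u"
    by (simp only: el_smult)
  also have "\<dots> \<in> FF K"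
    using x \<open>nrm a b \<noteq> 0\<close> by (intro FF_I pover_mult[OF K(1)] pover_uminus[OF K(1)] nrm_pover[OF K(1)])
  finally show "inverse x \<in> FF K" .
next
  fix x y
  assume "x \<in> FF K" "y \<in> FF K"
  then obtain a b c a' b' c' where
    x: "a \<in> pover K" "b \<in> pover K" "c \<in> pover K" "c \<noteq> 0" "x = el a b / poly c u" and
    y: "a' \<in> pover K" "b' \<in> pover K" "c' \<in> pover K" "c' \<noteq> 0" "y = el a' b' / poly c' u"
    by (elim FF_E)
  have nz: "poly c u \<noteq> 0" "poly c' u \<noteq> 0"
    using poly_u_nonzero x y by blast+
  have num: "el (c' * a + c * a') (c' * b + c * b') = el a b * poly c' u + el a' b' * poly c u"
    unfolding mult.commute[of "el a b"] mult.commute[of "el a' b'"] by (simp only: el_smult el_add)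
  have "x + y = el (c' * a + c * a') (c' * b + c * b') / poly (c * c') u"
    unfolding num x y poly_mult using nz by (rule add_frac_eq)
  also have "\<dots> \<in> FF K"
    using x y by (intro FF_I pover_mult[OF K(1)] pover_add[OF K(1)]) auto
  finally show "x + y \<in> FF K" .
  have "x * y = el (a * a' + crv_poly * (b * b')) (a * b' + a' * b) / poly (c * c') u"
    by (simp add: x y el_mult[symmetric])
  also have "\<dots> \<in> FF K"
    using x y by (intro FF_I pover_mult[OF K(1)] pover_add[OF K(1)] crv_poly_pover[OF K(1)]) auto
  finally show "x * y \<in> FF K" .
qed

lemma FF_eq_adjoin: "FF K = adjoin K {u, v}"
proof
  show "adjoin K {u, v} \<subseteq> FF K"
    by (rule adjoin_min[OF subfield_FF const_FF]) (use u_FF v_FF in auto)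
  have sf: "subfield (adjoin K {u, v}) CC"
    by (rule subfield_adjoin)
  have uv: "u \<in> adjoin K {u, v}" "v \<in> adjoin K {u, v}"
    using adjoin_incl[of K "{u, v}"] by auto
  have p: "poly p u \<in> adjoin K {u, v}" if "p \<in> pover K" for p
    using poly_in_sf[OF sf _ uv(1)] pover_mono[OF adjoin_base_subset] that by blast
  show "FF K \<subseteq> adjoin K {u, v}"
  proof
    fix h
    assume "h \<in> FF K"
    then obtain a b c where "a \<in> pover K" "b \<in> pover K" "c \<in> pover K" "h = el a b / poly c u"
      by (rule FF_E)
    then show "h \<in> adjoin K {u, v}"
      unfolding el_def by (simp only:) (intro sf_divide[OF sf] sf_add[OF sf] sf_mult[OF sf] uv p)
  qed
qed

end

lemmas subfield_F = subfield_FF[OF subfield_Qbar order_refl]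
lemmas el_F = el_FF[OF subfield_Qbar order_refl]
lemmas poly_F = poly_FF[OF subfield_Qbar order_refl]
lemmas const_F = subsetD[OF const_FF[OF subfield_Qbar order_refl]]
lemmas u_F = u_FF[OF subfield_Qbar order_refl]
lemmas v_F = v_FF[OF subfield_Qbar order_refl]

lemma algebraic_F_conv: "c \<in> Qbar \<Longrightarrow> u - c \<noteq> 0"
  using u_transcendental by (auto simp: Qbar_def)

lemma v_minus_const_nonzero: "c \<in> Qbar \<Longrightarrow> v - c \<noteq> 0"
  using el_eq_0_iff[of "[:-c:]" 1] pover_pCons[OF subfield_Qbar] pover_0[OF subfield_Qbar]
    pover_1[OF subfield_Qbar] sf_uminus[OF subfield_Qbar, of c]
  by (auto simp: el_def)

section \<open>Valuations of the function field\<close>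

text \<open>Unlike a place, \<open>w\<close> may take any values outside of \<open>F - {0}\<close>
  and may miss integers. The order of a Laurent expansion is of this kind before it is restricted
  and normalised.\<close>

definition valn :: "(complex \<Rightarrow> int) \<Rightarrow> bool" where
  "valn w \<longleftrightarrow> (\<forall>f\<in>F - {0}. \<forall>g\<in>F - {0}. w (f * g) = w f + w g) \<and>
     (\<forall>f\<in>F - {0}. \<forall>g\<in>F - {0}. f + g \<noteq> 0 \<longrightarrow> min (w f) (w g) \<le> w (f + g)) \<and>
     (\<forall>c\<in>Qbar - {0}. w c = 0)"

lemma places_iff: "w \<in> places Qbar F \<longleftrightarrow> w \<in> extensional (F - {0}) \<and> valn w \<and> w ` (F - {0}) = UNIV"
  by (auto simp: places_def valn_def)

context
  fixes w
  assumes w: "valn w"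
begin

lemma valn_mult: "f \<in> F \<Longrightarrow> g \<in> F \<Longrightarrow> f \<noteq> 0 \<Longrightarrow> g \<noteq> 0 \<Longrightarrow> w (f * g) = w f + w g"
  using w by (auto simp: valn_def)

lemma valn_add: "f \<in> F \<Longrightarrow> g \<in> F \<Longrightarrow> f \<noteq> 0 \<Longrightarrow> g \<noteq> 0 \<Longrightarrow> f + g \<noteq> 0 \<Longrightarrow> min (w f) (w g) \<le> w (f + g)"
  using w by (auto simp: valn_def)

lemma valn_const: "c \<in> Qbar \<Longrightarrow> c \<noteq> 0 \<Longrightarrow> w c = 0"
  using w by (auto simp: valn_def)

lemma valn_uminus: "f \<in> F \<Longrightarrow> w (- f) = w f"
proof (cases "f = 0")
  case False
  assume f: "f \<in> F"
  have m1: "- 1 \<in> Qbar"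
    using sf_uminus[OF subfield_Qbar sf_1[OF subfield_Qbar]] .
  have "w (- 1 * f) = w (- 1) + w f"
    using f False const_F[OF m1] by (intro valn_mult) auto
  then show ?thesis
    using valn_const[OF m1] by simp
qed simp

lemma valn_inverse: "f \<in> F \<Longrightarrow> f \<noteq> 0 \<Longrightarrow> w (inverse f) = - w f"
  using valn_mult[of f "inverse f"] valn_const[of 1] sf_1[OF subfield_Qbar] sf_inverse[OF subfield_F, of f]
  by auto

lemma valn_divide: "f \<in> F \<Longrightarrow> g \<in> F \<Longrightarrow> f \<noteq> 0 \<Longrightarrow> g \<noteq> 0 \<Longrightarrow> w (f / g) = w f - w g"
  using valn_mult[of f "inverse g"] valn_inverse[of g] sf_inverse[OF subfield_F, of g]
  by (simp add: divide_inverse)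

lemma valn_power: "f \<in> F \<Longrightarrow> f \<noteq> 0 \<Longrightarrow> w (f ^ n) = int n * w f"
proof (induction n)
  case 0
  then show ?case
    using valn_const[of 1] sf_1[OF subfield_Qbar] by simp
next
  case (Suc n)
  then show ?case
    using valn_mult[of f "f ^ n"] sf_power[OF subfield_F, of f n] by (simp add: algebra_simps)
qed

lemma valn_add_dominant:
  assumes "f \<in> F" "g \<in> F" "f \<noteq> 0" "g \<noteq> 0" "w f < w g"
  shows "f + g \<noteq> 0" "w (f + g) = w f"
proof -
  show nz: "f + g \<noteq> 0"
  proof
    assume "f + g = 0"
    then have "f = - g"
      by (simp add: eq_neg_iff_add_eq_0)
    then show False
      using valn_uminus[OF assms(2)] assms(5) by simp
  qed
  have "min (w (f + g)) (w (- g)) \<le> w (f + g + - g)"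
    using assms nz by (intro valn_add sf_add[OF subfield_F] sf_uminus[OF subfield_F]) auto
  then have "min (w (f + g)) (w g) \<le> w f"
    using valn_uminus[OF assms(2)] by simp
  moreover have "min (w f) (w g) \<le> w (f + g)"
    using assms nz by (intro valn_add) auto
  ultimately show "w (f + g) = w f"
    using assms(5) by auto
qed

text \<open>The convention that 0 has infinite valuation, since the number \<open>w 0\<close>
  carries no meaning.\<close>

definition wge :: "int \<Rightarrow> complex \<Rightarrow> bool" where
  "wge n f \<longleftrightarrow> f \<in> F \<and> (f \<noteq> 0 \<longrightarrow> n \<le> w f)"

lemma wge_add: "wge n f \<Longrightarrow> wge n g \<Longrightarrow> wge n (f + g)"
proof (cases "f = 0 \<or> g = 0 \<or> f + g = 0")
  case True
  assume "wge n f" "wge n g"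
  then show ?thesis
    using True sf_add[OF subfield_F, of f g] by (auto simp: wge_def)
next
  case False
  assume "wge n f" "wge n g"
  then show ?thesis
    using valn_add[of f g] False sf_add[OF subfield_F, of f g] by (auto simp: wge_def)
qed

lemma wge_mult: "wge n f \<Longrightarrow> wge m g \<Longrightarrow> wge (n + m) (f * g)"
  using valn_mult[of f g] sf_mult[OF subfield_F, of f g] by (auto simp: wge_def)

lemma wge_mult0: "wge n f \<Longrightarrow> wge 0 g \<Longrightarrow> wge n (f * g)" "wge 0 f \<Longrightarrow> wge n g \<Longrightarrow> wge n (f * g)"
  using wge_mult[of n f 0 g] wge_mult[of 0 f n g] by auto

lemma wge_const: "c \<in> Qbar \<Longrightarrow> wge 0 c"
  using valn_const const_F by (auto simp: wge_def)

lemma wge_mono: "wge n f \<Longrightarrow> m \<le> n \<Longrightarrow> wge m f"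
  by (auto simp: wge_def)

lemma wge_poly: "wge 0 u \<Longrightarrow> p \<in> pover Qbar \<Longrightarrow> wge 0 (poly p u)"
proof (induction p)
  case 0
  then show ?case
    using sf_0[OF subfield_F] by (simp add: wge_def)
next
  case (pCons a p)
  then have "a \<in> Qbar" "p \<in> pover Qbar"
    using pover_pCons_iff[OF subfield_Qbar] by auto
  then have "wge 0 a" "wge 0 (u * poly p u)"
    using pCons by (simp_all add: wge_const wge_mult0(1))
  then show ?case
    using wge_add by simp
qed

end

section \<open>Laurent expansions\<close>

definition evp :: "complex fls \<Rightarrow> complex poly \<Rightarrow> complex fls" where
  "evp U p = poly (map_poly fls_const p) U"

lemma evp_0 [simp]: "evp U 0 = 0"
  by (simp add: evp_def)

lemma evp_pCons [simp]: "evp U (pCons c p) = fls_const c + U * evp U p"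
  by (simp add: evp_def map_poly_pCons)

lemma evp_1 [simp]: "evp U 1 = 1"
  by (simp add: one_pCons)

lemma evp_add: "evp U (p + q) = evp U p + evp U q"
proof (induction p arbitrary: q)
  case (pCons c p)
  then show ?case
    by (cases q) (simp add: fls_plus_const[symmetric] algebra_simps)
qed simp

lemma evp_smult: "evp U (smult c p) = fls_const c * evp U p"
  by (induction p) (simp_all add: ring_distribs mult_ac)

lemma evp_mult: "evp U (p * q) = evp U p * evp U q"
  by (induction p) (simp_all add: evp_add evp_smult algebra_simps)

lemma evp_uminus: "evp U (- p) = - evp U p"
  using evp_smult[of U "-1" p] by simp

lemma evp_diff: "evp U (p - q) = evp U p - evp U q"
  using evp_add[of U p "- q"] by (simp add: evp_uminus)

lemma evp_power: "evp U (p ^ n) = evp U p ^ n"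
  by (induction n) (simp_all add: evp_mult)

lemma evp_crv_poly: "evp U crv_poly = crv U"
  by (simp add: crv_poly_def crv_def power2_eq_square power3_eq_cube algebra_simps)

text \<open>The second condition says that \<open>U\<close> is transcendental over the complex
  numbers; it makes the expansion of functions injective.\<close>

definition expansion :: "complex fls \<Rightarrow> complex fls \<Rightarrow> bool" where
  "expansion U V \<longleftrightarrow> V\<^sup>2 = crv U \<and> (\<forall>p. evp U p = 0 \<longrightarrow> p = 0)"

text \<open>A function has many representations \<open>el a b / poly c u\<close>. One is chosen, and
  \<open>expand_eq\<close> shows that the series does not depend on the choice.\<close>

definition expand :: "complex fls \<Rightarrow> complex fls \<Rightarrow> complex \<Rightarrow> complex fls" where
  "expand U V h = (SOME z. \<exists>a b c. a \<in> pover Qbar \<and> b \<in> pover Qbar \<and> c \<in> pover Qbar \<and> c \<noteq> 0 \<and>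
     h = el a b / poly c u \<and> z = (evp U a + evp U b * V) / evp U c)"

context
  fixes U V
  assumes UV: "expansion U V"
begin

lemma expand_eq:
  assumes "a \<in> pover Qbar" "b \<in> pover Qbar" "c \<in> pover Qbar" "c \<noteq> 0"
  shows "expand U V (el a b / poly c u) = (evp U a + evp U b * V) / evp U c"
proof -
  have "\<exists>z a' b' c'. a' \<in> pover Qbar \<and> b' \<in> pover Qbar \<and> c' \<in> pover Qbar \<and> c' \<noteq> 0 \<and>
     el a b / poly c u = el a' b' / poly c' u \<and> z = (evp U a' + evp U b' * V) / evp U c'"
    using assms by blast
  from someI_ex[OF this] obtain a' b' c' where *:
    "a' \<in> pover Qbar" "b' \<in> pover Qbar" "c' \<in> pover Qbar" "c' \<noteq> 0"
    "el a b / poly c u = el a' b' / poly c' u"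
    "expand U V (el a b / poly c u) = (evp U a' + evp U b' * V) / evp U c'"
    unfolding expand_def by blast
  have nz: "poly c u \<noteq> 0" "poly c' u \<noteq> 0" "evp U c \<noteq> 0" "evp U c' \<noteq> 0"
    using poly_u_eq_0_iff assms * UV by (auto simp: expansion_def)
  have "poly c' u * el a b = poly c u * el a' b'"
    using *(5) nz by (simp add: field_simps)
  then have "c' * a = c * a'" "c' * b = c * b'"
    using el_eq_iff[of "c' * a" "c' * b" "c * a'" "c * b'"] assms * pover_mult[OF subfield_Qbar]
    by (simp_all add: el_smult)
  then have "evp U c' * evp U a = evp U c * evp U a'" "evp U c' * evp U b = evp U c * evp U b'"
    by (simp_all flip: evp_mult)
  then have "evp U c' * (evp U a + evp U b * V) = evp U c * (evp U a' + evp U b' * V)"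
    by (simp add: algebra_simps)
  then have "(evp U a + evp U b * V) * evp U c' = (evp U a' + evp U b' * V) * evp U c"
    by (simp only: mult.commute)
  then show ?thesis
    using *(6) nz by (simp add: frac_eq_eq)
qed

lemma expand_el:
  "a \<in> pover Qbar \<Longrightarrow> b \<in> pover Qbar \<Longrightarrow> expand U V (el a b) = evp U a + evp U b * V"
  using expand_eq[of a b 1] pover_1[OF subfield_Qbar] by simp

lemma expand_poly: "a \<in> pover Qbar \<Longrightarrow> expand U V (poly a u) = evp U a"
  using expand_el[of a 0] pover_0[OF subfield_Qbar] by (simp add: el_def)

lemma expand_const: "c \<in> Qbar \<Longrightarrow> expand U V c = fls_const c"
  using expand_poly[of "[:c:]"] pover_pCons[OF subfield_Qbar] pover_0[OF subfield_Qbar] by simp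

lemma evp_nrm: "(evp U a + evp U b * V) * (evp U a - evp U b * V) = evp U (nrm a b)"
proof -
  have "(evp U a + evp U b * V) * (evp U a - evp U b * V) = (evp U a)\<^sup>2 - V\<^sup>2 * (evp U b)\<^sup>2"
    by (simp add: algebra_simps power2_eq_square)
  then show ?thesis
    using UV by (simp add: expansion_def nrm_def evp_diff evp_mult evp_power evp_crv_poly)
qed

text \<open>If the series of \<open>el a b\<close> vanished, so would the series of its norm, but
  polynomials in \<open>u\<close> expand injectively.\<close>

lemma expand_nonzero:
  assumes "h \<in> F" "h \<noteq> 0"
  shows "expand U V h \<noteq> 0"
proof -
  obtain a b c where h: "a \<in> pover Qbar" "b \<in> pover Qbar" "c \<in> pover Qbar" "c \<noteq> 0" "h = el a b / poly c u"
    using FF_E[OF assms(1)] .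
  have "nrm a b \<noteq> 0"
    using h assms(2) by (auto simp: nrm_eq_0_iff el_def)
  then have "evp U a + evp U b * V \<noteq> 0"
    using evp_nrm[of a b] UV by (auto simp: expansion_def)
  moreover have "evp U c \<noteq> 0"
    using UV h(4) by (auto simp: expansion_def)
  ultimately show ?thesis
    using h expand_eq by simp
qed

lemma expand_add:
  assumes "f \<in> F" "g \<in> F"
  shows "expand U V (f + g) = expand U V f + expand U V g"
    and "expand U V (f * g) = expand U V f * expand U V g"
proof -
  obtain a b c where f: "a \<in> pover Qbar" "b \<in> pover Qbar" "c \<in> pover Qbar" "c \<noteq> 0" "f = el a b / poly c u"
    using FF_E[OF assms(1)] .
  obtain a' b' c' where g: "a' \<in> pover Qbar" "b' \<in> pover Qbar" "c' \<in> pover Qbar" "c' \<noteq> 0" "g = el a' b' / poly c' u"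
    using FF_E[OF assms(2)] .
  have nz: "poly c u \<noteq> 0" "poly c' u \<noteq> 0" "evp U c \<noteq> 0" "evp U c' \<noteq> 0"
    using poly_u_eq_0_iff f g UV by (auto simp: expansion_def)
  note pov = pover_mult[OF subfield_Qbar] pover_add[OF subfield_Qbar] crv_poly_pover[OF subfield_Qbar]
  have num: "el (c' * a + c * a') (c' * b + c * b') = el a b * poly c' u + el a' b' * poly c u"
    unfolding mult.commute[of "el a b"] mult.commute[of "el a' b'"] by (simp only: el_smult el_add)
  have "f + g = el (c' * a + c * a') (c' * b + c * b') / poly (c * c') u"
    unfolding num f g poly_mult using nz(1,2) by (rule add_frac_eq)
  also have "expand U V \<dots> = (evp U (c' * a + c * a') + evp U (c' * b + c * b') * V) / evp U (c * c')"
    using f g by (intro expand_eq pov) auto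
  also have "\<dots> = ((evp U a + evp U b * V) * evp U c' + (evp U a' + evp U b' * V) * evp U c) / (evp U c * evp U c')"
    by (simp add: evp_add evp_mult ring_distribs mult_ac)
  also have "\<dots> = (evp U a + evp U b * V) / evp U c + (evp U a' + evp U b' * V) / evp U c'"
    using nz(3,4) by (rule add_frac_eq[symmetric])
  also have "\<dots> = expand U V f + expand U V g"
    using f g by (simp add: expand_eq)
  finally show "expand U V (f + g) = expand U V f + expand U V g" .
  have V2: "V\<^sup>2 = crv U"
    using UV by (simp add: expansion_def)
  have "f * g = el (a * a' + crv_poly * (b * b')) (a * b' + a' * b) / poly (c * c') u"
    by (simp add: f g el_mult[symmetric])
  also have "expand U V \<dots> = (evp U (a * a' + crv_poly * (b * b')) + evp U (a * b' + a' * b) * V) / evp U (c * c')"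
    using f g by (intro expand_eq pov) auto
  also have "\<dots> = (evp U a * evp U a' + V\<^sup>2 * (evp U b * evp U b') + (evp U a * evp U b' + evp U a' * evp U b) * V) / (evp U c * evp U c')"
    by (simp add: evp_add evp_mult evp_crv_poly V2)
  also have "\<dots> = (evp U a + evp U b * V) * (evp U a' + evp U b' * V) / (evp U c * evp U c')"
    by (simp add: algebra_simps power2_eq_square)
  also have "\<dots> = expand U V f * expand U V g"
    using f g by (simp add: expand_eq)
  finally show "expand U V (f * g) = expand U V f * expand U V g" .
qed

lemma valn_expand: "valn (\<lambda>h. fls_subdegree (expand U V h))"
  unfolding valn_def
proof (intro conjI ballI impI)
  fix f g
  assume fg: "f \<in> F - {0}" "g \<in> F - {0}"
  then show "fls_subdegree (expand U V (f * g)) = fls_subdegree (expand U V f) + fls_subdegree (expand U V g)"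
    using expand_nonzero by (simp add: expand_add)
  assume "f + g \<noteq> 0"
  then have "expand U V (f + g) \<noteq> 0"
    using expand_nonzero[of "f + g"] sf_add[OF subfield_F, of f g] fg by auto
  then show "min (fls_subdegree (expand U V f)) (fls_subdegree (expand U V g)) \<le> fls_subdegree (expand U V (f + g))"
    using fg fls_plus_subdegree by (simp add: expand_add)
next
  fix c
  assume "c \<in> Qbar - {0}"
  then show "fls_subdegree (expand U V c) = 0"
    by (simp add: expand_const)
qed

end

end

section \<open>Places of the function field and points of the curve\<close>

definition epts :: "complex set \<Rightarrow> point set" where
  "epts K = insert Infinity {Affine x y | x y. x \<in> K \<and> y \<in> K \<and> y\<^sup>2 = crv x}"

lemma epts_simps [simp]: "Infinity \<in> epts K" "Affine x y \<in> epts K \<longleftrightarrow> x \<in> K \<and> y \<in> K \<and> y\<^sup>2 = crv x"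
  by (auto simp: epts_def)

text \<open>The divided difference of the cubic at \<open>x\<close>; its value at \<open>x\<close>
  is the derivative of the cubic.\<close>

definition crv_quot :: "complex \<Rightarrow> complex poly" where
  "crv_quot x = [:x\<^sup>2 + x - 1, x + 1, 1:]"

lemma crv_diff: "crv y - crv x = (y - x) * poly (crv_quot x) y"
  by (simp add: crv_def crv_quot_def power2_eq_square power3_eq_cube algebra_simps)

text \<open>Smoothness of the curve at its points with ordinate 0: the cubic has no double
  root.\<close>

lemma crv_quot_nonzero: "crv x = 0 \<Longrightarrow> poly (crv_quot x) x \<noteq> 0"
proof
  assume 1: "crv x = 0" and 2: "poly (crv_quot x) x = 0"
  have d: "3 * x\<^sup>2 + 2 * x - 1 = 0"
    using 2 by (simp add: crv_quot_def power2_eq_square algebra_simps)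
  have "x * (x\<^sup>2 + x - 1) = 0"
    using 1 by (simp add: crv_def power2_eq_square power3_eq_cube algebra_simps)
  then consider "x = 0" | "x\<^sup>2 + x - 1 = 0"
    by auto
  then show False
  proof cases
    case 1
    then show False using d by simp
  next
    case 2
    then have e: "x\<^sup>2 = 1 - x"
      by (simp add: algebra_simps)
    have "2 - x = 0"
      using d unfolding e by (simp add: algebra_simps)
    then have "x = 2"
      by simp
    then show False
      using 2 by simp
  qed
qed

lemma crv_quot_pover: "subfield K CC \<Longrightarrow> x \<in> K \<Longrightarrow> crv_quot x \<in> pover K"
  unfolding crv_quot_def by (intro pover_pCons pover_0 sf_add sf_diff sf_power sf_1)

lemma pover_root_factor:
  assumes K: "subfield K CC" and "p \<in> pover K" "x \<in> K"
  obtains q where "q \<in> pover K" "p = [:- x, 1:] * q + [:poly p x:]"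
proof -
  have m: "[:- x, 1:] \<in> pover K" "lead_coeff [:- x, 1:] = 1"
    using assms by (auto simp: pover_pCons_iff sf_intros)
  obtain q r where qr: "q \<in> pover K" "p = q * [:- x, 1:] + r" "r = 0 \<or> degree r < degree [:- x, 1:]"
    using pover_division[OF K m assms(2)] by blast
  then have "degree r = 0"
    by auto
  then obtain c where c: "r = [:c:]"
    using degree_eq_zeroE by blast
  then have "poly p x = c"
    using qr(2) by simp
  then show ?thesis
    using that[of q] qr c by (simp add: mult.commute)
qed

lemma pover_order_factor:
  assumes K: "subfield K CC" and "p \<in> pover K" "x \<in> K" "p \<noteq> 0"
  obtains q where "q \<in> pover K" "p = [:- x, 1:] ^ order x p * q" "poly q x \<noteq> 0"
  using assms(2,4)
proof (induction "degree p" arbitrary: p thesis rule: less_induct)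
  case less
  show ?case
  proof (cases "poly p x = 0")
    case False
    then show ?thesis
      using less.prems(1)[of p] less.prems(2) by (simp add: order_root)
  next
    case True
    then obtain q where q: "q \<in> pover K" "p = [:- x, 1:] * q"
      using pover_root_factor[OF K less.prems(2) assms(3)] by auto
    then have "q \<noteq> 0"
      using less.prems(3) by auto
    then have "degree p = degree q + 1"
      unfolding q(2) by (subst degree_mult_eq) auto
    then have "degree q < degree p"
      by simp
    have "order x p = order x [:- x, 1:] + order x q"
      unfolding q(2) by (rule order_mult) (use \<open>q \<noteq> 0\<close> in \<open>simp only: mult_eq_0_iff, simp\<close>)
    then have "order x p = Suc (order x q)"
      using order_power_n_n[of x 1] by simp
    obtain r where r: "r \<in> pover K" "q = [:- x, 1:] ^ order x q * r" "poly r x \<noteq> 0"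
      using less.hyps[OF \<open>degree q < degree p\<close> _ q(1) \<open>q \<noteq> 0\<close>] by blast
    have "p = [:- x, 1:] * ([:- x, 1:] ^ order x q * r)"
      using q(2) r(2) by metis
    also have "\<dots> = [:- x, 1:] ^ order x p * r"
      unfolding \<open>order x p = Suc (order x q)\<close> by (simp only: power_Suc mult.assoc)
    finally show ?thesis
      using less.prems(1)[of r] r by blast
  qed
qed

lemma fps_square_root:
  fixes A :: "complex fps"
  assumes "fps_nth A 0 = y\<^sup>2" "y \<noteq> 0"
  obtains S where "S\<^sup>2 = A" "fps_nth S 0 = y"
proof -
  \<comment> \<open>The first argument of \<open>fps_radical\<close> chooses the root of the
    constant coefficient; the constant function selects the branch that begins with
    \<open>y\<close>.\<close>
  have "(fps_radical (\<lambda>_ _. y) (Suc 1) A) ^ Suc 1 = A"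
    using power_radical[of A "\<lambda>_ _. y" 1] assms by (simp add: power2_eq_square)
  moreover have "fps_nth (fps_radical (\<lambda>_ _. y) (Suc 1) A) 0 = y"
    by simp
  ultimately show ?thesis
    using that by (metis Suc_1)
qed

section \<open>Local rings at affine points and uniqueness of the place there\<close>

context curve_field
begin

text \<open>\<open>g\<close> lies in the affine coordinate ring over Qbar and takes the value
  \<open>\<alpha>\<close> at the point \<open>(x, y)\<close>.\<close>

definition reg :: "complex \<Rightarrow> complex \<Rightarrow> complex \<Rightarrow> complex \<Rightarrow> bool" where
  "reg x y g \<alpha> \<longleftrightarrow> (\<exists>a\<in>pover Qbar. \<exists>b\<in>pover Qbar. g = el a b \<and> \<alpha> = poly a x + poly b x * y)"

definition centered :: "(complex \<Rightarrow> int) \<Rightarrow> point \<Rightarrow> bool" where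
  "centered w P = (case P of Infinity \<Rightarrow> w u < 0 | Affine x y \<Rightarrow> wge w 1 (u - x) \<and> wge w 1 (v - y))"

lemma reg_el: "a \<in> pover Qbar \<Longrightarrow> b \<in> pover Qbar \<Longrightarrow> reg x y (el a b) (poly a x + poly b x * y)"
  by (auto simp: reg_def)

lemma reg_poly: "a \<in> pover Qbar \<Longrightarrow> reg x y (poly a u) (poly a x)"
  using reg_el[of a 0 x y] pover_0[OF subfield_Qbar] by (simp add: el_def)

lemma reg_const: "c \<in> Qbar \<Longrightarrow> reg x y c c"
  using reg_poly[of "[:c:]" x y] pover_pCons[OF subfield_Qbar] pover_0[OF subfield_Qbar] by simp

lemma reg_u: "reg x y u x"
  using reg_poly[OF pover_X[OF subfield_Qbar order_refl], of x y] by simp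

lemma reg_v: "reg x y v y"
  using reg_el[of 0 1 x y] pover_0[OF subfield_Qbar] pover_1[OF subfield_Qbar] by (simp add: el_def)

lemma reg_add: "reg x y g \<alpha> \<Longrightarrow> reg x y h \<beta> \<Longrightarrow> reg x y (g + h) (\<alpha> + \<beta>)"
proof -
  assume "reg x y g \<alpha>" "reg x y h \<beta>"
  then obtain a b a' b' where *: "a \<in> pover Qbar" "b \<in> pover Qbar" "a' \<in> pover Qbar" "b' \<in> pover Qbar"
    "g = el a b" "h = el a' b'" "\<alpha> = poly a x + poly b x * y" "\<beta> = poly a' x + poly b' x * y"
    by (auto simp: reg_def)
  then show ?thesis
    using reg_el[of "a + a'" "b + b'" x y]
    by (simp add: el_add pover_add[OF subfield_Qbar] algebra_simps)
qed

lemma reg_mult: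
  assumes "y\<^sup>2 = crv x" "reg x y g \<alpha>" "reg x y h \<beta>"
  shows "reg x y (g * h) (\<alpha> * \<beta>)"
proof -
  obtain a b a' b' where *: "a \<in> pover Qbar" "b \<in> pover Qbar" "a' \<in> pover Qbar" "b' \<in> pover Qbar"
    "g = el a b" "h = el a' b'" "\<alpha> = poly a x + poly b x * y" "\<beta> = poly a' x + poly b' x * y"
    using assms(2,3) by (auto simp: reg_def)
  have "\<alpha> * \<beta> = poly a x * poly a' x + y\<^sup>2 * (poly b x * poly b' x) + (poly a x * poly b' x + poly a' x * poly b x) * y"
    unfolding * by (simp add: algebra_simps power2_eq_square)
  then have "\<alpha> * \<beta> = poly (a * a' + crv_poly * (b * b')) x + poly (a * b' + a' * b) x * y"
    by (simp add: assms(1))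
  moreover have "g * h = el (a * a' + crv_poly * (b * b')) (a * b' + a' * b)"
    unfolding * by (rule el_mult)
  ultimately show ?thesis
    using * reg_el[of "a * a' + crv_poly * (b * b')" "a * b' + a' * b" x y]
    by (simp add: pover_add[OF subfield_Qbar] pover_mult[OF subfield_Qbar] crv_poly_pover[OF subfield_Qbar])
qed

lemma reg_F: "reg x y g \<alpha> \<Longrightarrow> g \<in> F"
  using el_F by (auto simp: reg_def)

text \<open>The maximal ideal of the point is generated by \<open>u - x\<close> and
  \<open>v - y\<close>, as division of \<open>a\<close> and \<open>b\<close> by the linear factor of
  \<open>x\<close> shows.\<close>

lemma reg_split:
  assumes "reg x y g \<alpha>" "x \<in> Qbar" "y \<in> Qbar" "y\<^sup>2 = crv x"
  obtains A B \<beta> \<gamma> where "reg x y A \<beta>" "reg x y B \<gamma>" "g = (u - x) * A + (v - y) * B + \<alpha>"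
proof -
  obtain a b where ab: "a \<in> pover Qbar" "b \<in> pover Qbar" "g = el a b" "\<alpha> = poly a x + poly b x * y"
    using assms(1) by (auto simp: reg_def)
  obtain a' where a': "a' \<in> pover Qbar" "a = [:- x, 1:] * a' + [:poly a x:]"
    using pover_root_factor[OF subfield_Qbar ab(1) assms(2)] .
  obtain b' where b': "b' \<in> pover Qbar" "b = [:- x, 1:] * b' + [:poly b x:]"
    using pover_root_factor[OF subfield_Qbar ab(2) assms(2)] .
  have pu: "poly a u = (u - x) * poly a' u + poly a x" "poly b u = (u - x) * poly b' u + poly b x"
    by (subst a'(2), simp add: algebra_simps) (subst b'(2), simp add: algebra_simps)
  have "g = (u - x) * (poly a' u + poly b' u * v) + (v - y) * poly b x + \<alpha>"
    unfolding ab(3,4) el_def pu by (simp add: algebra_simps)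
  moreover have "reg x y (poly a' u + poly b' u * v) (poly a' x + poly b' x * y)"
    using reg_el[OF a'(1) b'(1)] by (simp add: el_def)
  moreover have "reg x y (poly b x) (poly b x)"
    using reg_const poly_in_sf[OF subfield_Qbar ab(2) assms(2)] by blast
  ultimately show ?thesis
    by (intro that)
qed

context
  fixes w x y
  assumes w: "valn w" and xy: "Affine x y \<in> epts Qbar" and cen: "centered w (Affine x y)"
begin

lemma centered_u: "wge w 1 (u - x)" and centered_v: "wge w 1 (v - y)"
  using cen by (auto simp: centered_def)

lemma wge_reg_diff:
  assumes "reg x y g \<alpha>"
  shows "wge w 1 (g - \<alpha>)" and "wge w 0 g"
proof -
  have u0: "wge w 0 u"
    using wge_add[OF w wge_mono[OF w centered_u, of 0] wge_const[OF w, of x]] xy by simp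
  have v0: "wge w 0 v"
    using wge_add[OF w wge_mono[OF w centered_v, of 0] wge_const[OF w, of y]] xy by simp
  have reg0: "wge w 0 h" if h: "reg x y h \<beta>" for h \<beta>
  proof -
    obtain a b where "a \<in> pover Qbar" "b \<in> pover Qbar" "h = el a b"
      using h by (auto simp: reg_def)
    then show ?thesis
      using wge_poly[OF w u0] wge_add[OF w] wge_mult0(1)[OF w] v0 by (auto simp: el_def)
  qed
  then show "wge w 0 g"
    using assms by blast
  obtain A B \<beta> \<gamma> where AB: "reg x y A \<beta>" "reg x y B \<gamma>" "g = (u - x) * A + (v - y) * B + \<alpha>"
  proof -
    have "x \<in> Qbar" "y \<in> Qbar" "y\<^sup>2 = crv x"
      using xy by auto
    then show ?thesis
      by (rule reg_split[OF assms]) (rule that)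
  qed
  have "wge w 1 ((u - x) * A + (v - y) * B)"
    using AB(1,2) reg0 by (intro wge_add[OF w] wge_mult0(1)[OF w] centered_u centered_v)
  then show "wge w 1 (g - \<alpha>)"
    using AB(3) by simp
qed

lemma reg_value_Qbar: "reg x y g \<alpha> \<Longrightarrow> \<alpha> \<in> Qbar"
  using xy by (auto simp: reg_def intro!: sf_add[OF subfield_Qbar] sf_mult[OF subfield_Qbar] poly_in_sf[OF subfield_Qbar])

lemma valn_reg_unit:
  assumes "reg x y g \<alpha>" "\<alpha> \<noteq> 0"
  shows "g \<noteq> 0" "w g = 0"
proof -
  note d = wge_reg_diff(1)[OF assms(1)]
  note \<alpha> = reg_value_Qbar[OF assms(1)]
  have "g \<noteq> 0 \<and> w g = 0"
  proof (cases "g - \<alpha> = 0")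
    case True
    then show ?thesis
      using valn_const[OF w \<alpha>] assms(2) by simp
  next
    case False
    have "\<alpha> + (g - \<alpha>) \<noteq> 0 \<and> w (\<alpha> + (g - \<alpha>)) = w \<alpha>"
      using valn_add_dominant[OF w const_F[OF \<alpha>], of "g - \<alpha>"] d False assms(2) valn_const[OF w \<alpha>]
      by (auto simp: wge_def[OF w])
    then show ?thesis
      using valn_const[OF w \<alpha>] assms(2) by simp
  qed
  then show "g \<noteq> 0" "w g = 0"
    by auto
qed

lemma valn_reg_zero: "reg x y g 0 \<Longrightarrow> g \<noteq> 0 \<Longrightarrow> w g \<ge> 1"
  using wge_reg_diff(1)[of g 0] by (auto simp: wge_def[OF w])

lemma valn_reg_nonneg: "reg x y g \<alpha> \<Longrightarrow> g \<noteq> 0 \<Longrightarrow> w g \<ge> 0"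
  using wge_reg_diff(2)[of g \<alpha>] by (auto simp: wge_def[OF w])

end

text \<open>At a point with \<open>y = 0\<close> the tangent is vertical and \<open>u - x\<close>
  vanishes doubly, so \<open>v\<close> has to serve as uniformiser.\<close>

definition unif :: "complex \<Rightarrow> complex \<Rightarrow> complex" where
  "unif x y = (if y = 0 then v else u - x)"

lemma unif_reg:
  assumes "Affine x y \<in> epts Qbar"
  shows "reg x y (unif x y) 0" "unif x y \<noteq> 0"
proof -
  have "reg x y (u + (- x)) (x + (- x))"
    using assms by (intro reg_add reg_u reg_const sf_uminus[OF subfield_Qbar]) auto
  then show "reg x y (unif x y) 0"
    using reg_v[of x y] by (auto simp: unif_def)
  show "unif x y \<noteq> 0"
    using algebraic_F_conv[of x] v_minus_const_nonzero[of 0] assms sf_0[OF subfield_Qbar] by (auto simp: unif_def)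
qed

text \<open>In the local ring both generators of the maximal ideal are multiples of the uniformiser.
  This comes from \<open>(v - y) * (v + y) = (u - x) * poly (crv_quot x) u\<close>, in which
  \<open>v + y\<close> is a unit for \<open>y \<noteq> 0\<close> and the divided difference is one
  for \<open>y = 0\<close>; \<open>s\<close> is that unit.\<close>

lemma unif_generates:
  assumes xy: "Affine x y \<in> epts Qbar"
  obtains s p q \<sigma> \<pi> \<kappa> where "reg x y s \<sigma>" "\<sigma> \<noteq> 0" "reg x y p \<pi>" "reg x y q \<kappa>"
    "(u - x) * s = unif x y * p" "(v - y) * s = unif x y * q"
proof (cases "y = 0")
  case False
  have "y \<in> Qbar" "y\<^sup>2 = crv x" "x \<in> Qbar"
    using xy by auto
  have "reg x y (v + y) (y + y)"
    using \<open>y \<in> Qbar\<close> by (intro reg_add reg_v reg_const)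
  moreover have "y + y \<noteq> 0"
    using False by simp
  moreover have "reg x y (poly (crv_quot x) u) (poly (crv_quot x) x)"
    using \<open>x \<in> Qbar\<close> by (intro reg_poly crv_quot_pover[OF subfield_Qbar])
  moreover have "(v - y) * (v + y) = unif x y * poly (crv_quot x) u"
  proof -
    have "(v - y) * (v + y) = v\<^sup>2 - y\<^sup>2"
      by (simp add: power2_eq_square algebra_simps)
    then show ?thesis
      using False \<open>y\<^sup>2 = crv x\<close> by (simp add: unif_def curve_eq crv_diff)
  qed
  moreover have "(u - x) * (v + y) = unif x y * (v + y)"
    using False by (simp add: unif_def)
  ultimately show ?thesis
    by (intro that)
next
  case True
  have x: "x \<in> Qbar" "crv x = 0"
    using xy True by auto
  have r: "reg x y (poly (crv_quot x) u) (poly (crv_quot x) x)"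
    using x by (intro reg_poly crv_quot_pover[OF subfield_Qbar])
  have "(u - x) * poly (crv_quot x) u = v\<^sup>2"
    using crv_diff[of u x] x by (simp add: curve_eq)
  then have "(u - x) * poly (crv_quot x) u = unif x y * v"
    using True by (simp add: unif_def power2_eq_square)
  moreover have "(v - y) * poly (crv_quot x) u = unif x y * poly (crv_quot x) u"
    using True by (simp add: unif_def)
  ultimately show ?thesis
    using that[OF r crv_quot_nonzero[OF x(2)] reg_v r] by blast
qed

text \<open>A power of the uniformiser times a unit, written without denominators. Each uniformiser
  that is split off lowers \<open>w0 g\<close>, so the existence of one valuation centered at the
  point ends the recursion.\<close>

lemma reg_factor:
  assumes w0: "valn w0" and xy: "Affine x y \<in> epts Qbar" and cen: "centered w0 (Affine x y)"
    and g: "reg x y g \<alpha>" "g \<noteq> 0"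
  shows "\<exists>n g1 g2 \<beta> \<gamma>. reg x y g1 \<beta> \<and> \<beta> \<noteq> 0 \<and> reg x y g2 \<gamma> \<and> \<gamma> \<noteq> 0 \<and> g * g2 = unif x y ^ n * g1"
  using g
proof (induction "nat (w0 g)" arbitrary: g \<alpha> rule: less_induct)
  case less
  have sq: "y\<^sup>2 = crv x" "x \<in> Qbar" "y \<in> Qbar"
    using xy by auto
  show ?case
  proof (cases "\<alpha> = 0")
    case False
    have "reg x y 1 1"
      using reg_const[OF sf_1[OF subfield_Qbar]] .
    then show ?thesis
      using less.prems False by (intro exI[of _ 0] exI[of _ g] exI[of _ 1] exI[of _ \<alpha>]) auto
  next
    case True
    obtain A B \<beta> \<gamma> where AB: "reg x y A \<beta>" "reg x y B \<gamma>" "g = (u - x) * A + (v - y) * B + \<alpha>"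
      by (rule reg_split[OF less.prems(1) sq(2,3,1)])
    obtain s p q \<sigma> \<pi> \<kappa> where spq: "reg x y s \<sigma>" "\<sigma> \<noteq> 0" "reg x y p \<pi>" "reg x y q \<kappa>"
      "(u - x) * s = unif x y * p" "(v - y) * s = unif x y * q"
      using unif_generates[OF xy] .
    define g' where "g' = A * p + B * q"
    have g': "reg x y g' (\<beta> * \<pi> + \<gamma> * \<kappa>)"
      unfolding g'_def by (intro reg_add reg_mult AB spq sq)
    have "g * s = ((u - x) * s) * A + ((v - y) * s) * B"
      unfolding AB(3) True by (simp add: algebra_simps)
    then have gs: "g * s = unif x y * g'"
      unfolding spq(5,6) g'_def by (simp add: algebra_simps)
    note s = valn_reg_unit[OF w0 xy cen spq(1,2)]
    note t = unif_reg[OF xy]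
    have g'0: "g' \<noteq> 0"
      using gs less.prems(2) s(1) by auto
    have "w0 g + w0 s = w0 (unif x y) + w0 g'"
      using valn_mult[OF w0 reg_F[OF less.prems(1)] reg_F[OF spq(1)] less.prems(2) s(1)]
        valn_mult[OF w0 reg_F[OF t(1)] reg_F[OF g'] t(2) g'0] gs by simp
    then have "w0 g' < w0 g" "w0 g' \<ge> 0"
      using s(2) valn_reg_zero[OF w0 xy cen t] valn_reg_nonneg[OF w0 xy cen g' g'0] by auto
    then obtain n g1 g2 \<beta>' \<gamma>' where *: "reg x y g1 \<beta>'" "\<beta>' \<noteq> 0" "reg x y g2 \<gamma>'" "\<gamma>' \<noteq> 0"
      "g' * g2 = unif x y ^ n * g1"
      using less.hyps[OF _ g' g'0] by fastforce
    have "g * (s * g2) = unif x y ^ Suc n * g1"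
      using gs *(5) by (simp add: mult_ac)
    moreover have "reg x y (s * g2) (\<sigma> * \<gamma>')" "\<sigma> * \<gamma>' \<noteq> 0"
      using reg_mult[OF sq(1) spq(1) *(3)] spq(2) *(4) by auto
    ultimately show ?thesis
      using *(1,2) by blast
  qed
qed

text \<open>The exponent depends on \<open>h\<close> and the point only. All valuations centered
  there are thus proportional, and equal once they are normalised.\<close>

lemma centered_unif_multiple:
  assumes w0: "valn w0" and xy: "Affine x y \<in> epts Qbar" and cen: "centered w0 (Affine x y)"
    and h: "h \<in> F" "h \<noteq> 0"
  shows "\<exists>n. \<forall>w. valn w \<longrightarrow> centered w (Affine x y) \<longrightarrow> w h = n * w (unif x y)"
proof -
  note t = unif_reg[OF xy]
  have key: "\<exists>n. \<forall>w. valn w \<longrightarrow> centered w (Affine x y) \<longrightarrow> w g = n * w (unif x y)"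
    if g: "reg x y g \<alpha>" "g \<noteq> 0" for g \<alpha>
  proof -
    obtain n g1 g2 \<beta> \<gamma> where *: "reg x y g1 \<beta>" "\<beta> \<noteq> 0" "reg x y g2 \<gamma>" "\<gamma> \<noteq> 0" "g * g2 = unif x y ^ n * g1"
      using reg_factor[OF w0 xy cen g] by blast
    have "w g = int n * w (unif x y)" if w: "valn w" "centered w (Affine x y)" for w
    proof -
      note g1 = valn_reg_unit[OF w(1) xy w(2) *(1,2)]
      note g2 = valn_reg_unit[OF w(1) xy w(2) *(3,4)]
      have "w (g * g2) = w g"
        using valn_mult[OF w(1) reg_F[OF g(1)] reg_F[OF *(3)] g(2) g2(1)] g2(2) by simp
      moreover have "w (unif x y ^ n * g1) = w (unif x y ^ n)"
        using valn_mult[OF w(1) sf_power[OF subfield_F reg_F[OF t(1)]] reg_F[OF *(1)] _ g1(1)] t(2) g1(2) by simp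
      ultimately show ?thesis
        using *(5) valn_power[OF w(1) reg_F[OF t(1)] t(2)] by simp
    qed
    then show ?thesis
      by blast
  qed
  obtain a b c where abc: "a \<in> pover Qbar" "b \<in> pover Qbar" "c \<in> pover Qbar" "c \<noteq> 0" "h = el a b / poly c u"
    using FF_E[OF h(1)] .
  have nz: "el a b \<noteq> 0" "poly c u \<noteq> 0"
    using abc h(2) by auto
  obtain n where n: "\<forall>w. valn w \<longrightarrow> centered w (Affine x y) \<longrightarrow> w (el a b) = n * w (unif x y)"
    using key[OF reg_el[OF abc(1,2)] nz(1)] by blast
  obtain m where m: "\<forall>w. valn w \<longrightarrow> centered w (Affine x y) \<longrightarrow> w (poly c u) = m * w (unif x y)"
    using key[OF reg_poly[OF abc(3)] nz(2)] by blast
  have "w h = (n - m) * w (unif x y)" if w: "valn w" "centered w (Affine x y)" for w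
    using valn_divide[OF w(1) el_F[OF abc(1,2)] poly_F[OF abc(3)] nz] n m w unfolding abc(5)
    by (simp add: algebra_simps)
  then show ?thesis
    by blast
qed

text \<open>The value 1 is attained and is a multiple of the positive value of the
  uniformiser.\<close>

lemma place_unif:
  assumes w: "w \<in> places Qbar F" and xy: "Affine x y \<in> epts Qbar" and cen: "centered w (Affine x y)"
  shows "w (unif x y) = 1"
proof -
  have w': "valn w" "w ` (F - {0}) = UNIV"
    using w by (auto simp: places_iff)
  have "1 \<in> w ` (F - {0})"
    unfolding w'(2) by simp
  then obtain h where h: "h \<in> F" "h \<noteq> 0" "w h = 1"
    by fastforce
  obtain n where "w h = n * w (unif x y)"
    using centered_unif_multiple[OF w'(1) xy cen h(1,2)] w'(1) cen by blast
  moreover have "w (unif x y) \<ge> 1"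
    using valn_reg_zero[OF w'(1) xy cen unif_reg[OF xy]] .
  ultimately show ?thesis
    using h(3) by (metis dvd_triv_right zdvd1_eq abs_of_nonneg order_trans zero_le_one)
qed

lemma affine_place_unique:
  assumes w: "w \<in> places Qbar F" "w' \<in> places Qbar F" and xy: "Affine x y \<in> epts Qbar"
    and cen: "centered w (Affine x y)" "centered w' (Affine x y)"
  shows "w = w'"
proof (rule extensionalityI[of _ "F - {0}"])
  show "w \<in> extensional (F - {0})" "w' \<in> extensional (F - {0})"
    using w by (auto simp: places_iff)
  have v: "valn w" "valn w'"
    using w by (auto simp: places_iff)
  fix h
  assume "h \<in> F - {0}"
  then obtain n where n: "\<forall>w. valn w \<longrightarrow> centered w (Affine x y) \<longrightarrow> w h = n * w (unif x y)"
    using centered_unif_multiple[OF v(1) xy cen(1), of h] by auto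
  have "w h = n * w (unif x y)" "w' h = n * w' (unif x y)"
    using n v cen by blast+
  then show "w h = w' h"
    using place_unif[OF w(1) xy cen(1)] place_unif[OF w(2) xy cen(2)] by simp
qed

section \<open>The place at infinity\<close>

lemma valn_pole_poly:
  assumes w: "valn w" and inf: "w u < 0" and p: "p \<in> pover Qbar" "p \<noteq> 0"
  shows "w (poly p u) = int (degree p) * w u"
  using p
proof (induction p)
  case (pCons a p)
  have ap: "a \<in> Qbar" "p \<in> pover Qbar"
    using pCons.prems(1) pover_pCons_iff[OF subfield_Qbar] by auto
  show ?case
  proof (cases "p = 0")
    case True
    then show ?thesis
      using valn_const[OF w ap(1)] pCons.prems(2) by simp
  next
    case False
    have nz: "poly p u \<noteq> 0"
      using poly_u_eq_0_iff[OF ap(2)] False by simp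
    have u0: "u \<noteq> 0"
      using algebraic_F_conv[OF sf_0[OF subfield_Qbar]] by simp
    have wp: "w (u * poly p u) = int (degree (pCons a p)) * w u"
      using valn_mult[OF w u_F poly_F[OF ap(2)] u0 nz] pCons.IH[OF ap(2) False] False
      by (simp add: algebra_simps)
    show ?thesis
    proof (cases "a = 0")
      case True
      then show ?thesis
        using wp by simp
    next
      case a0: False
      have "w (u * poly p u) < w a"
        unfolding wp valn_const[OF w ap(1) a0] using inf False by (simp add: mult_pos_neg)
      then have "w (u * poly p u + a) = w (u * poly p u)"
        using valn_add_dominant[OF w sf_mult[OF subfield_F u_F poly_F[OF ap(2)]] const_F[OF ap(1)]] u0 nz a0 by simp
      then show ?thesis
        using wp by (simp add: add.commute)
    qed
  qed
qed simp

lemma valn_pole_v: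
  assumes w: "valn w" and inf: "w u < 0"
  shows "2 * w v = 3 * w u"
proof -
  have v0: "v \<noteq> 0"
    using v_minus_const_nonzero[OF sf_0[OF subfield_Qbar]] by simp
  have "w (v\<^sup>2) = 2 * w v"
    using valn_power[OF w v_F v0, of 2] by simp
  moreover have "w (poly crv_poly u) = 3 * w u"
    using valn_pole_poly[OF w inf crv_poly_pover[OF subfield_Qbar]] by simp
  ultimately show ?thesis
    by (simp add: curve_eq)
qed

text \<open>The doubled values of \<open>poly a u\<close> and \<open>poly b u * v\<close> are
  multiples of \<open>w u\<close> by an even and an odd number, so one summand dominates.\<close>

lemma valn_pole_el:
  assumes w: "valn w" and inf: "w u < 0" and ab: "a \<in> pover Qbar" "b \<in> pover Qbar" "el a b \<noteq> 0"
  shows "2 * w (el a b) = int (degree (nrm a b)) * w u"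
proof -
  have v0: "v \<noteq> 0"
    using v_minus_const_nonzero[OF sf_0[OF subfield_Qbar]] by simp
  have wa: "2 * w (poly a u) = int (2 * degree a) * w u" if "a \<noteq> 0"
    using valn_pole_poly[OF w inf ab(1) that] by simp
  have wb: "2 * w (poly b u * v) = int (2 * degree b + 3) * w u" if "b \<noteq> 0"
  proof -
    have "w (poly b u * v) = w (poly b u) + w v"
      using that poly_u_eq_0_iff[OF ab(2)] by (intro valn_mult[OF w poly_F[OF ab(2)] v_F _ v0]) auto
    then show ?thesis
      using valn_pole_poly[OF w inf ab(2) that] valn_pole_v[OF w inf] by (simp add: algebra_simps)
  qed
  consider "a = 0" "b \<noteq> 0" | "a \<noteq> 0" "b = 0" | "a \<noteq> 0" "b \<noteq> 0"
    using ab(3) by (cases "a = 0"; cases "b = 0") (auto simp: el_def)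
  then show ?thesis
  proof cases
    case 1
    then have "degree (nrm a b) = 2 * degree b + 3"
      using degree_crv_times_square[of b] by (simp add: nrm_def)
    then show ?thesis
      using wb 1 by (simp add: el_def)
  next
    case 2
    then have "degree (nrm a b) = 2 * degree a"
      by (simp add: nrm_def degree_power_eq)
    then show ?thesis
      using wa 2 by (simp add: el_def)
  next
    case 3
    have nz: "poly a u \<noteq> 0" "poly b u * v \<noteq> 0"
      using 3 poly_u_eq_0_iff ab v0 by auto
    have F: "poly a u \<in> F" "poly b u * v \<in> F"
      using ab poly_F v_F sf_mult[OF subfield_F] by auto
    have "2 * degree a \<noteq> 2 * degree b + 3"
      by presburger
    then consider "2 * degree a < 2 * degree b + 3" | "2 * degree b + 3 < 2 * degree a"
      by linarith
    then show ?thesis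
    proof cases
      case 1
      then have "int (2 * degree b + 3) * w u < int (2 * degree a) * w u"
        using inf by (intro mult_strict_right_mono_neg) auto
      then have "w (poly b u * v) < w (poly a u)"
        using wa wb 3 by simp
      then have "w (poly b u * v + poly a u) = w (poly b u * v)"
        by (rule valn_add_dominant(2)[OF w F(2,1) nz(2,1)])
      then show ?thesis
        using wb 3 1 degree_nrm[of a b] by (simp add: el_def add.commute)
    next
      case 2
      then have "int (2 * degree a) * w u < int (2 * degree b + 3) * w u"
        using inf by (intro mult_strict_right_mono_neg) auto
      then have "w (poly a u) < w (poly b u * v)"
        using wa wb 3 by simp
      then have "w (poly a u + poly b u * v) = w (poly a u)"
        by (rule valn_add_dominant(2)[OF w F nz])
      then show ?thesis
        using wa 3 2 degree_nrm[of a b] by (simp add: el_def)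
    qed
  qed
qed

lemma infinite_place_value:
  assumes w: "w \<in> places Qbar F" and inf: "w u < 0"
    and abc: "a \<in> pover Qbar" "b \<in> pover Qbar" "c \<in> pover Qbar" "el a b \<noteq> 0" "c \<noteq> 0"
  shows "w (el a b / poly c u) = 2 * int (degree c) - int (degree (nrm a b))"
proof -
  have w': "valn w" "w ` (F - {0}) = UNIV"
    using w by (auto simp: places_iff)
  have val: "2 * w (el a b / poly c u) = (int (degree (nrm a b)) - 2 * int (degree c)) * w u"
    if "a \<in> pover Qbar" "b \<in> pover Qbar" "c \<in> pover Qbar" "el a b \<noteq> 0" "c \<noteq> 0" for a b c
  proof -
    have nz: "poly c u \<noteq> 0"
      using poly_u_eq_0_iff that by simp
    have "w (el a b / poly c u) = w (el a b) - w (poly c u)"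
      using that by (intro valn_divide[OF w'(1)] el_F poly_F nz)
    then show ?thesis
      using valn_pole_el[OF w'(1) inf that(1,2,4)] valn_pole_poly[OF w'(1) inf that(3,5)]
      by (simp add: algebra_simps)
  qed
  have "1 \<in> w ` (F - {0})"
    unfolding w'(2) by simp
  then obtain h where h: "h \<in> F" "h \<noteq> 0" "w h = 1"
    by fastforce
  obtain a' b' c' where h': "a' \<in> pover Qbar" "b' \<in> pover Qbar" "c' \<in> pover Qbar" "c' \<noteq> 0" "h = el a' b' / poly c' u"
    using FF_E[OF h(1)] .
  \<comment> \<open>Normalisation: some function has value 1, so \<open>w u\<close> divides 2, while
    \<open>2 * w v = 3 * w u\<close> makes it even. This leaves -2.\<close>
  have "2 = (int (degree (nrm a' b')) - 2 * int (degree c')) * w u"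
    using val[OF h'(1,2,3) _ h'(4)] h h' by auto
  then have "w u dvd 2"
    by (metis dvd_triv_right)
  moreover have "2 dvd w u"
    using valn_pole_v[OF w'(1) inf] by presburger
  ultimately have "w u = - 2"
    using inf by (metis abs_minus_cancel abs_numeral abs_of_neg add.inverse_inverse zdvd_antisym_abs)
  then show ?thesis
    using val[OF abc] by simp
qed

lemma infinite_place_unique:
  assumes w: "w \<in> places Qbar F" "w' \<in> places Qbar F" and inf: "w u < 0" "w' u < 0"
  shows "w = w'"
proof (rule extensionalityI[of _ "F - {0}"])
  show "w \<in> extensional (F - {0})" "w' \<in> extensional (F - {0})"
    using w by (auto simp: places_iff)
  fix h
  assume h: "h \<in> F - {0}"
  then obtain a b c where h': "a \<in> pover Qbar" "b \<in> pover Qbar" "c \<in> pover Qbar" "c \<noteq> 0" "h = el a b / poly c u"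
    using FF_E by blast
  then have "el a b \<noteq> 0"
    using h by auto
  then show "w h = w' h"
    using infinite_place_value[OF w(1) inf(1) h'(1-3) _ h'(4)] infinite_place_value[OF w(2) inf(2) h'(1-3) _ h'(4)] h'(5)
    by simp
qed

end

fun eneg :: "point \<Rightarrow> point" where
  "eneg Infinity = Infinity"
| "eneg (Affine x y) = Affine x (- y)"

lemma eneg_eneg [simp]: "eneg (eneg P) = P"
  by (cases P) auto

lemma eneg_epts: "subfield K CC \<Longrightarrow> P \<in> epts K \<Longrightarrow> eneg P \<in> epts K"
  by (cases P) (auto intro: sf_uminus)

section \<open>Existence of places by Laurent expansions\<close>

context curve_field
begin

lemma evp_fps:
  "\<exists>G. evp (fps_to_fls S) p = fps_to_fls G \<and> fps_nth G 0 = poly p (fps_nth S 0)"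
proof (induction p)
  case (pCons c p)
  then obtain G where "evp (fps_to_fls S) p = fps_to_fls G" "fps_nth G 0 = poly p (fps_nth S 0)"
    by blast
  then show ?case
    by (intro exI[of _ "fps_const c + S * G"]) (simp add: fls_times_fps_to_fls)
qed (auto intro: exI[of _ 0])

lemma evp_linear: "evp U [:- c:] = - fls_const c" "evp U [:- c, 1:] = U - fls_const c"
  using evp_uminus[of U "[:c:]"] by simp_all

text \<open>\<open>p\<close> splits into a power of the linear factor of \<open>x\<close>, whose
  value is not 0 because \<open>S\<close> is not constant, and a factor whose series has a nonzero
  constant coefficient.\<close>

lemma evp_nonzero_affine:
  assumes "S \<noteq> fps_const (fps_nth S 0)" "p \<noteq> 0"
  shows "evp (fps_to_fls S) p \<noteq> 0"
proof -
  define x where "x = fps_nth S 0"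
  obtain q where q: "p = [:- x, 1:] ^ order x p * q" "\<not> [:- x, 1:] dvd q"
    using order_decomp[OF assms(2)] by blast
  then have "poly q x \<noteq> 0"
    by (simp add: poly_eq_0_iff_dvd)
  obtain G where G: "evp (fps_to_fls S) q = fps_to_fls G" "fps_nth G 0 = poly q x"
    using evp_fps[of S q] unfolding x_def by blast
  have "evp (fps_to_fls S) q \<noteq> 0"
    using G \<open>poly q x \<noteq> 0\<close> by auto
  moreover have "evp (fps_to_fls S) [:- x, 1:] = fps_to_fls (S - fps_const x)"
    by (simp only: evp_linear fps_to_fls_minus fps_const_to_fls)
  moreover have "S - fps_const x \<noteq> 0"
    using assms(1) by (simp add: x_def)
  ultimately have "evp (fps_to_fls S) [:- x, 1:] \<noteq> 0" "evp (fps_to_fls S) q \<noteq> 0"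
    by (simp_all only: fps_to_fls_eq_0_iff not_False_eq_True)
  then show ?thesis
    by (subst q(1)) (simp only: evp_mult evp_power mult_eq_0_iff power_eq_0_iff, simp)
qed

lemma fps_crv_shift:
  fixes T :: "complex fps"
  shows "crv (fps_const x + T) = fps_const (crv x) + T * (fps_const (3 * x\<^sup>2 + 2 * x - 1) + T * (fps_const (3 * x + 1) + T))"
proof -
  have c: "fps_const (crv x) = fps_const x ^ 3 + fps_const x ^ 2 - fps_const x"
    "fps_const (3 * x\<^sup>2 + 2 * x - 1) = 3 * fps_const x ^ 2 + 2 * fps_const x - 1"
    "fps_const (3 * x + 1) = 3 * fps_const x + 1"
    by (simp_all add: crv_def fps_const_power[symmetric] fps_const_mult[symmetric] fps_const_add[symmetric]
      fps_const_sub[symmetric] numeral_fps_const del: fps_const_power fps_const_mult fps_const_add fps_const_sub)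
  show ?thesis
    by (unfold c, unfold crv_def, Groebner_Basis.algebra)
qed

lemma crv_fps_to_fls: "crv (fps_to_fls S) = fps_to_fls (crv S)"
  by (simp add: crv_def fps_to_fls_power)

text \<open>In terms of the local parameter X, a point with \<open>y \<noteq> 0\<close> has
  \<open>u = x + X\<close>, and \<open>v\<close> is a square root of the cubic. For
  \<open>y = 0\<close> the abscissa is ramified, \<open>u = x + X\<^sup>2\<close> and
  \<open>v = X * R\<close>; the root \<open>R\<close> exists because the derivative of the cubic is
  not 0.\<close>

lemma affine_expansion_exists:
  assumes "y\<^sup>2 = crv x"
  obtains S T where "expansion (fps_to_fls S) (fps_to_fls T)" "fps_nth S 0 = x" "fps_nth T 0 = y"
    "y \<noteq> 0 \<Longrightarrow> subdegree (S - fps_const x) = 1" "y = 0 \<Longrightarrow> subdegree T = 1"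
proof (cases "y = 0")
  case False
  define S where "S = fps_const x + fps_X"
  have "fps_nth (crv S) 0 = y\<^sup>2"
    unfolding S_def fps_crv_shift by (simp add: assms)
  then obtain T where T: "T\<^sup>2 = crv S" "fps_nth T 0 = y"
    using fps_square_root False by blast
  have S0: "fps_nth S 0 = x" "S - fps_const x = fps_X"
    by (auto simp: S_def)
  then have "S \<noteq> fps_const (fps_nth S 0)"
    by (metis fps_X_neq_zero right_minus_eq)
  then have "expansion (fps_to_fls S) (fps_to_fls T)"
    using evp_nonzero_affine T(1) by (auto simp: expansion_def crv_fps_to_fls simp flip: fps_to_fls_power)
  then show ?thesis
    using that[of S T] S0 T False by simp
next
  case True
  have x: "crv x = 0"
    using assms True by simp
  define S where "S = fps_const x + fps_X\<^sup>2"
  define A where "A = fps_const (3 * x\<^sup>2 + 2 * x - 1) + fps_X\<^sup>2 * (fps_const (3 * x + 1) + fps_X\<^sup>2)"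
  have A0: "fps_nth A 0 = 3 * x\<^sup>2 + 2 * x - 1"
    by (simp add: A_def)
  have "poly (crv_quot x) x = 3 * x\<^sup>2 + 2 * x - 1"
    by (simp add: crv_quot_def power2_eq_square algebra_simps)
  then have "fps_nth A 0 \<noteq> 0"
    using crv_quot_nonzero[OF x] A0 by simp
  then have "csqrt (fps_nth A 0) \<noteq> 0" "fps_nth A 0 = (csqrt (fps_nth A 0))\<^sup>2"
    by auto
  then obtain R where R: "R\<^sup>2 = A" "fps_nth R 0 = csqrt (fps_nth A 0)"
    using fps_square_root by blast
  define T where "T = fps_X * R"
  have "crv S = fps_X\<^sup>2 * A"
    unfolding S_def fps_crv_shift A_def by (simp add: x)
  then have T: "T\<^sup>2 = crv S"
    by (simp add: T_def R power_mult_distrib)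
  have R0: "fps_nth R 0 \<noteq> 0"
    using R(2) \<open>csqrt (fps_nth A 0) \<noteq> 0\<close> by simp
  then have "R \<noteq> 0"
    by auto
  then have dT: "subdegree T = 1"
    using R0 by (simp add: T_def subdegree_mult)
  have S0: "fps_nth S 0 = x"
    by (simp add: S_def)
  have "S - fps_const x = fps_X\<^sup>2"
    by (simp add: S_def)
  moreover have "fps_X\<^sup>2 \<noteq> (0 :: complex fps)"
    by simp
  ultimately have "S \<noteq> fps_const (fps_nth S 0)"
    unfolding S0 by (metis eq_iff_diff_eq_0)
  then have "expansion (fps_to_fls S) (fps_to_fls T)"
    using evp_nonzero_affine T by (auto simp: expansion_def crv_fps_to_fls simp flip: fps_to_fls_power)
  moreover have "fps_nth T 0 = y"
    using True by (simp add: T_def)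
  ultimately show ?thesis
    using that[of S T] S0 dT True by simp
qed

text \<open>With \<open>u = X\<^sup>-\<^sup>2\<close> the equation of the curve makes
  \<open>v\<close> the product of \<open>X\<^sup>-\<^sup>3\<close> and a square root of
  \<open>1 + X\<^sup>2 - X ^ 4\<close>, and this root is a power series.\<close>

lemma infinite_expansion_exists:
  obtains U V where "expansion U V" "fls_subdegree U = - 2" "fls_subdegree V = - 3"
proof -
  define A :: "complex fps" where "A = 1 + fps_X\<^sup>2 - fps_X ^ 4"
  have "fps_nth A 0 = 1\<^sup>2"
    by (simp add: A_def)
  then obtain R where R: "R\<^sup>2 = A" "fps_nth R 0 = 1"
    using fps_square_root[of A 1] by auto
  then have R0: "R \<noteq> 0"
    by auto
  define U V :: "complex fls" where "U = fls_X_inv ^ 2" and "V = fls_X_inv ^ 3 * fps_to_fls R"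
  have dU: "fls_subdegree U = - 2"
    by (simp add: U_def fls_subdegree_pow)
  have dV: "fls_subdegree V = - 3"
  proof -
    have "fls_subdegree V = fls_subdegree (fls_X_inv ^ 3 :: complex fls) + fls_subdegree (fps_to_fls R)"
      unfolding V_def using R0 by (intro fls_subdegree_mult) auto
    then show ?thesis
      using R(2) by (simp add: fls_subdegree_pow fls_subdegree_fls_to_fps)
  qed
  define I :: "complex fls" where "I = fls_X_inv"
  have XI: "fls_X * I = 1"
    by (simp add: I_def flip: fls_inverse_X)
  have "V\<^sup>2 = I ^ 6 * fps_to_fls A"
    by (simp add: V_def I_def power_mult_distrib R(1)[symmetric] fps_to_fls_power flip: power_mult)
  also have "fps_to_fls A = 1 + fls_X\<^sup>2 - fls_X ^ 4"
    by (simp add: A_def fps_to_fls_power)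
  also have "I ^ 6 * (1 + fls_X\<^sup>2 - fls_X ^ 4) = I ^ 6 + I ^ 4 * (fls_X * I)\<^sup>2 - I\<^sup>2 * (fls_X * I) ^ 4"
    by (simp add: power_mult_distrib algebra_simps flip: power_add)
  also have "\<dots> = crv U"
    unfolding XI by (simp add: crv_def U_def I_def flip: power_mult)
  finally have VU: "V\<^sup>2 = crv U" .
  have "evp U p \<noteq> 0 \<and> fls_subdegree (evp U p) = - 2 * int (degree p)" if "p \<noteq> 0" for p
    using that
  proof (induction p)
    case (pCons c p)
    show ?case
    proof (cases "p = 0")
      case True
      then show ?thesis
        using pCons.prems by simp
    next
      case False
      note IH = pCons.IH[OF False]
      have U0: "U \<noteq> 0"
        using dU by auto
      have d: "fls_subdegree (U * evp U p) = - 2 * int (degree (pCons c p))"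
        using IH U0 dU False by simp
      have UP: "U * evp U p \<noteq> 0"
        using IH U0 by simp
      show ?thesis
      proof (cases "c = 0")
        case True
        then show ?thesis
          using d UP by simp
      next
        case c: False
        have lt: "fls_subdegree (U * evp U p) < fls_subdegree (fls_const c)"
          unfolding d using False by simp
        then have "fls_subdegree (U * evp U p + fls_const c) = fls_subdegree (U * evp U p)"
          using UP by (intro fls_subdegree_add_eq1)
        moreover have "U * evp U p + fls_const c \<noteq> 0"
        proof
          assume "U * evp U p + fls_const c = 0"
          then have "U * evp U p = - fls_const c"
            by (simp add: eq_neg_iff_add_eq_0)
          then have "fls_subdegree (U * evp U p) = 0"
            by simp
          then show False
            using lt by simp
        qed
        ultimately show ?thesis
          using d by (simp add: add.commute)
      qed
    qed
  qed simp
  then have "expansion U V"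
    using VU by (auto simp: expansion_def)
  then show ?thesis
    using that dU dV by blast
qed

lemma valn_cong:
  assumes "\<And>h. h \<in> F - {0} \<Longrightarrow> w h = w' h"
  shows "valn w \<longleftrightarrow> valn w'"
proof -
  have "f * g \<in> F - {0}" if "f \<in> F - {0}" "g \<in> F - {0}" for f g
    using that sf_mult[OF subfield_F] by auto
  moreover have "f + g \<in> F - {0}" if "f \<in> F - {0}" "g \<in> F - {0}" "f + g \<noteq> 0" for f g
    using that sf_add[OF subfield_F] by auto
  moreover have "c \<in> F - {0}" if "c \<in> Qbar - {0}" for c
    using that const_F by auto
  ultimately show ?thesis
    unfolding valn_def using assms by (intro conj_cong ball_cong refl imp_cong) metis+
qed

definition place_of :: "complex fls \<Rightarrow> complex fls \<Rightarrow> complex \<Rightarrow> int" where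
  "place_of U V = restrict (\<lambda>h. fls_subdegree (expand U V h)) (F - {0})"

lemma place_of_eq: "h \<in> F \<Longrightarrow> h \<noteq> 0 \<Longrightarrow> place_of U V h = fls_subdegree (expand U V h)"
  by (simp add: place_of_def)

text \<open>The powers of one function of order 1 attain every integer.\<close>

lemma place_of_place:
  assumes UV: "expansion U V" and t: "t \<in> F" "t \<noteq> 0" "fls_subdegree (expand U V t) = 1"
  shows "place_of U V \<in> places Qbar F"
  unfolding places_iff
proof (intro conjI)
  show "place_of U V \<in> extensional (F - {0})"
    by (simp add: place_of_def)
  show w: "valn (place_of U V)"
    using valn_cong[of "\<lambda>h. fls_subdegree (expand U V h)" "place_of U V"] valn_expand[OF UV]
    by (simp add: place_of_eq)
  have t1: "place_of U V t = 1"
    using t by (simp add: place_of_eq)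
  show "place_of U V ` (F - {0}) = UNIV"
  proof (intro equalityI subset_UNIV subsetI)
    fix n :: int
    define h where "h = (if n \<ge> 0 then t ^ nat n else inverse (t ^ nat (- n)))"
    have "h \<in> F" "h \<noteq> 0"
      using t by (auto simp: h_def intro: sf_power[OF subfield_F] sf_inverse[OF subfield_F])
    moreover have "place_of U V h = n"
      using valn_power[OF w t(1,2)] valn_inverse[OF w sf_power[OF subfield_F t(1)]] t t1 by (auto simp: h_def)
    ultimately show "n \<in> place_of U V ` (F - {0})"
      by force
  qed
qed

lemma fls_fps_subdegree_pos:
  assumes "fps_to_fls G \<noteq> 0" "fps_nth G 0 = 0"
  shows "fls_subdegree (fps_to_fls G) \<ge> 1"
proof -
  have "subdegree G \<noteq> 0"
    using assms by (auto simp: subdegree_eq_0_iff)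
  then show ?thesis
    by (simp add: fls_subdegree_fls_to_fps)
qed

lemma u_minus_el: "x \<in> Qbar \<Longrightarrow> u - x = el [:- x, 1:] 0 \<and> [:- x, 1:] \<in> pover Qbar"
  using pover_pCons[OF subfield_Qbar] pover_0[OF subfield_Qbar] sf_1[OF subfield_Qbar] sf_uminus[OF subfield_Qbar]
  by (simp add: el_def)

lemma v_minus_el: "y \<in> Qbar \<Longrightarrow> v - y = el [:- y:] 1 \<and> [:- y:] \<in> pover Qbar"
  using pover_pCons[OF subfield_Qbar] pover_0[OF subfield_Qbar] sf_uminus[OF subfield_Qbar]
  by (simp add: el_def)

lemma place_exists:
  assumes P: "P \<in> epts Qbar"
  shows "\<exists>U V. expansion U V \<and> place_of U V \<in> places Qbar F \<and> centered (place_of U V) P"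
proof (cases P)
  case Infinity
  obtain U V where UV: "expansion U V" "fls_subdegree U = - 2" "fls_subdegree V = - 3"
    by (rule infinite_expansion_exists)
  note pX = pover_X[OF subfield_Qbar order_refl]
  have eu: "expand U V u = U"
    using expand_poly[OF UV(1) pX] by simp
  have ev: "expand U V v = V"
    using expand_el[OF UV(1) pover_0[OF subfield_Qbar] pover_1[OF subfield_Qbar]] by (simp add: el_def)
  have nz: "u \<noteq> 0" "v \<noteq> 0"
    using algebraic_F_conv[OF sf_0[OF subfield_Qbar]] v_minus_const_nonzero[OF sf_0[OF subfield_Qbar]] by auto
  \<comment> \<open>\<open>u / v\<close> has order -2 + 3 = 1 and serves as uniformiser at
    infinity.\<close>
  have "fls_subdegree (expand U V (u / v)) = 1"
    using valn_divide[OF valn_expand[OF UV(1)] u_F v_F nz] UV eu ev by simp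
  then have "place_of U V \<in> places Qbar F"
    using place_of_place[OF UV(1)] sf_divide[OF subfield_F u_F v_F] nz by simp
  moreover have "centered (place_of U V) P"
    using Infinity eu nz UV(2) by (simp add: centered_def place_of_eq u_F)
  ultimately show ?thesis
    using UV(1) by blast
next
  case (Affine x y)
  have xy: "x \<in> Qbar" "y \<in> Qbar" "y\<^sup>2 = crv x"
    using P Affine by auto
  obtain S T where ST: "expansion (fps_to_fls S) (fps_to_fls T)" "fps_nth S 0 = x" "fps_nth T 0 = y"
    "y \<noteq> 0 \<Longrightarrow> subdegree (S - fps_const x) = 1" "y = 0 \<Longrightarrow> subdegree T = 1"
    using affine_expansion_exists[OF xy(3)] by blast
  define U V where "U = fps_to_fls S" and "V = fps_to_fls T"
  note UV = ST(1)[folded U_def V_def]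
  note um = u_minus_el[OF xy(1)]
  note vm = v_minus_el[OF xy(2)]
  have eu: "expand U V (u - x) = fps_to_fls (S - fps_const x)"
    using expand_el[OF UV, of "[:- x, 1:]" 0] um pover_0[OF subfield_Qbar]
    by (simp only: um U_def evp_linear evp_0 mult_zero_left add_0_right fps_to_fls_minus fps_const_to_fls)
  have ev: "expand U V (v - y) = fps_to_fls (T - fps_const y)"
    using expand_el[OF UV, of "[:- y:]" 1] vm pover_1[OF subfield_Qbar]
    by (simp only: vm V_def evp_linear evp_1 mult_1 fps_to_fls_minus fps_const_to_fls uminus_add_conv_diff)
  have nz: "u - x \<noteq> 0" "v - y \<noteq> 0"
    using algebraic_F_conv v_minus_const_nonzero xy by auto
  have mem: "u - x \<in> F" "v - y \<in> F"
    using sf_diff[OF subfield_F] u_F v_F const_F xy by auto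
  have t: "fls_subdegree (expand U V (unif x y)) = 1"
  proof (cases "y = 0")
    case True
    then show ?thesis
      using ev ST(5) by (simp add: unif_def fls_subdegree_fls_to_fps)
  next
    case False
    then show ?thesis
      using eu ST(4) fls_subdegree_fls_to_fps[of "S - fps_const x"] by (simp add: unif_def del: fps_to_fls_minus)
  qed
  have "place_of U V \<in> places Qbar F"
    using place_of_place[OF UV reg_F[OF unif_reg(1)] unif_reg(2) t] P Affine by blast
  moreover have "valn (place_of U V)"
    using calculation by (simp add: places_iff)
  moreover have "fls_subdegree (expand U V (u - x)) \<ge> 1"
    unfolding eu by (rule fls_fps_subdegree_pos) (use expand_nonzero[OF UV mem(1) nz(1)] eu ST in auto)
  moreover have "fls_subdegree (expand U V (v - y)) \<ge> 1"
    unfolding ev by (rule fls_fps_subdegree_pos) (use expand_nonzero[OF UV mem(2) nz(2)] ev ST in auto)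
  ultimately have "centered (place_of U V) P"
    using mem nz by (simp add: Affine centered_def wge_def place_of_eq)
  then show ?thesis
    using UV \<open>place_of U V \<in> places Qbar F\<close> by blast
qed

text \<open>If no \<open>u - x\<close> had positive value, \<open>w\<close> would vanish on all
  nonzero polynomials in \<open>u\<close>, which split over Qbar, and then on all of
  \<open>F - {0}\<close>, against surjectivity. Once \<open>x\<close> is found,
  \<open>(v - y) * (v + y)\<close> is divisible by \<open>u - x\<close>, so one of its factors has
  positive value too.\<close>

lemma center_exists:
  assumes w: "w \<in> places Qbar F"
  shows "\<exists>P\<in>epts Qbar. centered w P"
proof (cases "w u < 0")
  case True
  then show ?thesis
    by (intro bexI[of _ Infinity]) (auto simp: centered_def)
next
  case False
  have w': "valn w" "w ` (F - {0}) = UNIV"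
    using w by (auto simp: places_iff)
  have u0: "wge w 0 u"
    using False u_F by (simp add: wge_def[OF w'(1)])
  have nz: "u - x \<noteq> 0" "v - x \<noteq> 0" if "x \<in> Qbar" for x
    using algebraic_F_conv v_minus_const_nonzero that by auto
  have mem: "u - x \<in> F" "v - x \<in> F" "v + x \<in> F" if "x \<in> Qbar" for x
    using sf_diff[OF subfield_F] sf_add[OF subfield_F] u_F v_F const_F that by auto
  have "\<exists>x\<in>Qbar. w (u - x) \<ge> 1"
  proof (rule ccontr)
    assume no: "\<not> ?thesis"
    have zero: "w (u - x) = 0" if "x \<in> Qbar" for x
    proof -
      have "wge w 0 (u + (- x))"
        using that by (intro wge_add[OF w'(1)] u0 wge_const[OF w'(1)] sf_uminus[OF subfield_Qbar])
      then show ?thesis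
        using no that nz[OF that] by (force simp: wge_def[OF w'(1)])
    qed
    have zero_poly: "w (poly p u) = 0" if "p \<in> pover Qbar" "p \<noteq> 0" for p
      using that
    proof (induction "degree p" arbitrary: p rule: less_induct)
      case less
      show ?case
      proof (cases "degree p = 0")
        case True
        then obtain c where "p = [:c:]"
          using degree_eq_zeroE by blast
        then show ?thesis
          using less.prems valn_const[OF w'(1), of c] poverD[of p Qbar 0] by simp
      next
        case False
        then obtain x where x: "poly p x = 0"
          using poly_has_root by blast
        then have xQ: "x \<in> Qbar"
          using Qbar_root less.prems by blast
        obtain q where q: "q \<in> pover Qbar" "p = [:- x, 1:] * q"
          using pover_root_factor[OF subfield_Qbar less.prems(1) xQ] x by auto
        have q0: "q \<noteq> 0"
          using q less.prems by auto
        have "degree p = degree q + 1"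
          unfolding q(2) using q0 by (subst degree_mult_eq) auto
        then have "w (poly q u) = 0"
          using less.hyps[of q] q q0 by simp
        moreover have "poly p u = (u - x) * poly q u"
          unfolding q(2) by (simp add: algebra_simps)
        moreover have "poly q u \<noteq> 0"
          using q q0 poly_u_eq_0_iff by simp
        ultimately show ?thesis
          using valn_mult[OF w'(1) mem(1)[OF xQ] poly_F[OF q(1)] nz(1)[OF xQ]] zero[OF xQ] by simp
      qed
    qed
    \<comment> \<open>The values of \<open>el a b\<close> and of its conjugate add up to 0, by the
      norm. If they were not 0, they would differ, and the smaller one would be the value of the sum
      \<open>2 * a\<close>, which is 0; for \<open>a = 0\<close> they are equal anyway.\<close>
    have zero_el: "w (el a b) = 0" if ab: "a \<in> pover Qbar" "b \<in> pover Qbar" "el a b \<noteq> 0" for a b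
    proof (rule ccontr)
      assume ne: "w (el a b) \<noteq> 0"
      have mb: "- b \<in> pover Qbar"
        using ab pover_uminus[OF subfield_Qbar] by blast
      have nab: "nrm a b \<noteq> 0" "nrm a b \<in> pover Qbar"
        using ab by (auto simp: nrm_eq_0_iff el_def nrm_pover[OF subfield_Qbar])
      have c0: "el a (- b) \<noteq> 0"
        using el_eq_0_iff ab mb by auto
      have sum: "w (el a b) + w (el a (- b)) = 0"
        using valn_mult[OF w'(1) el_F[OF ab(1,2)] el_F[OF ab(1) mb] ab(3) c0] zero_poly[OF nab(2,1)]
        by (simp add: el_conj)
      have two: "el a b + el a (- b) = poly (smult 2 a) u"
        by (simp add: el_def)
      show False
      proof (cases "a = 0")
        case True
        then have "el a (- b) = - el a b"
          by (simp add: el_def)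
        then show False
          using sum ne valn_uminus[OF w'(1) el_F[OF ab(1,2)]] by simp
      next
        case a0: False
        have s: "w (poly (smult 2 a) u) = 0"
          using ab(1) a0 by (intro zero_poly pover_smult[OF subfield_Qbar] sf_numeral[OF subfield_Qbar]) auto
        consider "w (el a b) < w (el a (- b))" | "w (el a (- b)) < w (el a b)"
          using sum ne by linarith
        then show False
        proof cases
          case 1
          then show False
            using valn_add_dominant(2)[OF w'(1) el_F[OF ab(1,2)] el_F[OF ab(1) mb] ab(3) c0] s ne
            unfolding two by simp
        next
          case 2
          then show False
            using valn_add_dominant(2)[OF w'(1) el_F[OF ab(1) mb] el_F[OF ab(1,2)] c0 ab(3)] s ne sum two
            by (simp add: add.commute)
        qed
      qed
    qed
    have "1 \<in> w ` (F - {0})"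
      unfolding w'(2) by simp
    then obtain h where h: "h \<in> F" "h \<noteq> 0" "w h = 1"
      by fastforce
    obtain a b c where h': "a \<in> pover Qbar" "b \<in> pover Qbar" "c \<in> pover Qbar" "c \<noteq> 0" "h = el a b / poly c u"
      using FF_E[OF h(1)] .
    have ne: "el a b \<noteq> 0" "poly c u \<noteq> 0"
      using h h' by auto
    show False
      using valn_divide[OF w'(1) el_F[OF h'(1,2)] poly_F[OF h'(3)] ne] zero_el[OF h'(1,2) ne(1)]
        zero_poly[OF h'(3,4)] h(3) h'(5) by simp
  qed
  then obtain x where x: "x \<in> Qbar" "w (u - x) \<ge> 1"
    by blast
  define y where "y = csqrt (crv x)"
  have crvQ: "crv x \<in> Qbar"
    unfolding crv_def using x by (intro sf_diff[OF subfield_Qbar] sf_add[OF subfield_Qbar] sf_power[OF subfield_Qbar])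
  have y: "y \<in> Qbar" "y\<^sup>2 = crv x"
    using Qbar_csqrt[OF crvQ] by (simp_all add: y_def)
  have y': "- y \<in> Qbar"
    using y sf_uminus[OF subfield_Qbar] by blast
  have vy: "v - y \<noteq> 0" "v + y \<noteq> 0"
    using nz(2)[OF y(1)] nz(2)[OF y'] by auto
  have "(v - y) * (v + y) = v\<^sup>2 - y\<^sup>2"
    by (simp add: power2_eq_square algebra_simps)
  then have prod: "(v - y) * (v + y) = (u - x) * poly (crv_quot x) u"
    using curve_eq y(2) crv_diff by simp
  have ux: "wge w 1 (u - x)"
    using x mem(1) by (simp add: wge_def[OF w'(1)])
  have "wge w 1 ((u - x) * poly (crv_quot x) u)"
    using x by (intro wge_mult0(1)[OF w'(1) ux] wge_poly[OF w'(1) u0] crv_quot_pover[OF subfield_Qbar])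
  then have "w ((v - y) * (v + y)) \<ge> 1"
    using prod vy by (auto simp: wge_def[OF w'(1)])
  then have "w (v - y) + w (v + y) \<ge> 1"
    using valn_mult[OF w'(1) mem(2)[OF y(1)] mem(3)[OF y(1)] vy] by simp
  then have "w (v - y) \<ge> 1 \<or> w (v + y) \<ge> 1"
    by linarith
  then show ?thesis
  proof
    assume "w (v - y) \<ge> 1"
    then show ?thesis
      using ux mem(2)[OF y(1)] x(1) y by (intro bexI[of _ "Affine x y"]) (auto simp: centered_def wge_def[OF w'(1)])
  next
    assume "w (v + y) \<ge> 1"
    then show ?thesis
      using ux mem(3)[OF y(1)] x(1) y y' by (intro bexI[of _ "Affine x (- y)"]) (auto simp: centered_def wge_def[OF w'(1)])
  qed
qed

text \<open>Two different affine centres would give a nonzero constant a positive value; at an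
  affine centre \<open>u\<close> has no pole, which separates it from infinity.\<close>

lemma center_unique:
  assumes w: "w \<in> places Qbar F" and P: "P \<in> epts Qbar" "Q \<in> epts Qbar" and cen: "centered w P" "centered w Q"
  shows "P = Q"
proof -
  have w': "valn w"
    using w by (auto simp: places_iff)
  have const1: "c = 0" if "c \<in> Qbar" "wge w 1 c" for c
    using that valn_const[OF w'] by (force simp: wge_def[OF w'])
  have wm: "wge w 1 (- f)" if "wge w 1 f" for f
    using that valn_uminus[OF w'] sf_uminus[OF subfield_F] by (auto simp: wge_def[OF w'])
  have u0: "w u \<ge> 0" if "x \<in> Qbar" "wge w 1 (u - x)" for x
  proof -
    have "wge w 0 u"
      using wge_add[OF w' wge_mono[OF w' that(2), of 0] wge_const[OF w' that(1)]] by simp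
    then show ?thesis
      using algebraic_F_conv[OF sf_0[OF subfield_Qbar]] by (simp add: wge_def[OF w'])
  qed
  show ?thesis
  proof (cases P; cases Q)
    fix x y x' y'
    assume PQ: "P = Affine x y" "Q = Affine x' y'"
    have 1: "wge w 1 (u - x)" "wge w 1 (v - y)" "wge w 1 (u - x')" "wge w 1 (v - y')"
      using cen PQ by (auto simp: centered_def)
    have "wge w 1 ((u - x) + - (u - x'))"
      by (rule wge_add[OF w' 1(1) wm[OF 1(3)]])
    moreover have "wge w 1 ((v - y) + - (v - y'))"
      by (rule wge_add[OF w' 1(2) wm[OF 1(4)]])
    ultimately have "wge w 1 (x' - x)" "wge w 1 (y' - y)"
      by simp_all
    moreover have "x' - x \<in> Qbar" "y' - y \<in> Qbar"
      using P PQ sf_diff[OF subfield_Qbar] by auto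
    ultimately have "x' - x = 0" "y' - y = 0"
      using const1 by blast+
    then show ?thesis
      using PQ by simp
  qed (use cen P u0 in \<open>force simp: centered_def\<close>)+
qed

section \<open>Places indexed by points, and the values of functions at them\<close>

definition pl :: "point \<Rightarrow> complex \<Rightarrow> int" where
  "pl P = (THE w. w \<in> places Qbar F \<and> centered w P)"

lemma place_unique:
  assumes "P \<in> epts Qbar" "w \<in> places Qbar F" "w' \<in> places Qbar F" "centered w P" "centered w' P"
  shows "w = w'"
  using assms affine_place_unique infinite_place_unique by (cases P) (auto simp: centered_def)

lemma pl_eqI:
  assumes "P \<in> epts Qbar" "w \<in> places Qbar F" "centered w P"
  shows "pl P = w"
  unfolding pl_def using assms place_unique by (intro the_equality) blast+

lemma pl_place: "P \<in> epts Qbar \<Longrightarrow> pl P \<in> places Qbar F"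
  and pl_centered: "P \<in> epts Qbar \<Longrightarrow> centered (pl P) P"
  using place_exists[of P] pl_eqI[of P] by force+

lemma pl_valn: "P \<in> epts Qbar \<Longrightarrow> valn (pl P)"
  using pl_place by (simp add: places_iff)

lemma pl_inj: "P \<in> epts Qbar \<Longrightarrow> Q \<in> epts Qbar \<Longrightarrow> pl P = pl Q \<longleftrightarrow> P = Q"
  using center_unique[OF pl_place] pl_centered by metis

lemma places_eq: "places Qbar F = pl ` epts Qbar"
  using pl_place center_exists pl_eqI by (force simp: image_iff)

text \<open>Replacing \<open>V\<close> by \<open>- V\<close> turns an expansion at \<open>P\<close>
  into an expansion at the opposite point.\<close>

lemma pl_conj:
  assumes P: "P \<in> epts Qbar" and ab: "a \<in> pover Qbar" "b \<in> pover Qbar" "el a b \<noteq> 0"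
  shows "pl (eneg P) (el a b) = pl P (el a (- b))"
proof -
  obtain U V where UV: "expansion U V" "place_of U V \<in> places Qbar F" "centered (place_of U V) P"
    using place_exists[OF P] by blast
  have UV': "expansion U (- V)"
    using UV(1) by (simp add: expansion_def)
  have conj: "expand U (- V) (el a b / poly c u) = expand U V (el a (- b) / poly c u)"
    if "a \<in> pover Qbar" "b \<in> pover Qbar" "c \<in> pover Qbar" "c \<noteq> 0" for a b c
    using that expand_eq[OF UV(1), of a "- b" c] expand_eq[OF UV', of a b c] pover_uminus[OF subfield_Qbar]
    by (simp add: evp_uminus)
  have conj1: "place_of U (- V) (el a b) = place_of U V (el a (- b))"
    if "a \<in> pover Qbar" "b \<in> pover Qbar" "el a b \<noteq> 0" for a b
  proof -
    have "- b \<in> pover Qbar" "el a (- b) \<noteq> 0"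
      using that pover_uminus[OF subfield_Qbar] el_eq_0_iff by auto
    then show ?thesis
      using that conj[of a b 1] pover_1[OF subfield_Qbar] el_F by (simp add: place_of_eq)
  qed
  have "1 \<in> place_of U V ` (F - {0})"
    using UV(2) by (simp add: places_iff)
  then obtain t where t: "t \<in> F" "t \<noteq> 0" "place_of U V t = 1"
    by force
  obtain a' b' c where t': "a' \<in> pover Qbar" "b' \<in> pover Qbar" "c \<in> pover Qbar" "c \<noteq> 0" "t = el a' b' / poly c u"
    using FF_E[OF t(1)] .
  have mb: "- b' \<in> pover Qbar"
    using t' pover_uminus[OF subfield_Qbar] by blast
  have "el a' (- b') \<noteq> 0" "poly c u \<noteq> 0"
    using t t' mb el_eq_0_iff by auto
  then have "place_of U (- V) \<in> places Qbar F"
    using place_of_place[OF UV' FF_I[OF t'(1) mb t'(3,4)]] conj[OF t'(1) mb t'(3,4)] t t'(5) by (simp add: place_of_eq)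
  moreover have "centered (place_of U (- V)) (eneg P)"
  proof (cases P)
    case Infinity
    have "u = el [:0, 1:] 0"
      by (simp add: el_def)
    then have "place_of U (- V) u = place_of U V u"
      using conj1[OF pover_X[OF subfield_Qbar order_refl] pover_0[OF subfield_Qbar]]
        algebraic_F_conv[OF sf_0[OF subfield_Qbar]] by simp
    then show ?thesis
      using UV(3) Infinity by (simp add: centered_def)
  next
    case (Affine x y)
    have xy: "x \<in> Qbar" "y \<in> Qbar" "- y \<in> Qbar"
      using P Affine sf_uminus[OF subfield_Qbar] by auto
    have nz: "u - x \<noteq> 0" "v - y \<noteq> 0" "v + y \<noteq> 0"
      using algebraic_F_conv v_minus_const_nonzero[OF xy(2)] v_minus_const_nonzero[OF xy(3)] xy by auto
    have vl: "valn (place_of U V)" "valn (place_of U (- V))"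
      using UV(2) calculation by (simp_all add: places_iff)
    have c: "place_of U V (u - x) \<ge> 1" "place_of U V (v - y) \<ge> 1"
      using UV(3) Affine nz by (auto simp: centered_def wge_def[OF vl(1)])
    have 1: "place_of U (- V) (u - x) = place_of U V (u - x)"
      using conj1[of "[:- x, 1:]" 0] u_minus_el[OF xy(1)] pover_0[OF subfield_Qbar] nz(1) by simp
    have el: "v + y = el [:y:] 1" "el [:y:] (- 1) = - (v - y)" "[:y:] \<in> pover Qbar"
      using xy(2) pover_pCons[OF subfield_Qbar] pover_0[OF subfield_Qbar] by (auto simp: el_def)
    have "place_of U (- V) (v + y) = place_of U V (- (v - y))"
      using conj1[OF el(3) pover_1[OF subfield_Qbar]] el nz(3) by simp
    then have 2: "place_of U (- V) (v + y) = place_of U V (v - y)"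
      using valn_uminus[OF vl(1) sf_diff[OF subfield_F v_F const_F[OF xy(2)]]] by simp
    show ?thesis
      using c 1 2 sf_diff[OF subfield_F u_F const_F[OF xy(1)]] sf_add[OF subfield_F v_F const_F[OF xy(2)]] Affine
      by (simp add: centered_def wge_def[OF vl(2)])
  qed
  ultimately have "pl (eneg P) = place_of U (- V)"
    using pl_eqI[OF eneg_epts[OF subfield_Qbar P]] by blast
  moreover have "pl P = place_of U V"
    using pl_eqI[OF P UV(2,3)] .
  ultimately show ?thesis
    using conj1[OF ab] by simp
qed

lemma pl_u_minus:
  assumes "Affine x y \<in> epts Qbar"
  shows "pl (Affine x y) (u - x) = (if y = 0 then 2 else 1)"
proof (cases "y = 0")
  case False
  then show ?thesis
    using place_unif[OF pl_place assms pl_centered] assms by (simp add: unif_def)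
next
  case True
  note w = pl_valn[OF assms]
  have x: "x \<in> Qbar" "crv x = 0"
    using assms True by auto
  have v1: "pl (Affine x y) v = 1"
    using place_unif[OF pl_place assms pl_centered] assms True by (simp add: unif_def)
  have q: "crv_quot x \<in> pover Qbar"
    using crv_quot_pover[OF subfield_Qbar x(1)] .
  note unit = valn_reg_unit[OF w assms pl_centered[OF assms] reg_poly[OF q] crv_quot_nonzero[OF x(2)]]
  have nz: "u - x \<noteq> 0" "v \<noteq> 0"
    using algebraic_F_conv[OF x(1)] v_minus_const_nonzero[OF sf_0[OF subfield_Qbar]] by auto
  have "(u - x) * poly (crv_quot x) u = v\<^sup>2"
    using crv_diff[of u x] x by (simp add: curve_eq)
  then have "pl (Affine x y) (u - x) + pl (Affine x y) (poly (crv_quot x) u) = 2 * pl (Affine x y) v"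
    using valn_mult[OF w sf_diff[OF subfield_F u_F const_F[OF x(1)]] poly_F[OF q] nz(1) unit(1)]
      valn_power[OF w v_F nz(2), of 2] by simp
  then show ?thesis
    using v1 unit(2) True by simp
qed

lemma pl_poly:
  assumes P: "Affine x y \<in> epts Qbar" and p: "p \<in> pover Qbar" "p \<noteq> 0"
  shows "pl (Affine x y) (poly p u) = (if y = 0 then 2 else 1) * int (order x p)"
proof -
  note w = pl_valn[OF P]
  have x: "x \<in> Qbar"
    using P by simp
  obtain q where q: "q \<in> pover Qbar" "p = [:- x, 1:] ^ order x p * q" "poly q x \<noteq> 0"
    using pover_order_factor[OF subfield_Qbar p(1) x p(2)] .
  note unit = valn_reg_unit[OF w P pl_centered[OF P] reg_poly[OF q(1)] q(3)]
  have nz: "u - x \<noteq> 0" and mem: "u - x \<in> F"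
    using algebraic_F_conv[OF x] sf_diff[OF subfield_F u_F const_F[OF x]] by auto
  have "poly p u = (u - x) ^ order x p * poly q u"
    by (subst q(2)) (simp add: algebra_simps)
  then have "pl (Affine x y) (poly p u) = pl (Affine x y) ((u - x) ^ order x p) + pl (Affine x y) (poly q u)"
    using valn_mult[OF w sf_power[OF subfield_F mem] poly_F[OF q(1)] _ unit(1)] nz by simp
  then show ?thesis
    using valn_power[OF w mem nz] unit(2) pl_u_minus[OF P] by simp
qed

lemma pl_el_conj_sum:
  assumes P: "P \<in> epts Qbar" and ab: "a \<in> pover Qbar" "b \<in> pover Qbar" "el a b \<noteq> 0"
  shows "pl P (el a b) + pl (eneg P) (el a b) = pl P (poly (nrm a b) u)"
proof -
  have "- b \<in> pover Qbar" "el a (- b) \<noteq> 0"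
    using ab pover_uminus[OF subfield_Qbar] el_eq_0_iff by auto
  then show ?thesis
    using valn_mult[OF pl_valn[OF P] el_F[OF ab(1,2)] el_F[OF ab(1), of "- b"] ab(3)] pl_conj[OF P ab]
    by (simp add: el_conj)
qed

lemma pl_Infinity_el:
  assumes "a \<in> pover Qbar" "b \<in> pover Qbar" "el a b \<noteq> 0"
  shows "pl Infinity (el a b) = - int (degree (nrm a b))"
  using infinite_place_value[OF pl_place _ assms(1,2) pover_1[OF subfield_Qbar] assms(3), of Infinity] pl_centered[of Infinity]
  by (simp add: centered_def)

text \<open>The values at a point and at its opposite add up to the value of the norm. For
  \<open>y \<noteq> 0\<close> the function vanishes at no more than one of them, because
  \<open>a\<close> and \<open>b\<close> do not both vanish at \<open>x\<close>, and this point gets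
  the whole order. For \<open>y = 0\<close> the points coincide and both sides are doubled.\<close>

lemma pl_el:
  assumes P: "Affine x y \<in> epts Qbar" and ab: "a \<in> pover Qbar" "b \<in> pover Qbar" "el a b \<noteq> 0"
    and red: "\<not> (poly a x = 0 \<and> poly b x = 0)"
  shows "pl (Affine x y) (el a b) = (if poly a x + poly b x * y = 0 then int (order x (nrm a b)) else 0)"
proof (cases "poly a x + poly b x * y = 0")
  case False
  then show ?thesis
    using valn_reg_unit(2)[OF pl_valn[OF P] P pl_centered[OF P] reg_el[OF ab(1,2)]] by simp
next
  case True
  have nab: "nrm a b \<noteq> 0" "nrm a b \<in> pover Qbar"
    using ab by (auto simp: nrm_eq_0_iff el_def nrm_pover[OF subfield_Qbar])
  note sum = pl_el_conj_sum[OF P ab]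
  show ?thesis
  proof (cases "y = 0")
    case y: True
    then show ?thesis
      using sum pl_poly[OF P nab(2,1)] True by simp
  next
    case y: False
    have P': "Affine x (- y) \<in> epts Qbar"
      using eneg_epts[OF subfield_Qbar P] by simp
    have "poly a x + poly b x * (- y) \<noteq> 0"
    proof
      assume "poly a x + poly b x * (- y) = 0"
      then have "poly a x = poly b x * y"
        by simp
      then have "2 * (poly b x * y) = 0"
        using True by auto
      then show False
        using red y \<open>poly a x = poly b x * y\<close> by auto
    qed
    then have "pl (Affine x (- y)) (el a b) = 0"
      using valn_reg_unit(2)[OF pl_valn[OF P'] P' pl_centered[OF P'] reg_el[OF ab(1,2)]] by simp
    then show ?thesis
      using sum pl_poly[OF P nab(2,1)] True y by simp
  qed
qed

end

section \<open>Divisor classes and the group law\<close>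

definition slope :: "complex \<Rightarrow> complex \<Rightarrow> complex \<Rightarrow> complex \<Rightarrow> complex" where
  "slope x1 y1 x2 y2 = (if x1 = x2 then (3 * x1\<^sup>2 + 2 * x1 - 1) / (2 * y1) else (y2 - y1) / (x2 - x1))"

fun eadd :: "point \<Rightarrow> point \<Rightarrow> point" where
  "eadd Infinity R = R"
| "eadd R Infinity = R"
| "eadd (Affine x1 y1) (Affine x2 y2) =
     (if x1 = x2 \<and> y1 = - y2 then Infinity
      else let l = slope x1 y1 x2 y2; x3 = l\<^sup>2 - 1 - x1 - x2
           in Affine x3 (l * (x1 - x3) - y1))"

text \<open>The line through two points, not opposite to each other, meets the curve in the abscissae
  \<open>x1\<close>, \<open>x2\<close> and \<open>x3\<close>.\<close>

lemma line_norm: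
  assumes 1: "y1\<^sup>2 = crv x1" and 2: "y2\<^sup>2 = crv x2" and ne: "\<not> (x1 = x2 \<and> y1 = - y2)"
    and l: "l = slope x1 y1 x2 y2" and x3: "x3 = l\<^sup>2 - 1 - x1 - x2"
  shows "nrm [:- (y1 - l * x1), - l:] 1 = - ([:- x1, 1:] * [:- x2, 1:] * [:- x3, 1:])"
    and "y2 = l * x2 + (y1 - l * x1)"
proof -
  define m where "m = y1 - l * x1"
  have y1: "y1 = l * x1 + m"
    by (simp add: m_def)
  \<comment> \<open>For a chord this is the difference of the two curve equations divided by
    \<open>x1 - x2\<close>; for a tangent it is the definition of the slope.\<close>
  have "x1\<^sup>2 + x1 * x2 + x2\<^sup>2 + (1 - l\<^sup>2) * (x1 + x2) - 1 - 2 * l * m = 0 \<and> y2 = l * x2 + m"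
  proof (cases "x1 = x2")
    case True
    have "(y1 - y2) * (y1 + y2) = 0"
      using 1 2 True by (simp add: power2_eq_square algebra_simps)
    moreover have "y1 + y2 \<noteq> 0"
      using ne True by (simp add: eq_neg_iff_add_eq_0)
    ultimately have yy: "y2 = y1" and "y1 \<noteq> 0"
      by auto
    then have "l * (2 * y1) = 3 * x1\<^sup>2 + 2 * x1 - 1"
      using l True by (simp add: slope_def)
    then have "l * (2 * (l * x1 + m)) = 3 * x1\<^sup>2 + 2 * x1 - 1"
      using y1 by simp
    then show ?thesis
      using True yy y1 by (simp add: power2_eq_square algebra_simps)
  next
    case False
    then have "l * (x2 - x1) = y2 - y1"
      using l by (simp add: slope_def)
    then have y2: "y2 = l * x2 + m"
      by (simp add: m_def algebra_simps)
    have "(l * x1 + m)\<^sup>2 - (l * x2 + m)\<^sup>2 = crv x1 - crv x2"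
      using 1 2 y1 y2 by simp
    then have "(x1 - x2) * (x1\<^sup>2 + x1 * x2 + x2\<^sup>2 + (1 - l\<^sup>2) * (x1 + x2) - 1 - 2 * l * m) = 0"
      unfolding crv_def by Groebner_Basis.algebra
    then show ?thesis
      using False y2 by simp
  qed
  then have R: "x1\<^sup>2 + x1 * x2 + x2\<^sup>2 + (1 - l\<^sup>2) * (x1 + x2) - 1 - 2 * l * m = 0" and y2: "y2 = l * x2 + m"
    by auto
  show "y2 = l * x2 + (y1 - l * x1)"
    using y2 by (simp add: m_def)
  have e2: "x1 * x2 + x1 * x3 + x2 * x3 = - 1 - 2 * l * m"
    using R unfolding x3 by Groebner_Basis.algebra
  have "(l * x1 + m)\<^sup>2 = x1 ^ 3 + x1\<^sup>2 - x1"
    using 1 y1 by (simp add: crv_def)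
  then have e3: "x1 * x2 * x3 = m\<^sup>2"
    using R unfolding x3 by Groebner_Basis.algebra
  have e1: "l\<^sup>2 - 1 = x1 + x2 + x3"
    unfolding x3 by simp
  have N: "nrm [:- m, - l:] 1 = [:m\<^sup>2, 2 * l * m + 1, l\<^sup>2 - 1, - 1:]"
    by (simp add: nrm_def crv_poly_def power2_eq_square algebra_simps)
  have c1: "2 * l * m + 1 = - (x1 * x2 + x1 * x3 + x2 * x3)"
    unfolding e2 by simp
  have "- ([:- x1, 1:] * [:- x2, 1:] * [:- x3, 1:]) = [:x1 * x2 * x3, - (x1 * x2 + x1 * x3 + x2 * x3), x1 + x2 + x3, - 1:]"
    by (simp add: algebra_simps)
  then show "nrm [:- (y1 - l * x1), - l:] 1 = - ([:- x1, 1:] * [:- x2, 1:] * [:- x3, 1:])"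
    unfolding m_def[symmetric] by (simp only: N c1 e1 e3)
qed

lemma eadd_closed:
  assumes K: "subfield K CC" and "P \<in> epts K" "Q \<in> epts K"
  shows "eadd P Q \<in> epts K"
proof (cases "P = Infinity \<or> Q = Infinity \<or> P = eneg Q")
  case True
  then show ?thesis
    using assms by (cases P; cases Q) auto
next
  case False
  then obtain x1 y1 x2 y2 where PQ: "P = Affine x1 y1" "Q = Affine x2 y2"
    by (cases P; cases Q) auto
  define l where "l = slope x1 y1 x2 y2"
  define x3 where "x3 = l\<^sup>2 - 1 - x1 - x2"
  have mem: "x1 \<in> K" "y1 \<in> K" "x2 \<in> K" "y2 \<in> K"
    using assms PQ by auto
  have lK: "l \<in> K"
    unfolding l_def slope_def using mem by (auto intro!: sf_intros[OF K])
  then have x3K: "x3 \<in> K"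
    unfolding x3_def using mem by (intro sf_intros[OF K])
  have eq: "eadd P Q = Affine x3 (l * (x1 - x3) - y1)"
    using False PQ by (simp add: l_def x3_def Let_def)
  have ne: "\<not> (x1 = x2 \<and> y1 = - y2)"
    using False PQ by auto
  have c: "y1\<^sup>2 = crv x1" "y2\<^sup>2 = crv x2"
    using assms PQ by auto
  have root: "poly [:- x3, 1:] x3 = 0"
    by simp
  have "poly (nrm [:- (y1 - l * x1), - l:] 1) x3 = 0"
    unfolding line_norm(1)[OF c ne l_def x3_def] poly_minus poly_mult by (simp only: root mult_zero_right minus_zero)
  then have "(l * (x1 - x3) - y1)\<^sup>2 = crv x3"
    by (simp add: nrm_def power2_eq_square algebra_simps)
  then show ?thesis
    unfolding eq using lK x3K mem by (auto intro!: sf_intros[OF K])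
qed

section \<open>Degrees of principal divisors\<close>

definition zpts :: "complex poly \<Rightarrow> point set" where
  "zpts N = {Affine x y | x y. poly N x = 0 \<and> y\<^sup>2 = crv x}"

lemma square_roots_set: "{y::complex. y\<^sup>2 = c} = {csqrt c, - csqrt c}"
  using power2_eq_iff[of _ "csqrt c"] by auto

lemma finite_zpts: "N \<noteq> 0 \<Longrightarrow> finite (zpts N)"
proof -
  assume "N \<noteq> 0"
  then have "finite (\<Union>x\<in>{x. poly N x = 0}. (\<lambda>y. Affine x y) ` {y. y\<^sup>2 = crv x})"
    unfolding square_roots_set by (intro finite_UN_I poly_roots_finite) auto
  also have "(\<Union>x\<in>{x. poly N x = 0}. (\<lambda>y. Affine x y) ` {y. y\<^sup>2 = crv x}) = zpts N"
    by (auto simp: zpts_def)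
  finally show ?thesis .
qed

lemma sum_order_roots:
  assumes "(N :: complex poly) \<noteq> 0"
  shows "(\<Sum>x | poly N x = 0. order x N) = degree N"
proof -
  have "degree N = size (proots N)"
    by (simp add: size_proots_complex)
  also have "\<dots> = (\<Sum>x\<in>set_mset (proots N). count (proots N) x)"
    by (rule size_multiset_overloaded_eq)
  finally show ?thesis
    using assms by simp
qed

text \<open>Above a root lie either two points of weight 1 or one ramified point of weight
  2.\<close>

lemma sum_zpts:
  assumes N: "N \<noteq> 0"
  shows "(\<Sum>P\<in>zpts N. case P of Infinity \<Rightarrow> 0 | Affine x y \<Rightarrow> (if y = 0 then 2 else 1) * int (order x N)) = 2 * int (degree N)"
    (is "sum ?f _ = _")
proof -
  have inner: "sum ?f ((\<lambda>y. Affine x y) ` {y. y\<^sup>2 = crv x}) = 2 * int (order x N)" for x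
  proof -
    have "sum ?f ((\<lambda>y. Affine x y) ` {y. y\<^sup>2 = crv x}) = (\<Sum>y | y\<^sup>2 = crv x. (if y = 0 then 2 else 1) * int (order x N))"
      by (subst sum.reindex) (auto simp: inj_on_def)
    also have "\<dots> = 2 * int (order x N)"
    proof (cases "crv x = 0")
      case True
      then show ?thesis
        by (simp add: square_roots_set)
    next
      case False
      then have "csqrt (crv x) \<noteq> - csqrt (crv x)" "csqrt (crv x) \<noteq> 0"
        by (auto simp: eq_neg_iff_add_eq_0)
      then show ?thesis
        unfolding square_roots_set by simp
    qed
    finally show ?thesis .
  qed
  define A where "A = {x. poly N x = 0}"
  define B where "B x = (\<lambda>y. Affine x y) ` {y. y\<^sup>2 = crv x}" for x :: complex
  have "finite A"
    unfolding A_def by (rule poly_roots_finite[OF N])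
  moreover have "\<forall>x\<in>A. finite (B x)"
    unfolding B_def square_roots_set by simp
  moreover have "\<forall>x\<in>A. \<forall>x'\<in>A. x \<noteq> x' \<longrightarrow> B x \<inter> B x' = {}"
    unfolding B_def by blast
  ultimately have "sum ?f (\<Union> (B ` A)) = (\<Sum>x\<in>A. sum ?f (B x))"
    by (rule sum.UNION_disjoint)
  moreover have "\<Union> (B ` A) = zpts N"
    by (auto simp: zpts_def A_def B_def)
  moreover have "(\<Sum>x\<in>A. sum ?f (B x)) = (\<Sum>x\<in>A. 2 * int (order x N))"
    unfolding B_def by (rule sum.cong[OF refl]) (rule inner)
  moreover have "(\<Sum>x\<in>A. 2 * int (order x N)) = 2 * int (\<Sum>x\<in>A. order x N)"
    by (simp only: sum_distrib_left of_nat_sum)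
  ultimately show ?thesis
    using sum_order_roots[OF N] by (simp only: A_def)
qed

definition dg :: "('a \<Rightarrow>\<^sub>0 int) \<Rightarrow> int" where
  "dg D = (\<Sum>w\<in>Poly_Mapping.keys D. Poly_Mapping.lookup D w)"

lemma dg_superset: "finite S \<Longrightarrow> Poly_Mapping.keys D \<subseteq> S \<Longrightarrow> dg D = (\<Sum>w\<in>S. Poly_Mapping.lookup D w)"
  unfolding dg_def by (intro sum.mono_neutral_left) (auto simp: in_keys_iff)

lemma dg_diff: "dg (D - E) = dg D - dg E"
proof -
  define S where "S = Poly_Mapping.keys D \<union> Poly_Mapping.keys E"
  have "finite S" "Poly_Mapping.keys D \<subseteq> S" "Poly_Mapping.keys E \<subseteq> S" "Poly_Mapping.keys (D - E) \<subseteq> S"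
    using keys_diff[of D E] by (auto simp: S_def)
  then show ?thesis
    by (simp add: dg_superset lookup_minus sum_subtractf)
qed

lemma dg_0 [simp]: "dg 0 = 0"
  by (simp add: dg_def)

lemma dg_frag_of [simp]: "dg (frag_of w) = 1"
  by (simp add: dg_def keys_frag_of)

lemma dg_frag_cmul: "dg (frag_cmul n D) = n * dg D"
proof -
  have "dg (frag_cmul n D) = (\<Sum>w\<in>Poly_Mapping.keys D. Poly_Mapping.lookup (frag_cmul n D) w)"
    using keys_cmul by (intro dg_superset) auto
  then show ?thesis
    by (simp add: dg_def sum_distrib_left)
qed

context curve_field
begin

lemma affine_epts_Qbar: "poly N x = 0 \<Longrightarrow> N \<in> pover Qbar \<Longrightarrow> N \<noteq> 0 \<Longrightarrow> y\<^sup>2 = crv x \<Longrightarrow> Affine x y \<in> epts Qbar"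
proof -
  assume *: "poly N x = 0" "N \<in> pover Qbar" "N \<noteq> 0" "y\<^sup>2 = crv x"
  then have x: "x \<in> Qbar"
    using Qbar_root by blast
  then have "y\<^sup>2 \<in> Qbar"
    unfolding *(4) crv_def by (intro sf_intros[OF subfield_Qbar])
  then show ?thesis
    using x *(4) Qbar_sq by simp
qed

lemma zpts_Qbar: "N \<in> pover Qbar \<Longrightarrow> N \<noteq> 0 \<Longrightarrow> zpts N \<subseteq> epts Qbar"
  using affine_epts_Qbar by (auto simp: zpts_def)

lemma nrm_props: "a \<in> pover Qbar \<Longrightarrow> b \<in> pover Qbar \<Longrightarrow> el a b \<noteq> 0 \<Longrightarrow> nrm a b \<noteq> 0 \<and> nrm a b \<in> pover Qbar"
  by (auto simp: nrm_eq_0_iff el_def nrm_pover[OF subfield_Qbar])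

lemma pl_el_support:
  assumes ab: "a \<in> pover Qbar" "b \<in> pover Qbar" "el a b \<noteq> 0" and P: "P \<in> epts Qbar" "pl P (el a b) \<noteq> 0"
  shows "P \<in> insert Infinity (zpts (nrm a b))"
proof (cases P)
  case (Affine x y)
  have "poly a x + poly b x * y = 0"
    using valn_reg_unit(2)[OF pl_valn[OF P(1)] _ _ reg_el[OF ab(1,2)], of x y] pl_centered[OF P(1)] P Affine by auto
  then have "poly a x = - (poly b x * y)"
    by (simp add: eq_neg_iff_add_eq_0)
  then have "poly (nrm a b) x = 0"
    using P(1) Affine by (simp add: nrm_def power_mult_distrib)
  then show ?thesis
    using Affine P(1) by (simp add: zpts_def)
qed simp

text \<open>Adding the values at opposite points replaces the function by its norm, a polynomial in
  \<open>u\<close>, whose zeros are counted by its degree. The same degree is the pole order at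
  infinity.\<close>

lemma pl_el_sum:
  assumes ab: "a \<in> pover Qbar" "b \<in> pover Qbar" "el a b \<noteq> 0"
    and S: "finite S" "insert Infinity (zpts (nrm a b)) \<subseteq> S" "S \<subseteq> epts Qbar"
  shows "(\<Sum>P\<in>S. pl P (el a b)) = 0"
proof -
  define N where "N = nrm a b"
  have N: "N \<noteq> 0" "N \<in> pover Qbar"
    using nrm_props[OF ab] by (auto simp: N_def)
  note fin = finite_zpts[OF N(1)]
  have sub: "P \<in> epts Qbar" if "P \<in> zpts N" for P
    using zpts_Qbar[OF N(2,1)] that by blast
  have inf: "Infinity \<notin> zpts N"
    by (auto simp: zpts_def)
  have neg: "eneg P \<in> zpts N" if "P \<in> zpts N" for P
    using that by (auto simp: zpts_def)
  have "(\<Sum>P\<in>zpts N. pl P (el a b)) = (\<Sum>P\<in>zpts N. pl (eneg P) (el a b))"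
    by (rule sum.reindex_bij_witness[of _ eneg eneg]) (auto simp: neg)
  then have "2 * (\<Sum>P\<in>zpts N. pl P (el a b)) = (\<Sum>P\<in>zpts N. pl P (el a b) + pl (eneg P) (el a b))"
    by (simp add: sum.distrib)
  also have "\<dots> = (\<Sum>P\<in>zpts N. pl P (poly N u))"
    using pl_el_conj_sum[OF sub ab] by (simp add: N_def)
  also have "\<dots> = (\<Sum>P\<in>zpts N. case P of Infinity \<Rightarrow> 0 | Affine x y \<Rightarrow> (if y = 0 then 2 else 1) * int (order x N))"
    using pl_poly[OF sub N(2,1)] inf by (intro sum.cong refl) (auto split: point.splits)
  also have "\<dots> = 2 * int (degree N)"
    by (rule sum_zpts[OF N(1)])
  finally have aff: "(\<Sum>P\<in>zpts N. pl P (el a b)) = int (degree N)"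
    by simp
  have "(\<Sum>P\<in>S. pl P (el a b)) = (\<Sum>P\<in>insert Infinity (zpts N). pl P (el a b))"
  proof (rule sum.mono_neutral_right[OF S(1)])
    show "insert Infinity (zpts N) \<subseteq> S"
      using S(2) by (simp add: N_def)
    show "\<forall>P\<in>S - insert Infinity (zpts N). pl P (el a b) = 0"
      using pl_el_support[OF ab] S(3) by (force simp: N_def)
  qed
  also have "\<dots> = pl Infinity (el a b) + (\<Sum>P\<in>zpts N. pl P (el a b))"
    using fin inf by simp
  finally show ?thesis
    using aff pl_Infinity_el[OF ab] by (simp add: N_def)
qed

lemma principal_degree:
  assumes h: "h \<in> F" "h \<noteq> 0"
  obtains S where "finite S" "S \<subseteq> epts Qbar" "(\<Sum>P\<in>S. pl P h) = 0" "\<forall>P\<in>epts Qbar. pl P h \<noteq> 0 \<longrightarrow> P \<in> S"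
proof -
  obtain a b c where abc: "a \<in> pover Qbar" "b \<in> pover Qbar" "c \<in> pover Qbar" "c \<noteq> 0" "h = el a b / poly c u"
    using FF_E[OF h(1)] .
  have c0: "poly c u = el c 0"
    by (simp add: el_def)
  have nz: "el a b \<noteq> 0" "el c 0 \<noteq> 0"
    using abc h by (auto simp: c0)
  note z = pover_0[OF subfield_Qbar]
  define S where "S = insert Infinity (zpts (nrm a b) \<union> zpts (nrm c 0))"
  have S: "finite S" "S \<subseteq> epts Qbar"
    using nrm_props[OF abc(1,2) nz(1)] nrm_props[OF abc(3) z nz(2)] finite_zpts zpts_Qbar by (auto simp: S_def)
  have val: "pl P h = pl P (el a b) - pl P (el c 0)" if "P \<in> epts Qbar" for P
    unfolding abc(5) c0 using abc z nz by (intro valn_divide[OF pl_valn[OF that]] el_F)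
  have "(\<Sum>P\<in>S. pl P h) = (\<Sum>P\<in>S. pl P (el a b)) - (\<Sum>P\<in>S. pl P (el c 0))"
    using val S(2) by (subst sum_subtractf[symmetric]) (auto intro: sum.cong)
  also have "\<dots> = 0"
  proof -
    have "insert Infinity (zpts (nrm a b)) \<subseteq> S" "insert Infinity (zpts (nrm c 0)) \<subseteq> S"
      by (auto simp: S_def)
    then show ?thesis
      using pl_el_sum[OF abc(1,2) nz(1) S(1) _ S(2)] pl_el_sum[OF abc(3) z nz(2) S(1) _ S(2)] by simp
  qed
  finally have "(\<Sum>P\<in>S. pl P h) = 0" .
  moreover have "P \<in> S" if "P \<in> epts Qbar" "pl P h \<noteq> 0" for P
    using that val[OF that(1)] pl_el_support[OF abc(1,2) nz(1) that(1)] pl_el_support[OF abc(3) z nz(2) that(1)]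
    by (cases "pl P (el a b) = 0") (auto simp: S_def)
  ultimately show ?thesis
    using that S by blast
qed

section \<open>Divisors of lines and the classes of points\<close>

abbreviation "DD \<equiv> Div Qbar F"
abbreviation "Prin \<equiv> principal_divisors Qbar F"

definition fr :: "point \<Rightarrow> (complex \<Rightarrow> int) \<Rightarrow>\<^sub>0 int" where
  "fr P = frag_of (pl P)"

lemma lookup_fr: "P \<in> epts Qbar \<Longrightarrow> Q \<in> epts Qbar \<Longrightarrow> Poly_Mapping.lookup (fr P) (pl Q) = (if P = Q then 1 else 0)"
  using pl_inj by (auto simp: fr_def)

lemma keys_fr: "P \<in> epts Qbar \<Longrightarrow> Poly_Mapping.keys (fr P) \<subseteq> places Qbar F"
  using pl_place by (simp add: fr_def keys_frag_of)

lemma dg_fr [simp]: "dg (fr P) = 1"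
  by (simp add: fr_def)

lemma Prin_I:
  assumes "Poly_Mapping.keys D \<subseteq> places Qbar F" "f \<in> F" "f \<noteq> 0"
    "\<And>P. P \<in> epts Qbar \<Longrightarrow> Poly_Mapping.lookup D (pl P) = pl P f"
  shows "D \<in> Prin"
  using assms by (auto simp: principal_divisors_def places_eq)

lemma Prin_E:
  assumes "D \<in> Prin"
  obtains f where "f \<in> F" "f \<noteq> 0" "\<forall>P\<in>epts Qbar. Poly_Mapping.lookup D (pl P) = pl P f"
    "Poly_Mapping.keys D \<subseteq> places Qbar F"
  using assms by (auto simp: principal_divisors_def places_eq)

lemma Prin_0: "0 \<in> Prin"
proof (rule Prin_I[of _ 1])
  show "1 \<in> F"
    using sf_1[OF subfield_F] .
  fix P
  assume "P \<in> epts Qbar"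
  then show "Poly_Mapping.lookup 0 (pl P) = pl P 1"
    using valn_const[OF pl_valn sf_1[OF subfield_Qbar]] by simp
qed auto

lemma Prin_add:
  assumes "D \<in> Prin" "E \<in> Prin"
  shows "D + E \<in> Prin"
proof -
  obtain f where f: "f \<in> F" "f \<noteq> 0" "\<forall>P\<in>epts Qbar. Poly_Mapping.lookup D (pl P) = pl P f"
    "Poly_Mapping.keys D \<subseteq> places Qbar F"
    by (rule Prin_E[OF assms(1)])
  obtain g where g: "g \<in> F" "g \<noteq> 0" "\<forall>P\<in>epts Qbar. Poly_Mapping.lookup E (pl P) = pl P g"
    "Poly_Mapping.keys E \<subseteq> places Qbar F"
    by (rule Prin_E[OF assms(2)])
  show ?thesis
    using f g keys_add[of D E] valn_mult[OF pl_valn f(1) g(1) f(2) g(2)] sf_mult[OF subfield_F f(1) g(1)]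
    by (intro Prin_I[of _ "f * g"]) (auto simp: lookup_add)
qed

lemma Prin_uminus:
  assumes "D \<in> Prin"
  shows "- D \<in> Prin"
proof -
  obtain f where f: "f \<in> F" "f \<noteq> 0" "\<forall>P\<in>epts Qbar. Poly_Mapping.lookup D (pl P) = pl P f"
    "Poly_Mapping.keys D \<subseteq> places Qbar F"
    by (rule Prin_E[OF assms(1)])
  show ?thesis
    using f valn_inverse[OF pl_valn f(1,2)] sf_inverse[OF subfield_F f(1)]
    by (intro Prin_I[of _ "inverse f"]) auto
qed

lemma Prin_diff: "D \<in> Prin \<Longrightarrow> E \<in> Prin \<Longrightarrow> D - E \<in> Prin"
  using Prin_add[of D "- E"] Prin_uminus[of E] by simp

lemma Prin_dg: "D \<in> Prin \<Longrightarrow> dg D = 0"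
proof -
  assume "D \<in> Prin"
  then obtain f where f: "f \<in> F" "f \<noteq> 0" "\<forall>P\<in>epts Qbar. Poly_Mapping.lookup D (pl P) = pl P f"
    "Poly_Mapping.keys D \<subseteq> places Qbar F"
    using Prin_E by metis
  obtain S where S: "finite S" "S \<subseteq> epts Qbar" "(\<Sum>P\<in>S. pl P f) = 0" "\<forall>P\<in>epts Qbar. pl P f \<noteq> 0 \<longrightarrow> P \<in> S"
    by (rule principal_degree[OF f(1,2)])
  have "Poly_Mapping.keys D \<subseteq> pl ` S"
  proof
    fix w
    assume w: "w \<in> Poly_Mapping.keys D"
    then obtain P where P: "P \<in> epts Qbar" "w = pl P"
      using f(4) by (auto simp: places_eq)
    then have "pl P f \<noteq> 0"
      using w f(3) by (simp add: in_keys_iff)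
    then show "w \<in> pl ` S"
      using S(4) P by blast
  qed
  then have "dg D = (\<Sum>w\<in>pl ` S. Poly_Mapping.lookup D w)"
    using S(1) by (intro dg_superset) auto
  also have "\<dots> = (\<Sum>P\<in>S. Poly_Mapping.lookup D (pl P))"
    using S(2) pl_inj by (subst sum.reindex) (auto simp: inj_on_def)
  also have "\<dots> = (\<Sum>P\<in>S. pl P f)"
    using S(2) f(3) by (intro sum.cong) auto
  finally show ?thesis
    using S(3) by simp
qed

lemma Prin_carrier: "D \<in> Prin \<Longrightarrow> Poly_Mapping.keys D \<subseteq> places Qbar F"
  by (auto simp: principal_divisors_def)

lemma order_linear: "order x [:- c, 1:] = (if x = c then 1 else 0)"
proof (cases "x = c")
  case True
  then show ?thesis
    using order_power_n_n[of c 1] by simp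
next
  case False
  then show ?thesis
    by (simp add: order_0I)
qed

text \<open>For an affine \<open>P\<close> this is the divisor of \<open>u - x\<close>; for
  \<open>P = Infinity\<close> it is 0.\<close>

lemma vertical_line:
  assumes P: "P \<in> epts Qbar"
  shows "fr P + fr (eneg P) - frag_cmul 2 (fr Infinity) \<in> Prin"
proof (cases P)
  case Infinity
  have "fr P + fr (eneg P) - frag_cmul 2 (fr Infinity) = 0"
    using frag_cmul_distrib[of 1 1 "fr Infinity"] Infinity by simp
  then show ?thesis
    using Prin_0 by simp
next
  case (Affine x y)
  note P' = eneg_epts[OF subfield_Qbar P]
  have x: "x \<in> Qbar"
    using P Affine by simp
  note um = u_minus_el[OF x]
  have nz: "u - x \<noteq> 0" "el [:- x, 1:] 0 \<noteq> 0"
    using algebraic_F_conv[OF x] um by auto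
  show ?thesis
  proof (rule Prin_I[of _ "u - x"])
    show "Poly_Mapping.keys (fr P + fr (eneg P) - frag_cmul 2 (fr Infinity)) \<subseteq> places Qbar F"
      using keys_fr[OF P] keys_fr[OF P'] keys_fr[of Infinity] keys_cmul[of 2 "fr Infinity"]
        keys_add[of "fr P" "fr (eneg P)"] keys_diff[of "fr P + fr (eneg P)" "frag_cmul 2 (fr Infinity)"]
      by auto blast
    show "u - x \<in> F" "u - x \<noteq> 0"
      using nz sf_diff[OF subfield_F u_F const_F[OF x]] by auto
    fix Q
    assume Q: "Q \<in> epts Qbar"
    show "Poly_Mapping.lookup (fr P + fr (eneg P) - frag_cmul 2 (fr Infinity)) (pl Q) = pl Q (u - x)"
    proof (cases Q)
      case Infinity
      have "nrm [:- x, 1:] 0 = [:- x, 1:]\<^sup>2"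
        by (simp add: nrm_def)
      then have "degree (nrm [:- x, 1:] 0) = 2"
        by (simp add: degree_power_eq)
      then have "pl Infinity (u - x) = - 2"
        using pl_Infinity_el[of "[:- x, 1:]" 0] um nz(2) pover_0[OF subfield_Qbar] by simp
      then show ?thesis
        using Infinity Affine P P' by (simp add: lookup_add lookup_minus lookup_fr)
    next
      case Q': (Affine x' y')
      have "pl Q (u - x) = (if y' = 0 then 2 else 1) * int (order x' [:- x, 1:])"
        using pl_poly[of x' y' "[:- x, 1:]"] um Q Q' by simp
      also have "\<dots> = (if y' = 0 then 2 else 1) * (if x' = x then 1 else 0)"
        by (simp add: order_linear)
      also have "\<dots> = (if P = Q then 1 else 0) + (if eneg P = Q then 1 else 0)"
      proof (cases "x' = x")
        case True
        then have "y'\<^sup>2 = y\<^sup>2"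
          using P Q Affine Q' by simp
        then have "y' = y \<or> y' = - y"
          by (simp add: power2_eq_iff)
        then show ?thesis
          using True Affine Q' by (elim disjE) simp_all
      next
        case False
        then show ?thesis
          using Affine Q' by auto
      qed
      finally show ?thesis
        using Q P P' Q' by (simp add: lookup_add lookup_minus lookup_fr)
    qed
  qed
qed

text \<open>The divisor of \<open>v - l * u - m\<close>. Tangents get the right multiplicities
  because the order of the norm counts coinciding abscissae.\<close>

lemma sloped_line:
  assumes P: "Affine x1 y1 \<in> epts Qbar" and Q: "Affine x2 y2 \<in> epts Qbar" and ne: "\<not> (x1 = x2 \<and> y1 = - y2)"
  shows "fr (Affine x1 y1) + fr (Affine x2 y2) + fr (eneg (eadd (Affine x1 y1) (Affine x2 y2))) - frag_cmul 3 (fr Infinity) \<in> Prin"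
proof -
  define l where "l = slope x1 y1 x2 y2"
  define x3 where "x3 = l\<^sup>2 - 1 - x1 - x2"
  define m where "m = y1 - l * x1"
  define R where "R = eneg (eadd (Affine x1 y1) (Affine x2 y2))"
  have c: "y1\<^sup>2 = crv x1" "y2\<^sup>2 = crv x2"
    using P Q by auto
  note line = line_norm[OF c ne l_def x3_def, folded m_def]
  have R: "R = Affine x3 (l * x3 + m)"
  proof -
    have "eadd (Affine x1 y1) (Affine x2 y2) = Affine x3 (l * (x1 - x3) - y1)"
      using ne by (simp add: Let_def l_def x3_def)
    then show ?thesis
      by (simp add: R_def m_def algebra_simps)
  qed
  have Re: "R \<in> epts Qbar"
    unfolding R_def by (intro eneg_epts eadd_closed subfield_Qbar P Q)
  have Q2: "Affine x2 y2 = Affine x2 (l * x2 + m)" and P2: "Affine x1 y1 = Affine x1 (l * x1 + m)"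
    using line(2) by (auto simp: m_def)
  have lm: "l \<in> Qbar" "m \<in> Qbar"
  proof -
    show "l \<in> Qbar"
      unfolding l_def slope_def using P Q by (auto intro!: sf_intros[OF subfield_Qbar])
    then show "m \<in> Qbar"
      unfolding m_def using P by (auto intro!: sf_intros[OF subfield_Qbar])
  qed
  define a where "a = [:- m, - l:]"
  have a: "a \<in> pover Qbar"
    unfolding a_def using lm by (intro pover_pCons pover_0 sf_uminus subfield_Qbar)
  note one = pover_1[OF subfield_Qbar]
  have e0: "el a 1 \<noteq> 0"
    using el_eq_0_iff[OF a one] by simp
  have N: "nrm a 1 = - ([:- x1, 1:] * [:- x2, 1:] * [:- x3, 1:])"
    using line(1) by (simp only: a_def)
  have N0: "[:- x1, 1:] * [:- x2, 1:] * [:- x3, 1:] \<noteq> 0"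
    by simp
  have ord: "order x (nrm a 1) = (if x = x1 then 1 else 0) + (if x = x2 then 1 else 0) + (if x = x3 then 1 else 0)" for x
  proof -
    have "order x (nrm a 1) = order x ([:- x1, 1:] * [:- x2, 1:] * [:- x3, 1:])"
      unfolding N by (rule order_uminus)
    also have "\<dots> = order x ([:- x1, 1:] * [:- x2, 1:]) + order x [:- x3, 1:]"
      by (rule order_mult[OF N0])
    also have "order x ([:- x1, 1:] * [:- x2, 1:]) = order x [:- x1, 1:] + order x [:- x2, 1:]"
      by (rule order_mult) simp
    finally show ?thesis
      by (simp only: order_linear)
  qed
  have dN: "degree (nrm a 1) = 3"
    unfolding N degree_minus by (simp add: degree_mult_eq)
  define D where "D = fr (Affine x1 y1) + fr (Affine x2 y2) + fr R - frag_cmul 3 (fr Infinity)"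
  have "D \<in> Prin"
  proof (rule Prin_I[OF _ el_F[OF a one] e0])
    show "Poly_Mapping.keys D \<subseteq> places Qbar F"
      unfolding D_def
      by (intro order_trans[OF keys_diff] order_trans[OF keys_add] Un_least order_trans[OF keys_cmul] keys_fr P Q Re) simp
    fix T
    assume T: "T \<in> epts Qbar"
    show "Poly_Mapping.lookup D (pl T) = pl T (el a 1)"
    proof (cases T)
      case Infinity
      then show ?thesis
        using pl_Infinity_el[OF a one e0] dN P Q Re R by (simp add: D_def lookup_add lookup_minus lookup_fr)
    next
      case (Affine x y)
      have "pl T (el a 1) = (if poly a x + poly 1 x * y = 0 then int (order x (nrm a 1)) else 0)"
        using pl_el[of x y a 1] T Affine a one e0 by simp
      also have "poly a x + poly 1 x * y = 0 \<longleftrightarrow> y = l * x + m"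
        by (simp add: a_def algebra_simps)
      finally have val: "pl T (el a 1) = (if y = l * x + m then (if x = x1 then 1 else 0) + (if x = x2 then 1 else 0) + (if x = x3 then 1 else 0) else 0)"
        unfolding ord by simp
      have L: "Poly_Mapping.lookup D (pl T) = (if Affine x1 y1 = T then 1 else 0) + (if Affine x2 y2 = T then 1 else 0) + (if R = T then 1 else 0)"
        using T P Q Re Affine by (simp add: D_def lookup_add lookup_minus lookup_fr)
      show ?thesis
        unfolding val L unfolding Affine R P2 Q2 by auto
    qed
  qed
  then show ?thesis
    by (simp add: D_def R_def)
qed

text \<open>The divisor of the line through \<open>P\<close> and \<open>Q\<close> minus that of the
  vertical line through their sum.\<close>

lemma eadd_class:
  assumes P: "P \<in> epts Qbar" and Q: "Q \<in> epts Qbar"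
  shows "(fr P - fr Infinity) + (fr Q - fr Infinity) - (fr (eadd P Q) - fr Infinity) \<in> Prin"
proof -
  have cm: "frag_cmul 2 (fr Infinity) = fr Infinity + fr Infinity" "frag_cmul 3 (fr Infinity) = fr Infinity + fr Infinity + fr Infinity"
    using frag_cmul_distrib[of 1 1 "fr Infinity"] frag_cmul_distrib[of 2 1 "fr Infinity"] by simp_all
  consider "P = Infinity" | "Q = Infinity" | x y where "P = Affine x y" "Q = Affine x (- y)"
    | x1 y1 x2 y2 where "P = Affine x1 y1" "Q = Affine x2 y2" "\<not> (x1 = x2 \<and> y1 = - y2)"
    by (cases P; cases Q) force+
  then show ?thesis
  proof cases
    case 1
    then show ?thesis
      using Prin_0 by simp
  next
    case 2
    then have "eadd P Q = P"
      by (cases P) auto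
    then show ?thesis
      using Prin_0 2 by simp
  next
    case 3
    then show ?thesis
      using vertical_line[OF P] by (simp add: cm algebra_simps)
  next
    case 4
    have PQ: "eadd P Q \<in> epts Qbar"
      using eadd_closed[OF subfield_Qbar P Q] .
    have "fr P + fr Q + fr (eneg (eadd P Q)) - frag_cmul 3 (fr Infinity) \<in> Prin"
      using sloped_line 4 P Q by metis
    from Prin_diff[OF this vertical_line[OF PQ]] show ?thesis
      by (simp add: cm algebra_simps)
  qed
qed

lemma eneg_class:
  assumes "P \<in> epts Qbar"
  shows "(fr P - fr Infinity) + (fr (eneg P) - fr Infinity) \<in> Prin"
proof -
  have "frag_cmul 2 (fr Infinity) = fr Infinity + fr Infinity"
    using frag_cmul_distrib[of 1 1 "fr Infinity"] by simp
  then show ?thesis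
    using vertical_line[OF assms] by (simp add: algebra_simps)
qed

text \<open>The group law merges points one at a time; the multiple of infinity absorbs the degree.
  The induction runs over differences of divisors, so opposite points are used for
  subtraction.\<close>

lemma divisor_class_exists:
  assumes "Poly_Mapping.keys D \<subseteq> places Qbar F"
  shows "\<exists>P\<in>epts Qbar. \<exists>n. D - frag_cmul n (fr Infinity) - (fr P - fr Infinity) \<in> Prin"
proof (rule free_Abelian_group_induct[OF assms,
      where P = "\<lambda>D. \<exists>P\<in>epts Qbar. \<exists>n. D - frag_cmul n (fr Infinity) - (fr P - fr Infinity) \<in> Prin"], goal_cases)
  case 1
  show ?case
    by (intro bexI[of _ Infinity] exI[of _ 0]) (auto simp: Prin_0)
next
  case (2 D E)
  obtain P n where P: "P \<in> epts Qbar" "D - frag_cmul n (fr Infinity) - (fr P - fr Infinity) \<in> Prin"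
    using 2 by blast
  obtain Q m where Q: "Q \<in> epts Qbar" "E - frag_cmul m (fr Infinity) - (fr Q - fr Infinity) \<in> Prin"
    using 2 by blast
  have Q': "eneg Q \<in> epts Qbar"
    using eneg_epts[OF subfield_Qbar Q(1)] .
  have "(D - frag_cmul n (fr Infinity) - (fr P - fr Infinity)) - (E - frag_cmul m (fr Infinity) - (fr Q - fr Infinity))
     + ((fr P - fr Infinity) + (fr (eneg Q) - fr Infinity) - (fr (eadd P (eneg Q)) - fr Infinity))
     - ((fr Q - fr Infinity) + (fr (eneg Q) - fr Infinity)) \<in> Prin"
    by (intro Prin_diff Prin_add P(2) Q(2) eadd_class eneg_class P(1) Q(1) Q')
  then have "D - E - frag_cmul (n - m) (fr Infinity) - (fr (eadd P (eneg Q)) - fr Infinity) \<in> Prin"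
    by (simp add: frag_cmul_diff_distrib algebra_simps)
  then show ?case
    using eadd_closed[OF subfield_Qbar P(1) Q'] by blast
next
  case (3 w)
  then obtain P where P: "P \<in> epts Qbar" "w = pl P"
    by (auto simp: places_eq)
  have "frag_of w - frag_cmul 1 (fr Infinity) - (fr P - fr Infinity) = 0"
    using P by (simp add: fr_def)
  then show ?case
    using P(1) Prin_0 by metis
qed

text \<open>The affine coordinate ring is integrally closed. At a root \<open>x\<close> of the
  denominator the numerator vanishes at all points above \<open>x\<close>, doubly if the ordinate is
  0; this makes \<open>x\<close> a zero of both \<open>a\<close> and \<open>b\<close>, and the
  linear factor cancels.\<close>

lemma regular_function:
  assumes h: "h \<in> F" "h \<noteq> 0" and reg: "\<And>x y. Affine x y \<in> epts Qbar \<Longrightarrow> pl (Affine x y) h \<ge> 0"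
  obtains a b where "a \<in> pover Qbar" "b \<in> pover Qbar" "h = el a b"
proof -
  obtain a b c where abc: "a \<in> pover Qbar" "b \<in> pover Qbar" "c \<in> pover Qbar" "c \<noteq> 0" "h = el a b / poly c u"
    using FF_E[OF h(1)] .
  have "\<exists>a b. a \<in> pover Qbar \<and> b \<in> pover Qbar \<and> h = el a b"
    using abc
  proof (induction "degree c" arbitrary: a b c rule: less_induct)
    case less
    note [simp] = less.prems(1-4)
    show ?case
    proof (cases "degree c = 0")
      case True
      then obtain d where d: "c = [:d:]"
        using degree_eq_zeroE by blast
      then have "d \<in> Qbar" "d \<noteq> 0"
        using less.prems poverD[of c Qbar 0] by auto
      have "h = el (smult (inverse d) a) (smult (inverse d) b)"
        using less.prems(5) d by (simp add: el_def divide_inverse algebra_simps)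
      then show ?thesis
        using \<open>d \<in> Qbar\<close> by (metis less.prems(1,2) pover_smult[OF subfield_Qbar] sf_inverse[OF subfield_Qbar])
    next
      case False
      then obtain x where x0: "poly c x = 0"
        using poly_has_root by blast
      define y where "y = csqrt (crv x)"
      have P: "Affine x y \<in> epts Qbar" "Affine x (- y) \<in> epts Qbar" and x: "x \<in> Qbar"
        using affine_epts_Qbar[OF x0 less.prems(3,4)] Qbar_root[OF less.prems(3,4) x0] by (auto simp: y_def)
      have nz: "el a b \<noteq> 0" "poly c u \<noteq> 0"
        using less.prems h(2) by auto
      have ge: "pl (Affine x z) (el a b) \<ge> (if z = 0 then 2 else 1)" if "Affine x z \<in> epts Qbar" for z
      proof -
        have "order x c \<ge> 1"
          using x0 less.prems(4) order_root[of c x] by auto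
        moreover have "pl (Affine x z) h = pl (Affine x z) (el a b) - pl (Affine x z) (poly c u)"
          unfolding less.prems(5) using nz by (intro valn_divide[OF pl_valn[OF that]] el_F poly_F) auto
        ultimately show ?thesis
          using reg[OF that] pl_poly[OF that less.prems(3,4)] by (auto split: if_splits)
      qed
      have val: "poly a x + poly b x * z = 0" if "Affine x z \<in> epts Qbar" for z
        using valn_reg_unit(2)[OF pl_valn[OF that] that pl_centered[OF that] reg_el[OF less.prems(1,2)]] ge[OF that]
        by (auto split: if_splits)
      have "poly b x = 0"
      proof (cases "y = 0")
        case y0: False
        have "poly a x + poly b x * y = 0" "poly a x + poly b x * (- y) = 0"
          using val P by blast+
        then have "2 * (poly b x * y) = 0"
          by (simp add: algebra_simps)
        then show ?thesis
          using y0 by simp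
      next
        case y0: True
        show ?thesis
        proof (rule ccontr)
          \<comment> \<open>With \<open>y = 0\<close> the term \<open>poly b u * v\<close> would
            have order 1 and \<open>poly a u\<close> order at least 2, so that the numerator would
            vanish to first order only.\<close>
          assume b: "poly b x \<noteq> 0"
          have "poly a x = 0"
            using val[OF P(1)] y0 by simp
          note w = pl_valn[OF P(1)]
          have v0: "v \<noteq> 0"
            using v_minus_const_nonzero[OF sf_0[OF subfield_Qbar]] by simp
          have v1: "pl (Affine x y) v = 1"
            using place_unif[OF pl_place[OF P(1)] P(1) pl_centered[OF P(1)]] y0 by (simp add: unif_def)
          note bu = valn_reg_unit[OF w P(1) pl_centered[OF P(1)] reg_poly[OF less.prems(2)] b]
          have bv: "pl (Affine x y) (poly b u * v) = 1" "poly b u * v \<noteq> 0"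
            using valn_mult[OF w poly_F[OF less.prems(2)] v_F bu(1) v0] bu v1 v0 by auto
          have wa: "wge (pl (Affine x y)) 2 (poly a u)"
          proof (cases "a = 0")
            case True
            then show ?thesis
              using sf_0[OF subfield_F] by (simp add: wge_def[OF w])
          next
            case False
            then have "order x a \<ge> 1"
              using \<open>poly a x = 0\<close> order_root[of a x] by auto
            then show ?thesis
              unfolding wge_def[OF w] using pl_poly[OF P(1) less.prems(1) False] y0 poly_F[OF less.prems(1)] by simp
          qed
          have "pl (Affine x y) (el a b) = 1"
          proof (cases "poly a u = 0")
            case True
            then show ?thesis
              using bv by (simp add: el_def)
          next
            case False
            then have "pl (Affine x y) (poly b u * v) < pl (Affine x y) (poly a u)"
              using wa bv by (simp add: wge_def[OF w])
            then have "pl (Affine x y) (poly b u * v + poly a u) = 1"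
              using valn_add_dominant(2)[OF w sf_mult[OF subfield_F poly_F[OF less.prems(2)] v_F] poly_F[OF less.prems(1)] bv(2) False] bv(1)
              by simp
            then show ?thesis
              by (simp add: el_def add.commute)
          qed
          then show False
            using ge[OF P(1)] y0 by simp
        qed
      qed
      moreover have "poly a x = 0"
        using val[OF P(1)] calculation by simp
      moreover obtain a' where a': "a' \<in> pover Qbar" "a = [:- x, 1:] * a' + [:poly a x:]"
        using pover_root_factor[OF subfield_Qbar less.prems(1) x] .
      moreover obtain b' where b': "b' \<in> pover Qbar" "b = [:- x, 1:] * b' + [:poly b x:]"
        using pover_root_factor[OF subfield_Qbar less.prems(2) x] .
      moreover obtain c' where c': "c' \<in> pover Qbar" "c = [:- x, 1:] * c' + [:poly c x:]"
        using pover_root_factor[OF subfield_Qbar less.prems(3) x] .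
      ultimately have fac: "a = [:- x, 1:] * a'" "b = [:- x, 1:] * b'" "c = [:- x, 1:] * c'"
        using x0 by auto
      have c'0: "c' \<noteq> 0"
        using fac(3) less.prems(4) by auto
      have "degree c = degree c' + 1"
        unfolding fac(3) using c'0 by (subst degree_mult_eq) auto
      moreover have "h = el a' b' / poly c' u"
      proof -
        have ux: "poly [:- x, 1:] u \<noteq> 0"
          using algebraic_F_conv[OF x] by simp
        have "h = (poly [:- x, 1:] u * el a' b') / (poly [:- x, 1:] u * poly c' u)"
          unfolding less.prems(5) fac el_smult[symmetric] poly_mult ..
        then show ?thesis
          using nonzero_mult_divide_mult_cancel_left[OF ux, of "el a' b'" "poly c' u"] by metis
      qed
      ultimately show ?thesis
        using less.hyps[of c' a' b'] a' b' c' c'0 by simp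
    qed
  qed
  then show ?thesis
    using that by blast
qed

text \<open>A norm with \<open>b \<noteq> 0\<close> has degree at least 3. Pole orders at infinity
  below 3 are therefore even, and a simple pole at infinity cannot be the only pole.\<close>

lemma degree_nrm_cases:
  assumes "degree (nrm a b) < 3"
  shows "b = 0" "degree (nrm a b) = 2 * degree a"
proof -
  show b: "b = 0"
  proof (rule ccontr)
    assume b0: "b \<noteq> 0"
    then show False
      using assms degree_nrm[of a b] degree_crv_times_square[OF b0] by (cases "a = 0") (auto simp: nrm_def)
  qed
  show "degree (nrm a b) = 2 * degree a"
    by (cases "a = 0") (auto simp: b nrm_def degree_power_eq)
qed

text \<open>A function with divisor \<open>P - Q\<close> would have a single simple pole. At
  infinity this is excluded by \<open>degree_nrm_cases\<close>. For an affine \<open>Q\<close>,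
  multiplication by \<open>u - x1\<close> moves the pole to infinity with order at most 2; what
  remains is a linear polynomial in \<open>u\<close>, whose zeros are opposite points, and it
  vanishes at \<open>P\<close> and at the opposite of \<open>Q\<close>.\<close>

lemma point_class_inj:
  assumes P: "P \<in> epts Qbar" and Q: "Q \<in> epts Qbar" and D: "fr P - fr Q \<in> Prin"
  shows "P = Q"
proof (rule ccontr)
  assume PQ: "P \<noteq> Q"
  obtain f where f: "f \<in> F" "f \<noteq> 0" "\<forall>R\<in>epts Qbar. Poly_Mapping.lookup (fr P - fr Q) (pl R) = pl R f"
    using Prin_E[OF D] by metis
  have fv: "pl R f = (if P = R then 1 else 0) - (if Q = R then 1 else 0)" if "R \<in> epts Qbar" for R
    using bspec[OF f(3) that] lookup_fr[OF P that] lookup_fr[OF Q that] by (simp add: lookup_minus)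
  show False
  proof (cases Q)
    case Infinity
    have "pl (Affine x y) f \<ge> 0" if "Affine x y \<in> epts Qbar" for x y
      using fv[OF that] Infinity by simp
    then obtain a b where ab: "a \<in> pover Qbar" "b \<in> pover Qbar" "f = el a b"
      using regular_function[OF f(1,2)] by metis
    have "degree (nrm a b) = 1"
      using pl_Infinity_el[OF ab(1,2)] fv[of Infinity] PQ Infinity f(2) ab(3) by simp
    then show False
      using degree_nrm_cases(2)[of a b] by presburger
  next
    case (Affine x1 y1)
    have x1: "x1 \<in> Qbar"
      using Q Affine by simp
    define g where "g = f * (u - x1)"
    have nz: "u - x1 \<noteq> 0" and mem: "u - x1 \<in> F"
      using algebraic_F_conv[OF x1] sf_diff[OF subfield_F u_F const_F[OF x1]] by auto
    have g: "g \<in> F" "g \<noteq> 0"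
      using f nz mem sf_mult[OF subfield_F] by (auto simp: g_def)
    have gv: "pl R g = (if P = R then 1 else 0) - (if Q = R then 1 else 0) + pl R (u - x1)" if "R \<in> epts Qbar" for R
      using valn_mult[OF pl_valn[OF that] f(1) mem f(2) nz] fv[OF that] by (simp add: g_def)
    have ge: "pl R (u - x1) \<ge> (if Q = R then 1 else 0)" if R: "R \<in> epts Qbar" "R = Affine x y" for R x y
    proof -
      have "pl R (u - x1) = (if y = 0 then 2 else 1) * int (order x [:- x1, 1:])"
        using pl_poly[of x y "[:- x1, 1:]"] R u_minus_el[OF x1] by simp
      then show ?thesis
        unfolding order_linear R(2) Affine by (cases "x = x1") auto
    qed
    have "pl (Affine x y) g \<ge> 0" if "Affine x y \<in> epts Qbar" for x y
    proof -
      have "0 \<le> (if P = Affine x y then 1 else (0::int))"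
        by simp
      then show ?thesis
        using gv[OF that] ge[OF that refl] by linarith
    qed
    then obtain a b where ab: "a \<in> pover Qbar" "b \<in> pover Qbar" "g = el a b"
      using regular_function[OF g] by metis
    have inf: "pl Infinity (u - x1) = - 2"
    proof -
      have "degree (nrm [:- x1, 1:] 0) = 2"
        by (simp add: nrm_def degree_power_eq)
      then show ?thesis
        using pl_Infinity_el[of "[:- x1, 1:]" 0] u_minus_el[OF x1] nz pover_0[OF subfield_Qbar] by simp
    qed
    have "int (degree (nrm a b)) = 2 - (if P = Infinity then 1 else 0)"
      using pl_Infinity_el[OF ab(1,2)] gv[of Infinity] inf g(2) ab(3) Affine by simp
    moreover from this have "b = 0" "degree (nrm a b) = 2 * degree a"
      using degree_nrm_cases[of a b] by (auto split: if_splits)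
    ultimately have Pa: "P \<noteq> Infinity" and da: "degree a = 1"
      by (auto split: if_splits) presburger
    obtain xp yp where Pp: "P = Affine xp yp"
      using Pa by (cases P) auto
    have ga: "g = poly a u" "a \<noteq> 0"
      using ab(3) \<open>b = 0\<close> da by (auto simp: el_def)
    have pla: "pl (Affine x y) g = (if y = 0 then 2 else 1) * int (order x a)" if "Affine x y \<in> epts Qbar" for x y
      using pl_poly[OF that ab(1) ga(2)] ga(1) by simp
    have gP: "pl P g = 1 + pl P (u - x1)"
      using gv[OF P] PQ by auto
    then have "pl P g \<ge> 1"
      using ge[OF P Pp] by (auto split: if_splits)
    then have "order xp a \<noteq> 0"
      using pla[of xp yp] P Pp by (intro notI) simp
    then have rp: "poly a xp = 0"
      using order_root by blast
    have Q': "Affine x1 (- y1) \<in> epts Qbar"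
      using eneg_epts[OF subfield_Qbar Q] Affine by simp
    have "pl (Affine x1 (- y1)) g \<ge> 1"
    proof -
      have "pl (Affine x1 (- y1)) (u - x1) = (if y1 = 0 then 2 else 1)"
        using pl_u_minus[OF Q'] by simp
      then show ?thesis
        using gv[OF Q'] Affine by (auto split: if_splits simp: eq_neg_iff_add_eq_0)
    qed
    then have "order x1 a \<noteq> 0"
      using pla[OF Q'] by (intro notI) simp
    then have r1: "poly a x1 = 0"
      using order_root by blast
    obtain d e where a: "a = [:d, e:]" "e \<noteq> 0"
      using da by (metis degree_eq_zeroE degree_pCons_eq_if lead_coeff_pCons(2) degree_0 leading_coeff_0_iff one_neq_zero pCons_cases pCons_eq_0_iff Suc_inject One_nat_def)
    then have "xp = x1"
      using rp r1 by (simp add: add_eq_0_iff) (metis mult_cancel_left mult.commute)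
    have "yp\<^sup>2 = y1\<^sup>2"
      using P Q Pp Affine \<open>xp = x1\<close> by simp
    then have "yp = - y1" "y1 \<noteq> 0"
      using PQ Pp Affine \<open>xp = x1\<close> by (auto simp: power2_eq_iff)
    \<comment> \<open>It remains to exclude that \<open>P\<close> is the opposite of
      \<open>Q\<close>: the function would vanish there twice, more than a linear polynomial allows
      at an unramified point.\<close>
    have "order x1 a \<le> 1"
      using order_degree[OF ga(2), of x1] da by simp
    then have "pl P g \<le> 1"
      using pla[of x1 yp] P Pp \<open>xp = x1\<close> \<open>yp = - y1\<close> \<open>y1 \<noteq> 0\<close> by simp
    moreover have "pl P (u - x1) \<ge> 1"
      using pl_u_minus[of x1 yp] P Pp \<open>xp = x1\<close> by simp
    ultimately show False
      using gP by simp
  qed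
qed

end

section \<open>The group of points and its identification with divisor classes\<close>

definition epts_group :: "complex set \<Rightarrow> point monoid" where
  "epts_group K = \<lparr>carrier = epts K, monoid.mult = eadd, one = Infinity\<rparr>"

lemma epts_group_simps [simp]:
  "carrier (epts_group K) = epts K" "P \<otimes>\<^bsub>epts_group K\<^esub> Q = eadd P Q" "\<one>\<^bsub>epts_group K\<^esub> = Infinity"
  by (simp_all add: epts_group_def)

fun point_map :: "(complex \<Rightarrow> complex) \<Rightarrow> point \<Rightarrow> point" where
  "point_map \<sigma> Infinity = Infinity"
| "point_map \<sigma> (Affine x y) = Affine (\<sigma> x) (\<sigma> y)"

lemma point_map_epts:
  assumes "embedding Qbar \<sigma>" "P \<in> epts Qbar"
  shows "point_map \<sigma> P \<in> epts Qbar"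
proof (cases P)
  case (Affine x y)
  note e = assms(1)
  have xy: "x \<in> Qbar" "y \<in> Qbar" "y\<^sup>2 = crv x"
    using assms(2) Affine by auto
  have "\<sigma> x \<in> Qbar" "\<sigma> y \<in> Qbar"
    using xy embedding_root_Qbar[OF e order_refl] by auto
  moreover have "(\<sigma> y)\<^sup>2 = crv (\<sigma> x)"
  proof -
    have "\<sigma> (y\<^sup>2) = \<sigma> (x ^ 3 + x\<^sup>2 - x)"
      using xy(3) by (simp add: crv_def)
    also have "\<sigma> (y\<^sup>2) = (\<sigma> y)\<^sup>2"
      by (rule embedding_power[OF e xy(2)])
    finally show ?thesis
      using xy by (simp add: crv_def embedding_power[OF e] embedding_add[OF e] embedding_diff[OF e] sf_intros[OF subfield_Qbar])
  qed
  ultimately show ?thesis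
    using Affine by simp
qed simp

lemma point_map_fixed:
  assumes "\<sigma> \<in> gal K" "P \<in> epts K"
  shows "point_map \<sigma> P = P"
  using assms galD(3) by (cases P) auto

lemma point_map_surj:
  assumes s: "s \<in> gal K" and Q: "Q \<in> epts Qbar"
  shows "\<exists>P\<in>epts Qbar. point_map s P = Q"
proof (cases Q)
  case (Affine x y)
  note e = galD(1)[OF s]
  obtain x' where x': "x' \<in> Qbar" "s x' = x"
    using galD(4)[OF s, of x] Q Affine by auto
  obtain y' where y': "y' \<in> Qbar" "s y' = y"
    using galD(4)[OF s, of y] Q Affine by auto
  have c: "crv x' \<in> Qbar" "y'\<^sup>2 \<in> Qbar"
    unfolding crv_def using x'(1) y'(1) by (intro sf_intros[OF subfield_Qbar]; simp)+
  have "s (crv x') = crv x" "s (y'\<^sup>2) = y\<^sup>2"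
    using x' y'
    by (simp_all add: crv_def embedding_power[OF e] embedding_add[OF e] embedding_diff[OF e] sf_intros[OF subfield_Qbar])
  then have "y'\<^sup>2 = crv x'"
    using embedding_inj[OF e c(2) c(1)] Q Affine by simp
  then show ?thesis
    using x' y' Affine by (intro bexI[of _ "Affine x' y'"]) simp_all
qed (intro bexI[of _ Infinity], auto)

context curve_field
begin

text \<open>The class of the divisor \<open>P\<close> minus infinity, as a coset of the principal
  divisors.\<close>

definition kap :: "point \<Rightarrow> ((complex \<Rightarrow> int) \<Rightarrow>\<^sub>0 int) set" where
  "kap P = {D. D - (fr P - fr Infinity) \<in> Prin}"

lemma Div0_iff: "D \<in> Div0 Qbar F \<longleftrightarrow> Poly_Mapping.keys D \<subseteq> places Qbar F \<and> dg D = 0"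
  by (simp add: Div0_def dg_def)

lemma Prin_Div0: "Prin \<subseteq> Div0 Qbar F"
  using Prin_carrier Prin_dg Div0_iff by blast

lemma Div0_diff: "D \<in> Div0 Qbar F \<Longrightarrow> E \<in> Div0 Qbar F \<Longrightarrow> D - E \<in> Div0 Qbar F"
  using keys_diff[of D E] by (auto simp: Div0_iff dg_diff)

lemma point_divisor_Div0: "P \<in> epts Qbar \<Longrightarrow> fr P - fr Infinity \<in> Div0 Qbar F"
  using keys_fr[of P] keys_fr[of Infinity] keys_diff[of "fr P" "fr Infinity"] by (auto simp: Div0_iff dg_diff)

lemma coset_kap: "Prin #>\<^bsub>DD\<lparr>carrier := Div0 Qbar F\<rparr>\<^esub> D = {E. E - D \<in> Prin}"
proof -
  have "E \<in> (\<lambda>h. h + D) ` Prin" if "E - D \<in> Prin" for E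
    using that by (intro image_eqI[of _ _ "E - D"]) auto
  then show ?thesis
    by (auto simp: r_coset_def image_iff)
qed

text \<open>Principal divisors have degree 0, which forces the multiple of infinity in
  \<open>divisor_class_exists\<close> to vanish.\<close>

lemma class_kap:
  assumes "D \<in> Div0 Qbar F"
  shows "\<exists>P\<in>epts Qbar. {E. E - D \<in> Prin} = kap P"
proof -
  obtain P n where P: "P \<in> epts Qbar" "D - frag_cmul n (fr Infinity) - (fr P - fr Infinity) \<in> Prin"
    using divisor_class_exists assms Div0_iff by blast
  have "n = 0"
    using Prin_dg[OF P(2)] assms by (simp add: dg_diff dg_frag_cmul Div0_iff)
  then have D: "D - (fr P - fr Infinity) \<in> Prin"
    using P(2) by simp
  have "E - D \<in> Prin \<longleftrightarrow> E - (fr P - fr Infinity) \<in> Prin" for E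
    using Prin_add[OF _ D, of "E - D"] Prin_diff[OF _ D, of "E - (fr P - fr Infinity)"]
    by (auto simp: algebra_simps)
  then show ?thesis
    using P(1) by (auto simp: kap_def)
qed

lemma carrier_Pic0: "carrier (Pic0 Qbar F) = kap ` epts Qbar"
proof -
  have "carrier (Pic0 Qbar F) = (\<lambda>D. {E. E - D \<in> Prin}) ` Div0 Qbar F"
    unfolding Pic0_def FactGroup_def RCOSETS_def by (simp only: coset_kap) auto
  also have "\<dots> = kap ` epts Qbar"
    using class_kap point_divisor_Div0 by (fastforce simp: kap_def)
  finally show ?thesis .
qed

lemma kap_mem: "fr P - fr Infinity \<in> kap P"
  using Prin_0 by (simp add: kap_def)

lemma kap_eq:
  assumes P: "P \<in> epts Qbar" "Q \<in> epts Qbar" and D: "D \<in> kap P" "D \<in> kap Q"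
  shows "P = Q"
proof -
  have "(D - (fr Q - fr Infinity)) - (D - (fr P - fr Infinity)) \<in> Prin"
    by (rule Prin_diff) (use D in \<open>auto simp: kap_def\<close>)
  then show ?thesis
    using point_class_inj[OF P] by simp
qed

lemma kap_inj: "inj_on kap (epts Qbar)"
  using kap_eq kap_mem by (metis inj_onI)

lemma one_Pic0: "\<one>\<^bsub>Pic0 Qbar F\<^esub> = kap Infinity"
  by (simp add: Pic0_def FactGroup_def kap_def)

lemma mult_Pic0:
  assumes P: "P \<in> epts Qbar" and Q: "Q \<in> epts Qbar"
  shows "kap P \<otimes>\<^bsub>Pic0 Qbar F\<^esub> kap Q = kap (eadd P Q)"
proof -
  note cls = eadd_class[OF P Q]
  have "D + E \<in> kap (eadd P Q)" if "D \<in> kap P" "E \<in> kap Q" for D E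
  proof -
    have "(D - (fr P - fr Infinity)) + (E - (fr Q - fr Infinity))
        + ((fr P - fr Infinity) + (fr Q - fr Infinity) - (fr (eadd P Q) - fr Infinity)) \<in> Prin"
      using that by (intro Prin_add cls) (auto simp: kap_def)
    then show ?thesis
      by (simp add: kap_def algebra_simps)
  qed
  moreover have "\<exists>D'\<in>kap P. \<exists>E'\<in>kap Q. D = D' + E'" if "D \<in> kap (eadd P Q)" for D
  proof (intro bexI)
    show "D = (D - (fr Q - fr Infinity)) + (fr Q - fr Infinity)"
      by simp
    show "fr Q - fr Infinity \<in> kap Q"
      by (rule kap_mem)
    have "(D - (fr (eadd P Q) - fr Infinity))
        - ((fr P - fr Infinity) + (fr Q - fr Infinity) - (fr (eadd P Q) - fr Infinity)) \<in> Prin"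
      by (rule Prin_diff[OF _ cls]) (use that in \<open>simp add: kap_def\<close>)
    then show "D - (fr Q - fr Infinity) \<in> kap P"
      by (simp add: kap_def algebra_simps)
  qed
  ultimately have "{D. \<exists>D'\<in>kap P. \<exists>E'\<in>kap Q. D = D' + E'} = kap (eadd P Q)"
    by blast
  moreover have "kap P \<otimes>\<^bsub>Pic0 Qbar F\<^esub> kap Q = {D. \<exists>D'\<in>kap P. \<exists>E'\<in>kap Q. D = D' + E'}"
    by (auto simp: Pic0_def FactGroup_def set_mult_def)
  ultimately show ?thesis
    by simp
qed

lemma Div0_subgroup: "subgroup (Div0 Qbar F) DD"
proof
  show "Div0 Qbar F \<subseteq> carrier DD"
    by (auto simp: Div0_iff)
  fix D E
  assume D: "D \<in> Div0 Qbar F"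
  have z: "0 \<in> Div0 Qbar F"
    by (simp add: Div0_iff)
  show "inv\<^bsub>DD\<^esub> D \<in> Div0 Qbar F"
    using D Div0_diff[OF z D] by (simp add: Div0_iff)
  assume E: "E \<in> Div0 Qbar F"
  show "D \<otimes>\<^bsub>DD\<^esub> E \<in> Div0 Qbar F"
    using Div0_diff[OF D Div0_diff[OF z E]] by simp
qed (simp add: Div0_iff)

lemma Pic0_group: "comm_group (Pic0 Qbar F)"
proof -
  interpret D: comm_group DD
    by (rule abelian_free_Abelian_group)
  interpret D0: group "DD\<lparr>carrier := Div0 Qbar F\<rparr>"
    by (rule D.subgroup_imp_group[OF Div0_subgroup])
  interpret D0: comm_group "DD\<lparr>carrier := Div0 Qbar F\<rparr>"
    by (rule D0.group_comm_groupI) simp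
  have "subgroup Prin (DD\<lparr>carrier := Div0 Qbar F\<rparr>)"
  proof (rule D0.subgroupI)
    show "Prin \<subseteq> carrier (DD\<lparr>carrier := Div0 Qbar F\<rparr>)"
      using Prin_Div0 by simp
    show "Prin \<noteq> {}"
      using Prin_0 by blast
    show "inv\<^bsub>DD\<lparr>carrier := Div0 Qbar F\<rparr>\<^esub> D \<in> Prin" if "D \<in> Prin" for D
      using that Prin_Div0 Prin_uminus[OF that] D.m_inv_consistent[OF Div0_subgroup, of D] Prin_carrier[OF that] by auto
    show "D \<otimes>\<^bsub>DD\<lparr>carrier := Div0 Qbar F\<rparr>\<^esub> E \<in> Prin" if "D \<in> Prin" "E \<in> Prin" for D E
      using Prin_add[OF that] by simp
  qed
  then show ?thesis
    unfolding Pic0_def by (rule D0.abelian_FactGroup)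
qed

text \<open>\<open>kap\<close> is injective and carries \<open>eadd\<close> to the product of the
  class group, so associativity is inherited from the addition of divisors.\<close>

lemma epts_assoc:
  assumes "P \<in> epts Qbar" "Q \<in> epts Qbar" "R \<in> epts Qbar"
  shows "eadd (eadd P Q) R = eadd P (eadd Q R)"
proof -
  interpret comm_group "Pic0 Qbar F"
    by (rule Pic0_group)
  have c: "eadd S T \<in> epts Qbar" if "S \<in> epts Qbar" "T \<in> epts Qbar" for S T
    using that by (rule eadd_closed[OF subfield_Qbar])
  have m: "kap S \<in> carrier (Pic0 Qbar F)" if "S \<in> epts Qbar" for S
    using that by (simp add: carrier_Pic0)
  have "kap (eadd (eadd P Q) R) = kap (eadd P (eadd Q R))"
    using m_assoc[OF m m m, OF assms] by (simp add: mult_Pic0 assms c)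
  then show ?thesis
    using kap_inj assms c by (simp add: inj_on_eq_iff)
qed

lemma epts_comm:
  assumes "P \<in> epts Qbar" "Q \<in> epts Qbar"
  shows "eadd P Q = eadd Q P"
proof -
  interpret comm_group "Pic0 Qbar F"
    by (rule Pic0_group)
  have "kap (eadd P Q) = kap (eadd Q P)"
    using m_comm[of "kap P" "kap Q"] assms by (simp add: mult_Pic0 carrier_Pic0)
  then show ?thesis
    using kap_inj assms eadd_closed[OF subfield_Qbar] by (simp add: inj_on_eq_iff)
qed

lemma epts_comm_group:
  assumes K: "subfield K CC" "K \<subseteq> Qbar"
  shows "comm_group (epts_group K)"
proof -
  have sub: "P \<in> epts Qbar" if "P \<in> epts K" for P
    using that K(2) by (cases P) auto
  show ?thesis
  proof (rule comm_groupI, goal_cases)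
    case (3 P Q R)
    then show ?case
      by (simp add: epts_assoc sub)
  next
    case (4 P Q)
    then show ?case
      by (simp add: epts_comm sub)
  next
    case (6 P)
    have "eadd (eneg P) P = Infinity"
      by (cases P) auto
    then show ?case
      using 6 eneg_epts[OF K(1), of P] by auto
  qed (auto simp: eadd_closed[OF K(1)])
qed

section \<open>The Galois action on places, divisors and classes\<close>

lemma field_auts_embedding:
  assumes K: "subfield K CC" "K \<subseteq> Qbar" and s: "s \<in> field_auts F (FF K)"
  shows "embedding F s" "s ` F = F" "s \<in> gal K" "s u = u" "s v = v"
proof -
  have h: "s \<in> ring_hom (CC\<lparr>carrier := F\<rparr>) (CC\<lparr>carrier := F\<rparr>)" "bij_betw s F F"
    and fix1: "\<forall>f\<in>FF K. s f = f"
    using s by (auto simp: field_auts_def ring_iso_def)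
  show "s u = u" "s v = v"
    using fix1 u_FF[OF K] v_FF[OF K] by auto
  show emb: "embedding F s"
    using h(1) subfield_F by (auto simp: embedding_def ring_hom_def)
  show sF: "s ` F = F"
    using h(2) by (simp add: bij_betw_def)
  have QF: "Qbar \<subseteq> F"
    using const_F by blast
  have "embedding Qbar s"
    using emb QF subfield_Qbar by (auto simp: embedding_def)
  then show "s \<in> gal K"
    using embedding_Qbar_surj const_FF[OF K] fix1 by (auto simp: gal_def)
qed

lemma field_auts_inverse:
  assumes "s \<in> field_auts F F0" "F0 \<subseteq> F"
  shows "inv_into F s \<in> field_auts F F0"
proof -
  have r: "ring (CC\<lparr>carrier := F\<rparr>)"
    using subfield_F ring.subfield_iff(2)[OF ring_CC, of F] field.is_ring by blast
  have i: "s \<in> ring_iso (CC\<lparr>carrier := F\<rparr>) (CC\<lparr>carrier := F\<rparr>)" and fx: "\<forall>f\<in>F0. s f = f"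
    using assms(1) by (auto simp: field_auts_def)
  have "inj_on s F"
    using i by (auto simp: ring_iso_def bij_betw_def)
  then have "inv_into F s f = f" if "f \<in> F0" for f
    using inv_into_f_f[of s F f] fx assms(2) that by auto
  then show ?thesis
    using ring_iso_set_sym[OF r i] by (simp add: field_auts_def)
qed

text \<open>Since \<open>s (u - x) = u - s x\<close>, precomposition with \<open>s\<close> carries
  the place at the image of \<open>P\<close> to the place at \<open>P\<close>, against the direction
  of \<open>s\<close>.\<close>

lemma act_place_pl:
  assumes K: "subfield K CC" "K \<subseteq> Qbar" and s: "s \<in> field_auts F (FF K)" and P: "P \<in> epts Qbar"
  shows "act_place F s (pl (point_map s P)) = pl P"
proof -
  note e = field_auts_embedding[OF K s]
  have eQ: "embedding Qbar s"
    using galD(1)[OF e(3)] .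
  define P' where "P' = point_map s P"
  have P': "P' \<in> epts Qbar"
    unfolding P'_def by (rule point_map_epts[OF eQ P])
  define w where "w = act_place F s (pl P')"
  have wf: "w f = pl P' (s f)" if "f \<in> F" "f \<noteq> 0" for f
    using that by (simp add: w_def act_place_def)
  have sF: "s f \<in> F" if "f \<in> F" for f
    using e(2) that by blast
  have s0: "s f \<noteq> 0" if "f \<in> F" "f \<noteq> 0" for f
    using embedding_eq_0_iff[OF e(1)] that by blast
  note val = pl_valn[OF P']
  have vw: "valn w"
    unfolding valn_def
  proof (intro conjI ballI impI)
    fix f g
    assume f: "f \<in> F - {0}" and g: "g \<in> F - {0}"
    show "w (f * g) = w f + w g"
      using f g sf_mult[OF subfield_F] by (simp add: wf embedding_mult[OF e(1)] valn_mult[OF val] sF s0)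
    show "min (w f) (w g) \<le> w (f + g)" if "f + g \<noteq> 0"
    proof -
      have fg: "f + g \<in> F"
        using f g sf_add[OF subfield_F] by blast
      have "s f + s g \<noteq> 0"
        using s0[OF fg that] f g by (simp add: embedding_add[OF e(1)])
      then show ?thesis
        using f g fg that valn_add[OF val, of "s f" "s g"] by (simp add: wf embedding_add[OF e(1)] sF s0)
    qed
  next
    fix c
    assume "c \<in> Qbar - {0}"
    then show "w c = 0"
      using wf[of c] valn_const[OF val, of "s c"] const_F s0 galD(2)[OF e(3)] by auto
  qed
  have "w ` (F - {0}) = pl P' ` (s ` (F - {0}))"
    unfolding image_image using wf by (intro image_cong) auto
  also have "s ` (F - {0}) = F - {0}"
  proof
    show "s ` (F - {0}) \<subseteq> F - {0}"
      using sF s0 by auto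
    show "F - {0} \<subseteq> s ` (F - {0})"
    proof
      fix f
      assume f: "f \<in> F - {0}"
      then obtain g where "g \<in> F" "f = s g"
        using e(2) by (metis DiffD1 imageE)
      then show "f \<in> s ` (F - {0})"
        using f embedding_0[OF e(1)] by auto
    qed
  qed
  also have "pl P' ` (F - {0}) = UNIV"
    using pl_place[OF P'] places_iff by blast
  finally have "w ` (F - {0}) = UNIV" .
  then have w: "w \<in> places Qbar F"
    using vw by (simp add: places_iff w_def act_place_def)
  have cen: "centered w P"
  proof (cases P)
    case Infinity
    have "u \<noteq> 0"
      using algebraic_F_conv[OF sf_0[OF subfield_Qbar]] by simp
    then show ?thesis
      using pl_centered[OF P'] Infinity wf[OF u_F] e(4) by (simp add: P'_def centered_def)
  next
    case (Affine x y)
    have xy: "x \<in> Qbar" "y \<in> Qbar"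
      using P Affine by auto
    have c: "wge (pl P') 1 (u - s x)" "wge (pl P') 1 (v - s y)"
      using pl_centered[OF P'] Affine by (auto simp: P'_def centered_def)
    have m: "u - x \<in> F" "v - y \<in> F"
      using xy const_F u_F v_F sf_diff[OF subfield_F] by auto
    have "s (u - x) = u - s x" "s (v - y) = v - s y"
      using embedding_diff[OF e(1)] u_F v_F const_F xy e(4,5) by auto
    then show ?thesis
      using c m Affine wf s0 by (auto simp: centered_def wge_def[OF vw] wge_def[OF val])
  qed
  show ?thesis
    using pl_eqI[OF P w cen] by (simp add: w_def P'_def)
qed

lemma act_place_places:
  assumes K: "subfield K CC" "K \<subseteq> Qbar" and s: "s \<in> field_auts F (FF K)" and w: "w \<in> places Qbar F"
  shows "act_place F s w \<in> places Qbar F"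
    and "w' \<in> places Qbar F \<Longrightarrow> act_place F s w = act_place F s w' \<longleftrightarrow> w = w'"
proof -
  note e = field_auts_embedding[OF K s]
  have eQ: "embedding Qbar s"
    using galD(1)[OF e(3)] .
  have pre: "\<exists>P\<in>epts Qbar. w = pl (point_map s P)" if mem: "w \<in> places Qbar F" for w
  proof -
    obtain Q where Q: "Q \<in> epts Qbar" "w = pl Q"
      using mem unfolding places_eq by (metis imageE)
    have "\<exists>P\<in>epts Qbar. point_map s P = Q"
      by (rule point_map_surj[OF e(3) Q(1)])
    then show ?thesis
      using Q(2) by blast
  qed
  obtain P where P: "P \<in> epts Qbar" "w = pl (point_map s P)"
    using pre[OF w] by blast
  show "act_place F s w \<in> places Qbar F"
    using act_place_pl[OF K s P(1)] pl_place[OF P(1)] P(2) by simp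
  show "act_place F s w = act_place F s w' \<longleftrightarrow> w = w'" if "w' \<in> places Qbar F"
  proof -
    obtain P' where P': "P' \<in> epts Qbar" "w' = pl (point_map s P')"
      using pre[OF \<open>w' \<in> places Qbar F\<close>] by blast
    show ?thesis
      using act_place_pl[OF K s P(1)] act_place_pl[OF K s P'(1)] P P' pl_inj by metis
  qed
qed

lemma act_div_diff: "act_div F s (D - E) = act_div F s D - act_div F s E"
  by (simp add: act_div_def frag_extend_diff)

lemma keys_act_div:
  assumes K: "subfield K CC" "K \<subseteq> Qbar" and s: "s \<in> field_auts F (FF K)"
    and D: "Poly_Mapping.keys D \<subseteq> places Qbar F"
  shows "Poly_Mapping.keys (act_div F s D) \<subseteq> places Qbar F"
  using keys_frag_extend[of "frag_of \<circ> act_place F s" D] D act_place_places(1)[OF K s]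
  unfolding act_div_def by (auto simp: keys_frag_of split: if_splits)

lemma lookup_act_div:
  assumes K: "subfield K CC" "K \<subseteq> Qbar" and s: "s \<in> field_auts F (FF K)"
    and D: "Poly_Mapping.keys D \<subseteq> places Qbar F" and w: "w \<in> places Qbar F"
  shows "Poly_Mapping.lookup (act_div F s D) (act_place F s w) = Poly_Mapping.lookup D w"
proof (rule free_Abelian_group_induct[OF D,
      where P = "\<lambda>D. Poly_Mapping.lookup (act_div F s D) (act_place F s w) = Poly_Mapping.lookup D w"], goal_cases)
  case (2 D E)
  then show ?case
    by (simp add: act_div_diff lookup_minus)
next
  case (3 w')
  then show ?case
    using act_place_places(2)[OF K s w, of w'] by (auto simp: act_div_def lookup_frag_of)
qed (simp add: act_div_def)

lemma act_div_Prin: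
  assumes K: "subfield K CC" "K \<subseteq> Qbar" and s: "s \<in> field_auts F (FF K)" and D: "D \<in> Prin"
  shows "act_div F s D \<in> Prin"
proof -
  note e = field_auts_embedding[OF K s]
  have eQ: "embedding Qbar s"
    using galD(1)[OF e(3)] .
  obtain f where f: "f \<in> F" "f \<noteq> 0" "\<forall>P\<in>epts Qbar. Poly_Mapping.lookup D (pl P) = pl P f"
    "Poly_Mapping.keys D \<subseteq> places Qbar F"
    by (rule Prin_E[OF D])
  obtain g where g: "g \<in> F" "s g = f"
    using e(2) f(1) by (metis imageE)
  have g0: "g \<noteq> 0"
    using f(2) g(2) embedding_0[OF e(1)] by auto
  show ?thesis
  proof (rule Prin_I[OF keys_act_div[OF K s f(4)] g(1) g0])
    fix P
    assume P: "P \<in> epts Qbar"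
    note P' = point_map_epts[OF eQ P]
    have a: "act_place F s (pl (point_map s P)) = pl P"
      by (rule act_place_pl[OF K s P])
    have "Poly_Mapping.lookup (act_div F s D) (pl P) = Poly_Mapping.lookup D (pl (point_map s P))"
      using lookup_act_div[OF K s f(4) pl_place[OF P']] a by simp
    also have "\<dots> = pl (point_map s P) (s g)"
      using f(3) P' g(2) by simp
    also have "\<dots> = act_place F s (pl (point_map s P)) g"
      using g(1) g0 by (simp add: act_place_def)
    finally show "Poly_Mapping.lookup (act_div F s D) (pl P) = pl P g"
      by (simp only: a)
  qed
qed

lemma act_div_inverse:
  assumes K: "subfield K CC" "K \<subseteq> Qbar" and s: "s \<in> field_auts F (FF K)"
    and D: "Poly_Mapping.keys D \<subseteq> places Qbar F"
  shows "act_div F s (act_div F (inv_into F s) D) = D"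
proof (rule free_Abelian_group_induct[OF D, where P = "\<lambda>D. act_div F s (act_div F (inv_into F s) D) = D"], goal_cases)
  case (2 D E)
  then show ?case
    by (simp add: act_div_diff)
next
  case (3 w)
  note e = field_auts_embedding[OF K s]
  have inj: "inj_on s F"
    using embedding_inj[OF e(1)] by (auto simp: inj_on_def)
  have "act_place F s (act_place F (inv_into F s) w) = w"
  proof
    fix f
    show "act_place F s (act_place F (inv_into F s) w) f = w f"
    proof (cases "f \<in> F - {0}")
      case True
      then have "s f \<in> F - {0}"
        using e(2) embedding_eq_0_iff[OF e(1)] by auto
      then show ?thesis
        using True inj by (simp add: act_place_def)
    next
      case False
      have "w \<in> extensional (F - {0})"
        using 3 places_iff by simp
      then have "w f = undefined"
        by (rule extensional_arb) (rule False)
      then show ?thesis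
        using False by (simp only: act_place_def restrict_def if_False)
    qed
  qed
  then show ?case
    by (simp add: act_div_def)
qed (simp add: act_div_def)

lemma act_div_kap:
  assumes K: "subfield K CC" "K \<subseteq> Qbar" and s: "s \<in> field_auts F (FF K)" and P: "P \<in> epts Qbar"
  shows "act_div F s ` kap (point_map s P) = kap P"
proof -
  note e = field_auts_embedding[OF K s]
  have eQ: "embedding Qbar s"
    using galD(1)[OF e(3)] .
  note P' = point_map_epts[OF eQ P]
  have frm: "act_div F s (fr (point_map s Q) - fr Infinity) = fr Q - fr Infinity" if "Q \<in> epts Qbar" for Q
    using act_place_pl[OF K s that] act_place_pl[OF K s, of Infinity] by (simp add: act_div_diff) (simp add: act_div_def fr_def)
  have si: "inv_into F s \<in> field_auts F (FF K)"
    using field_auts_inverse[OF s] FF_mono[OF K(2)] by blast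
  show ?thesis
  proof
    show "act_div F s ` kap (point_map s P) \<subseteq> kap P"
      using act_div_Prin[OF K s] frm[OF P] by (force simp: kap_def act_div_diff)
    show "kap P \<subseteq> act_div F s ` kap (point_map s P)"
    proof
      fix D
      assume D: "D \<in> kap P"
      define E where "E = act_div F (inv_into F s) (D - (fr P - fr Infinity))"
      have DP: "D - (fr P - fr Infinity) \<in> Prin"
        using D by (simp add: kap_def)
      have "E \<in> Prin"
        unfolding E_def by (rule act_div_Prin[OF K si DP])
      moreover have "act_div F s E = D - (fr P - fr Infinity)"
        unfolding E_def by (rule act_div_inverse[OF K s Prin_carrier[OF DP]])
      \<comment> \<open>Subtracting \<open>0 - D\<close> stands for adding \<open>D\<close>, because
        compatibility of the action is available for differences.\<close>
      then have "act_div F s (E - (0 - (fr (point_map s P) - fr Infinity))) = D"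
        using frm[OF P] by (simp only: act_div_diff[of s E] act_div_diff[of s 0]) (simp add: act_div_def)
      ultimately show "D \<in> act_div F s ` kap (point_map s P)"
        by (intro image_eqI[of _ _ "E - (0 - (fr (point_map s P) - fr Infinity))"]) (auto simp: kap_def)
    qed
  qed
qed

text \<open>The action carries the class of the image of a point to the class of the point itself,
  and classes determine points.\<close>

lemma kap_invariant_iff:
  assumes K: "subfield K CC" "K \<subseteq> Qbar" and s: "s \<in> field_auts F (FF K)" and P: "P \<in> epts Qbar"
  shows "act_div F s ` kap P = kap P \<longleftrightarrow> point_map s P = P"
proof -
  obtain Q where Q: "Q \<in> epts Qbar" "point_map s Q = P"
    using point_map_surj[OF field_auts_embedding(3)[OF K s] P] by blast
  have "act_div F s ` kap P = kap P \<longleftrightarrow> Q = P"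
    using act_div_kap[OF K s Q(1)] Q kap_inj P by (simp add: inj_on_eq_iff)
  also have "\<dots> \<longleftrightarrow> point_map s Q = point_map s P"
  proof
    have inj: "s x = s y \<longleftrightarrow> x = y" if "x \<in> Qbar" "y \<in> Qbar" for x y
      using embedding_inj[OF galD(1)[OF field_auts_embedding(3)[OF K s]]] that by blast
    show "Q = P" if "point_map s Q = point_map s P"
      using that P Q(1) by (cases P; cases Q) (auto simp: inj)
  qed simp
  finally show ?thesis
    using Q(2) by auto
qed

text \<open>Conversely, a Galois automorphism acts on functions through their coefficients.\<close>

lemma gal_extends:
  assumes K: "subfield K CC" "K \<subseteq> Qbar" and t: "t \<in> gal K"
  obtains s where "s \<in> field_auts F (FF K)" "\<And>c. c \<in> Qbar \<Longrightarrow> s c = t c"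
proof -
  have e: "embedding Qbar t"
    using galD(1)[OF t] .
  define m where "m p = map_poly t p" for p :: "complex poly"
  have mp: "m p \<in> pover Qbar" if "p \<in> pover Qbar" for p
    using that galD(2)[OF t] by (auto simp: pover_def m_def coeff_map_embedding[OF e])
  have m0: "m p = 0 \<longleftrightarrow> p = 0" if "p \<in> pover Qbar" for p
    using that embedding_eq_0_iff[OF e] by (auto simp: poly_eq_iff m_def coeff_map_embedding[OF e] pover_def)
  have m_add: "m (p + q) = m p + m q" and m_diff: "m (p - q) = m p - m q" and m_mult: "m (p * q) = m p * m q"
    if "p \<in> pover Qbar" "q \<in> pover Qbar" for p q
    unfolding m_def using map_poly_embedding_add[OF e that] map_poly_embedding_diff[OF e that] map_poly_embedding_mult[OF e that] .
  have m_fix: "m p = p" if "p \<in> pover K" for p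
    using that galD(3)[OF t] by (auto simp: poly_eq_iff m_def coeff_map_embedding[OF e] pover_def)
  have m_surj: "\<exists>q\<in>pover Qbar. m q = p" if "p \<in> pover Qbar" for p
  proof -
    define r where "r c = (SOME d. d \<in> Qbar \<and> t d = c)" for c
    have r: "r c \<in> Qbar \<and> t (r c) = c" if "c \<in> Qbar" for c
      using someI_ex[of "\<lambda>d. d \<in> Qbar \<and> t d = c"] galD(4)[OF t that] unfolding r_def by blast
    have r0: "r 0 = 0"
      using r[OF sf_0[OF subfield_Qbar]] embedding_eq_0_iff[OF e] by blast
    have "map_poly r p \<in> pover Qbar"
      using that r by (auto simp: pover_def coeff_map_poly r0)
    moreover have "m (map_poly r p) = p"
      using that r by (auto simp: poly_eq_iff m_def coeff_map_embedding[OF e] coeff_map_poly r0 pover_def)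
    ultimately show ?thesis
      by blast
  qed
  define s where "s h = (SOME z. \<exists>a b c. a \<in> pover Qbar \<and> b \<in> pover Qbar \<and> c \<in> pover Qbar \<and> c \<noteq> 0 \<and>
     h = el a b / poly c u \<and> z = el (m a) (m b) / poly (m c) u)" for h
  have nz: "poly c u \<noteq> 0" if "c \<in> pover Qbar" "c \<noteq> 0" for c
    using poly_u_nonzero[OF subfield_Qbar order_refl that] .
  note P_intros = pover_add[OF subfield_Qbar] pover_mult[OF subfield_Qbar] pover_diff[OF subfield_Qbar] mp
  have s_eq: "s (el a b / poly c u) = el (m a) (m b) / poly (m c) u"
    if abc: "a \<in> pover Qbar" "b \<in> pover Qbar" "c \<in> pover Qbar" "c \<noteq> 0" for a b c
  proof -
    have uniq: "el (m a') (m b') / poly (m c') u = el (m a) (m b) / poly (m c) u"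
      if "a' \<in> pover Qbar" "b' \<in> pover Qbar" "c' \<in> pover Qbar" "c' \<noteq> 0"
        "el a b / poly c u = el a' b' / poly c' u" for a' b' c'
    proof -
      have "poly c' u * el a b = poly c u * el a' b'"
        using that(5) nz[OF abc(3,4)] nz[OF that(3,4)] by (simp add: field_simps)
      then have "c' * a = c * a' \<and> c' * b = c * b'"
        unfolding el_smult
        by (subst (asm) el_eq_iff) (intro pover_mult subfield_Qbar abc that)+
      then have "m c' * m a = m c * m a'" "m c' * m b = m c * m b'"
        using abc(1-3) that(1-3) by (simp_all flip: m_mult)
      then have "poly (m c') u * el (m a) (m b) = poly (m c) u * el (m a') (m b')"
        unfolding el_smult by simp
      moreover have "poly (m c) u \<noteq> 0" "poly (m c') u \<noteq> 0"
        using nz mp m0 abc that by auto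
      ultimately show ?thesis
        by (simp add: field_simps)
    qed
    show ?thesis
      unfolding s_def
    proof (rule some_equality)
      show "\<exists>a' b' c'. a' \<in> pover Qbar \<and> b' \<in> pover Qbar \<and> c' \<in> pover Qbar \<and> c' \<noteq> 0 \<and>
          el a b / poly c u = el a' b' / poly c' u \<and> el (m a) (m b) / poly (m c) u = el (m a') (m b') / poly (m c') u"
        using abc by blast
    qed (use uniq in blast)
  qed
  have s_add: "s (f + g) = s f + s g" and s_mult: "s (f * g) = s f * s g" if fg: "f \<in> F" "g \<in> F" for f g
  proof -
    obtain a b c where f: "a \<in> pover Qbar" "b \<in> pover Qbar" "c \<in> pover Qbar" "c \<noteq> 0" "f = el a b / poly c u"
      using FF_E[OF fg(1)] .
    obtain a' b' c' where g: "a' \<in> pover Qbar" "b' \<in> pover Qbar" "c' \<in> pover Qbar" "c' \<noteq> 0" "g = el a' b' / poly c' u"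
      using FF_E[OF fg(2)] .
    have nn: "poly c u \<noteq> 0" "poly c' u \<noteq> 0" "poly (m c) u \<noteq> 0" "poly (m c') u \<noteq> 0"
      using nz mp m0 f g by auto
    have "f + g = (poly c' u * el a b + poly c u * el a' b') / poly (c * c') u"
      unfolding f(5) g(5) poly_mult using nn(1,2) by (simp add: add_frac_eq mult.commute)
    also have "\<dots> = el (c' * a + c * a') (c' * b + c * b') / poly (c * c') u"
      by (simp only: el_smult el_add)
    finally have fg_sum: "f + g = \<dots>" .
    have "s (f + g) = el (m (c' * a + c * a')) (m (c' * b + c * b')) / poly (m (c * c')) u"
      unfolding fg_sum by (rule s_eq) (use f g in \<open>simp_all add: P_intros\<close>)
    also have "\<dots> = (poly (m c') u * el (m a) (m b) + poly (m c) u * el (m a') (m b')) / (poly (m c) u * poly (m c') u)"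
      using f g by (simp add: m_add m_mult P_intros el_smult el_add)
    also have "\<dots> = s f + s g"
      unfolding f(5) g(5) s_eq[OF f(1-4)] s_eq[OF g(1-4)] using nn(3,4)
      by (simp add: add_frac_eq mult.commute)
    finally show "s (f + g) = s f + s g" .
    have fg_prod: "f * g = el (a * a' + crv_poly * (b * b')) (a * b' + a' * b) / poly (c * c') u"
      using f(5) g(5) by (simp add: el_mult)
    have "s (f * g) = el (m (a * a' + crv_poly * (b * b'))) (m (a * b' + a' * b)) / poly (m (c * c')) u"
      unfolding fg_prod by (rule s_eq) (use f g crv_poly_pover[OF subfield_Qbar] in \<open>simp_all add: P_intros\<close>)
    also have "\<dots> = (el (m a) (m b) * el (m a') (m b')) / (poly (m c) u * poly (m c') u)"
    proof -
      have "m crv_poly = crv_poly"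
        using m_fix crv_poly_pover[OF K(1)] by blast
      then show ?thesis
        using f g crv_poly_pover[OF subfield_Qbar] by (simp add: m_add m_mult P_intros el_mult)
    qed
    also have "\<dots> = s f * s g"
      using f g by (simp add: s_eq)
    finally show "s (f * g) = s f * s g" .
  qed
  have s_FF: "s f = f" if mem: "f \<in> FF K" for f
  proof -
    obtain a b c where f: "a \<in> pover K" "b \<in> pover K" "c \<in> pover K" "c \<noteq> 0" "f = el a b / poly c u"
      using FF_E[OF mem] .
    then show ?thesis
      using s_eq[of a b c] m_fix pover_mono[OF K(2)] by auto
  qed
  have s1: "s 1 = 1"
    by (rule s_FF[OF sf_1[OF subfield_FF[OF K]]])
  have es: "embedding F s"
    unfolding embedding_def using subfield_F s1 s_add s_mult by blast
  have sF: "s f \<in> F" if mem: "f \<in> F" for f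
  proof -
    obtain a b c where f: "a \<in> pover Qbar" "b \<in> pover Qbar" "c \<in> pover Qbar" "c \<noteq> 0" "f = el a b / poly c u"
      using FF_E[OF mem] .
    then show ?thesis
      using s_eq[of a b c] FF_I[of "m a" Qbar "m b" "m c"] mp m0 by simp
  qed
  have surj: "\<exists>g\<in>F. s g = f" if mem: "f \<in> F" for f
  proof -
    obtain a b c where f: "a \<in> pover Qbar" "b \<in> pover Qbar" "c \<in> pover Qbar" "c \<noteq> 0" "f = el a b / poly c u"
      using FF_E[OF mem] .
    obtain a' b' c' where g: "a' \<in> pover Qbar" "b' \<in> pover Qbar" "c' \<in> pover Qbar" "m a' = a" "m b' = b" "m c' = c"
      using m_surj f(1-3) by metis
    have "c' \<noteq> 0"
      using g f(4) m0 by auto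
    then show ?thesis
      using s_eq[OF g(1-3)] g f(5) FF_I[OF g(1-3)] by auto
  qed
  have "bij_betw s F F"
    using sF surj embedding_inj[OF es] by (auto simp: bij_betw_def inj_on_def image_iff)
  then have "s \<in> field_auts F (FF K)"
    using sF s_add s_mult s1 s_FF by (auto simp: field_auts_def ring_iso_def ring_hom_def)
  moreover have "s c = t c" if "c \<in> Qbar" for c
  proof -
    have "s (el [:c:] 0 / poly 1 u) = el (m [:c:]) (m 0) / poly (m 1) u"
      using that by (intro s_eq pover_pCons that pover_0 pover_1 subfield_Qbar) auto
    then show ?thesis
      by (simp add: m_def map_poly_embedding_const[OF e] map_poly_embedding_1[OF e] el_def)
  qed
  ultimately show ?thesis
    using that by blast
qed

text \<open>An invariant class belongs to a point whose coordinates are fixed by every automorphism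
  of Qbar over \<open>K\<close>, hence lie in \<open>K\<close> by
  \<open>fixed_field_gal\<close>.\<close>

lemma invariant_classes:
  assumes K: "subfield K CC" "K \<subseteq> Qbar"
  shows "{C \<in> carrier (Pic0 Qbar F). \<forall>s\<in>field_auts F (FF K). act_div F s ` C = C} = kap ` epts K"
proof -
  have KQ: "P \<in> epts Qbar" if "P \<in> epts K" for P
    using that K(2) by (cases P) auto
  have "(\<forall>s\<in>field_auts F (FF K). act_div F s ` kap P = kap P) \<longleftrightarrow> P \<in> epts K" if P: "P \<in> epts Qbar" for P
  proof
    assume "P \<in> epts K"
    then show "\<forall>s\<in>field_auts F (FF K). act_div F s ` kap P = kap P"
      using kap_invariant_iff[OF K _ P] field_auts_embedding(3)[OF K] point_map_fixed by blast
  next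
    assume inv: "\<forall>s\<in>field_auts F (FF K). act_div F s ` kap P = kap P"
    show "P \<in> epts K"
    proof (cases P)
      case (Affine x y)
      have fx: "t x = x \<and> t y = y" if t: "t \<in> gal K" for t
      proof -
        obtain s where s: "s \<in> field_auts F (FF K)" "\<And>c. c \<in> Qbar \<Longrightarrow> s c = t c"
          using gal_extends[OF K t] by metis
        have "point_map s P = P"
          using inv kap_invariant_iff[OF K s(1) P] s(1) by blast
        then show ?thesis
          using s(2) P Affine by auto
      qed
      have "z \<in> K" if "z \<in> Qbar" "\<forall>t\<in>gal K. t z = z" for z
        using fixed_field_gal[OF K that(1)] that(2) by blast
      then show ?thesis
        using fx P Affine by auto
    qed simp
  qed
  then show ?thesis
    unfolding carrier_Pic0 using KQ by auto
qed

lemma J1_points_eq: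
  assumes "X1_field Qbar j P Q = F" "X1_field K j P Q = FF K" "subfield K CC" "K \<subseteq> Qbar"
  shows "J1_points j P Q K = (Pic0 Qbar F)\<lparr>carrier := kap ` epts K\<rparr>"
  using invariant_classes[OF assms(3,4)] by (simp add: J1_points_def assms(1,2) Let_def)

end

section \<open>The function field of \<open>X\<^sub>1(2,10)\<close>\<close>

lemma ej_add_Infinity [simp]: "ej_add j R Infinity = R"
  by (cases R) auto

lemma ej_points_simps [simp]: "Infinity \<in> ej_points j"
  "Affine x y \<in> ej_points j \<longleftrightarrow> y\<^sup>2 = x ^ 3 + ej_coeff j * x + ej_coeff j"
  by (auto simp: ej_points_def)

text \<open>One description for chords and tangents: slope and symmetric functions of the three
  abscissae. The sum is written with ordinate \<open>- y3\<close> so that \<open>(x3, y3)\<close> is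
  the third point on the line.\<close>

lemma ej_line:
  assumes 1: "Affine x1 y1 \<in> ej_points j" and 2: "Affine x2 y2 \<in> ej_points j"
    and sum: "ej_add j (Affine x1 y1) (Affine x2 y2) = Affine x3 (- y3)"
  obtains l where "y2 = y1 + l * (x2 - x1)" "y3 = y1 + l * (x3 - x1)" "x1 + x2 + x3 = l\<^sup>2"
    "x1 * x2 + x1 * x3 + x2 * x3 = ej_coeff j - 2 * l * (y1 - l * x1)"
proof -
  define A where "A = ej_coeff j"
  have c: "y1\<^sup>2 = x1 ^ 3 + A * x1 + A" "y2\<^sup>2 = x2 ^ 3 + A * x2 + A"
    using 1 2 by (simp_all add: A_def)
  have ne: "\<not> (x1 = x2 \<and> y1 = - y2)"
    using sum by (auto split: if_splits)
  define l where "l = (if x1 = x2 then (3 * x1\<^sup>2 + A) / (2 * y1) else (y2 - y1) / (x2 - x1))"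
  have "ej_add j (Affine x1 y1) (Affine x2 y2) = Affine (l\<^sup>2 - x1 - x2) (l * (x1 - (l\<^sup>2 - x1 - x2)) - y1)"
    using ne by (simp add: l_def A_def Let_def)
  then have x3: "x3 = l\<^sup>2 - x1 - x2" and "- y3 = l * (x1 - x3) - y1"
    using sum by auto
  then have y3: "y3 = y1 + l * (x3 - x1)"
    by (simp add: eq_diff_eq algebra_simps minus_equation_iff[of y3])
  have "y2 = y1 + l * (x2 - x1) \<and> x1\<^sup>2 + x1 * x2 + x2\<^sup>2 + A = l * (y1 + y2)"
  proof (cases "x1 = x2")
    case True
    have "(y1 - y2) * (y1 + y2) = 0"
      using c True by (simp add: power2_eq_square algebra_simps)
    moreover have "y1 + y2 \<noteq> 0"
      using ne True by (simp add: eq_neg_iff_add_eq_0)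
    ultimately have "y2 = y1" "y1 \<noteq> 0"
      by auto
    then have "l * (2 * y1) = 3 * x1\<^sup>2 + A"
      using True by (simp add: l_def)
    then show ?thesis
      using True \<open>y2 = y1\<close> by (simp add: power2_eq_square algebra_simps)
  next
    case False
    then have y2: "y2 = y1 + l * (x2 - x1)"
      by (simp add: l_def)
    have "(x1 - x2) * (x1\<^sup>2 + x1 * x2 + x2\<^sup>2 + A - l * (y1 + y2)) = 0"
      using c y2 by Groebner_Basis.algebra
    then show ?thesis
      using False y2 by simp
  qed
  then have y2: "y2 = y1 + l * (x2 - x1)" and R: "x1\<^sup>2 + x1 * x2 + x2\<^sup>2 + A = l * (y1 + y2)"
    by auto
  have "x1 + x2 + x3 = l\<^sup>2"
    using x3 by simp
  moreover have "x1 * x2 + x1 * x3 + x2 * x3 = A - 2 * l * (y1 - l * x1)"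
    using R y2 x3 by Groebner_Basis.algebra
  ultimately show ?thesis
    using that[of l] y2 y3 by (simp add: A_def)
qed

lemma ej_add_closed:
  assumes "R \<in> ej_points j" "S \<in> ej_points j"
  shows "ej_add j R S \<in> ej_points j"
proof (cases "R = Infinity \<or> S = Infinity \<or> ej_add j R S = Infinity")
  case True
  then show ?thesis
    using assms by auto
next
  case False
  then obtain x1 y1 x2 y2 x3 y3 where pts: "R = Affine x1 y1" "S = Affine x2 y2" "ej_add j R S = Affine x3 (- y3)"
    by (metis point.exhaust minus_minus)
  define A where "A = ej_coeff j"
  obtain l where l: "y2 = y1 + l * (x2 - x1)" "y3 = y1 + l * (x3 - x1)" "x1 + x2 + x3 = l\<^sup>2"
    "x1 * x2 + x1 * x3 + x2 * x3 = A - 2 * l * (y1 - l * x1)"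
    using ej_line[of x1 y1 j x2 y2 x3 y3] assms pts unfolding A_def by metis
  have "y1\<^sup>2 = x1 ^ 3 + A * x1 + A"
    using assms(1) pts by (simp add: A_def)
  then have "y3\<^sup>2 = x3 ^ 3 + A * x3 + A"
    using l by Groebner_Basis.algebra
  then show ?thesis
    using pts by (simp add: A_def)
qed

lemma ej_mult_0 [simp]: "ej_mult j 0 R = Infinity"
  by (simp add: ej_mult_def)

lemma ej_mult_Suc: "ej_mult j (Suc n) R = ej_add j R (ej_mult j n R)"
  by (simp add: ej_mult_def)

lemma ej_mult_closed: "R \<in> ej_points j \<Longrightarrow> ej_mult j n R \<in> ej_points j"
  by (induction n) (auto simp: ej_mult_Suc ej_add_closed)

text \<open>Three points on a line add up to zero in every order. This replaces associativity in the
  passage from \<open>10 P = 0\<close> to \<open>5 P = - 5 P\<close>.\<close>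

lemma ej_add_collinear:
  assumes P: "Affine x1 y1 \<in> ej_points j" "y1 \<noteq> 0" and R: "Affine x2 y2 \<in> ej_points j"
    and sum: "ej_add j (Affine x1 y1) (Affine x2 y2) = Affine x3 (- y3)"
  shows "ej_add j (Affine x1 y1) (Affine x3 y3) = Affine x2 (- y2)"
proof -
  define A where "A = ej_coeff j"
  obtain l where l: "y2 = y1 + l * (x2 - x1)" "y3 = y1 + l * (x3 - x1)" "x1 + x2 + x3 = l\<^sup>2"
    "x1 * x2 + x1 * x3 + x2 * x3 = A - 2 * l * (y1 - l * x1)"
    using ej_line[OF P(1) R sum] unfolding A_def by metis
  have ne: "\<not> (x1 = x3 \<and> y1 = - y3)"
    using l(2) P(2) by auto
  define l' where "l' = (if x1 = x3 then (3 * x1\<^sup>2 + A) / (2 * y1) else (y3 - y1) / (x3 - x1))"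
  have "l' = l"
  proof (cases "x1 = x3")
    case True
    have "3 * x1\<^sup>2 + A = l * (2 * y1)"
      using l True by Groebner_Basis.algebra
    then show ?thesis
      using True P(2) by (simp add: l'_def)
  next
    case False
    then show ?thesis
      using l(2) by (simp add: l'_def)
  qed
  moreover have "ej_add j (Affine x1 y1) (Affine x3 y3) = Affine (l'\<^sup>2 - x1 - x3) (l' * (x1 - (l'\<^sup>2 - x1 - x3)) - y1)"
    using ne by (simp add: l'_def A_def Let_def)
  moreover have "l\<^sup>2 - x1 - x3 = x2"
    using l(3)[symmetric] by simp
  ultimately show ?thesis
    using l(1) by (simp add: algebra_simps)
qed

text \<open>From \<open>10 P = 0\<close> follow in turn \<open>9 P = - P\<close>,
  \<open>8 P = - 2 P\<close>, \<open>7 P = - 3 P\<close>, \<open>6 P = - 4 P\<close> and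
  \<open>5 P = - 5 P\<close>. Each relation reorders the three collinear points of one addition of
  \<open>P\<close>.\<close>

lemma ej_order_10:
  assumes P: "P \<in> ej_points j" and nz: "\<And>n. n \<in> {1..9} \<Longrightarrow> ej_mult j n P \<noteq> Infinity"
    and ten: "ej_mult j 10 P = Infinity"
  shows "\<exists>x. ej_mult j 5 P = Affine x 0"
proof -
  have "\<exists>x y. ej_mult j n P = Affine x y" if "n \<in> {1..9}" for n
    using nz[OF that] by (cases "ej_mult j n P") auto
  then obtain xx yy where n: "\<And>n. n \<in> {1..9} \<Longrightarrow> ej_mult j n P = Affine (xx n) (yy n)"
    by metis
  have s: "ej_mult j (Suc n) P = ej_add j P (ej_mult j n P)" for n
    by (rule ej_mult_Suc)
  have P1: "P = Affine (xx 1) (yy 1)"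
    using n[of 1] s[of 0] by simp
  have pts: "Affine (xx k) (yy k) \<in> ej_points j" if "k \<in> {1..9}" for k
    using ej_mult_closed[OF P, of k] n[OF that] by simp
  have st: "ej_add j P (Affine (xx k) (yy k)) = Affine (xx (Suc k)) (yy (Suc k))" if "k \<in> {1..8}" for k
    using s[of k] n[of k] n[of "Suc k"] that by simp
  have y1: "yy 1 \<noteq> 0"
    using nz[of 2] s[of 1] n[of 1] P1 by (auto simp: numeral_2_eq_2)
  have col: "Affine (xx (Suc i)) (yy (Suc i)) = Affine (xx k) (- yy k)"
    if "Affine (xx (Suc k)) (yy (Suc k)) = Affine (xx i) (- yy i)" "k \<in> {1..8}" "i \<in> {1..8}" for k i
  proof -
    have "ej_add j P (Affine (xx k) (yy k)) = Affine (xx i) (- yy i)"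
      using st[OF that(2)] that(1) by simp
    then have "ej_add j P (Affine (xx i) (yy i)) = Affine (xx k) (- yy k)"
      using ej_add_collinear[OF pts[of 1] y1 pts[of k]] P1 that by simp
    then show ?thesis
      using st[OF that(3)] by simp
  qed
  have "ej_add j P (Affine (xx 9) (yy 9)) = Infinity"
    using ten s[of 9] n[of 9] by simp
  then have "Affine (xx (Suc 8)) (yy (Suc 8)) = Affine (xx 1) (- yy 1)"
    using P1 by (auto split: if_splits simp: Let_def)
  from col[OF this] have "Affine (xx (Suc 7)) (yy (Suc 7)) = Affine (xx 2) (- yy 2)"
    by (simp add: numeral_2_eq_2)
  from col[OF this] have "Affine (xx (Suc 6)) (yy (Suc 6)) = Affine (xx 3) (- yy 3)"
    by (simp add: numeral_3_eq_3)
  from col[OF this] have "Affine (xx (Suc 5)) (yy (Suc 5)) = Affine (xx 4) (- yy 4)"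
    by simp
  from col[OF this] have "Affine (xx 5) (yy 5) = Affine (xx 5) (- yy 5)"
    by simp
  then have "yy 5 = 0"
    by simp
  then show ?thesis
    using n[of 5] by simp
qed

section \<open>The Tate normal form of a curve with a point of order 10\<close>

lemma ej_add_secant:
  assumes "x1 \<noteq> x2"
  shows "ej_add j (Affine x1 y1) (Affine x2 y2) =
    Affine (((y2 - y1) / (x2 - x1))\<^sup>2 - x1 - x2) ((y2 - y1) / (x2 - x1) * (x1 - (((y2 - y1) / (x2 - x1))\<^sup>2 - x1 - x2)) - y1)"
  using assms by (simp add: Let_def)

text \<open>The point with coordinates \<open>(r, s)\<close> on the Tate normal form
  \<open>y\<^sup>2 + (1 - c) x y - b y = x\<^sup>3 - b x\<^sup>2\<close>, moved to the short Weierstrass form scaled by \<open>\<rho>\<close>.\<close>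

definition tate :: "complex \<Rightarrow> complex \<Rightarrow> complex \<Rightarrow> complex \<Rightarrow> complex \<Rightarrow> point" where
  "tate \<rho> b c r s = Affine (\<rho>\<^sup>2 * (((1 - c)\<^sup>2 / 4 - b) / 3 + r)) (\<rho> ^ 3 * (s + (1 - c) / 2 * r - b / 2))"

text \<open>On the Tate form the chord from the origin to \<open>(r, s)\<close> is
  \<open>y = t x\<close>. Its three abscissae add up to \<open>t\<^sup>2 + (1 - c) * t + b\<close>,
  and negation sends \<open>y\<close> to \<open>b - y - (1 - c) x\<close>.\<close>

lemma tate_add:
  assumes "\<rho> \<noteq> 0" "r \<noteq> 0" "s = t * r" "r' = t\<^sup>2 + (1 - c) * t + b - r" "s' = b - (t + (1 - c)) * r'"
  shows "ej_add j (tate \<rho> b c 0 0) (tate \<rho> b c r s) = tate \<rho> b c r' s'"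
proof -
  define x where "x = ((1 - c)\<^sup>2 / 4 - b) / 3"
  define l where "l = \<rho> * (t + (1 - c) / 2)"
  have x3: "3 * x = (1 - c)\<^sup>2 / 4 - b"
    by (simp add: x_def)
  have ne: "\<rho>\<^sup>2 * (x + 0) \<noteq> \<rho>\<^sup>2 * (x + r)"
    using assms by simp
  have "(\<rho> ^ 3 * (s + (1 - c) / 2 * r - b / 2) - \<rho> ^ 3 * (0 + (1 - c) / 2 * 0 - b / 2)) = l * (\<rho>\<^sup>2 * (x + r) - \<rho>\<^sup>2 * (x + 0))"
    unfolding assms(3) l_def by (simp add: algebra_simps power2_eq_square power3_eq_cube)
  then have l: "(\<rho> ^ 3 * (s + (1 - c) / 2 * r - b / 2) - \<rho> ^ 3 * (0 + (1 - c) / 2 * 0 - b / 2)) / (\<rho>\<^sup>2 * (x + r) - \<rho>\<^sup>2 * (x + 0)) = l"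
    using ne by (simp add: divide_eq_eq)
  have a: "l\<^sup>2 - \<rho>\<^sup>2 * (x + 0) - \<rho>\<^sup>2 * (x + r) = \<rho>\<^sup>2 * (x + r')"
  proof -
    have "l\<^sup>2 - \<rho>\<^sup>2 * (x + 0) - \<rho>\<^sup>2 * (x + r) = \<rho>\<^sup>2 * ((t + (1 - c) / 2)\<^sup>2 - 3 * x + x - r)"
      unfolding l_def power_mult_distrib by (simp only: algebra_simps) simp
    also have "\<dots> = \<rho>\<^sup>2 * (x + r')"
      unfolding x3 assms(4) by (simp add: power2_eq_square field_simps)
    finally show ?thesis .
  qed
  have b: "l * (\<rho>\<^sup>2 * (x + 0) - \<rho>\<^sup>2 * (x + r')) - \<rho> ^ 3 * (0 + (1 - c) / 2 * 0 - b / 2) = \<rho> ^ 3 * (s' + (1 - c) / 2 * r' - b / 2)"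
    unfolding assms(5) l_def by (simp add: power2_eq_square power3_eq_cube field_simps)
  show ?thesis
    unfolding tate_def x_def[symmetric] ej_add_secant[OF ne] l a b ..
qed

text \<open>This is Kubert's parametrisation. The multiples of \<open>P\<close>, placed at the
  origin, become simple in \<open>b\<close>, \<open>c\<close> and the successive quotients
  \<open>d = b / c\<close> and \<open>f = c / (d - 1)\<close>; the denominators are not 0 because
  \<open>4 P\<close> and \<open>5 P\<close> are not. That \<open>5 P\<close> has order 2 is an
  equation linear in \<open>d\<close>, which leaves \<open>f\<close> as the parameter.\<close>

lemma tate_chain:
  assumes P: "P \<in> ej_points j" and nz: "\<And>n. n \<in> {1..9} \<Longrightarrow> ej_mult j n P \<noteq> Infinity"
    and ten: "ej_mult j 10 P = Infinity"
  obtains \<rho> f d b c where "\<rho> \<noteq> 0" "b \<noteq> 0" "f \<noteq> 0" "f \<noteq> 1" "2 * f - 1 \<noteq> 0" "f - (f - 1)\<^sup>2 \<noteq> 0"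
    "d * (f - (f - 1)\<^sup>2) = f\<^sup>2" "c = f * (d - 1)" "b = c * d" "d \<noteq> 1"
    "P = tate \<rho> b c 0 0" "ej_mult j 2 P = tate \<rho> b c b (b * c)" "ej_mult j 4 P = tate \<rho> b c (d * (d - 1)) (d\<^sup>2 * (c - d + 1))"
    "ej_mult j 5 P = Affine (\<rho>\<^sup>2 * (((1 - c)\<^sup>2 / 4 - b) / 3 + f * d * (f - 1))) 0"
    "ej_coeff j = \<rho> ^ 4 * (- b * (1 - c) / 2 - ((1 - c)\<^sup>2 / 4 - b)\<^sup>2 / 3)"
proof -
  have m: "ej_mult j (Suc n) P = ej_add j P (ej_mult j n P)" for n
    by (rule ej_mult_Suc)
  obtain x0 y0 where P0: "P = Affine x0 y0"
    using nz[of 1] m[of 0] by (cases P) auto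
  define A where "A = ej_coeff j"
  have m1: "ej_mult j 1 P = P"
    using m[of 0] by simp
  have m2: "ej_mult j 2 P = ej_add j P P"
    using m[of 1] m1 by (simp add: numeral_2_eq_2)
  have y0: "y0 \<noteq> 0"
    using nz[of 2] m2 P0 by auto
  \<comment> \<open>\<open>l\<close> is the slope of the tangent at \<open>P\<close>, and
    \<open>a\<close> is the abscissa of \<open>P\<close> minus that of \<open>2 P\<close>.\<close>
  define l where "l = (3 * x0\<^sup>2 + A) / (2 * y0)"
  define a where "a = 3 * x0 - l\<^sup>2"
  have l: "l * (2 * y0) = 3 * x0\<^sup>2 + A"
    using y0 by (simp add: l_def)
  have dbl: "ej_add j P P = Affine (l\<^sup>2 - x0 - x0) (l * (x0 - (l\<^sup>2 - x0 - x0)) - y0)"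
    using P0 y0 by (simp add: l_def A_def Let_def)
  \<comment> \<open>\<open>a = 0\<close> would mean \<open>2 P = - P\<close>, hence
    \<open>3 P = 0\<close>.\<close>
  have a0: "a \<noteq> 0"
  proof
    assume "a = 0"
    then have "l\<^sup>2 = 3 * x0"
      by (simp add: a_def)
    then have "ej_mult j 2 P = Affine x0 (- y0)"
      using m2 dbl by simp
    then have "ej_mult j 3 P = Infinity"
      using m[of 2] P0 by (simp add: numeral_3_eq_3 numeral_2_eq_2)
    then show False
      using nz[of 3] by simp
  qed
  \<comment> \<open>Found by comparison with the Tate form, where the tangent at the origin is
    horizontal and \<open>2 P\<close> has abscissa \<open>b\<close>: after the change of coordinates
    the slope is \<open>\<rho> * (1 - c) / 2\<close>, the abscissae of \<open>P\<close> and
    \<open>2 P\<close> differ by \<open>\<rho>\<^sup>2 * b\<close>, and \<open>P\<close> has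
    ordinate \<open>- (\<rho> ^ 3 * b / 2)\<close>.\<close>
  define \<rho> where "\<rho> = 2 * y0 / a"
  define b where "b = - a / \<rho>\<^sup>2"
  define c where "c = 1 - 2 * l / \<rho>"
  have L0: "\<rho> \<noteq> 0"
    using y0 a0 by (simp add: \<rho>_def)
  have b0: "b \<noteq> 0"
    using a0 L0 by (simp add: b_def)
  have la: "l = \<rho> * ((1 - c) / 2)"
    using L0 by (simp add: c_def)
  have ab: "a = - \<rho>\<^sup>2 * b"
    using L0 by (simp add: b_def)
  have "2 * y0 = \<rho> * a"
    using a0 by (simp add: \<rho>_def)
  then have "y0 = \<rho> * a / 2"
    by (simp add: mult.commute)
  then have yb: "y0 = - (\<rho> ^ 3 * b / 2)"
    unfolding ab by (simp add: power2_eq_square power3_eq_cube)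
  have xb: "x0 = \<rho>\<^sup>2 * (((1 - c)\<^sup>2 / 4 - b) / 3)"
    using a_def unfolding ab la by (simp add: power2_eq_square field_simps)
  have Pt: "P = tate \<rho> b c 0 0"
    unfolding P0 tate_def by (simp add: xb yb)
  have Ab: "A = \<rho> ^ 4 * (- b * (1 - c) / 2 - ((1 - c)\<^sup>2 / 4 - b)\<^sup>2 / 3)"
  proof -
    have "A = 2 * l * y0 - 3 * x0\<^sup>2"
      using l by Groebner_Basis.algebra
    also have "\<dots> = \<rho> ^ 4 * (- b * (1 - c) / 2 - ((1 - c)\<^sup>2 / 4 - b)\<^sup>2 / 3)"
      unfolding la yb xb by (simp add: power2_eq_square power3_eq_cube power4_eq_xxxx field_simps)
    finally show ?thesis .
  qed
  \<comment> \<open>On the Tate form \<open>(0, b)\<close> is the negative of the origin.\<close>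
  have neg: "ej_add j P (tate \<rho> b c 0 b) = Infinity"
    unfolding Pt by (simp add: tate_def)
  have two: "ej_mult j 2 P = tate \<rho> b c b (b * c)"
  proof -
    have "l\<^sup>2 - x0 - x0 = \<rho>\<^sup>2 * (((1 - c)\<^sup>2 / 4 - b) / 3 + b)"
      using ab by (simp add: a_def xb la power2_eq_square field_simps)
    moreover from this have "l * (x0 - (l\<^sup>2 - x0 - x0)) - y0 = \<rho> ^ 3 * (b * c + (1 - c) / 2 * b - b / 2)"
      by (simp only: xb la yb) (simp add: power2_eq_square power3_eq_cube field_simps)
    ultimately show ?thesis
      unfolding m2 dbl tate_def by simp
  qed
  have three: "ej_mult j 3 P = tate \<rho> b c c (b - c)"
    using tate_add[OF L0 b0, of "b * c" c c c b "b - c" j] m[of 2] two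
    by (simp add: Pt numeral_3_eq_3 numeral_2_eq_2 power2_eq_square algebra_simps)
  have c0: "c \<noteq> 0"
  proof
    assume "c = 0"
    then have "ej_mult j 4 P = Infinity"
      using m[of 3] three neg by (simp add: eval_nat_numeral)
    then show False
      using nz[of 4] by simp
  qed
  define d where "d = b / c"
  have bc: "b = c * d" and d0: "d \<noteq> 0"
    using c0 b0 by (auto simp: d_def)
  have four: "ej_mult j 4 P = tate \<rho> b c (d * (d - 1)) (d\<^sup>2 * (c - d + 1))"
  proof -
    have "ej_add j (tate \<rho> b c 0 0) (tate \<rho> b c c (b - c)) = tate \<rho> b c (d * (d - 1)) (d\<^sup>2 * (c - d + 1))"
      by (rule tate_add[OF L0 c0, where t = "d - 1"]) (simp_all add: bc power2_eq_square algebra_simps)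
    then show ?thesis
      using m[of 3] three Pt by (simp add: eval_nat_numeral)
  qed
  have d1: "d \<noteq> 1"
  proof
    assume "d = 1"
    then have "ej_mult j 5 P = Infinity"
      using m[of 4] four neg by (simp add: bc eval_nat_numeral)
    then show False
      using nz[of 5] by simp
  qed
  define f where "f = c / (d - 1)"
  have cf: "c = f * (d - 1)" and f0: "f \<noteq> 0"
    using d1 c0 by (auto simp: f_def)
  define t where "t = d * (f - 1)"
  define r where "r = f * d * (f - 1)"
  have five: "ej_mult j 5 P = tate \<rho> b c r (b - (t + (1 - c)) * r)"
  proof -
    have "ej_add j (tate \<rho> b c 0 0) (tate \<rho> b c (d * (d - 1)) (d\<^sup>2 * (c - d + 1))) = tate \<rho> b c r (b - (t + (1 - c)) * r)"
    proof (rule tate_add[OF L0, where t = t])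
      show "d * (d - 1) \<noteq> 0"
        using d0 d1 by simp
      show "d\<^sup>2 * (c - d + 1) = t * (d * (d - 1))" "r = t\<^sup>2 + (1 - c) * t + b - d * (d - 1)"
        by (simp_all add: cf bc t_def r_def power2_eq_square algebra_simps)
    qed simp
    then show ?thesis
      using m[of 4] four Pt by (simp add: eval_nat_numeral)
  qed
  obtain x5 where "ej_mult j 5 P = Affine x5 0"
    using ej_order_10[OF P nz ten] by blast
  then have five': "ej_mult j 5 P = Affine (\<rho>\<^sup>2 * (((1 - c)\<^sup>2 / 4 - b) / 3 + r)) 0"
    and y5: "b - (t + (1 - c)) * r + (1 - c) / 2 * r - b / 2 = 0"
    using five L0 by (auto simp: tate_def)
  have "b = (2 * t + (1 - c)) * r"
    using y5 by (simp add: field_simps) Groebner_Basis.algebra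
  then have "f * d * (d - 1) = f * d * ((2 * d * (f - 1) + 1 - f * (d - 1)) * (f - 1))"
    by (simp add: bc cf t_def r_def algebra_simps)
  then have "d - 1 = (2 * d * (f - 1) + 1 - f * (d - 1)) * (f - 1)"
    using f0 d0 by (simp only: mult_cancel_left) simp
  then have df: "d * (f - (f - 1)\<^sup>2) = f\<^sup>2"
    by Groebner_Basis.algebra
  then have D0: "f - (f - 1)\<^sup>2 \<noteq> 0"
    using f0 by (intro notI) simp
  have "(d - 1) * (f - (f - 1)\<^sup>2) = (2 * f - 1) * (f - 1)"
    using df by Groebner_Basis.algebra
  then have f1: "f \<noteq> 1" "2 * f - 1 \<noteq> 0"
    using d1 D0 by auto
  show ?thesis
    using that[of \<rho> b f d c] L0 b0 f0 f1 D0 df cf bc d1 Pt two four five' Ab by (simp add: r_def A_def)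
qed

text \<open>Solves the definition of the coefficient for \<open>j\<close>, which places
  \<open>j\<close> in every field that contains the coefficient.\<close>

lemma ej_coeff_inverse:
  assumes "j \<noteq> 1728"
  shows "j = 6912 * ej_coeff j / (4 * ej_coeff j + 27)"
proof -
  have j0: "4 * (j - 1728) \<noteq> 0"
    using assms by simp
  have "ej_coeff j * (4 * (j - 1728)) = - (27 * j)"
    unfolding ej_coeff_def by (rule nonzero_eq_divide_eq[THEN iffD1, OF j0 refl])
  then have eq: "j * (4 * ej_coeff j + 27) = 6912 * ej_coeff j"
    by (simp add: algebra_simps)
  have "4 * ej_coeff j + 27 \<noteq> 0"
  proof
    assume "4 * ej_coeff j + 27 = 0"
    moreover from this have "ej_coeff j = 0"
      using eq by simp
    ultimately show False
      by simp
  qed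
  then show ?thesis
    using eq by (simp add: eq_divide_eq)
qed

text \<open>These are the \<open>L\<close>-rational points of the quadratic twist by
  \<open>y0\<^sup>2\<close>. Multiples of \<open>P\<close> have abscissae in \<open>L\<close>, but
  their ordinates lie in \<open>L\<close> only up to the common factor \<open>y0\<close>.\<close>

lemma ej_twisted_subgroup:
  assumes L: "subfield L CC" and A: "ej_coeff j \<in> L" and y0: "y0\<^sup>2 \<in> L" "y0 \<noteq> 0"
    and S: "S = insert Infinity {Affine x (y0 * z) | x z. x \<in> L \<and> z \<in> L}"
    and RT: "R \<in> S" "T \<in> S"
  shows "ej_add j R T \<in> S"
proof (cases "R = Infinity \<or> T = Infinity \<or> ej_add j R T = Infinity")
  case True
  then show ?thesis
    using RT S by auto
next
  case False
  then obtain x1 z1 x2 z2 where pts: "R = Affine x1 (y0 * z1)" "T = Affine x2 (y0 * z2)"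
    and mem: "x1 \<in> L" "z1 \<in> L" "x2 \<in> L" "z2 \<in> L"
    using RT S by auto
  define l where "l = (if x1 = x2 then (3 * x1\<^sup>2 + ej_coeff j) / (2 * y0\<^sup>2 * z1) else (z2 - z1) / (x2 - x1))"
  have lL: "l \<in> L"
    unfolding l_def using mem A y0 by (auto intro!: sf_intros[OF L])
  have ne: "\<not> (x1 = x2 \<and> y0 * z1 = - (y0 * z2))"
    using False pts by auto
  have l: "(if x1 = x2 then (3 * x1\<^sup>2 + ej_coeff j) / (2 * (y0 * z1)) else (y0 * z2 - y0 * z1) / (x2 - x1)) = y0 * l"
    using y0(2) by (simp add: l_def power2_eq_square right_diff_distrib)
  define x3 where "x3 = y0\<^sup>2 * l\<^sup>2 - x1 - x2"
  have "x3 \<in> L"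
    unfolding x3_def using mem y0 lL by (auto intro!: sf_intros[OF L])
  moreover have "ej_add j R T = Affine x3 (y0 * (l * (x1 - x3) - z1))"
    unfolding pts ej_add.simps l Let_def x3_def using ne by (simp add: power_mult_distrib algebra_simps)
  moreover have "l * (x1 - x3) - z1 \<in> L"
    using lL mem calculation(1) by (auto intro!: sf_intros[OF L])
  ultimately show ?thesis
    using S by auto
qed

lemma X1_field_eq:
  assumes j: "\<not> algebraic j" and G: "gamma1_structure 2 5 j P Q"
  obtains u v where "curve_field u v" "\<forall>K. subfield K CC \<longrightarrow> K \<subseteq> Qbar \<longrightarrow> X1_field K j P Q = adjoin K {u, v}"
proof -
  define A where "A = ej_coeff j"
  have jQ: "j \<notin> Qbar"
    using j by (simp add: Qbar_def)
  have "j \<noteq> of_nat n" for n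
    using jQ sf_of_nat[OF subfield_Qbar, of n] by auto
  from this[of 0] this[of 1728] have j0: "j \<noteq> 0" "j \<noteq> 1728"
    by auto
  have A0: "A \<noteq> 0"
    using j0 by (simp add: A_def ej_coeff_def)
  have PQ: "P \<in> ej_points j" "Q \<in> ej_points j"
    and rel: "\<And>a b. ej_add j (ej_mult j a P) (ej_mult j b Q) = Infinity \<longleftrightarrow> 10 dvd a \<and> 2 dvd b"
    using G by (auto simp: gamma1_structure_def)
  have nz: "ej_mult j n P \<noteq> Infinity" if "n \<in> {1..9}" for n
    using rel[of n 0] that by (auto dest: dvd_imp_le)
  have ten: "ej_mult j 10 P = Infinity"
    using rel[of 10 0] by simp
  have Q1: "ej_mult j 1 Q = Q"
    using ej_mult_Suc[of j 0 Q] by simp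
  have Qne: "Q \<noteq> Infinity"
    using rel[of 0 1] Q1 by simp
  have "ej_add j Q Q = Infinity"
    using rel[of 0 2] ej_mult_Suc[of j 1 Q] Q1 by (simp add: numeral_2_eq_2)
  then obtain xq where xq: "Q = Affine xq 0"
    using Qne by (cases Q) (auto split: if_splits simp: Let_def)
  obtain \<rho> f d b c where R0: "\<rho> \<noteq> 0" and b0: "b \<noteq> 0" and f: "f \<noteq> 0" "f \<noteq> 1" "2 * f - 1 \<noteq> 0"
    and D0: "f - (f - 1)\<^sup>2 \<noteq> 0" and df: "d * (f - (f - 1)\<^sup>2) = f\<^sup>2" and cf: "c = f * (d - 1)" and bc: "b = c * d" and d1: "d \<noteq> 1"
    and P1: "P = tate \<rho> b c 0 0" and P2: "ej_mult j 2 P = tate \<rho> b c b (b * c)"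
    and P4: "ej_mult j 4 P = tate \<rho> b c (d * (d - 1)) (d\<^sup>2 * (c - d + 1))"
    and P5: "ej_mult j 5 P = Affine (\<rho>\<^sup>2 * (((1 - c)\<^sup>2 / 4 - b) / 3 + f * d * (f - 1))) 0"
    and Aeq: "ej_coeff j = \<rho> ^ 4 * (- b * (1 - c) / 2 - ((1 - c)\<^sup>2 / 4 - b)\<^sup>2 / 3)"
    by (rule tate_chain[OF PQ(1) nz ten])
  define D where "D = f - (f - 1)\<^sup>2"
  \<comment> \<open>\<open>e\<close> is the shift from the Tate form to the short Weierstrass form
    with coefficients \<open>a\<close> and \<open>k\<close>; \<open>\<xi>\<close> and
    \<open>r\<close> are the Tate abscissae of \<open>5 P\<close> and of \<open>Q\<close>.\<close>
  define e where "e = ((1 - c)\<^sup>2 / 4 - b) / 3"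
  define a where "a = - b * (1 - c) / 2 - 3 * e\<^sup>2"
  define k where "k = b\<^sup>2 / 4 - e ^ 3 - a * e"
  define \<xi> where "\<xi> = f * d * (f - 1)"
  define r where "r = xq / \<rho>\<^sup>2 - e"
  define p where "p = 4 * \<xi> + 12 * e"
  define u where "u = 2 * f - 1"
  \<comment> \<open>\<open>8 * r + p\<close> is four times the derivative at \<open>r\<close> of the
    quadratic that \<open>r\<close> satisfies, so its square is 16 times the discriminant. The
    factor \<open>D\<^sup>2 / u\<^sup>2\<close> removes the denominator and the square factor
    \<open>u ^ 4\<close>.\<close>
  define v where "v = (8 * r + p) * D\<^sup>2 / u\<^sup>2"
  have R2: "\<rho>\<^sup>2 \<noteq> 0"
    using R0 by simp
  have e12: "12 * e = (1 - c)\<^sup>2 - 4 * b"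
    by (simp add: e_def)
  have xqr: "xq = \<rho>\<^sup>2 * (e + r)"
    using R2 by (simp add: r_def)
  have P0: "P = Affine (\<rho>\<^sup>2 * e) (- (\<rho> ^ 3 * b / 2))"
    by (simp add: P1 tate_def e_def)
  have Aa: "A = \<rho> ^ 4 * a"
    by (simp add: A_def Aeq a_def e_def power_divide)
  have Ak: "A = \<rho> ^ 6 * k"
  proof -
    have "(- (\<rho> ^ 3 * b / 2))\<^sup>2 = (\<rho>\<^sup>2 * e) ^ 3 + A * (\<rho>\<^sup>2 * e) + A"
      using PQ(1) unfolding P0 by (simp add: A_def)
    moreover have "(- (\<rho> ^ 3 * b / 2))\<^sup>2 = \<rho> ^ 6 * (b\<^sup>2 / 4)" "(\<rho>\<^sup>2 * e) ^ 3 = \<rho> ^ 6 * e ^ 3"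
      by (simp_all add: power_mult_distrib power_divide flip: power_mult)
    moreover have "A * (\<rho>\<^sup>2 * e) = \<rho> ^ 6 * (a * e)"
      by (simp add: Aa eval_nat_numeral)
    ultimately have "\<rho> ^ 6 * (b\<^sup>2 / 4) = \<rho> ^ 6 * e ^ 3 + \<rho> ^ 6 * (a * e) + A"
      by (simp only:)
    then show ?thesis
      unfolding k_def right_diff_distrib by (simp only:)  simp
  qed
  have cubic: "z ^ 3 + 3 * e * z\<^sup>2 + (3 * e\<^sup>2 + a) * z + b\<^sup>2 / 4 = 0" if "Affine (\<rho>\<^sup>2 * (e + z)) 0 \<in> ej_points j" for z
  proof -
    have "0 = (\<rho>\<^sup>2 * (e + z)) ^ 3 + A * (\<rho>\<^sup>2 * (e + z)) + A"
      using that by (simp add: A_def)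
    also have "\<dots> = (\<rho>\<^sup>2 * (e + z)) ^ 3 + \<rho> ^ 4 * a * (\<rho>\<^sup>2 * (e + z)) + \<rho> ^ 6 * k"
      using Aa Ak by simp
    also have "\<dots> = \<rho> ^ 6 * (z ^ 3 + 3 * e * z\<^sup>2 + (3 * e\<^sup>2 + a) * z + b\<^sup>2 / 4)"
      by (simp add: k_def eval_nat_numeral algebra_simps)
    finally show ?thesis
      using R0 by simp
  qed
  have "Affine (\<rho>\<^sup>2 * (e + \<xi>)) 0 \<in> ej_points j"
    using ej_mult_closed[OF PQ(1), of 5] by (simp only: P5 e_def \<xi>_def)
  note cx = cubic[OF this]
  have "Affine (\<rho>\<^sup>2 * (e + r)) 0 \<in> ej_points j"
    using PQ(2) by (simp only: xq xqr)
  note cr = cubic[OF this]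
  have "r \<noteq> \<xi>"
  proof
    assume "r = \<xi>"
    then have "ej_mult j 5 P = Q"
      by (simp add: P5 xq xqr e_def \<xi>_def)
    then have "ej_add j (ej_mult j 5 P) (ej_mult j 1 Q) = Infinity"
      unfolding Q1 by (simp add: xq)
    then show False
      using rel[of 5 1] by simp
  qed
  have "(r - \<xi>) * (r\<^sup>2 + r * \<xi> + \<xi>\<^sup>2 + 3 * e * (r + \<xi>) + (3 * e\<^sup>2 + a)) = 0"
    using cx cr by Groebner_Basis.algebra
  then have quad: "r\<^sup>2 + r * \<xi> + \<xi>\<^sup>2 + 3 * e * (r + \<xi>) + (3 * e\<^sup>2 + a) = 0"
    using \<open>r \<noteq> \<xi>\<close> by simp
  have "3 * e\<^sup>2 + a = - (b * (1 - c) / 2)"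
    by (simp add: a_def)
  then have disc: "(8 * r + p)\<^sup>2 = p\<^sup>2 - 16 * (4 * \<xi>\<^sup>2 + 12 * e * \<xi> - 2 * b * (1 - c))"
    using quad unfolding p_def by (simp add: field_simps) Groebner_Basis.algebra
  have Dn0: "D \<noteq> 0"
    using D0 by (simp add: D_def)
  have u0: "u \<noteq> 0"
    using f by (simp add: u_def)
  have dD: "D * d = f\<^sup>2"
    using df by (simp add: D_def mult.commute)
  \<comment> \<open>Powers of \<open>D\<close> turn \<open>b\<close>, \<open>c\<close>,
    \<open>\<xi>\<close> and \<open>e\<close>, which are rational in \<open>f\<close>, into
    polynomials, so that the discriminant becomes a polynomial identity in \<open>f\<close>.\<close>
  have cD: "D * c = f * (f\<^sup>2 - D)"
    using dD by (simp add: cf algebra_simps)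
  have bD: "D\<^sup>2 * b = f ^ 3 * (f\<^sup>2 - D)"
    using dD cD unfolding bc by Groebner_Basis.algebra
  have xD: "D * \<xi> = f ^ 3 * (f - 1)"
    using dD unfolding \<xi>_def by Groebner_Basis.algebra
  have eD: "D\<^sup>2 * (12 * e) = (D - f * (f\<^sup>2 - D))\<^sup>2 - 4 * (f ^ 3 * (f\<^sup>2 - D))"
    unfolding e12 using bD cD by Groebner_Basis.algebra
  have pD: "D\<^sup>2 * p = 4 * (f ^ 3 * (f - 1) * D) + (D - f * (f\<^sup>2 - D))\<^sup>2 - 4 * (f ^ 3 * (f\<^sup>2 - D))"
    using xD eD unfolding p_def by Groebner_Basis.algebra
  have qD: "D ^ 3 * (4 * \<xi>\<^sup>2 + 12 * e * \<xi> - 2 * b * (1 - c)) =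
      4 * D * (f ^ 3 * (f - 1))\<^sup>2 + ((D - f * (f\<^sup>2 - D))\<^sup>2 - 4 * (f ^ 3 * (f\<^sup>2 - D))) * (f ^ 3 * (f - 1))
        - 2 * (f ^ 3 * (f\<^sup>2 - D)) * (D - f * (f\<^sup>2 - D))"
  proof -
    have "D ^ 3 * (4 * \<xi>\<^sup>2 + 12 * e * \<xi> - 2 * b * (1 - c)) =
        4 * D * (D * \<xi>)\<^sup>2 + (D\<^sup>2 * (12 * e)) * (D * \<xi>) - 2 * (D\<^sup>2 * b) * (D - D * c)"
      by (simp add: eval_nat_numeral algebra_simps)
    then show ?thesis
      by (simp only: xD eD bD cD)
  qed
  have "((8 * r + p) * D\<^sup>2)\<^sup>2 = (D\<^sup>2 * p)\<^sup>2 - 16 * (D * (D ^ 3 * (4 * \<xi>\<^sup>2 + 12 * e * \<xi> - 2 * b * (1 - c))))"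
    unfolding power_mult_distrib disc by (simp add: eval_nat_numeral algebra_simps)
  also have "\<dots> = u ^ 4 * (u ^ 3 + u\<^sup>2 - u)"
    unfolding pD qD unfolding D_def u_def by (simp add: eval_nat_numeral algebra_simps)
  finally have vsq: "v\<^sup>2 = crv u"
    using u0 by (simp add: v_def power_divide crv_def flip: power_mult)
  define y0 where "y0 = - (\<rho> ^ 3 * b / 2)"
  have y0n: "y0 \<noteq> 0"
    using R0 b0 by (simp add: y0_def)
  have main: "X1_field K j P Q = adjoin K {u, v}" if K: "subfield K CC" for K
  proof
    define L where "L = adjoin K {u, v}"
    have L: "subfield L CC"
      unfolding L_def by (rule subfield_adjoin)
    have uv: "u \<in> L" "v \<in> L" and KL: "K \<subseteq> L"
      using adjoin_incl[of K "{u, v}"] by (auto simp: L_def)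
    note I = sf_intros[OF L]
    have fL: "f \<in> L"
    proof -
      have "f = (u + 1) / 2"
        by (simp add: u_def)
      also have "\<dots> \<in> L"
        by (intro I uv(1))
      finally show ?thesis .
    qed
    have DL: "D \<in> L"
      unfolding D_def by (intro I fL)
    have dL: "d \<in> L"
    proof -
      have "d = f\<^sup>2 / D"
        using dD Dn0 by (simp add: eq_divide_eq mult.commute)
      also have "\<dots> \<in> L"
        by (intro I fL DL)
      finally show ?thesis .
    qed
    have cL: "c \<in> L"
      unfolding cf by (intro I fL dL)
    have bL: "b \<in> L"
      unfolding bc by (intro I cL dL)
    have eL: "e \<in> L"
      unfolding e_def by (intro I cL bL)
    have aL: "a \<in> L"
      unfolding a_def by (intro I cL bL eL)
    have kL: "k \<in> L"
      unfolding k_def by (intro I cL bL eL aL)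
    have RL: "\<rho>\<^sup>2 \<in> L"
    proof -
      \<comment> \<open>The linear and the constant coefficient of the model for \<open>j\<close>
        coincide. This ties down the scaling: \<open>\<rho>\<^sup>2\<close> is the quotient of
        \<open>a\<close> and \<open>k\<close>.\<close>
      have "\<rho> ^ 4 * a = \<rho> ^ 4 * (\<rho>\<^sup>2 * k)"
        using Aa Ak by Groebner_Basis.algebra
      moreover have "\<rho> ^ 4 \<noteq> 0"
        using R0 by simp
      ultimately have "a = \<rho>\<^sup>2 * k"
        by (simp only: mult_cancel_left) blast
      moreover have "k \<noteq> 0"
        using A0 Ak by auto
      ultimately have "\<rho>\<^sup>2 = a / k"
        by simp
      also have "\<dots> \<in> L"
        by (intro I aL kL)
      finally show ?thesis .
    qed
    have AL: "A \<in> L"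
    proof -
      have "A = (\<rho>\<^sup>2)\<^sup>2 * a"
        using Aa by (simp flip: power_mult)
      also have "\<dots> \<in> L"
        by (intro I RL aL)
      finally show ?thesis .
    qed
    have jL: "j \<in> L"
      by (subst ej_coeff_inverse[OF j0(2)]) (intro I AL[unfolded A_def])
    have xiL: "\<xi> \<in> L" and pL: "p \<in> L"
      unfolding \<xi>_def p_def by (intro I fL dL eL)+
    have rL: "r \<in> L"
    proof -
      have "r = (v * u\<^sup>2 / D\<^sup>2 - p) / 8"
        using Dn0 u0 by (simp add: v_def)
      also have "\<dots> \<in> L"
        by (intro I pL uv DL)
      finally show ?thesis .
    qed
    have y2L: "y0\<^sup>2 \<in> L"
    proof -
      have "y0\<^sup>2 = (\<rho>\<^sup>2) ^ 3 * b\<^sup>2 / 4"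
        by (simp add: y0_def power_mult_distrib power_divide flip: power_mult)
      also have "\<dots> \<in> L"
        by (intro I RL bL)
      finally show ?thesis .
    qed
    define S where "S = insert Infinity {Affine x (y0 * z) | x z. x \<in> L \<and> z \<in> L}"
    have S: "ej_add j R T \<in> S" if "R \<in> S" "T \<in> S" for R T
      using ej_twisted_subgroup[OF L AL[unfolded A_def] y2L y0n S_def that] .
    have Sm: "ej_mult j n R \<in> S" if "R \<in> S" for n R
      by (induction n) (auto simp: ej_mult_Suc S that, simp add: S_def)
    have "P = Affine (\<rho>\<^sup>2 * e) (y0 * 1)" "Q = Affine (\<rho>\<^sup>2 * (e + r)) (y0 * 0)"
      using P0 xq xqr by (simp_all add: y0_def)
    moreover have "Affine (\<rho>\<^sup>2 * e) (y0 * 1) \<in> S" "Affine (\<rho>\<^sup>2 * (e + r)) (y0 * 0) \<in> S"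
      unfolding S_def using sf_mult[OF L RL eL] sf_mult[OF L RL sf_add[OF L eL rL]] sf_0[OF L] sf_1[OF L] by blast+
    ultimately have PS: "P \<in> S" and QS: "Q \<in> S"
      by simp_all
    have SL: "x \<in> L" if "Affine x y \<in> S" for x y
      using that by (auto simp: S_def)
    have "x \<in> L" if "ej_add j (ej_mult j n P) (ej_mult j m Q) = Affine x y" for n m x y
      using SL[of x y] S[OF Sm[OF PS] Sm[OF QS], of n m] unfolding that by blast
    then show "X1_field K j P Q \<subseteq> adjoin K {u, v}"
      unfolding X1_field_def using L jL KL by (intro adjoin_min) (auto simp: L_def)
  next
    define M where "M = X1_field K j P Q"
    have M: "subfield M CC"
      unfolding M_def X1_field_def by (rule subfield_adjoin)
    have KM: "K \<subseteq> M"
      unfolding M_def X1_field_def by (rule adjoin_base_subset)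
    have gen: "x \<in> M" if "ej_add j (ej_mult j n P) (ej_mult j m Q) = Affine x y" for n m x y
      unfolding M_def X1_field_def using that by (intro subsetD[OF adjoin_gen_subset]) blast
    note I = sf_intros[OF M]
    have x1: "\<rho>\<^sup>2 * e \<in> M"
      using gen[of 1 0] P0 ej_mult_Suc[of j 0 P] by auto
    have x2: "\<rho>\<^sup>2 * (e + b) \<in> M"
      using gen[of 2 0] P2 by (auto simp: tate_def e_def)
    have x4: "\<rho>\<^sup>2 * (e + d * (d - 1)) \<in> M"
      using gen[of 4 0] P4 by (auto simp: tate_def e_def)
    have xqM: "xq \<in> M"
      using gen[of 0 1] Q1 xq by auto
    have d0: "d \<noteq> 0"
      using bc b0 by auto
    have fM: "f \<in> M"
    proof -
      \<comment> \<open>Relative to \<open>P\<close> the abscissae of \<open>2 P\<close> and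
        \<open>4 P\<close> are \<open>b\<close> and \<open>d * (d - 1)\<close> up to the common
        scaling, and their quotient is \<open>f\<close>.\<close>
      have "\<rho>\<^sup>2 * (e + b) - \<rho>\<^sup>2 * e = f * (\<rho>\<^sup>2 * (e + d * (d - 1)) - \<rho>\<^sup>2 * e)"
        by (simp add: bc cf algebra_simps)
      moreover have "\<rho>\<^sup>2 * (e + d * (d - 1)) - \<rho>\<^sup>2 * e \<noteq> 0"
        using R0 d0 d1 by (simp add: algebra_simps)
      ultimately have "f = (\<rho>\<^sup>2 * (e + b) - \<rho>\<^sup>2 * e) / (\<rho>\<^sup>2 * (e + d * (d - 1)) - \<rho>\<^sup>2 * e)"
        by (simp add: eq_divide_eq)
      also have "\<dots> \<in> M"
        by (intro I x1 x2 x4)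
      finally show ?thesis .
    qed
    have DM: "D \<in> M"
      unfolding D_def by (intro I fM)
    have dM: "d \<in> M"
    proof -
      have "d = f\<^sup>2 / D"
        using dD Dn0 by (simp add: eq_divide_eq mult.commute)
      also have "\<dots> \<in> M"
        by (intro I fM DM)
      finally show ?thesis .
    qed
    have cM: "c \<in> M"
      unfolding cf by (intro I fM dM)
    have bM: "b \<in> M"
      unfolding bc by (intro I cM dM)
    have eM: "e \<in> M"
      unfolding e_def by (intro I cM bM)
    have RM: "\<rho>\<^sup>2 \<in> M"
    proof -
      have "\<rho>\<^sup>2 = (\<rho>\<^sup>2 * (e + b) - \<rho>\<^sup>2 * e) / b"
        using b0 by (simp add: algebra_simps)
      also have "\<dots> \<in> M"
        by (intro I x1 x2 bM)
      finally show ?thesis .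
    qed
    have rM: "r \<in> M"
      unfolding r_def by (intro sf_diff[OF M] sf_divide[OF M] xqM RM eM)
    have "u \<in> M"
      unfolding u_def by (intro I fM)
    moreover have "p \<in> M"
      unfolding p_def \<xi>_def by (intro I eM fM dM)
    then have "v \<in> M"
      unfolding v_def by (intro I rM DM calculation)
    ultimately show "adjoin K {u, v} \<subseteq> X1_field K j P Q"
      using M KM by (intro adjoin_min) (auto simp: M_def)
  qed
  \<comment> \<open>If \<open>u\<close> were algebraic, then so would be \<open>v\<close> and with
    them \<open>j\<close>, which lies in Qbar(u, v).\<close>
  have ut: "\<not> algebraic u"
  proof
    assume "algebraic u"
    then have u: "u \<in> Qbar"
      by (simp add: Qbar_def)
    then have "v\<^sup>2 \<in> Qbar"
      unfolding vsq crv_def by (intro sf_intros[OF subfield_Qbar])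
    then have "v \<in> Qbar"
      using Qbar_sq by blast
    then have "X1_field Qbar j P Q \<subseteq> Qbar"
      unfolding main[OF subfield_Qbar] using u by (intro adjoin_min subfield_Qbar) auto
    moreover have "j \<in> X1_field Qbar j P Q"
      unfolding X1_field_def by (intro subsetD[OF adjoin_gen_subset]) blast
    ultimately show False
      using jQ by blast
  qed
  have "curve_field u v"
    using ut vsq by unfold_locales
  then show ?thesis
    using that main by blast
qed

section \<open>Multi-quadratic fields\<close>

text \<open>Inverses come from the conjugate \<open>a - b * s\<close>. The conjugate can vanish
  because \<open>s\<close> itself may be rational; then \<open>x = 2 * a\<close>.\<close>

lemma quadratic_set_subfield:
  assumes s: "s\<^sup>2 \<in> \<rat>"
  shows "subfield {a + b * s | a b. a \<in> \<rat> \<and> b \<in> \<rat>} CC" (is "subfield ?L CC")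
proof -
  have I: "a + b * s \<in> ?L" if "a \<in> \<rat>" "b \<in> \<rat>" for a b
    using that by blast
  show ?thesis
  proof (rule subfieldCI)
    show "1 \<in> ?L"
      using I[of 1 0] by simp
  next
    fix x y
    assume "x \<in> ?L" "y \<in> ?L"
    then obtain a b c d where x: "x = a + b * s" and y: "y = c + d * s" and ab: "a \<in> \<rat>" "b \<in> \<rat>" "c \<in> \<rat>" "d \<in> \<rat>"
      by blast
    show "x + y \<in> ?L"
      using I[of "a + c" "b + d"] x y ab by (simp add: algebra_simps)
    have "x * y = (a * c + b * d * s\<^sup>2) + (a * d + b * c) * s"
      by (simp add: x y power2_eq_square algebra_simps)
    then show "x * y \<in> ?L"
      using I[of "a * c + b * d * s\<^sup>2" "a * d + b * c"] ab s by simp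
  next
    fix x
    assume "x \<in> ?L"
    then obtain a b where x: "x = a + b * s" and ab: "a \<in> \<rat>" "b \<in> \<rat>"
      by blast
    show "- x \<in> ?L"
      using I[of "- a" "- b"] x ab by simp
    show "inverse x \<in> ?L" if "x \<noteq> 0"
    proof (cases "a = b * s")
      case True
      then have "inverse x = inverse (2 * a) + 0 * s"
        using x by simp
      also have "\<dots> \<in> ?L"
        by (rule I) (use ab in auto)
      finally show ?thesis .
    next
      case False
      define n where "n = a\<^sup>2 - b\<^sup>2 * s\<^sup>2"
      have "n = x * (a - b * s)"
        by (simp add: n_def x power2_eq_square algebra_simps)
      then have "n \<noteq> 0" "inverse x = (a - b * s) / n"
        using that False by (auto simp: field_simps)
      then have "inverse x = a / n + (- b / n) * s"
        by (simp add: diff_divide_distrib)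
      moreover have "n \<in> \<rat>"
        using ab s by (simp add: n_def)
      ultimately show ?thesis
        using I[of "a / n" "- b / n"] ab by simp
    qed
  qed
qed

lemma adjoin_sqrt:
  assumes "s\<^sup>2 \<in> \<rat>"
  shows "adjoin \<rat> {s} = {a + b * s | a b. a \<in> \<rat> \<and> b \<in> \<rat>}" (is "_ = ?L")
proof
  have "a \<in> ?L" if "a \<in> \<rat>" for a
    using that by (intro CollectI exI[of _ a] exI[of _ 0]) auto
  moreover have "s \<in> ?L"
    by (intro CollectI exI[of _ 0] exI[of _ 1]) auto
  ultimately show "adjoin \<rat> {s} \<subseteq> ?L"
    by (intro adjoin_min quadratic_set_subfield assms) auto
  have "subfield (adjoin \<rat> {s}) CC"
    by (rule subfield_adjoin)
  moreover have "s \<in> adjoin \<rat> {s}" "\<rat> \<subseteq> adjoin \<rat> {s}"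
    using adjoin_incl[of \<rat> "{s}"] by auto
  ultimately have "a + b * s \<in> adjoin \<rat> {s}" if "a \<in> \<rat>" "b \<in> \<rat>" for a b
    using that by (intro sf_add sf_mult) auto
  then show "?L \<subseteq> adjoin \<rat> {s}"
    by blast
qed

text \<open>A basis \<open>x\<close>, \<open>y\<close> of the field over the rationals is scaled to
  \<open>t\<close>, 1, and completing the square in the quadratic equation of \<open>t\<close> gives
  \<open>s\<close>.\<close>

lemma quadratic_field_generator:
  assumes "quadratic_field L"
  obtains s where "s\<^sup>2 \<in> \<rat>" "L = adjoin \<rat> {s}"
proof -
  have L: "subfield L CC" and dim: "ring.dimension CC 2 \<rat> L"
    using assms by (auto simp: quadratic_field_def)
  have le: "ring.line_extension CC \<rat> a E = {x * a + y | x y. x \<in> \<rat> \<and> y \<in> E}" for a E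
    by (auto simp: ring.line_extension_def[OF ring_CC] r_coset_def set_add_def set_mult_def)
  obtain x y where xy: "y \<noteq> 0" "L = {a * x + b * y | a b. a \<in> \<rat> \<and> b \<in> \<rat>}"
  proof -
    obtain x E where E: "x \<notin> E" "ring.dimension CC 1 \<rat> E" "L = ring.line_extension CC \<rat> x E"
      using dim by (cases rule: ring.dimension.cases[OF ring_CC]) (auto simp: numeral_2_eq_2)
    obtain y E' where E': "y \<notin> E'" "ring.dimension CC 0 \<rat> E'" "E = ring.line_extension CC \<rat> y E'"
      using E(2) by (cases rule: ring.dimension.cases[OF ring_CC]) auto
    have "E' = {0}"
      using ring.dimension_zero[OF ring_CC subfield_Rats E'(2)] by simp
    then have "y \<noteq> 0" "E = {b * y | b. b \<in> \<rat>}"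
      using E' by (auto simp: le)
    moreover from this have "L = {a * x + b * y | a b. a \<in> \<rat> \<and> b \<in> \<rat>}"
      using E(3) by (fastforce simp: le)
    ultimately show ?thesis
      using that[of y x] by blast
  qed
  have yL: "y \<in> L"
    unfolding xy(2) by (intro CollectI exI[of _ 0] exI[of _ 1]) auto
  have xL: "x \<in> L"
    unfolding xy(2) by (intro CollectI exI[of _ 1] exI[of _ 0]) auto
  define t where "t = x / y"
  have tL: "t \<in> L"
    unfolding t_def using sf_divide[OF L xL yL] .
  have Lt: "z \<in> L \<longleftrightarrow> (\<exists>a b. a \<in> \<rat> \<and> b \<in> \<rat> \<and> z = a + b * t)" for z
  proof
    assume "z \<in> L"
    then have "z * y \<in> L"
      using sf_mult[OF L _ yL] by blast
    then obtain a b where ab: "a \<in> \<rat>" "b \<in> \<rat>" "z * y = a * x + b * y"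
      using xy(2) by blast
    have "z = (a * x + b * y) / y"
      using xy(1) by (simp flip: ab(3))
    also have "\<dots> = b + a * t"
      using xy(1) by (simp add: t_def add_divide_distrib)
    finally have "b \<in> \<rat> \<and> a \<in> \<rat> \<and> z = b + a * t"
      using ab(1,2) by (intro conjI)
    then show "\<exists>a b. a \<in> \<rat> \<and> b \<in> \<rat> \<and> z = a + b * t"
      by (intro exI)
  next
    assume "\<exists>a b. a \<in> \<rat> \<and> b \<in> \<rat> \<and> z = a + b * t"
    then obtain a b where ab: "a \<in> \<rat>" "b \<in> \<rat>" "z = a + b * t"
      by blast
    show "z \<in> L"
      unfolding ab(3) by (intro sf_add sf_mult L tL subsetD[OF sf_Rats[OF L]] ab)
  qed
  have "t\<^sup>2 \<in> L"
    using sf_power[OF L tL] .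
  then obtain p q where pq: "p \<in> \<rat>" "q \<in> \<rat>" "t\<^sup>2 = p + q * t"
    unfolding Lt by blast
  define s where "s = t - q / 2"
  have "s\<^sup>2 = t\<^sup>2 - q * t + (q / 2)\<^sup>2"
    by (simp add: s_def power2_diff)
  then have "s\<^sup>2 = p + (q / 2)\<^sup>2"
    unfolding pq(3) by simp
  then have s: "s\<^sup>2 \<in> \<rat>"
    using pq by simp
  have "s \<in> L"
    unfolding s_def by (intro sf_diff[OF L] sf_divide[OF L] sf_numeral[OF L] tL subsetD[OF sf_Rats[OF L]] pq(2))
  then have "adjoin \<rat> {s} \<subseteq> L"
    using sf_Rats[OF L] by (intro adjoin_min L) simp_all
  moreover have "L \<subseteq> adjoin \<rat> {s}"
  proof
    fix z
    assume "z \<in> L"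
    then obtain a b where ab: "a \<in> \<rat>" "b \<in> \<rat>" "z = a + b * t"
      unfolding Lt by (elim exE conjE)
    have "z = (a + b * (q / 2)) + b * s"
      unfolding ab(3) s_def right_diff_distrib by simp
    moreover have "a + b * (q / 2) \<in> \<rat>"
      using ab pq by simp
    ultimately show "z \<in> adjoin \<rat> {s}"
      unfolding adjoin_sqrt[OF s] mem_Collect_eq using ab(2) by (intro exI conjI)
  qed
  ultimately have "L = adjoin \<rat> {s}"
    by simp
  then show ?thesis
    by (rule that[OF s])
qed

lemma multiquadratic_generators:
  assumes "multiquadratic_field K"
  obtains S where "finite S" "\<forall>s\<in>S. s\<^sup>2 \<in> \<rat>" "K = adjoin \<rat> S"
proof -
  obtain \<L> where LL: "finite \<L>" "\<forall>L\<in>\<L>. quadratic_field L" "K = adjoin \<rat> (\<Union>\<L>)"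
    using assms by (auto simp: multiquadratic_field_def)
  have "\<forall>L\<in>\<L>. \<exists>s. s\<^sup>2 \<in> \<rat> \<and> L = adjoin \<rat> {s}"
    using LL(2) quadratic_field_generator by metis
  then obtain g where g: "\<And>L. L \<in> \<L> \<Longrightarrow> (g L)\<^sup>2 \<in> \<rat>" "\<And>L. L \<in> \<L> \<Longrightarrow> L = adjoin \<rat> {g L}"
    by metis
  have "K = adjoin \<rat> (g ` \<L>)"
  proof
    have "L \<subseteq> adjoin \<rat> (g ` \<L>)" if "L \<in> \<L>" for L
    proof -
      have "adjoin \<rat> {g L} \<subseteq> adjoin \<rat> (g ` \<L>)"
        using that adjoin_incl[of \<rat> "g ` \<L>"] by (intro adjoin_min subfield_adjoin) auto
      then show ?thesis
        using g(2)[OF that] by simp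
    qed
    then show "K \<subseteq> adjoin \<rat> (g ` \<L>)"
      unfolding LL(3) using adjoin_incl[of \<rat> "g ` \<L>"] by (intro adjoin_min subfield_adjoin) auto
    have "g L \<in> K" if "L \<in> \<L>" for L
    proof -
      have "g L \<in> L"
        using g(2)[OF that] adjoin_incl[of \<rat> "{g L}"] by blast
      then show ?thesis
        unfolding LL(3) using that adjoin_incl[of \<rat> "\<Union>\<L>"] by blast
    qed
    moreover have "\<rat> \<subseteq> K"
      unfolding LL(3) using adjoin_incl[of \<rat> "\<Union>\<L>"] by blast
    ultimately show "adjoin \<rat> (g ` \<L>) \<subseteq> K"
      unfolding LL(3) by (intro adjoin_min subfield_adjoin) auto
  qed
  then show ?thesis
    using that[of "g ` \<L>"] LL(1) g(1) by blast
qed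

locale multiquadratic =
  fixes S K :: "complex set"
  assumes finite_S: "finite S" and S_squares: "\<And>s. s \<in> S \<Longrightarrow> s\<^sup>2 \<in> \<rat>" and K_eq: "K = adjoin \<rat> S"
begin

lemma subfield_K: "subfield K CC"
  unfolding K_eq by (rule subfield_adjoin)

lemma K_Qbar: "K \<subseteq> Qbar"
  unfolding K_eq using S_squares Rats_subset_Qbar Qbar_sq by (intro adjoin_min subfield_Qbar) auto

lemma S_K: "S \<subseteq> K"
  unfolding K_eq by (rule adjoin_gen_subset)

lemma gal_gen: "\<sigma> \<in> gal \<rat> \<Longrightarrow> s \<in> S \<Longrightarrow> \<sigma> s = s \<or> \<sigma> s = - s"
proof -
  assume \<sigma>: "\<sigma> \<in> gal \<rat>" and s: "s \<in> S"
  have "(\<sigma> s)\<^sup>2 = \<sigma> (s\<^sup>2)"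
    using embedding_power[OF galD(1)[OF \<sigma>], of s 2] s S_K K_Qbar by auto
  then have "(\<sigma> s)\<^sup>2 = s\<^sup>2"
    using galD(3)[OF \<sigma> S_squares[OF s]] by simp
  then show "\<sigma> s = s \<or> \<sigma> s = - s"
    by (simp add: power2_eq_iff)
qed

text \<open>Reduces the equality of two automorphisms on a generated field to the
  generators.\<close>

lemma equalizer_subfield:
  assumes "\<sigma> \<in> gal \<rat>" "\<tau> \<in> gal \<rat>"
  shows "subfield {x \<in> Qbar. \<sigma> x = \<tau> x} CC"
proof -
  note e = galD(1)[OF assms(1)] galD(1)[OF assms(2)]
  show ?thesis
    by (rule subfieldCI)
      (auto simp: sf_intros[OF subfield_Qbar] embedding_1[OF e(1)] embedding_1[OF e(2)] embedding_add[OF e(1)]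
        embedding_add[OF e(2)] embedding_uminus[OF e(1)] embedding_uminus[OF e(2)] embedding_mult[OF e(1)]
        embedding_mult[OF e(2)] embedding_inverse[OF e(1)] embedding_inverse[OF e(2)])
qed

lemma gal_agree:
  assumes st: "\<sigma> \<in> gal \<rat>" "\<tau> \<in> gal \<rat>" and S: "\<And>s. s \<in> S \<Longrightarrow> \<sigma> s = \<tau> s" and x: "x \<in> K"
  shows "\<sigma> x = \<tau> x"
proof -
  have "K \<subseteq> {x \<in> Qbar. \<sigma> x = \<tau> x}"
    unfolding K_eq using S S_K K_Qbar galD(3)[OF st(1)] galD(3)[OF st(2)] Rats_subset_Qbar
    by (intro adjoin_min equalizer_subfield st) auto
  then show ?thesis
    using x by blast
qed

lemma id_gal: "(\<lambda>x. x) \<in> gal \<rat>"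
  using subfield_Qbar by (auto simp: gal_def embedding_def)

lemma gal_involution: "\<sigma> \<in> gal \<rat> \<Longrightarrow> x \<in> K \<Longrightarrow> \<sigma> (\<sigma> x) = x"
proof -
  assume \<sigma>: "\<sigma> \<in> gal \<rat>" and x: "x \<in> K"
  have "\<sigma> (\<sigma> s) = s" if "s \<in> S" for s
    using gal_gen[OF \<sigma> that] embedding_uminus[OF galD(1)[OF \<sigma>], of s] that S_K K_Qbar by auto
  then show ?thesis
    using gal_agree[OF gal_comp[OF \<sigma> \<sigma>] id_gal _ x] by simp
qed

lemma gal_commute: "\<sigma> \<in> gal \<rat> \<Longrightarrow> \<tau> \<in> gal \<rat> \<Longrightarrow> x \<in> K \<Longrightarrow> \<sigma> (\<tau> x) = \<tau> (\<sigma> x)"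
proof -
  assume st: "\<sigma> \<in> gal \<rat>" "\<tau> \<in> gal \<rat>" and x: "x \<in> K"
  have "\<sigma> (\<tau> s) = \<tau> (\<sigma> s)" if "s \<in> S" for s
    using gal_gen[OF st(1) that] gal_gen[OF st(2) that] embedding_uminus[OF galD(1)[OF st(1)], of s]
      embedding_uminus[OF galD(1)[OF st(2)], of s] that S_K K_Qbar by auto
  then show ?thesis
    using gal_agree[OF gal_comp[OF st] gal_comp[OF st(2,1)] _ x] by simp
qed

lemma gal_K: "\<sigma> \<in> gal \<rat> \<Longrightarrow> x \<in> K \<Longrightarrow> \<sigma> x \<in> K"
proof -
  assume \<sigma>: "\<sigma> \<in> gal \<rat>" and x: "x \<in> K"
  note e = galD(1)[OF \<sigma>]
  have KQ: "z \<in> Qbar" if "z \<in> K" for z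
    using that K_Qbar by blast
  have "subfield {x \<in> K. \<sigma> x \<in> K} CC"
    by (rule subfieldCI)
      (auto simp: sf_intros[OF subfield_K] embedding_1[OF e] embedding_add[OF e] KQ
        embedding_uminus[OF e] embedding_mult[OF e] embedding_inverse[OF e])
  moreover have "\<sigma> s \<in> K" if "s \<in> S" for s
    using gal_gen[OF \<sigma> that] that S_K sf_uminus[OF subfield_K, of s] by auto
  ultimately have "K \<subseteq> {x \<in> K. \<sigma> x \<in> K}"
    using S_K sf_Rats[OF subfield_K] galD(3)[OF \<sigma>] by (subst K_eq) (intro adjoin_min, auto)
  then show ?thesis
    using x by blast
qed

end

section \<open>The field Q(sqrt 5) and the tenth roots of unity\<close>

lemma sqrt5_irrational:
  assumes "s\<^sup>2 = (5 :: complex)"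
  shows "s \<notin> \<rat>"
proof
  assume s: "s \<in> \<rat>"
  have "algebraic_int s"
  proof (rule algebraic_int.intros)
    show "lead_coeff [:-5, 0, 1 :: complex:] = 1" "\<forall>i. coeff [:-5, 0, 1 :: complex:] i \<in> \<int>"
      by (auto simp: coeff_pCons split: nat.split)
    show "poly [:-5, 0, 1:] s = 0"
      using assms by (simp add: power2_eq_square)
  qed
  then have "s \<in> \<int>"
    using s rational_algebraic_int_is_int by blast
  then obtain n where "s = of_int n"
    by (auto elim: Ints_cases)
  then have "(of_int (n\<^sup>2) :: complex) = of_int 5"
    using assms by simp
  then have "n\<^sup>2 = 5"
    by (simp only: of_int_eq_iff)
  then have "\<bar>n\<bar>\<^sup>2 = 5"
    by simp
  moreover have "\<bar>n\<bar> \<le> 2 \<or> 3 \<le> \<bar>n\<bar>"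
    by linarith
  then have "\<bar>n\<bar>\<^sup>2 \<le> 2\<^sup>2 \<or> 3\<^sup>2 \<le> \<bar>n\<bar>\<^sup>2"
    using power_mono[of "\<bar>n\<bar>" 2 2] power_mono[of 3 "\<bar>n\<bar>" 2] by auto
  ultimately show False
    by simp
qed

definition sqrt5 :: complex where
  "sqrt5 = complex_of_real (sqrt 5)"

lemma sqrt5_sq: "sqrt5\<^sup>2 = 5"
  by (simp add: sqrt5_def flip: of_real_power)

lemma sqrt5_Qbar: "sqrt5 \<in> Qbar"
  using Qbar_sq[of sqrt5] sf_numeral[OF subfield_Qbar] by (simp add: sqrt5_sq)

lemma sqrt_5_cases: "z\<^sup>2 = 5 \<Longrightarrow> z = sqrt5 \<or> z = - sqrt5"
  by (metis power2_eq_iff sqrt5_sq)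

lemma Q5_elements: "adjoin \<rat> {sqrt5} = {a + b * sqrt5 | a b. a \<in> \<rat> \<and> b \<in> \<rat>}"
  by (rule adjoin_sqrt) (simp add: sqrt5_sq)

lemma gal_sqrt5: "\<sigma> \<in> gal \<rat> \<Longrightarrow> \<sigma> sqrt5 = sqrt5 \<or> \<sigma> sqrt5 = - sqrt5"
proof -
  assume \<sigma>: "\<sigma> \<in> gal \<rat>"
  have "(\<sigma> sqrt5)\<^sup>2 = \<sigma> 5"
    using embedding_power[OF galD(1)[OF \<sigma>] sqrt5_Qbar, of 2] by (simp add: sqrt5_sq)
  then show ?thesis
    using galD(3)[OF \<sigma>, of 5] sqrt_5_cases by simp
qed

lemma gal_flip_sqrt5:
  obtains \<sigma> where "\<sigma> \<in> gal \<rat>" "\<sigma> sqrt5 = - sqrt5"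
proof -
  obtain \<sigma> where "\<sigma> \<in> gal \<rat>" "\<sigma> sqrt5 \<noteq> sqrt5"
    by (rule fixed_field_gal[OF subfield_Rats Rats_subset_Qbar sqrt5_Qbar sqrt5_irrational[OF sqrt5_sq]])
  then show ?thesis
    using that gal_sqrt5 by blast
qed

lemma Q5_subset:
  assumes "subfield L CC" "sqrt5 \<in> L"
  shows "adjoin \<rat> {sqrt5} \<subseteq> L"
  using assms sf_Rats[OF assms(1)] by (intro adjoin_min) auto

lemma subfield_of_Q5:
  assumes L: "subfield L CC" "L \<subseteq> adjoin \<rat> {sqrt5}"
  shows "L = \<rat> \<or> L = adjoin \<rat> {sqrt5}"
proof (cases "L \<subseteq> \<rat>")
  case True
  then show ?thesis
    using sf_Rats[OF L(1)] by blast
next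
  case False
  then obtain z where z: "z \<in> L" "z \<notin> \<rat>"
    by blast
  then obtain a b where ab: "a \<in> \<rat>" "b \<in> \<rat>" "z = a + b * sqrt5"
    using L(2) unfolding Q5_elements by blast
  have "b \<noteq> 0"
    using z(2) ab by auto
  then have "sqrt5 = (z - a) / b"
    using ab(3) by simp
  also have "\<dots> \<in> L"
    by (intro sf_divide sf_diff L(1) z subsetD[OF sf_Rats[OF L(1)]] ab)
  finally have "sqrt5 \<in> L" .
  then show ?thesis
    using Q5_subset[OF L(1)] L(2) by blast
qed

definition zeta10 :: complex where
  "zeta10 = cis (2 * pi / real 10)"

lemma zeta_powers: "zeta10 \<noteq> 0" "zeta10 ^ 10 = 1" "zeta10 ^ 4 - zeta10 ^ 3 + zeta10\<^sup>2 - zeta10 + 1 = 0"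
proof -
  show "zeta10 \<noteq> 0"
    by (simp add: zeta10_def)
  have "zeta10 ^ 5 = cis (real 5 * (2 * pi / real 10))"
    unfolding zeta10_def by (rule Complex.DeMoivre)
  also have "real 5 * (2 * pi / real 10) = pi"
    by simp
  finally have five: "zeta10 ^ 5 = - 1"
    by simp
  have "zeta10 ^ 10 = (zeta10 ^ 5) ^ 2"
    by (simp flip: power_mult)
  then show "zeta10 ^ 10 = 1"
    by (simp add: five)
  \<comment> \<open>\<open>z ^ 5 + 1\<close> is \<open>z + 1\<close> times the tenth cyclotomic
    polynomial, and the positive imaginary part excludes \<open>z = - 1\<close>.\<close>
  have "Im zeta10 = sin (pi / 5)"
    by (simp add: zeta10_def)
  moreover have "sin (pi / 5) > 0"
    by (intro sin_gt_zero) auto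
  ultimately have "zeta10 + 1 \<noteq> 0"
    by (auto simp: complex_eq_iff)
  moreover have "(zeta10 + 1) * (zeta10 ^ 4 - zeta10 ^ 3 + zeta10\<^sup>2 - zeta10 + 1) = 0"
    using five by Groebner_Basis.algebra
  ultimately show "zeta10 ^ 4 - zeta10 ^ 3 + zeta10\<^sup>2 - zeta10 + 1 = 0"
    by simp
qed

lemma zeta_Qbar: "zeta10 \<in> Qbar"
proof (rule Qbar_root)
  show "monom 1 10 - 1 \<in> pover Qbar"
    by (intro pover_diff pover_monom pover_1 subfield_Qbar sf_1)
  show "poly (monom 1 10 - 1) zeta10 = 0"
    by (simp add: poly_monom zeta_powers)
  have "coeff (monom 1 10 - 1 :: complex poly) 10 = 1"
    by (simp add: coeff_1)
  then show "monom 1 10 - 1 \<noteq> (0 :: complex poly)"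
    by (metis coeff_0 zero_neq_one)
qed

text \<open>\<open>zeta10 + inverse zeta10\<close> is the golden ratio, which places sqrt 5 in the
  cyclotomic field; the cube of \<open>zeta10\<close> yields its conjugate.\<close>

lemma zeta_sum: "(2 * (zeta10 + inverse zeta10) - 1)\<^sup>2 = 5" "zeta10 ^ 3 + inverse (zeta10 ^ 3) = 1 - (zeta10 + inverse zeta10)"
proof -
  define i where "i = inverse zeta10"
  have i: "zeta10 * i = 1"
    using zeta_powers(1) by (simp add: i_def)
  have "(zeta10 ^ 4 - zeta10 ^ 3 + zeta10\<^sup>2 - zeta10 + 1) * i\<^sup>2 = 0"
    using zeta_powers(3) by simp
  then have rel: "zeta10\<^sup>2 - zeta10 + 1 - i + i\<^sup>2 = 0"
    using i by Groebner_Basis.algebra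
  show "(2 * (zeta10 + inverse zeta10) - 1)\<^sup>2 = 5"
    unfolding i_def[symmetric] using rel i by Groebner_Basis.algebra
  have "zeta10 ^ 3 + i ^ 3 = 1 - (zeta10 + i)"
    using rel i by Groebner_Basis.algebra
  then show "zeta10 ^ 3 + inverse (zeta10 ^ 3) = 1 - (zeta10 + inverse zeta10)"
    by (simp add: i_def power_inverse)
qed

lemma cyclotomic_10: "cyclotomic_field 10 = adjoin \<rat> {zeta10}"
  by (simp add: cyclotomic_field_def zeta10_def)

lemma sqrt5_cyclotomic: "sqrt5 \<in> cyclotomic_field 10"
proof -
  have C: "subfield (cyclotomic_field 10) CC"
    unfolding cyclotomic_10 by (rule subfield_adjoin)
  have "zeta10 \<in> cyclotomic_field 10"
    unfolding cyclotomic_10 using adjoin_gen_subset[of "{zeta10}" \<rat>] by simp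
  then have "2 * (zeta10 + inverse zeta10) - 1 \<in> cyclotomic_field 10"
    by (intro sf_intros[OF C])
  moreover have "2 * (zeta10 + inverse zeta10) - 1 = sqrt5 \<or> 2 * (zeta10 + inverse zeta10) - 1 = - sqrt5"
    by (rule sqrt_5_cases[OF zeta_sum(1)])
  ultimately show ?thesis
    using sf_uminus[OF C, of "- sqrt5"] by auto
qed

lemma sum_inverse_eq:
  fixes x y :: complex
  assumes "x \<noteq> 0" "y \<noteq> 0" "x + inverse x = y + inverse y"
  shows "(x - y) * (x * y - 1) = 0"
proof -
  have "x * inverse x = 1" "y * inverse y = 1"
    using assms by simp_all
  then show ?thesis
    using assms(3) by Groebner_Basis.algebra
qed

text \<open>The Galois group of the cyclotomic field is cyclic of order 4, so an automorphism that
  fixes sqrt 5 acts there as a square, and squares act trivially on \<open>K\<close>. Concretely,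
  \<open>\<sigma>\<close> over Q(sqrt 5) that moves \<open>z\<close> inverts \<open>zeta10\<close>;
  a \<open>\<tau>\<close> that flips sqrt 5 sends \<open>zeta10\<close> to its cube or to the
  inverse of the cube, and in both cases \<open>\<tau> \<circ> \<tau>\<close> inverts
  \<open>zeta10\<close> too.\<close>

lemma (in multiquadratic) K_cyclotomic: "K \<inter> cyclotomic_field 10 \<subseteq> adjoin \<rat> {sqrt5}"
proof
  fix z
  assume z: "z \<in> K \<inter> cyclotomic_field 10"
  define Q5 where "Q5 = adjoin \<rat> {sqrt5}"
  have Q5: "subfield Q5 CC"
    unfolding Q5_def by (rule subfield_adjoin)
  have Q5Q: "Q5 \<subseteq> Qbar"
    unfolding Q5_def by (rule Q5_subset[OF subfield_Qbar sqrt5_Qbar])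
  have sQ5: "sqrt5 \<in> Q5"
    unfolding Q5_def using adjoin_gen_subset[of "{sqrt5}" \<rat>] by simp
  have zQ: "z \<in> Qbar"
    using z K_Qbar by blast
  define \<phi> where "\<phi> = zeta10 + inverse zeta10"
  have zi: "zeta10 \<in> Qbar" "inverse zeta10 \<in> Qbar"
    using zeta_Qbar sf_inverse[OF subfield_Qbar] by auto
  obtain \<epsilon> where eps: "\<epsilon> = 1 \<or> \<epsilon> = - 1" "2 * \<phi> - 1 = \<epsilon> * sqrt5"
    using sqrt_5_cases[OF zeta_sum(1)] unfolding \<phi>_def by (metis mult_1 mult_minus1)
  have phi: "\<phi> = (1 + \<epsilon> * sqrt5) / 2"
    using eps(2) by (simp add: field_simps)
  have eR: "\<epsilon> \<in> \<rat>"
    using eps(1) by auto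
  then have phiQ5: "\<phi> \<in> Q5"
    unfolding phi using sf_Rats[OF Q5] by (intro sf_divide sf_add sf_mult sf_1 sf_numeral Q5 sQ5) auto
  have on_C: "\<sigma> z = \<tau> z" if "\<sigma> \<in> gal \<rat>" "\<tau> \<in> gal \<rat>" "\<sigma> zeta10 = \<tau> zeta10" for \<sigma> \<tau>
  proof -
    have "cyclotomic_field 10 \<subseteq> {x \<in> Qbar. \<sigma> x = \<tau> x}"
      unfolding cyclotomic_10 using galD(3)[OF that(1)] galD(3)[OF that(2)] Rats_subset_Qbar that zi
      by (intro adjoin_min equalizer_subfield) auto
    then show ?thesis
      using z by blast
  qed
  show "z \<in> adjoin \<rat> {sqrt5}"
  proof (rule ccontr)
    assume "z \<notin> adjoin \<rat> {sqrt5}"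
    then obtain \<sigma> where \<sigma>: "\<sigma> \<in> gal Q5" "\<sigma> z \<noteq> z"
      using fixed_field_gal[OF Q5 Q5Q zQ] unfolding Q5_def by metis
    have \<sigma>Q: "\<sigma> \<in> gal \<rat>"
      using \<sigma>(1) gal_mono[OF sf_Rats[OF Q5]] by blast
    note es = galD(1)[OF \<sigma>Q]
    have s0: "\<sigma> zeta10 \<noteq> 0"
      using embedding_eq_0_iff[OF es zi(1)] zeta_powers(1) by simp
    have "\<sigma> zeta10 + inverse (\<sigma> zeta10) = \<sigma> \<phi>"
      unfolding \<phi>_def by (simp add: embedding_add[OF es zi] embedding_inverse[OF es zi(1)])
    also have "\<dots> = zeta10 + inverse zeta10"
      using galD(3)[OF \<sigma>(1) phiQ5] by (simp add: \<phi>_def)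
    finally have "(\<sigma> zeta10 - zeta10) * (\<sigma> zeta10 * zeta10 - 1) = 0"
      by (rule sum_inverse_eq[OF s0 zeta_powers(1)])
    moreover have "\<sigma> zeta10 \<noteq> zeta10"
      using on_C[OF \<sigma>Q id_gal] \<sigma>(2) by auto
    ultimately have sz: "\<sigma> zeta10 * zeta10 = 1"
      by simp
    obtain \<tau> where \<tau>: "\<tau> \<in> gal \<rat>" "\<tau> sqrt5 = - sqrt5"
      by (rule gal_flip_sqrt5)
    note et = galD(1)[OF \<tau>(1)]
    define \<eta> where "\<eta> = \<tau> zeta10"
    have n0: "\<eta> \<noteq> 0"
      using embedding_eq_0_iff[OF et zi(1)] zeta_powers(1) by (simp add: \<eta>_def)
    have "\<eta> + inverse \<eta> = \<tau> \<phi>"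
      unfolding \<phi>_def \<eta>_def by (simp add: embedding_add[OF et zi] embedding_inverse[OF et zi(1)])
    also have "\<dots> = 1 - \<phi>"
    proof -
      have q: "1 / 2 \<in> \<rat>" "\<epsilon> / 2 \<in> \<rat>"
        using eR by auto
      then have "1 / 2 \<in> Qbar" "\<epsilon> / 2 \<in> Qbar"
        using Rats_subset_Qbar by blast+
      then have "\<tau> (1 / 2 + (\<epsilon> / 2) * sqrt5) = \<tau> (1 / 2) + \<tau> (\<epsilon> / 2) * \<tau> sqrt5"
        using embedding_add[OF et _ sf_mult[OF subfield_Qbar _ sqrt5_Qbar], of "1 / 2" "\<epsilon> / 2"]
          embedding_mult[OF et _ sqrt5_Qbar, of "\<epsilon> / 2"] by simp
      also have "\<dots> = 1 / 2 - \<epsilon> / 2 * sqrt5"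
        unfolding galD(3)[OF \<tau>(1) q(1)] galD(3)[OF \<tau>(1) q(2)] \<tau>(2) by simp
      finally show ?thesis
        by (simp add: phi add_divide_distrib diff_divide_distrib)
    qed
    also have "\<dots> = zeta10 ^ 3 + inverse (zeta10 ^ 3)"
      using zeta_sum(2) by (simp add: \<phi>_def)
    finally have "(\<eta> - zeta10 ^ 3) * (\<eta> * zeta10 ^ 3 - 1) = 0"
      using zeta_powers(1) by (intro sum_inverse_eq n0) simp_all
    then have "\<tau> \<eta> * zeta10 = 1"
    proof (elim mult_eq_0_iff[THEN iffD1, THEN disjE])
      assume "\<eta> - zeta10 ^ 3 = 0"
      then have e3: "\<eta> = zeta10 ^ 3"
        by simp
      then have "\<tau> \<eta> = \<eta> ^ 3"
        using embedding_power[OF et zi(1), of 3] by (simp add: \<eta>_def)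
      then have "\<tau> \<eta> * zeta10 = zeta10 ^ 10"
        unfolding e3 by (simp add: eval_nat_numeral mult_ac)
      then show ?thesis
        using zeta_powers(2) by simp
    next
      assume "\<eta> * zeta10 ^ 3 - 1 = 0"
      then have e3: "\<eta> * zeta10 ^ 3 = 1"
        by simp
      have nQ: "\<eta> \<in> Qbar" "zeta10 ^ 3 \<in> Qbar"
        using galD(2)[OF \<tau>(1) zi(1)] sf_power[OF subfield_Qbar zi(1)] by (auto simp: \<eta>_def)
      have "\<tau> (\<eta> * zeta10 ^ 3) = 1"
        using e3 embedding_1[OF et] by simp
      then have t3: "\<tau> \<eta> * \<eta> ^ 3 = 1"
        using embedding_mult[OF et nQ] embedding_power[OF et zi(1), of 3] by (simp add: \<eta>_def)
      \<comment> \<open>Multiplication by the cube of \<open>\<eta> * zeta10 ^ 3 = 1\<close>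
        completes \<open>zeta10\<close> to its tenth power.\<close>
      have "\<tau> \<eta> * zeta10 = \<tau> \<eta> * zeta10 * (\<eta> * zeta10 ^ 3) ^ 3"
        by (simp add: e3)
      also have "\<dots> = (\<tau> \<eta> * \<eta> ^ 3) * zeta10 ^ 10"
        by (simp add: eval_nat_numeral mult_ac)
      finally show ?thesis
        by (simp add: t3 zeta_powers(2))
    qed
    then have "(\<tau> \<circ> \<tau>) zeta10 = \<sigma> zeta10"
      using sz zeta_powers(1) by (metis \<eta>_def comp_apply mult_cancel_right)
    then have "(\<tau> \<circ> \<tau>) z = \<sigma> z"
      by (rule on_C[OF gal_comp[OF \<tau>(1) \<tau>(1)] \<sigma>Q])
    then show False
      using gal_involution[OF \<tau>(1)] z \<sigma>(2) by simp
  qed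
qed

lemma (in multiquadratic) K10_cases:
  "K \<inter> cyclotomic_field 10 = (if sqrt5 \<in> K then adjoin \<rat> {sqrt5} else \<rat>)"
proof -
  have C: "subfield (cyclotomic_field 10) CC"
    unfolding cyclotomic_field_def by (rule subfield_adjoin)
  have "subfield (K \<inter> cyclotomic_field 10) CC"
    by (rule subfieldCI) (auto intro: sf_intros[OF subfield_K] sf_intros[OF C])
  note c = subfield_of_Q5[OF this K_cyclotomic]
  show ?thesis
  proof (cases "sqrt5 \<in> K")
    case True
    then have "sqrt5 \<in> K \<inter> cyclotomic_field 10"
      using sqrt5_cyclotomic by blast
    then show ?thesis
      using c True sqrt5_irrational[OF sqrt5_sq] by auto
  next
    case False
    have "sqrt5 \<in> adjoin \<rat> {sqrt5}"
      using adjoin_gen_subset[of "{sqrt5}" \<rat>] by simp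
    then show ?thesis
      using c False by auto
  qed
qed

section \<open>Torsion points over multi-quadratic fields\<close>

lemma eadd_Infinity [simp]: "eadd P Infinity = P"
  by (cases P) auto

lemma eadd_eneg [simp]: "eadd (eneg P) P = Infinity" "eadd P (eneg P) = Infinity"
  by (cases P; simp)+

lemma epts_mono: "K \<subseteq> L \<Longrightarrow> P \<in> epts K \<Longrightarrow> P \<in> epts L"
  by (cases P) auto

lemma point_map_eneg:
  assumes "embedding Qbar \<sigma>" "P \<in> epts Qbar"
  shows "point_map \<sigma> (eneg P) = eneg (point_map \<sigma> P)"
  using assms embedding_uminus[OF assms(1)] by (cases P) auto

lemma point_map_eadd:
  assumes e: "embedding Qbar \<sigma>" and P: "P \<in> epts Qbar" and Q: "Q \<in> epts Qbar"
  shows "point_map \<sigma> (eadd P Q) = eadd (point_map \<sigma> P) (point_map \<sigma> Q)"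
proof (cases "P = Infinity \<or> Q = Infinity")
  case True
  then show ?thesis
    by auto
next
  case False
  then obtain x1 y1 x2 y2 where PQ: "P = Affine x1 y1" "Q = Affine x2 y2"
    by (cases P; cases Q) auto
  have mem: "x1 \<in> Qbar" "y1 \<in> Qbar" "x2 \<in> Qbar" "y2 \<in> Qbar"
    using P Q PQ by auto
  note I = sf_intros[OF subfield_Qbar]
  have inj: "\<sigma> x = \<sigma> y \<longleftrightarrow> x = y" if "x \<in> Qbar" "y \<in> Qbar" for x y
    using embedding_inj[OF e that] .
  have neg: "\<sigma> y1 = - \<sigma> y2 \<longleftrightarrow> y1 = - y2"
    using inj[of y1 "- y2"] mem I(5) by (simp add: embedding_uminus[OF e])
  have num: "\<sigma> (numeral n) = numeral n" for n
    using embedding_of_nat[OF e, of "numeral n"] by simp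
  define l where "l = slope x1 y1 x2 y2"
  have lQ: "l \<in> Qbar"
    unfolding l_def slope_def using mem by (auto intro!: I)
  have l: "\<sigma> l = slope (\<sigma> x1) (\<sigma> y1) (\<sigma> x2) (\<sigma> y2)"
    unfolding l_def slope_def using mem
    by (auto simp: inj embedding_divide[OF e] embedding_add[OF e] embedding_diff[OF e] embedding_mult[OF e]
        embedding_power[OF e] embedding_1[OF e] num I)
  define x3 where "x3 = l\<^sup>2 - 1 - x1 - x2"
  have x3Q: "x3 \<in> Qbar"
    unfolding x3_def using mem lQ by (intro I)
  have x3: "\<sigma> x3 = (\<sigma> l)\<^sup>2 - 1 - \<sigma> x1 - \<sigma> x2"
    unfolding x3_def using mem lQ by (simp add: embedding_diff[OF e] embedding_power[OF e] embedding_1[OF e] I)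
  have y3: "\<sigma> (l * (x1 - x3) - y1) = \<sigma> l * (\<sigma> x1 - \<sigma> x3) - \<sigma> y1"
    using mem lQ x3Q by (simp add: embedding_diff[OF e] embedding_mult[OF e] I)
  show ?thesis
    unfolding PQ point_map.simps eadd.simps Let_def l_def[symmetric] l[symmetric] x3_def[symmetric] x3[symmetric]
    using inj mem neg y3 by simp
qed

lemma eadd_double:
  assumes P: "y\<^sup>2 = crv x" and D: "eadd (Affine x y) (Affine x y) = Affine x' y'"
  shows "y \<noteq> 0" "x' * (4 * crv x) = (x\<^sup>2 + 1)\<^sup>2"
proof -
  show y: "y \<noteq> 0"
    using D by auto
  define l where "l = (3 * x\<^sup>2 + 2 * x - 1) / (2 * y)"
  have l: "l * (2 * y) = 3 * x\<^sup>2 + 2 * x - 1"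
    using y by (simp add: l_def)
  have "x' = l\<^sup>2 - 1 - x - x"
    using D y by (auto simp: Let_def slope_def l_def)
  then show "x' * (4 * crv x) = (x\<^sup>2 + 1)\<^sup>2"
    using l P unfolding crv_def by Groebner_Basis.algebra
qed

text \<open>The abscissa 1 is fixed by duplication: at these affine points the double is the
  opposite point.\<close>

definition three_torsion :: "point set" where
  "three_torsion = {Infinity, Affine 1 1, Affine 1 (- 1)}"

lemma three_torsion_eadd: "P \<in> three_torsion \<Longrightarrow> Q \<in> three_torsion \<Longrightarrow> eadd P Q \<in> three_torsion"
  by (auto simp: three_torsion_def slope_def Let_def)

lemma three_torsion_eneg: "P \<in> three_torsion \<Longrightarrow> eneg P \<in> three_torsion"
  by (auto simp: three_torsion_def)

lemma three_torsion_triple: "P \<in> three_torsion \<Longrightarrow> eadd P (eadd P P) = Infinity"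
  by (auto simp: three_torsion_def slope_def Let_def)

lemma three_torsion_epts: "subfield K CC \<Longrightarrow> P \<in> three_torsion \<Longrightarrow> P \<in> epts K"
  using sf_1[of K] sf_uminus[of K 1] by (auto simp: three_torsion_def crv_def)

section \<open>The group of points over a multi-quadratic field\<close>

locale curve_multiquadratic = curve_field u v + multiquadratic S K for u v S K
begin

abbreviation "EG \<equiv> epts_group Qbar"

sublocale E: comm_group EG
  by (rule epts_comm_group[OF subfield_Qbar order_refl])

abbreviation mu :: "point \<Rightarrow> nat \<Rightarrow> point" where
  "mu P n \<equiv> P [^]\<^bsub>EG\<^esub> n"

lemma K_epts: "P \<in> epts K \<Longrightarrow> P \<in> epts Qbar"
  by (rule epts_mono[OF K_Qbar])

lemma mu_Suc: "mu P (Suc n) = eadd (mu P n) P" and mu_0: "mu P 0 = Infinity"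
  by simp_all

lemma mu_2: "P \<in> epts Qbar \<Longrightarrow> mu P 2 = eadd P P"
  by (simp add: numeral_2_eq_2)

lemma mu_closed: "subfield L CC \<Longrightarrow> P \<in> epts L \<Longrightarrow> mu P n \<in> epts L"
  by (induction n) (auto simp: eadd_closed)

lemma mu_mult: "P \<in> epts Qbar \<Longrightarrow> mu (mu P n) k = mu P (n * k)"
  using E.nat_pow_pow[of P n k] by simp

lemma mu_add: "P \<in> epts Qbar \<Longrightarrow> mu P (n + k) = eadd (mu P n) (mu P k)"
  using E.nat_pow_mult[of P n k] by simp

lemma mu_eadd: "P \<in> epts Qbar \<Longrightarrow> Q \<in> epts Qbar \<Longrightarrow> mu (eadd P Q) n = eadd (mu P n) (mu Q n)"
  using E.nat_pow_distrib[of P Q n] by simp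

lemma mu_Infinity [simp]: "mu Infinity n = Infinity"
  using E.nat_pow_one[of n] by simp

lemma eadd_Qbar: "P \<in> epts Qbar \<Longrightarrow> Q \<in> epts Qbar \<Longrightarrow> eadd P Q \<in> epts Qbar"
  by (rule eadd_closed[OF subfield_Qbar])

lemma eneg_Qbar: "P \<in> epts Qbar \<Longrightarrow> eneg P \<in> epts Qbar"
  by (rule eneg_epts[OF subfield_Qbar])

lemma eadd_cancel:
  assumes "P \<in> epts Qbar" "Q \<in> epts Qbar"
  shows "eadd (eadd P Q) (eneg Q) = P" "eadd P Q = Infinity \<longleftrightarrow> P = eneg Q"
proof -
  show c: "eadd (eadd P Q) (eneg Q) = P"
    using epts_assoc[OF assms eneg_Qbar[OF assms(2)]] by simp
  show "eadd P Q = Infinity \<longleftrightarrow> P = eneg Q"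
    using c by auto
qed

lemma eneg_eadd:
  assumes "P \<in> epts Qbar" "Q \<in> epts Qbar"
  shows "eneg (eadd P Q) = eadd (eneg P) (eneg Q)"
proof -
  note m = assms eneg_Qbar[OF assms(1)] eneg_Qbar[OF assms(2)]
  have "eadd (eadd (eneg P) (eneg Q)) (eadd Q P) = eadd (eneg P) (eadd (eadd (eneg Q) Q) P)"
    using m by (simp only: epts_assoc eadd_Qbar)
  then have "eadd (eadd (eneg P) (eneg Q)) (eadd P Q) = Infinity"
    using epts_comm[OF assms] by simp
  then show ?thesis
    using eadd_cancel(2)[of "eadd (eneg P) (eneg Q)" "eadd P Q"] m eadd_Qbar by simp
qed

lemma mu_eneg: "P \<in> epts Qbar \<Longrightarrow> mu (eneg P) n = eneg (mu P n)"
  by (induction n) (auto simp: eneg_eadd mu_closed[OF subfield_Qbar])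

lemma point_map_mu:
  assumes "embedding Qbar \<sigma>" "P \<in> epts Qbar"
  shows "point_map \<sigma> (mu P n) = mu (point_map \<sigma> P) n"
  using assms by (induction n) (auto simp: point_map_eadd mu_closed[OF subfield_Qbar])

lemma point_map_K: "\<sigma> \<in> gal \<rat> \<Longrightarrow> P \<in> epts K \<Longrightarrow> point_map \<sigma> P \<in> epts K"
  using point_map_epts[OF galD(1), of \<sigma> \<rat> P] K_epts[of P] gal_K by (cases P) auto

lemma point_map_involution: "\<sigma> \<in> gal \<rat> \<Longrightarrow> P \<in> epts K \<Longrightarrow> point_map \<sigma> (point_map \<sigma> P) = P"
  by (cases P) (auto simp: gal_involution)

lemma point_map_commute:
  "\<sigma> \<in> gal \<rat> \<Longrightarrow> \<tau> \<in> gal \<rat> \<Longrightarrow> P \<in> epts K \<Longrightarrow> point_map \<sigma> (point_map \<tau> P) = point_map \<tau> (point_map \<sigma> P)"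
  by (cases P) (auto simp: gal_commute)

section \<open>Points of 2-power order\<close>

lemma norm_5_fixes_sqrt5:
  assumes \<rho>: "\<rho> \<in> gal \<rat>" and y: "y \<in> K" and n: "(y * \<rho> y)\<^sup>2 = 5"
  shows "\<rho> sqrt5 = sqrt5"
proof -
  have m: "y \<in> Qbar" "\<rho> y \<in> Qbar"
    using y gal_K[OF \<rho> y] K_Qbar by auto
  have fixed: "\<rho> (y * \<rho> y) = y * \<rho> y"
    using embedding_mult[OF galD(1)[OF \<rho>] m] gal_involution[OF \<rho> y] by simp
  have "\<rho> (- sqrt5) = - \<rho> sqrt5"
    using embedding_uminus[OF galD(1)[OF \<rho>] sqrt5_Qbar] .
  then show ?thesis
    using fixed sqrt_5_cases[OF n] by auto
qed

lemma sqrt5_nonzero: "sqrt5 \<noteq> - sqrt5"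
  using sqrt5_irrational[OF sqrt5_sq] by auto

text \<open>A half of \<open>(0, 0)\<close> has as abscissa a square root of -1, and the square of
  its ordinate has norm 5. By \<open>norm_5_fixes_sqrt5\<close> every automorphism that moves
  \<open>x\<close> fixes sqrt 5. An automorphism \<open>\<tau>\<close> that flips sqrt 5 must then
  fix \<open>x\<close>; but with a \<open>\<sigma>\<close> that moves \<open>x\<close>, the
  composition \<open>\<sigma> \<circ> \<tau>\<close> moves \<open>x\<close> and still flips sqrt
  5.\<close>

lemma not_twice_origin:
  assumes x: "x \<in> K" "x\<^sup>2 = - 1" and y: "y \<in> K" "y\<^sup>2 = - 1 - 2 * x"
  shows False
proof -
  have xn: "x \<notin> \<rat>"
  proof
    assume "x \<in> \<rat>"
    then obtain q :: rat where "x = of_rat q"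
      by (auto elim: Rats_cases)
    then have "(of_rat (q\<^sup>2) :: complex) = of_rat (- 1)"
      using x(2) by (simp add: of_rat_power of_rat_minus)
    then have "q\<^sup>2 = - 1"
      by (simp only: of_rat_eq_iff)
    then show False
      using zero_le_power2[of q] by linarith
  qed
  have xQ: "x \<in> Qbar"
    using x(1) K_Qbar by blast
  obtain \<sigma> where \<sigma>: "\<sigma> \<in> gal \<rat>" "\<sigma> x \<noteq> x"
    by (rule fixed_field_gal[OF subfield_Rats Rats_subset_Qbar xQ xn])
  have yQ: "y \<in> Qbar"
    using y(1) K_Qbar by blast
  have key: "\<rho> sqrt5 = sqrt5" if \<rho>: "\<rho> \<in> gal \<rat>" "\<rho> x \<noteq> x" for \<rho>
  proof -
    note e = galD(1)[OF \<rho>(1)]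
    have m1: "\<rho> (- 1) = - 1"
      using galD(3)[OF \<rho>(1), of "- 1"] by simp
    have two: "\<rho> 2 = 2"
      using galD(3)[OF \<rho>(1), of 2] by simp
    have "(\<rho> x)\<^sup>2 = x\<^sup>2"
      using embedding_power[OF e xQ, of 2] x(2) m1 by simp
    then have rx: "\<rho> x = - x"
      using \<rho>(2) by (auto simp: power2_eq_iff)
    have mem: "- 1 \<in> Qbar" "2 * x \<in> Qbar" "2 \<in> Qbar"
      using xQ by (auto intro!: sf_intros[OF subfield_Qbar])
    have "(\<rho> y)\<^sup>2 = \<rho> (- 1 - 2 * x)"
      using embedding_power[OF e yQ, of 2] y(2) by simp
    also have "\<dots> = - 1 + 2 * x"
      unfolding embedding_diff[OF e mem(1,2)] embedding_mult[OF e mem(3) xQ] m1 two rx by simp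
    finally have "(y * \<rho> y)\<^sup>2 = (- 1 - 2 * x) * (- 1 + 2 * x)"
      by (simp only: power_mult_distrib y(2))
    also have "\<dots> = 5"
      using x(2) by Groebner_Basis.algebra
    finally have "(y * \<rho> y)\<^sup>2 = 5" .
    then show ?thesis
      by (rule norm_5_fixes_sqrt5[OF \<rho>(1) y(1)])
  qed
  obtain \<tau> where \<tau>: "\<tau> \<in> gal \<rat>" "\<tau> sqrt5 = - sqrt5"
    by (rule gal_flip_sqrt5)
  then have tx: "\<tau> x = x"
    using key sqrt5_nonzero by metis
  have "(\<sigma> \<circ> \<tau>) sqrt5 = sqrt5"
    using key[OF gal_comp[OF \<sigma>(1) \<tau>(1)]] tx \<sigma>(2) by simp
  moreover have "\<sigma> (- sqrt5) = - sqrt5"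
    using key[OF \<sigma>] embedding_uminus[OF galD(1)[OF \<sigma>(1)] sqrt5_Qbar] by simp
  ultimately show False
    using \<tau>(2) sqrt5_nonzero by simp
qed

text \<open>A half of a 2-torsion point \<open>(e, 0)\<close> with irrational \<open>e\<close> has
  abscissa \<open>e + w\<close>. Flipping sqrt 5 exchanges \<open>e\<close> with
  \<open>- 1 - e\<close>, and \<open>(2 - e) * (3 + e) = 5\<close>.\<close>

lemma not_twice_other:
  assumes e: "e \<in> K" "e\<^sup>2 + e - 1 = 0" and w: "w \<in> K" "w\<^sup>2 = 2 - e"
  shows False
proof -
  obtain \<rho> where \<rho>: "\<rho> \<in> gal \<rat>" "\<rho> sqrt5 = - sqrt5"
    by (rule gal_flip_sqrt5)
  note emb = galD(1)[OF \<rho>(1)]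
  have Q: "e \<in> Qbar" "w \<in> Qbar" "2 \<in> Qbar" "1 \<in> Qbar" "2 * e \<in> Qbar"
    using e(1) w(1) K_Qbar by (auto intro!: sf_intros[OF subfield_Qbar])
  have r: "\<rho> 2 = 2" "\<rho> 1 = 1"
    using galD(3)[OF \<rho>(1)] by auto
  have "(2 * e + 1)\<^sup>2 = 5"
    using e(2) by Groebner_Basis.algebra
  then have "2 * e + 1 = sqrt5 \<or> 2 * e + 1 = - sqrt5"
    by (rule sqrt_5_cases)
  moreover have "\<rho> (- sqrt5) = sqrt5"
    using embedding_uminus[OF emb sqrt5_Qbar] \<rho>(2) by simp
  ultimately have "\<rho> (2 * e + 1) = - (2 * e + 1)"
    by (elim disjE) (simp_all only: \<rho>(2) minus_minus)
  moreover have "\<rho> (2 * e + 1) = 2 * \<rho> e + 1"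
    unfolding embedding_add[OF emb Q(5,4)] embedding_mult[OF emb Q(3,1)] r ..
  ultimately have "2 * \<rho> e + 1 = - (2 * e + 1)"
    by simp
  then have re: "\<rho> e = - 1 - e"
    by Groebner_Basis.algebra
  have "(\<rho> w)\<^sup>2 = 2 - \<rho> e"
    using embedding_power[OF emb Q(2), of 2] w(2) embedding_diff[OF emb Q(3,1)] r by simp
  then have "(w * \<rho> w)\<^sup>2 = (2 - e) * (3 + e)"
    unfolding power_mult_distrib w(2) re by simp
  also have "\<dots> = 5"
    using e(2) by Groebner_Basis.algebra
  finally have "\<rho> sqrt5 = sqrt5"
    by (rule norm_5_fixes_sqrt5[OF \<rho>(1) w(1)])
  then show False
    using \<rho>(2) sqrt5_nonzero by simp
qed

lemma no_order_four:
  assumes P: "P \<in> epts K" and four: "mu P 4 = Infinity"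
  shows "mu P 2 = Infinity"
proof (rule ccontr)
  assume two: "mu P 2 \<noteq> Infinity"
  have PQ: "P \<in> epts Qbar"
    using K_epts[OF P] .
  obtain x y where xy: "P = Affine x y"
    using two by (cases P) auto
  obtain e z where ez: "mu P 2 = Affine e z"
    using two by (cases "mu P 2") auto
  have D: "eadd (Affine x y) (Affine x y) = Affine e z"
    using ez mu_2[OF PQ] xy by simp
  have c: "y\<^sup>2 = crv x" "x \<in> K" "y \<in> K"
    using P xy by auto
  have "Affine e z \<in> epts K"
    using mu_closed[OF subfield_K P, of 2] ez by simp
  then have ezK: "e \<in> K" "z\<^sup>2 = crv e"
    by auto
  have "mu (mu P 2) 2 = Infinity"
    using mu_mult[OF PQ, of 2 2] four by simp
  then have "eadd (Affine e z) (Affine e z) = Infinity"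
    using mu_2[OF mu_closed[OF subfield_Qbar PQ], of 2] unfolding ez by (simp only:)
  then have "z = 0"
    by (auto split: if_splits simp: Let_def)
  then have "e * (e\<^sup>2 + e - 1) = 0"
    using ezK(2) by (simp add: crv_def power2_eq_square power3_eq_cube algebra_simps)
  then have "e = 0 \<or> e\<^sup>2 + e - 1 = 0"
    by simp
  then show False
  proof
    assume "e = 0"
    then have "(x\<^sup>2 + 1)\<^sup>2 = 0"
      using eadd_double(2)[OF c(1) D] by simp
    then have x2: "x\<^sup>2 = - 1"
      by (simp add: add_eq_0_iff2)
    have "y\<^sup>2 = - 1 - 2 * x"
      using c(1) x2 unfolding crv_def by Groebner_Basis.algebra
    then show False
      using not_twice_origin[OF c(2) x2 c(3)] by blast
  next
    assume e: "e\<^sup>2 + e - 1 = 0"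
    \<comment> \<open>For a 2-torsion abscissa \<open>e\<close> the condition that the double has
      abscissa \<open>e\<close> is a perfect square in \<open>x\<close>.\<close>
    have "((x - e)\<^sup>2 - (2 - e))\<^sup>2 = 0"
      using eadd_double(2)[OF c(1) D] e unfolding crv_def by Groebner_Basis.algebra
    then have "(x - e)\<^sup>2 = 2 - e"
      by simp
    then show False
      using not_twice_other[OF ezK(1) e sf_diff[OF subfield_K c(2) ezK(1)]] by blast
  qed
qed

lemma two_power_torsion:
  assumes "P \<in> epts K" "mu P (2 ^ a) = Infinity"
  shows "mu P 2 = Infinity"
  using assms
proof (induction a arbitrary: P)
  case 0
  then show ?case
    using K_epts[of P] by simp
next
  case (Suc a)
  note PQ = K_epts[OF Suc.prems(1)]
  have "mu (mu P 2) (2 ^ a) = Infinity"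
    using Suc.prems(2) mu_mult[OF PQ, of 2 "2 ^ a"] by simp
  then have "mu (mu P 2) 2 = Infinity"
    by (rule Suc.IH[OF mu_closed[OF subfield_K Suc.prems(1)]])
  then show ?case
    using no_order_four[OF Suc.prems(1)] mu_mult[OF PQ, of 2 2] by simp
qed

section \<open>Points of odd order\<close>

definition semi_invariant :: "(complex \<Rightarrow> complex) \<Rightarrow> point \<Rightarrow> bool" where
  "semi_invariant \<sigma> P \<longleftrightarrow> point_map \<sigma> P = P \<or> point_map \<sigma> P = eneg P"

lemma semi_invariant_mu:
  "\<sigma> \<in> gal \<rat> \<Longrightarrow> P \<in> epts K \<Longrightarrow> semi_invariant \<sigma> P \<Longrightarrow> semi_invariant \<sigma> (mu P n)"
  using point_map_mu[OF galD(1), of \<sigma> \<rat> P n] mu_eneg[of P n] K_epts[of P] by (auto simp: semi_invariant_def)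

text \<open>2 is invertible modulo the odd number \<open>m\<close>. By Euler's theorem the points
  \<open>2 ^ k P\<close> repeat with period \<open>totient m\<close>, and none of them is 0 unless
  \<open>P\<close> is; this allows \<open>duplication_periodic\<close> to be applied to their
  abscissae.\<close>

lemma odd_torsion_rational:
  assumes P: "P \<in> epts K" and m: "odd m" "mu P m = Infinity"
    and semi: "\<forall>\<sigma>\<in>gal \<rat>. semi_invariant \<sigma> P"
  shows "P \<in> three_torsion"
proof (cases "P = Infinity")
  case False
  note PQ = K_epts[OF P]
  have ne: "mu P (2 ^ k) \<noteq> Infinity" for k
  proof
    assume "mu P (2 ^ k) = Infinity"
    then have "E.ord P dvd 2 ^ k" "E.ord P dvd m"
      using E.pow_eq_id[of P] PQ m(2) by auto
    moreover have "Rings.coprime (2 ^ k) m"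
      using m(1) by simp
    ultimately have "E.ord P dvd 1"
      using coprime_common_divisor by blast
    then have "mu P 1 = Infinity"
      using E.pow_eq_id[of P 1] PQ by simp
    then show False
      using False PQ by simp
  qed
  have "\<exists>q y. mu P (2 ^ k) = Affine (of_rat q) y" for k
  proof -
    obtain x y where xy: "mu P (2 ^ k) = Affine x y"
      using ne[of k] by (cases "mu P (2 ^ k)") auto
    have "Affine x y \<in> epts K"
      using mu_closed[OF subfield_K P, of "2 ^ k"] xy by simp
    then have xQ: "x \<in> Qbar"
      using K_Qbar by auto
    have "\<sigma> x = x" if "\<sigma> \<in> gal \<rat>" for \<sigma>
      using semi_invariant_mu[OF that P, of "2 ^ k"] semi that xy by (auto simp: semi_invariant_def)
    then have "x \<in> \<rat>"
      using fixed_field_gal[OF subfield_Rats Rats_subset_Qbar xQ] by blast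
    then show ?thesis
      using xy by (auto elim: Rats_cases)
  qed
  then obtain f y where f: "\<And>k. mu P (2 ^ k) = Affine (of_rat (f k)) (y k)"
    by metis
  have c: "(y k)\<^sup>2 = crv (of_rat (f k))" for k
    using mu_closed[OF subfield_K P, of "2 ^ k"] f[of k] by simp
  have "f (Suc k) * (4 * (f k ^ 3 + (f k)\<^sup>2 - f k)) = ((f k)\<^sup>2 + 1)\<^sup>2" for k
  proof -
    have "mu (mu P (2 ^ k)) 2 = mu P (2 ^ Suc k)"
      using mu_mult[OF PQ, of "2 ^ k" 2] by (simp add: mult.commute)
    then have "eadd (Affine (of_rat (f k)) (y k)) (Affine (of_rat (f k)) (y k)) = Affine (of_rat (f (Suc k))) (y (Suc k))"
      using mu_2[OF mu_closed[OF subfield_Qbar PQ, of "2 ^ k"]] f[of k] f[of "Suc k"] by simp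
    from eadd_double(2)[OF c this]
    have "(of_rat (f (Suc k) * (4 * (f k ^ 3 + (f k)\<^sup>2 - f k))) :: complex) = of_rat (((f k)\<^sup>2 + 1)\<^sup>2)"
      by (simp add: crv_def of_rat_mult of_rat_add of_rat_diff of_rat_power)
    then show ?thesis
      by (simp only: of_rat_eq_iff)
  qed
  moreover have "f (totient m) = f 0"
  proof -
    have "[2 ^ totient m = 1] (mod m)"
      using m(1) by (intro euler_theorem) simp
    then have "m dvd 2 ^ totient m - 1"
      by (simp add: cong_altdef_nat)
    then obtain q where "2 ^ totient m - 1 = m * q"
      by (rule dvdE)
    moreover have "(1 :: nat) \<le> 2 ^ totient m"
      by simp
    ultimately have q: "2 ^ totient m = m * q + 1"
      by linarith
    have "mu P (2 ^ totient m) = eadd (mu (mu P m) q) (mu P 1)"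
      unfolding q mu_add[OF PQ] mu_mult[OF PQ] ..
    then have "mu P (2 ^ totient m) = mu P (2 ^ 0)"
      using m(2) PQ by simp
    then show ?thesis
      using f[of "totient m"] f[of 0] by simp
  qed
  moreover have "totient m > 0"
    using m(1) by (auto intro!: Nat.gr0I)
  ultimately have "f 0 = 1"
    by (rule duplication_periodic)
  then have "P = Affine 1 (y 0)" "(y 0)\<^sup>2 = 1"
    using f[of 0] c[of 0] PQ by (auto simp: crv_def)
  then show ?thesis
    by (auto simp: three_torsion_def power2_eq_1_iff)
qed (simp add: three_torsion_def)

lemma point_map_eq_restrict:
  assumes st: "\<sigma> \<in> gal \<rat>" "\<tau> \<in> gal \<rat>" "{s \<in> S. \<sigma> s = s} = {s \<in> S. \<tau> s = s}" and P: "P \<in> epts K"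
  shows "point_map \<sigma> P = point_map \<tau> P"
proof -
  have "\<sigma> s = \<tau> s" if "s \<in> S" for s
  proof -
    have "\<sigma> s = s \<longleftrightarrow> \<tau> s = s"
      using st(3) that by (auto simp: set_eq_iff)
    then show ?thesis
      using gal_gen[OF st(1) that] gal_gen[OF st(2) that] by auto
  qed
  then have "\<sigma> x = \<tau> x" if "x \<in> K" for x
    using gal_agree[OF st(1,2) _ that] by simp
  then show ?thesis
    using P by (cases P) auto
qed

text \<open>If \<open>\<tau> P \<noteq> \<plusminus>P\<close>, then \<open>P + \<tau> P\<close> and \<open>P - \<tau> P\<close> are mapped to \<open>\<plusminus>\<close>themselves by strictly more
  automorphisms than \<open>P\<close>, and \<open>2 P\<close> is their sum.\<close>

lemma odd_torsion:
  assumes m: "odd m"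
  shows "P \<in> epts K \<Longrightarrow> mu P m = Infinity \<Longrightarrow> P \<in> three_torsion"
proof (induction "card ((\<lambda>\<sigma>. {s \<in> S. \<sigma> s = s}) ` {\<sigma> \<in> gal \<rat>. \<not> semi_invariant \<sigma> P})" arbitrary: P rule: less_induct)
  case less
  \<comment> \<open>The induction counts the automorphisms that do not act on \<open>P\<close> by a
    sign, each recorded by the generators in \<open>S\<close> that it fixes. These generators
    determine the action on \<open>K\<close>, and the finiteness of \<open>S\<close> makes the count
    finite.\<close>
  define res where "res \<sigma> = {s \<in> S. \<sigma> s = s}" for \<sigma> :: "complex \<Rightarrow> complex"
  define bad where "bad P = {\<sigma> \<in> gal \<rat>. \<not> semi_invariant \<sigma> P}" for P
  note P = less.prems(1)
  note PQ = K_epts[OF P]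
  show ?case
  proof (cases "\<forall>\<sigma>\<in>gal \<rat>. semi_invariant \<sigma> P")
    case True
    then show ?thesis
      using odd_torsion_rational[OF P m less.prems(2)] by blast
  next
    case False
    then obtain \<tau> where \<tau>: "\<tau> \<in> gal \<rat>" "\<not> semi_invariant \<tau> P"
      by blast
    have IH: "R \<in> three_torsion" if R: "R \<in> epts K" "mu R m = Infinity" "semi_invariant \<tau> R"
      and mono: "\<And>\<sigma>. \<sigma> \<in> gal \<rat> \<Longrightarrow> semi_invariant \<sigma> P \<Longrightarrow> semi_invariant \<sigma> R" for R
    proof -
      have "res ` bad R \<subseteq> res ` bad P"
        using mono by (auto simp: bad_def)
      moreover have "res \<tau> \<in> res ` bad P"
        using \<tau> by (auto simp: bad_def)
      moreover have "res \<tau> \<notin> res ` bad R"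
      proof
        assume "res \<tau> \<in> res ` bad R"
        then obtain \<sigma> where \<sigma>: "\<sigma> \<in> gal \<rat>" "\<not> semi_invariant \<sigma> R" "res \<tau> = res \<sigma>"
          by (auto simp: bad_def)
        then have "point_map \<sigma> R = point_map \<tau> R"
          using point_map_eq_restrict[OF \<sigma>(1) \<tau>(1) _ R(1)] by (simp add: res_def)
        then show False
          using \<sigma>(2) R(3) by (simp add: semi_invariant_def)
      qed
      ultimately have "res ` bad R \<subset> res ` bad P"
        by blast
      moreover have "finite (res ` bad P)"
        by (rule finite_subset[of _ "Pow S"]) (auto simp: res_def finite_S)
      ultimately have "card (res ` bad R) < card (res ` bad P)"
        by (rule psubset_card_mono[rotated])
      then show ?thesis
        using less.hyps[of R] R(1,2) by (simp add: res_def[abs_def] bad_def)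
    qed
    define T where "T = point_map \<tau> P"
    have T: "T \<in> epts K" "T \<in> epts Qbar" "eneg T \<in> epts K" "eneg T \<in> epts Qbar"
      using point_map_K[OF \<tau>(1) P] K_epts eneg_epts[OF subfield_K] by (auto simp: T_def)
    note et = galD(1)[OF \<tau>(1)]
    have Tt: "point_map \<tau> T = P"
      using point_map_involution[OF \<tau>(1) P] by (simp add: T_def)
    have nP: "eneg P \<in> epts Qbar"
      using eneg_Qbar[OF PQ] .
    have "mu T m = point_map \<tau> (mu P m)"
      unfolding T_def using point_map_mu[OF et PQ] by simp
    then have mT: "mu T m = Infinity"
      using less.prems(2) by simp
    have semiT: "point_map \<sigma> P = P \<and> point_map \<sigma> T = T \<or> point_map \<sigma> P = eneg P \<and> point_map \<sigma> T = eneg T"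
      if "\<sigma> \<in> gal \<rat>" "semi_invariant \<sigma> P" for \<sigma>
    proof -
      have "point_map \<sigma> T = point_map \<tau> (point_map \<sigma> P)"
        unfolding T_def by (rule point_map_commute[OF that(1) \<tau>(1) P])
      then show ?thesis
        using that(2) point_map_eneg[OF et PQ] by (auto simp: semi_invariant_def T_def)
    qed
    have "eadd P T \<in> three_torsion"
    proof (rule IH)
      show "eadd P T \<in> epts K"
        by (rule eadd_closed[OF subfield_K P T(1)])
      show "mu (eadd P T) m = Infinity"
        using mu_eadd[OF PQ T(2)] less.prems(2) mT by simp
      show "semi_invariant \<tau> (eadd P T)"
        using point_map_eadd[OF et PQ T(2)] Tt epts_comm[OF PQ T(2)] by (simp add: semi_invariant_def T_def)
      show "semi_invariant \<sigma> (eadd P T)" if "\<sigma> \<in> gal \<rat>" "semi_invariant \<sigma> P" for \<sigma>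
        using semiT[OF that] point_map_eadd[OF galD(1)[OF that(1)] PQ T(2)] eneg_eadd[OF PQ T(2)]
        by (auto simp: semi_invariant_def)
    qed
    moreover have "eadd P (eneg T) \<in> three_torsion"
    proof (rule IH)
      show "eadd P (eneg T) \<in> epts K"
        by (rule eadd_closed[OF subfield_K P T(3)])
      show "mu (eadd P (eneg T)) m = Infinity"
        using mu_eadd[OF PQ T(4)] mu_eneg[OF T(2)] less.prems(2) mT by simp
      show "semi_invariant \<tau> (eadd P (eneg T))"
        using point_map_eadd[OF et PQ T(4)] point_map_eneg[OF et T(2)] Tt epts_comm[OF nP T(2)] eneg_eadd[OF PQ T(4)]
        by (simp add: semi_invariant_def T_def)
      show "semi_invariant \<sigma> (eadd P (eneg T))" if "\<sigma> \<in> gal \<rat>" "semi_invariant \<sigma> P" for \<sigma>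
        using semiT[OF that] point_map_eadd[OF galD(1)[OF that(1)] PQ T(4)] point_map_eneg[OF galD(1)[OF that(1)] T(2)]
          eneg_eadd[OF PQ T(4)] by (auto simp: semi_invariant_def)
    qed
    ultimately have D3: "eadd (eadd P T) (eadd P (eneg T)) \<in> three_torsion"
      by (rule three_torsion_eadd)
    have "eadd (eadd P T) (eadd P (eneg T)) = eadd (eadd (eadd P T) (eneg T)) P"
      using epts_assoc[OF eadd_Qbar[OF PQ T(2)] T(4) PQ] epts_comm[OF PQ T(4)] by simp
    also have "\<dots> = mu P 2"
      using eadd_cancel(1)[OF PQ T(2)] mu_2[OF PQ] by simp
    finally have D: "mu P 2 \<in> three_torsion"
      using D3 by simp
    \<comment> \<open>Since \<open>m = 2 * k + 1\<close> kills \<open>P\<close>, the point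
      \<open>P\<close> is the negative of a multiple of \<open>2 P\<close>.\<close>
    obtain k where k: "m = 2 * k + 1"
      using m by (rule oddE)
    have Dk: "mu (mu P 2) k \<in> three_torsion" for k
      by (induction k) (auto simp: three_torsion_eadd[OF _ D], simp add: three_torsion_def)
    have "eadd (mu (mu P 2) k) P = mu P m"
      using mu_add[OF PQ, of "2 * k" 1] mu_mult[OF PQ, of 2 k] PQ k by simp
    then have "mu (mu P 2) k = eneg P"
      using eadd_cancel(2)[OF mu_closed[OF subfield_Qbar mu_closed[OF subfield_Qbar PQ]] PQ] less.prems(2) by simp
    then show ?thesis
      using three_torsion_eneg[OF Dk[of k]] by simp
  qed
qed

text \<open>As \<open>2 P\<close> is killed by 3, the point \<open>3 P\<close> is killed by 2, and
  \<open>P = 3 P - 2 P\<close>.\<close>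

lemma torsion_decomposition:
  assumes P: "P \<in> epts K" and n: "n > 0" "mu P n = Infinity"
  obtains e t where "e \<in> epts K" "eadd e e = Infinity" "t \<in> three_torsion" "P = eadd e t"
proof -
  note PQ = K_epts[OF P]
  have "\<exists>a m. n = 2 ^ a * m \<and> odd m"
    using n(1)
  proof (induction n rule: less_induct)
    case (less n)
    show ?case
    proof (cases "even n")
      case True
      then obtain k where k: "n = 2 * k"
        by blast
      then obtain a m where "k = 2 ^ a * m" "odd m"
        using less.IH[of k] less.prems by auto
      then show ?thesis
        using k by (intro exI[of _ "Suc a"] exI[of _ m]) simp
    qed (intro exI[of _ 0] exI[of _ n], simp)
  qed
  then obtain a m where am: "n = 2 ^ a * m" "odd m"
    by blast
  have "mu (mu P m) (2 ^ a) = Infinity"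
    using mu_mult[OF PQ, of m "2 ^ a"] am n(2) by (simp add: mult.commute)
  then have "mu (mu P m) 2 = Infinity"
    by (rule two_power_torsion[OF mu_closed[OF subfield_K P]])
  then have "mu (mu P 2) m = Infinity"
    using mu_mult[OF PQ, of m 2] mu_mult[OF PQ, of 2 m] by (simp add: mult.commute)
  then have T: "mu P 2 \<in> three_torsion"
    by (rule odd_torsion[OF am(2) mu_closed[OF subfield_K P]])
  define T where "T = eadd P P"
  have T3: "T \<in> three_torsion"
    using T mu_2[OF PQ] by (simp add: T_def)
  have TK: "T \<in> epts K" "T \<in> epts Qbar" "eneg T \<in> epts Qbar"
    using three_torsion_epts[OF _ T3] subfield_K subfield_Qbar eneg_Qbar by auto
  have "eadd (eadd P T) (eadd P T) = eadd (eadd P P) (eadd T T)"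
    using mu_eadd[OF PQ TK(2), of 2] mu_2[OF PQ] mu_2[OF TK(2)] mu_2[OF eadd_Qbar[OF PQ TK(2)]] by simp
  then have "eadd (eadd P T) (eadd P T) = Infinity"
    using three_torsion_triple[OF T3] by (simp add: T_def)
  moreover have "P = eadd (eadd P T) (eneg T)"
    using eadd_cancel(1)[OF PQ TK(2)] by simp
  ultimately show ?thesis
    using that[of "eadd P T" "eneg T"] eadd_closed[OF subfield_K P TK(1)] three_torsion_eneg[OF T3] by blast
qed

section \<open>The explicit torsion points\<close>

lemma two_torsion_points:
  assumes e: "e \<in> epts K" "eadd e e = Infinity"
  shows "e = Infinity \<or> e = Affine 0 0 \<or>
    sqrt5 \<in> K \<and> (e = Affine ((sqrt5 - 1) / 2) 0 \<or> e = Affine (- 1 - (sqrt5 - 1) / 2) 0)"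
proof (cases e)
  case (Affine x z)
  have xK: "x \<in> K" and c: "z\<^sup>2 = crv x"
    using e(1) Affine by auto
  have z: "z = 0"
    using e(2) Affine by (auto split: if_splits simp: Let_def)
  have "x * (x\<^sup>2 + x - 1) = 0"
    using c z by (simp add: crv_def power2_eq_square power3_eq_cube algebra_simps)
  then have "x = 0 \<or> x\<^sup>2 + x - 1 = 0"
    by simp
  then show ?thesis
  proof
    assume "x\<^sup>2 + x - 1 = 0"
    then have "(2 * x + 1)\<^sup>2 = 5"
      by Groebner_Basis.algebra
    then have s: "2 * x + 1 = sqrt5 \<or> 2 * x + 1 = - sqrt5"
      by (rule sqrt_5_cases)
    have "2 * x + 1 \<in> K"
      by (intro sf_intros[OF subfield_K] xK)
    then have "sqrt5 \<in> K"
      using s sf_uminus[OF subfield_K, of "- sqrt5"] by auto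
    moreover have "x = (sqrt5 - 1) / 2 \<or> x = - 1 - (sqrt5 - 1) / 2"
      using s
    proof
      assume "2 * x + 1 = sqrt5"
      then have "x = (sqrt5 - 1) / 2"
        by (metis add_diff_cancel_right' nonzero_mult_div_cancel_left zero_neq_numeral)
      then show ?thesis ..
    next
      assume "2 * x + 1 = - sqrt5"
      then have s': "sqrt5 = - (2 * x + 1)"
        by simp
      have "x = - 1 - (sqrt5 - 1) / 2"
        unfolding s' by (simp add: field_simps)
      then show ?thesis ..
    qed
    ultimately show ?thesis
      using Affine z by auto
  qed (use Affine z in simp)
qed simp

text \<open>A point of order 6 whose multiples turn out to be all the rational points.\<close>

definition gg :: point where
  "gg = Affine (- 1) 1"

definition tt :: point where
  "tt = Affine ((sqrt5 - 1) / 2) 0"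

text \<open>Coordinates on the group of type Z/2 x Z/6 generated by \<open>tt\<close> and
  \<open>gg\<close>.\<close>

definition PT :: "nat \<Rightarrow> nat \<Rightarrow> point" where
  "PT a b = eadd (mu tt a) (mu gg b)"

lemma alpha_eq: "((sqrt5 - 1) / 2)\<^sup>2 + (sqrt5 - 1) / 2 - 1 = 0"
  using sqrt5_sq by (simp add: power2_eq_square field_simps)

lemma alpha_nonzero: "(sqrt5 - 1) / 2 \<noteq> 0"
  using alpha_eq by (intro notI) simp

lemma gg_epts: "subfield L CC \<Longrightarrow> gg \<in> epts L"
  using sf_1[of L] sf_uminus[of L 1] by (simp add: gg_def crv_def)

lemma tt_epts: "subfield L CC \<Longrightarrow> sqrt5 \<in> L \<Longrightarrow> tt \<in> epts L"
proof -
  assume L: "subfield L CC" "sqrt5 \<in> L"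
  have "crv z = z * (z\<^sup>2 + z - 1)" for z :: complex
    by (simp add: crv_def power2_eq_square power3_eq_cube algebra_simps)
  then have "crv ((sqrt5 - 1) / 2) = 0"
    by (simp only: alpha_eq mult_zero_right)
  moreover have "(sqrt5 - 1) / 2 \<in> L" "0 \<in> L"
    by (intro sf_intros[OF L(1)] L(2))+
  ultimately show ?thesis
    by (simp add: tt_def)
qed

lemmas gg_Qbar = gg_epts[OF subfield_Qbar]
lemmas tt_Qbar = tt_epts[OF subfield_Qbar sqrt5_Qbar]

lemma mu_gg: "mu gg 1 = gg" "mu gg 2 = Affine 1 (- 1)" "mu gg 3 = Affine 0 0" "mu gg 4 = Affine 1 1"
  "mu gg 5 = Affine (- 1) (- 1)" "mu gg 6 = Infinity"
proof -
  show 1: "mu gg 1 = gg"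
    using gg_Qbar by simp
  have S: "mu gg m = eadd (mu gg n) gg" if "m = Suc n" for m n
    unfolding that by (rule mu_Suc)
  have "mu gg 2 = eadd gg gg"
    using S[of 2 1] unfolding 1 by simp
  also have "\<dots> = Affine 1 (- 1)"
    by (simp add: gg_def slope_def Let_def)
  finally show 2: "mu gg 2 = Affine 1 (- 1)" .
  have "mu gg 3 = eadd (mu gg 2) gg"
    by (rule S) simp
  also have "\<dots> = Affine 0 0"
    unfolding 2 by (simp add: gg_def slope_def Let_def)
  finally show 3: "mu gg 3 = Affine 0 0" .
  have "mu gg 4 = eadd (mu gg 3) gg"
    by (rule S) simp
  also have "\<dots> = Affine 1 1"
    unfolding 3 by (simp add: gg_def slope_def Let_def)
  finally show 4: "mu gg 4 = Affine 1 1" .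
  have "mu gg 5 = eadd (mu gg 4) gg"
    by (rule S) simp
  also have "\<dots> = Affine (- 1) (- 1)"
    unfolding 4 by (simp add: gg_def slope_def Let_def)
  finally show 5: "mu gg 5 = Affine (- 1) (- 1)" .
  have "mu gg 6 = eadd (mu gg 5) gg"
    by (rule S) simp
  also have "\<dots> = Infinity"
    unfolding 5 by (simp add: gg_def)
  finally show "mu gg 6 = Infinity" .
qed

lemma mu_tt: "mu tt 1 = tt" "mu tt 2 = Infinity"
  using mu_2[OF tt_Qbar] tt_Qbar by (simp_all add: tt_def)

lemma PT_closed:
  assumes L: "subfield L CC" and a: "a = 0 \<or> sqrt5 \<in> L"
  shows "PT a b \<in> epts L"
proof -
  have "mu tt a \<in> epts L"
  proof (cases "a = 0")
    case True
    then show ?thesis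
      by simp
  next
    case False
    then show ?thesis
      using a by (intro mu_closed[OF L] tt_epts[OF L]) simp
  qed
  then show ?thesis
    unfolding PT_def by (rule eadd_closed[OF L _ mu_closed[OF L gg_epts[OF L]]])
qed

lemmas PT_Qbar = PT_closed[OF subfield_Qbar disjI2[OF sqrt5_Qbar]]

lemma PT_add: "eadd (PT a b) (PT c d) = PT (a + c) (b + d)"
proof -
  have m: "mu tt n \<in> epts Qbar" "mu gg n \<in> epts Qbar" for n
    by (intro mu_closed subfield_Qbar tt_Qbar gg_Qbar)+
  have "eadd (PT a b) (PT c d) = eadd (mu tt a) (eadd (eadd (mu gg b) (mu tt c)) (mu gg d))"
    unfolding PT_def by (simp only: epts_assoc m eadd_Qbar)
  also have "\<dots> = eadd (mu tt a) (eadd (eadd (mu tt c) (mu gg b)) (mu gg d))"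
    by (simp only: epts_comm[OF m(2) m(1)])
  also have "\<dots> = PT (a + c) (b + d)"
    unfolding PT_def mu_add[OF tt_Qbar] mu_add[OF gg_Qbar] by (simp only: epts_assoc m eadd_Qbar)
  finally show ?thesis .
qed

lemma mu_tt_mod: "mu tt (a mod 2) = mu tt a"
proof -
  have "mu tt a = eadd (mu tt (2 * (a div 2))) (mu tt (a mod 2))"
    by (simp flip: mu_add[OF tt_Qbar])
  also have "mu tt (2 * (a div 2)) = Infinity"
    by (simp flip: mu_mult[OF tt_Qbar] add: mu_tt)
  finally show ?thesis
    by simp
qed

lemma mu_gg_mod: "mu gg (b mod 6) = mu gg b"
proof -
  have "mu gg b = eadd (mu gg (6 * (b div 6))) (mu gg (b mod 6))"
    by (simp flip: mu_add[OF gg_Qbar])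
  also have "mu gg (6 * (b div 6)) = Infinity"
    by (simp flip: mu_mult[OF gg_Qbar] add: mu_gg)
  finally show ?thesis
    by simp
qed

lemma PT_mod: "PT (a mod 2) (b mod 6) = PT a b"
  by (simp add: PT_def mu_tt_mod mu_gg_mod)

lemma mu_gg_cases: "b < 6 \<Longrightarrow> b = 0 \<or> b = 1 \<or> b = 2 \<or> b = 3 \<or> b = 4 \<or> b = (5 :: nat)"
  by auto

text \<open>Multiples of \<open>gg\<close> are rational and distinct below 6, whereas the abscissa
  of \<open>tt\<close> is irrational, so \<open>tt\<close> is not a difference of such
  multiples.\<close>

lemma PT_inj:
  assumes lt: "a < 2" "c < 2" "b < 6" "d < 6" and eq: "PT a b = PT c d"
  shows "a = c \<and> b = d"
proof -
  have m: "mu tt n \<in> epts Qbar" "mu gg n \<in> epts Qbar" for n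
    by (intro mu_closed subfield_Qbar tt_Qbar gg_Qbar)+
  have no: False if "eadd tt (mu gg i) = mu gg k" for i k
  proof -
    have "tt = eadd (mu gg k) (eneg (mu gg i))"
      using eadd_cancel(1)[OF tt_Qbar m(2)[of i]] that by simp
    also have "\<dots> \<in> epts \<rat>"
      by (intro eadd_closed eneg_epts mu_closed gg_epts subfield_Rats)
    finally have "2 * ((sqrt5 - 1) / 2) + 1 \<in> \<rat>"
      unfolding tt_def epts_simps by (intro Rats_add Rats_mult) auto
    then show False
      using sqrt5_irrational[OF sqrt5_sq] by simp
  qed
  have ac: "(a = 0 \<or> a = 1) \<and> (c = 0 \<or> c = 1)"
    using lt(1,2) by auto
  have "a = c"
  proof (rule ccontr)
    assume "a \<noteq> c"
    then consider "a = 1" "c = 0" | "a = 0" "c = 1"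
      using ac by auto
    then show False
    proof cases
      case 1
      have "eadd tt (mu gg b) = mu gg d"
        using eq unfolding 1 PT_def mu_tt mu_0 by simp
      then show False
        by (rule no)
    next
      case 2
      have "eadd tt (mu gg d) = mu gg b"
        using eq unfolding 2 PT_def mu_tt mu_0 by simp
      then show False
        by (rule no)
    qed
  qed
  then have "eadd (mu gg b) (mu tt c) = eadd (mu gg d) (mu tt c)"
    using eq epts_comm[OF m(1) m(2)] by (simp add: PT_def)
  then have "mu gg b = mu gg d"
    using eadd_cancel(1)[OF m(2) m(1)] by metis
  then have "b = d"
    using mu_gg_cases[OF lt(3)] mu_gg_cases[OF lt(4)] mu_gg by (auto simp: gg_def)
  then show ?thesis
    using \<open>a = c\<close> by simp
qed

lemma torsion_PT:
  assumes P: "P \<in> epts K" and n: "n > 0" "mu P n = Infinity"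
  shows "\<exists>a b. (a = 0 \<or> sqrt5 \<in> K) \<and> P = PT a b"
proof -
  obtain e t where et: "e \<in> epts K" "eadd e e = Infinity" "t \<in> three_torsion" "P = eadd e t"
    by (rule torsion_decomposition[OF P n])
  have pts: "Infinity = PT 0 0" "Affine 0 0 = PT 0 3" "Affine ((sqrt5 - 1) / 2) 0 = PT 1 0" "Affine 1 1 = PT 0 4" "Affine 1 (- 1) = PT 0 2"
    by (simp_all only: PT_def mu_0 mu_gg mu_tt eadd.simps eadd_Infinity flip: tt_def)
  \<comment> \<open>The third point of order 2 is the sum of the other two.\<close>
  have pt: "Affine (- 1 - (sqrt5 - 1) / 2) 0 = PT 1 3"
  proof -
    have "PT 1 3 = eadd tt (Affine 0 0)"
      by (simp only: PT_def mu_gg mu_tt)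
    then show ?thesis
      using alpha_nonzero by (simp add: tt_def slope_def Let_def)
  qed
  have "\<exists>a b. (a = 0 \<or> sqrt5 \<in> K) \<and> e = PT a b"
    using two_torsion_points[OF et(1,2)] unfolding pts pt by blast
  moreover have "\<exists>b. t = PT 0 b"
    using et(3) unfolding three_torsion_def pts by blast
  ultimately obtain a b c where "a = 0 \<or> sqrt5 \<in> K" "e = PT a b" "t = PT 0 c"
    by blast
  then show ?thesis
    using et(4) PT_add[of a b 0 c] by auto
qed

section \<open>All points over Q and over Q(sqrt 5) are torsion\<close>

lemma rational_torsion:
  assumes P: "P \<in> epts \<rat>"
  shows "mu P 6 = Infinity"
proof -
  \<comment> \<open>\<open>rational_points\<close> lists the abscissae; their points together with
    infinity are the six multiples of \<open>gg\<close>.\<close>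
  have "\<exists>b. P = mu gg b"
  proof (cases P)
    case Infinity
    then show ?thesis
      using mu_gg(6) by metis
  next
    case (Affine x y)
    then obtain p q :: rat where pq: "x = of_rat p" "y = of_rat q"
      using P by (auto elim!: Rats_cases)
    have c: "y\<^sup>2 = crv x"
      using P Affine by simp
    then have "(of_rat (q\<^sup>2) :: complex) = of_rat (p ^ 3 + p\<^sup>2 - p)"
      by (simp add: pq crv_def of_rat_add of_rat_diff of_rat_power)
    then have "q\<^sup>2 = p ^ 3 + p\<^sup>2 - p"
      by (simp only: of_rat_eq_iff)
    from rational_points[OF this] have "x = 0 \<or> x = 1 \<or> x = - 1"
      unfolding pq(1) by (elim disjE) simp_all
    then have "P = Affine 0 0 \<or> P = Affine 1 1 \<or> P = Affine 1 (- 1) \<or> P = Affine (- 1) 1 \<or> P = Affine (- 1) (- 1)"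
      using c Affine by (auto simp: crv_def power2_eq_1_iff)
    then show ?thesis
      using mu_gg unfolding gg_def by metis
  qed
  then obtain b where b: "P = mu gg b"
    by blast
  have "mu P 6 = mu (mu gg 6) b"
    unfolding b mu_mult[OF gg_Qbar] by (simp add: mult.commute)
  then show ?thesis
    by (simp add: mu_gg)
qed

text \<open>With the conjugation \<open>\<rho>\<close> of \<open>\<rat>(\<surd>5)\<close>, the point \<open>P + \<rho> P\<close> is rational, and \<open>P - \<rho> P\<close> is a rational
  point of the quadratic twist.\<close>

lemma Q5_torsion:
  assumes P: "P \<in> epts (adjoin \<rat> {sqrt5})"
  shows "mu P 12 = Infinity"
proof -
  define Q5 where "Q5 = adjoin \<rat> {sqrt5}"
  have Q5: "subfield Q5 CC" "Q5 \<subseteq> Qbar"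
    unfolding Q5_def by (rule subfield_adjoin, rule Q5_subset[OF subfield_Qbar sqrt5_Qbar])
  obtain \<rho> where \<rho>: "\<rho> \<in> gal \<rat>" "\<rho> sqrt5 = - sqrt5"
    by (rule gal_flip_sqrt5)
  note e = galD(1)[OF \<rho>(1)]
  have el: "\<exists>a b. a \<in> \<rat> \<and> b \<in> \<rat> \<and> z = a + b * sqrt5 \<and> \<rho> z = a - b * sqrt5" if z: "z \<in> Q5" for z
  proof -
    obtain a b where ab: "a \<in> \<rat>" "b \<in> \<rat>" "z = a + b * sqrt5"
      using z unfolding Q5_def Q5_elements by blast
    then have Q: "a \<in> Qbar" "b \<in> Qbar"
      using Rats_subset_Qbar by auto
    have "\<rho> z = \<rho> a + \<rho> b * \<rho> sqrt5"
      using ab(3) embedding_add[OF e Q(1) sf_mult[OF subfield_Qbar Q(2) sqrt5_Qbar]] embedding_mult[OF e Q(2) sqrt5_Qbar] by simp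
    then show ?thesis
      using ab galD(3)[OF \<rho>(1)] \<rho>(2) by (intro exI[of _ a] exI[of _ b]) simp
  qed
  have comb: "a + b * sqrt5 \<in> Q5" if "a \<in> \<rat>" "b \<in> \<rat>" for a b
    using that unfolding Q5_def Q5_elements by blast
  have rQ5: "\<rho> z \<in> Q5" "\<rho> (\<rho> z) = z" if z: "z \<in> Q5" for z
  proof -
    obtain a b where ab: "a \<in> \<rat>" "b \<in> \<rat>" "z = a + b * sqrt5" "\<rho> z = a - b * sqrt5"
      using el[OF z] by blast
    show rz: "\<rho> z \<in> Q5"
      using comb[of a "- b"] ab by simp
    have Q: "a \<in> Qbar" "b * sqrt5 \<in> Qbar" "b \<in> Qbar"
      using ab(1,2) Rats_subset_Qbar sqrt5_Qbar sf_mult[OF subfield_Qbar] by auto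
    have "\<rho> (\<rho> z) = \<rho> a - \<rho> b * \<rho> sqrt5"
      unfolding ab(4) embedding_diff[OF e Q(1,2)] embedding_mult[OF e Q(3) sqrt5_Qbar] ..
    then show "\<rho> (\<rho> z) = z"
      using ab galD(3)[OF \<rho>(1)] \<rho>(2) by simp
  qed
  define R where "R = point_map \<rho> P"
  have P5: "P \<in> epts Q5"
    using P by (simp add: Q5_def)
  have PQ: "P \<in> epts Qbar"
    using epts_mono[OF Q5(2) P5] .
  have RQ: "R \<in> epts Qbar"
    unfolding R_def by (rule point_map_epts[OF e PQ])
  have R5: "R \<in> epts Q5"
    using RQ P5 rQ5(1) unfolding R_def by (cases P) auto
  have RR: "point_map \<rho> R = P"
    using P5 rQ5(2) unfolding R_def by (cases P) auto
  have fixed: "z \<in> \<rat>" if "z \<in> Q5" "\<rho> z = z" for z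
    using el[OF that(1)] that(2) sqrt5_nonzero by (auto simp: eq_neg_iff_add_eq_0)
  have anti: "\<exists>b\<in>\<rat>. z = b * sqrt5" if "z \<in> Q5" "\<rho> z = - z" for z
    using el[OF that(1)] that(2) by auto
  have "mu (eadd P R) 6 = Infinity"
  proof (rule rational_torsion)
    have s5: "eadd P R \<in> epts Q5"
      by (rule eadd_closed[OF Q5(1) P5 R5])
    have "point_map \<rho> (eadd P R) = eadd P R"
      using point_map_eadd[OF e PQ RQ] RR epts_comm[OF PQ RQ] by (simp add: R_def)
    then show "eadd P R \<in> epts \<rat>"
      using s5 fixed by (cases "eadd P R") auto
  qed
  moreover have "mu (eadd P (eneg R)) 6 = Infinity"
  proof -
    define D where "D = eadd P (eneg R)"
    have nR: "eneg R \<in> epts Qbar" "eneg P \<in> epts Qbar"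
      using eneg_Qbar RQ PQ by auto
    have D5: "D \<in> epts Q5"
      unfolding D_def by (intro eadd_closed eneg_epts Q5(1) P5 R5)
    have DQ: "D \<in> epts Qbar"
      using epts_mono[OF Q5(2) D5] .
    have "point_map \<rho> D = eadd R (eneg P)"
      unfolding D_def using point_map_eadd[OF e PQ nR(1)] point_map_eneg[OF e RQ] RR by (simp add: R_def)
    also have "\<dots> = eneg D"
      unfolding D_def using eneg_eadd[OF PQ nR(1)] epts_comm[OF nR(2) RQ] by simp
    finally have anti_D: "point_map \<rho> D = eneg D" .
    have "eadd D D = Infinity"
    proof (cases D)
      case (Affine x y)
      have xy: "x \<in> Q5" "y \<in> Q5" "y\<^sup>2 = crv x" "\<rho> x = x" "\<rho> y = - y"
        using D5 anti_D Affine by auto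
      obtain b where b: "b \<in> \<rat>" "y = b * sqrt5"
        using anti[OF xy(2,5)] by blast
      obtain p q :: rat where pq: "x = of_rat p" "b = of_rat q"
        using fixed[OF xy(1,4)] b(1) by (auto elim!: Rats_cases)
      have "5 * b\<^sup>2 = crv x"
        using xy(3) unfolding b(2) power_mult_distrib sqrt5_sq by (simp add: mult.commute)
      then have "(of_rat (5 * q\<^sup>2) :: complex) = of_rat (p ^ 3 + p\<^sup>2 - p)"
        by (simp add: pq crv_def of_rat_add of_rat_diff of_rat_power of_rat_mult)
      then have "5 * q\<^sup>2 = p ^ 3 + p\<^sup>2 - p"
        by (simp only: of_rat_eq_iff)
      then have "p = 0"
        by (rule rational_points_twist)
      then have "y = 0"
        using xy(3) pq(1) by (simp add: crv_def)
      then show ?thesis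
        using Affine by simp
    qed simp
    then have "mu D 2 = Infinity"
      using mu_2[OF DQ] by simp
    then have "mu (mu D 2) 3 = Infinity"
      by simp
    then show ?thesis
      unfolding mu_mult[OF DQ] by (simp add: D_def)
  qed
  \<comment> \<open>The sum and the difference of \<open>P\<close> and its conjugate add up to
    \<open>2 P\<close>, so that 6 becomes 12.\<close>
  ultimately have "mu (eadd (eadd P R) (eadd P (eneg R))) 6 = Infinity"
    using mu_eadd[OF eadd_Qbar[OF PQ RQ] eadd_Qbar[OF PQ eneg_Qbar[OF RQ]], of 6] by simp
  also have "eadd (eadd P R) (eadd P (eneg R)) = eadd (eadd (eadd P R) (eneg R)) P"
    using epts_assoc[OF eadd_Qbar[OF PQ RQ] eneg_Qbar[OF RQ] PQ] epts_comm[OF PQ eneg_Qbar[OF RQ]] by simp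
  also have "\<dots> = mu P 2"
    using eadd_cancel(1)[OF PQ RQ] mu_2[OF PQ] by simp
  finally show ?thesis
    unfolding mu_mult[OF PQ] by simp
qed

text \<open>A cycle of inclusions: the explicit points have coordinates in \<open>K10\<close>,
  points over \<open>K10\<close> are torsion because of the descents, and torsion points over
  \<open>K\<close> are explicit.\<close>

lemma torsion_points:
  defines "K10 \<equiv> K \<inter> cyclotomic_field 10"
  shows "{P \<in> epts K. \<exists>n>0. mu P n = Infinity} = epts K10"
    and "epts K10 = {PT a b | a b. a < 2 \<and> b < 6 \<and> (a = 0 \<or> sqrt5 \<in> K)}"
proof -
  define tor where "tor = {P \<in> epts K. \<exists>n>0. mu P n = Infinity}"
  define pts where "pts = {PT a b | a b. a < 2 \<and> b < 6 \<and> (a = 0 \<or> sqrt5 \<in> K)}"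
  have K10: "K10 = (if sqrt5 \<in> K then adjoin \<rat> {sqrt5} else \<rat>)"
    unfolding K10_def by (rule K10_cases)
  have sub: "subfield K10 CC"
    unfolding K10 using subfield_Rats subfield_adjoin[of \<rat> "{sqrt5}"] by simp
  have "sqrt5 \<in> K10" if "sqrt5 \<in> K"
    using that adjoin_gen_subset[of "{sqrt5}" \<rat>] by (simp add: K10)
  then have 1: "pts \<subseteq> epts K10"
    using PT_closed[OF sub] by (auto simp: pts_def)
  have "\<exists>n>0. mu P n = Infinity" if "P \<in> epts K10" for P
  proof (cases "sqrt5 \<in> K")
    case True
    then show ?thesis
      using Q5_torsion[of P] that by (intro exI[of _ 12]) (simp add: K10)
  next
    case False
    then show ?thesis
      using rational_torsion[of P] that by (intro exI[of _ 6]) (simp add: K10)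
  qed
  then have 2: "epts K10 \<subseteq> tor"
    using epts_mono[of K10 K] by (auto simp: tor_def K10_def)
  have 3: "tor \<subseteq> pts"
  proof
    fix P
    assume "P \<in> tor"
    then obtain n where n: "P \<in> epts K" "n > 0" "mu P n = Infinity"
      unfolding tor_def by blast
    obtain a b where ab: "a = 0 \<or> sqrt5 \<in> K" "P = PT a b"
      using torsion_PT[OF n] by blast
    have "P = PT (a mod 2) (b mod 6)"
      unfolding PT_mod by (rule ab(2))
    moreover have "a mod 2 < 2" "b mod 6 < 6" "a mod 2 = 0 \<or> sqrt5 \<in> K"
      using ab(1) by auto
    ultimately show "P \<in> pts"
      unfolding pts_def mem_Collect_eq by (intro exI conjI)
  qed
  show "tor = epts K10" "epts K10 = pts"
    using 1 2 3 by auto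
qed

end

section \<open>The torsion of the Jacobian\<close>

context curve_multiquadratic
begin

text \<open>\<open>J1_points_eq\<close> identifies this group with the \<open>L\<close>-rational
  points of the Jacobian, for a subfield \<open>L\<close> of Qbar.\<close>

abbreviation Jac :: "complex set \<Rightarrow> ((complex \<Rightarrow> int) \<Rightarrow>\<^sub>0 int) set monoid" where
  "Jac L \<equiv> (Pic0 Qbar F)\<lparr>carrier := kap ` epts L\<rparr>"

lemma kap_pow:
  assumes P: "P \<in> epts Qbar"
  shows "kap P [^]\<^bsub>Jac L\<^esub> (n :: nat) = kap (mu P n)"
proof (induction n)
  case 0
  then show ?case
    by (simp add: nat_pow_def one_Pic0)
next
  case (Suc n)
  have "kap P [^]\<^bsub>Jac L\<^esub> Suc n = kap P [^]\<^bsub>Jac L\<^esub> n \<otimes>\<^bsub>Pic0 Qbar F\<^esub> kap P"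
    by (simp add: nat_pow_def)
  then show ?case
    using Suc mult_Pic0[OF mu_closed[OF subfield_Qbar P, of n] P] by (simp only: mu_Suc)
qed

lemma torsion_Jac: "torsion (Jac K) = kap ` epts (K \<inter> cyclotomic_field 10)"
proof -
  have "kap P [^]\<^bsub>Jac K\<^esub> (n :: nat) = \<one>\<^bsub>Jac K\<^esub> \<longleftrightarrow> mu P n = Infinity" if "P \<in> epts K" for P n
  proof -
    note PQ = K_epts[OF that]
    have "kap P [^]\<^bsub>Jac K\<^esub> n = \<one>\<^bsub>Jac K\<^esub> \<longleftrightarrow> kap (mu P n) = kap Infinity"
      unfolding kap_pow[OF PQ] by (simp add: one_Pic0)
    then show ?thesis
      using kap_inj mu_closed[OF subfield_Qbar PQ, of n] by (simp add: inj_on_eq_iff)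
  qed
  then have "torsion (Jac K) = kap ` {P \<in> epts K. \<exists>n>0. mu P n = Infinity}"
    by (auto simp: torsion_def)
  then show ?thesis
    by (simp only: torsion_points(1))
qed

lemma kap_PT_add: "kap (PT a b) \<otimes>\<^bsub>Pic0 Qbar F\<^esub> kap (PT c d) = kap (PT (a + c) (b + d))"
  by (simp add: mult_Pic0[OF PT_Qbar PT_Qbar] PT_add)

lemma kap_PT_inj: "a < 2 \<Longrightarrow> c < 2 \<Longrightarrow> b < 6 \<Longrightarrow> d < 6 \<Longrightarrow> kap (PT a b) = kap (PT c d) \<Longrightarrow> a = c \<and> b = d"
  using PT_inj[of a c b d] kap_inj PT_Qbar by (simp add: inj_on_eq_iff)

lemma nat_mod: "0 \<le> x \<Longrightarrow> 0 \<le> y \<Longrightarrow> nat ((x + y) mod int n) = (nat x + nat y) mod n"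
  by (simp add: nat_mod_distrib nat_add_distrib)

lemma torsion_Z6:
  assumes "sqrt5 \<notin> K"
  shows "(Jac K)\<lparr>carrier := torsion (Jac K)\<rparr> \<cong> integer_mod_group 6"
proof -
  \<comment> \<open>The isomorphism is built in the direction where it is explicit, from residues to
    classes, and inverted at the end.\<close>
  define h where "h x = kap (PT 0 (nat x))" for x
  have pts: "torsion (Jac K) = {kap (PT 0 b) | b. b < 6}"
    unfolding torsion_Jac torsion_points(2) using assms by auto
  have "h \<in> iso (integer_mod_group 6) ((Jac K)\<lparr>carrier := torsion (Jac K)\<rparr>)"
    unfolding iso_def
  proof (intro CollectI conjI)
    show "h \<in> hom (integer_mod_group 6) ((Jac K)\<lparr>carrier := torsion (Jac K)\<rparr>)"
    proof (rule homI)
      fix x y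
      assume "x \<in> carrier (integer_mod_group 6)" "y \<in> carrier (integer_mod_group 6)"
      then have xy: "0 \<le> x" "0 \<le> y" "x < 6"
        by (auto simp: carrier_integer_mod_group)
      then show "h x \<in> carrier ((Jac K)\<lparr>carrier := torsion (Jac K)\<rparr>)"
        by (auto simp: pts h_def)
      have "h ((x + y) mod 6) = kap (PT 0 ((nat x + nat y) mod 6))"
        using nat_mod[OF xy(1,2), of 6] by (simp add: h_def)
      also have "\<dots> = kap (PT 0 (nat x + nat y))"
        using PT_mod[of 0] by simp
      finally show "h (x \<otimes>\<^bsub>integer_mod_group 6\<^esub> y) = h x \<otimes>\<^bsub>(Jac K)\<lparr>carrier := torsion (Jac K)\<rparr>\<^esub> h y"
        by (simp add: h_def kap_PT_add)
    qed
    have "inj_on h {0..<6}"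
    proof (rule inj_onI)
      fix x y :: int
      assume xy: "x \<in> {0..<6}" "y \<in> {0..<6}" "h x = h y"
      then have "nat x < 6" "nat y < 6"
        by auto
      then have "nat x = nat y"
        using xy(3) kap_PT_inj[of 0 0 "nat x" "nat y"] by (simp add: h_def)
      then show "x = y"
        using xy by (simp add: eq_nat_nat_iff)
    qed
    moreover have "h ` {0..<6} = torsion (Jac K)"
    proof -
      have "kap (PT 0 b) \<in> h ` {0..<6}" if "b < 6" for b
        using that by (intro image_eqI[of _ _ "int b"]) (auto simp: h_def)
      moreover have "h x \<in> torsion (Jac K)" if "x \<in> {0..<6}" for x
      proof -
        have "nat x < 6"
          using that by auto
        then show ?thesis
          by (auto simp: pts h_def)
      qed
      ultimately show ?thesis
        by (auto simp: pts)
    qed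
    ultimately show "bij_betw h (carrier (integer_mod_group 6)) (carrier ((Jac K)\<lparr>carrier := torsion (Jac K)\<rparr>))"
      by (simp add: bij_betw_def carrier_integer_mod_group)
  qed
  then show ?thesis
    using group.iso_sym[OF group_integer_mod_group] is_isoI by blast
qed

lemma torsion_Z2_Z6:
  assumes "sqrt5 \<in> K"
  shows "(Jac K)\<lparr>carrier := torsion (Jac K)\<rparr> \<cong> integer_mod_group 2 \<times>\<times> integer_mod_group 6"
proof -
  define h where "h = (\<lambda>(x, y). kap (PT (nat x) (nat y)))"
  have pts: "torsion (Jac K) = {kap (PT a b) | a b. a < 2 \<and> b < 6}"
    unfolding torsion_Jac torsion_points(2) using assms by auto
  have car: "carrier (integer_mod_group 2 \<times>\<times> integer_mod_group 6) = {0..<2} \<times> {0..<6}"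
    by (simp add: DirProd_def carrier_integer_mod_group)
  have "h \<in> iso (integer_mod_group 2 \<times>\<times> integer_mod_group 6) ((Jac K)\<lparr>carrier := torsion (Jac K)\<rparr>)"
    unfolding iso_def
  proof (intro CollectI conjI)
    show "h \<in> hom (integer_mod_group 2 \<times>\<times> integer_mod_group 6) ((Jac K)\<lparr>carrier := torsion (Jac K)\<rparr>)"
    proof (rule homI)
      fix p q
      assume pq: "p \<in> carrier (integer_mod_group 2 \<times>\<times> integer_mod_group 6)"
        "q \<in> carrier (integer_mod_group 2 \<times>\<times> integer_mod_group 6)"
      obtain x y where p: "p = (x, y)"
        by (cases p)
      obtain z w where q: "q = (z, w)"
        by (cases q)
      have b: "0 \<le> x" "x < 2" "0 \<le> y" "y < 6" "0 \<le> z" "0 \<le> w"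
        using pq unfolding car p q by simp_all
      have "nat x < 2 \<and> nat y < 6"
        using b by (simp add: nat_less_iff)
      then show "h p \<in> carrier ((Jac K)\<lparr>carrier := torsion (Jac K)\<rparr>)"
        by (auto simp: pts h_def p)
      have "h ((x + z) mod 2, (y + w) mod 6) = kap (PT ((nat x + nat z) mod 2) ((nat y + nat w) mod 6))"
        using nat_mod[OF b(1,5), of 2] nat_mod[OF b(3,6), of 6] by (simp add: h_def)
      also have "\<dots> = kap (PT (nat x + nat z) (nat y + nat w))"
        by (simp only: PT_mod)
      finally show "h (p \<otimes>\<^bsub>integer_mod_group 2 \<times>\<times> integer_mod_group 6\<^esub> q) =
          h p \<otimes>\<^bsub>(Jac K)\<lparr>carrier := torsion (Jac K)\<rparr>\<^esub> h q"
        by (simp add: p q h_def kap_PT_add)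
    qed
    have "inj_on h ({0..<2} \<times> {0..<6})"
    proof (rule inj_onI)
      fix p q :: "int \<times> int"
      assume pq: "p \<in> {0..<2} \<times> {0..<6}" "q \<in> {0..<2} \<times> {0..<6}" "h p = h q"
      obtain x y where p: "p = (x, y)"
        by (cases p)
      obtain z w where q: "q = (z, w)"
        by (cases q)
      have "nat x < 2" "nat z < 2" "nat y < 6" "nat w < 6"
        using pq(1,2) by (auto simp: p q)
      from kap_PT_inj[OF this] have "nat x = nat z \<and> nat y = nat w"
        using pq(3) by (simp add: h_def p q)
      then show "p = q"
        using pq by (simp add: p q eq_nat_nat_iff)
    qed
    moreover have "h ` ({0..<2} \<times> {0..<6}) = torsion (Jac K)"
    proof
      show "h ` ({0..<2} \<times> {0..<6}) \<subseteq> torsion (Jac K)"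
      proof
        fix C
        assume "C \<in> h ` ({0..<2} \<times> {0..<6})"
        then obtain x y where "0 \<le> x" "x < 2" "0 \<le> y" "y < 6" "C = kap (PT (nat x) (nat y))"
          by (auto simp: h_def)
        moreover from this have "nat x < 2" "nat y < 6"
          by (simp_all add: nat_less_iff)
        ultimately show "C \<in> torsion (Jac K)"
          unfolding pts by blast
      qed
      have "kap (PT a b) \<in> h ` ({0..<2} \<times> {0..<6})" if "a < 2" "b < 6" for a b
        using that by (intro image_eqI[of _ _ "(int a, int b)"]) (auto simp: h_def)
      then show "torsion (Jac K) \<subseteq> h ` ({0..<2} \<times> {0..<6})"
        by (auto simp: pts)
    qed
    ultimately show "bij_betw h (carrier (integer_mod_group 2 \<times>\<times> integer_mod_group 6)) (carrier ((Jac K)\<lparr>carrier := torsion (Jac K)\<rparr>))"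
      unfolding car by (simp add: bij_betw_def)
  qed
  then show ?thesis
    using group.iso_sym[OF DirProd_group[OF group_integer_mod_group group_integer_mod_group]] is_isoI by blast
qed

end

theorem theorem4p8:
  fixes K :: "complex set" and j :: complex and P Q :: point
  assumes "multiquadratic_field K"
    and "\<not> Polynomial.algebraic j"
    and "gamma1_structure 2 5 j P Q"
  shows
    "let K10 = K \<inter> cyclotomic_field 10;
         Q5 = adjoin \<rat> {complex_of_real (sqrt 5)};
         J = J1_points j P Q;
         Jtors = (J K)\<lparr>carrier := torsion (J K)\<rparr>
     in torsion (J K) = carrier (J K10) \<and>
        (K10 = \<rat> \<or> K10 = Q5) \<and>
        (K10 = \<rat> \<longrightarrow> Jtors \<cong> integer_mod_group 6) \<and>
        (K10 = Q5 \<longrightarrow> Jtors \<cong> integer_mod_group 2 \<times>\<times> integer_mod_group 6)"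
proof -
  obtain S where S: "finite S" "\<forall>s\<in>S. s\<^sup>2 \<in> \<rat>" "K = adjoin \<rat> S"
    by (rule multiquadratic_generators[OF assms(1)])
  obtain u v where uv: "curve_field u v"
    and X1: "\<forall>L. subfield L CC \<longrightarrow> L \<subseteq> Qbar \<longrightarrow> X1_field L j P Q = adjoin L {u, v}"
    by (rule X1_field_eq[OF assms(2,3)])
  interpret curve_multiquadratic u v S K
    using uv S by (intro curve_multiquadratic.intro multiquadratic.intro) auto
  have field: "X1_field L j P Q = FF L" if "subfield L CC" "L \<subseteq> Qbar" for L
    using X1 that FF_eq_adjoin[OF that] by simp
  define K10 where "K10 = K \<inter> cyclotomic_field 10"
  have K10: "K10 = (if sqrt5 \<in> K then adjoin \<rat> {sqrt5} else \<rat>)"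
    unfolding K10_def by (rule K10_cases)
  have sub: "subfield K10 CC"
    unfolding K10 using subfield_Rats subfield_adjoin[of \<rat> "{sqrt5}"] by simp
  have "K10 \<subseteq> Qbar"
    using K_Qbar by (auto simp: K10_def)
  note J10 = J1_points_eq[OF field[OF subfield_Qbar order_refl] field[OF sub this] sub this]
  note JK = J1_points_eq[OF field[OF subfield_Qbar order_refl] field[OF subfield_K K_Qbar] subfield_K K_Qbar]
  \<comment> \<open>The two possible values of \<open>K10\<close> differ, so each of them decides
    whether sqrt 5 lies in \<open>K\<close>.\<close>
  have ne: "adjoin \<rat> {sqrt5} \<noteq> \<rat>"
    using adjoin_gen_subset[of "{sqrt5}" \<rat>] sqrt5_irrational[OF sqrt5_sq] by auto
  have 1: "torsion (J1_points j P Q K) = carrier (J1_points j P Q K10)"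
    unfolding JK J10 torsion_Jac by (simp add: K10_def)
  have 2: "K10 = \<rat> \<or> K10 = adjoin \<rat> {sqrt5}"
    unfolding K10 by simp
  have 3: "(J1_points j P Q K)\<lparr>carrier := torsion (J1_points j P Q K)\<rparr> \<cong> integer_mod_group 6" if "K10 = \<rat>"
    unfolding JK by (rule torsion_Z6) (metis that K10 ne)
  have 4: "(J1_points j P Q K)\<lparr>carrier := torsion (J1_points j P Q K)\<rparr> \<cong> integer_mod_group 2 \<times>\<times> integer_mod_group 6"
    if "K10 = adjoin \<rat> {sqrt5}"
    unfolding JK by (rule torsion_Z2_Z6) (metis that K10 ne)
  show ?thesis
    unfolding Let_def K10_def[symmetric] sqrt5_def[symmetric] by (intro conjI impI 1 2 3 4)
qed

end
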